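(* Let $[Y]$ be an orbifold with transversal $ADE$ singularities, with singular locus $S\subset Y$. 1. The restriction of $\tau:Y_1\to Y$ to the coarse moduli space of the union of the twisted sectors is a topological covering $\tau_|:\bigsqcup_{(g)\ne(1)}Y_{(g)}\to S$. 2. For any point $y\in S$, the fiber $(\tau_|)^{-1}(y)$ is canonically identified with the set of conjugacy classes of the local group $G_y$ which are different from the class of the neutral element, and hence with the set of nontrivial irreducible representations of $G_y$. 3. For $y\in S$, the fiber $[N]_y$ of the normal bundle of $[S]$ in $[Y]$ is a $2$-dimensional representation of $G_y$; let $\Gamma_{G_y}$ be the McKay graph of $G_y$ with respect to $[N]_y$. Then the monodromy of the covering $\tau_|$ at $y$ takes values in the automorphism group of the McKay graph $\Gamma_{G_y}$.
   Context: Work over $\mathbb{C}$. A projective variety $Y$ has transversal $ADE$ singularities if its singular locus $S$ is connected and smooth and $(S,Y)$ is locally, in the complex topology, isomorphic to $(\mathbb{C}^k\times\{0\},\mathbb{C}^k\times R)$, where $R\cong\mathbb{C}^2/G$ is a rational double point, $G\subset SL(2,\mathbb{C})$ finite (type $A_n$, $D_n$, $E_6$, $E_7$ or $E_8$). The associated orbifold with transversal $ADE$ singularities $[Y]$ is the complex orbifold structure on $Y$ with charts $\mathbb{C}^k\times\mathbb{C}^2$ near points of $S$, $G$ acting on the second factor only, and trivial local groups off $S$. $[S]$ is the suborbifold of $[Y]$ over $S$. $[Y_1]$ is the inertia orbifold, with coarse space $Y_1=\{(y,(g)_y): y\in Y,\ (g)_y \text{ a conjugacy class of } G_y\}$, and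 $\tau(y,(g)_y)=y$; its connected components are denoted $Y_{(g)}$, the twisted sectors being those with $(g)\ne(1)$. McKay graph of a finite group $G$ with respect to a representation $Q$: one vertex for each nontrivial irreducible representation $\lambda_i$ of $G$, two vertices $\lambda_i,\lambda_j$ being joined by $a_{ij}=\dim_{\mathbb{C}}\mathrm{Hom}_G(\lambda_i,Q\otimes\lambda_j)$ arrows. Via the identification in part 2, the monodromy acts on the set of vertices of $\Gamma_{G_y}$. *)

theory Defs
  imports
    "HOL-Analysis.Analysis"
    "HOL-Algebra.Group_Action"
    "Jordan_Normal_Form.Matrix"
    "Jordan_Normal_Form.Determinant"
    "Jordan_Normal_Form.VS_Connect"
begin

no_notation Matrix.vec_index (infixl "$" 100)

section \<open>Topology\<close>

definition quotient_topology :: "'a topology \<Rightarrow> ('a \<Rightarrow> 'b) \<Rightarrow> 'b topology" where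
  "quotient_topology X q = topology (\<lambda>U. U \<subseteq> q ` topspace X \<and> openin X {x \<in> topspace X. q x \<in> U})"

lemma openin_quotient_topology:
  "openin (quotient_topology X q) U \<longleftrightarrow>
     U \<subseteq> q ` topspace X \<and> openin X {x \<in> topspace X. q x \<in> U}"
proof -
  have "istopology (\<lambda>U. U \<subseteq> q ` topspace X \<and> openin X {x \<in> topspace X. q x \<in> U})"
    unfolding istopology_def
  proof (intro conjI allI impI)
    fix S T assume "S \<subseteq> q ` topspace X \<and> openin X {x \<in> topspace X. q x \<in> S}"
      and "T \<subseteq> q ` topspace X \<and> openin X {x \<in> topspace X. q x \<in> T}"
    moreover have "{x \<in> topspace X. q x \<in> S \<inter> T}
        = {x \<in> topspace X. q x \<in> S} \<inter> {x \<in> topspace X. q x \<in> T}" by auto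
    ultimately show "S \<inter> T \<subseteq> q ` topspace X" "openin X {x \<in> topspace X. q x \<in> S \<inter> T}" by auto
  next
    fix K assume K: "\<forall>S\<in>K. S \<subseteq> q ` topspace X \<and> openin X {x \<in> topspace X. q x \<in> S}"
    then show "\<Union> K \<subseteq> q ` topspace X" by auto
    have "{x \<in> topspace X. q x \<in> \<Union> K} = (\<Union>S\<in>K. {x \<in> topspace X. q x \<in> S})" by auto
    then show "openin X {x \<in> topspace X. q x \<in> \<Union> K}" using K by auto
  qed
  then show ?thesis by (simp add: quotient_topology_def topology_inverse')
qed

definition covering_map :: "'a topology \<Rightarrow> 'b topology \<Rightarrow> ('a \<Rightarrow> 'b) \<Rightarrow> bool" where
  "covering_map E B p \<longleftrightarrow>
     continuous_map E B p \<and> p ` topspace E = topspace B \<and>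
     (\<forall>b \<in> topspace B. \<exists>U. openin B U \<and> b \<in> U \<and>
        (\<exists>\<V>. \<Union>\<V> = {u \<in> topspace E. p u \<in> U} \<and> pairwise disjnt \<V> \<and>
           (\<forall>V \<in> \<V>. openin E V \<and> homeomorphic_map (subtopology E V) (subtopology B U) p)))"

text \<open>The end point of the lift of the path \<open>\<gamma>\<close> starting at \<open>u\<close>.\<close>

definition monodromy :: "'a topology \<Rightarrow> ('a \<Rightarrow> 'b) \<Rightarrow> (real \<Rightarrow> 'b) \<Rightarrow> 'a \<Rightarrow> 'a" where
  "monodromy E p \<gamma> u =
     (THE w. \<exists>\<eta>. pathin E \<eta> \<and> (\<forall>t \<in> {0..1}. p (\<eta> t) = \<gamma> t) \<and> \<eta> 0 = u \<and> \<eta> 1 = w)"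


section \<open>Holomorphic functions and complex spaces\<close>

text \<open>Reduced complex spaces are represented by a topology together with a predicate telling which
  functions on an open set are sections of the structure sheaf.\<close>

type_synonym 'a fun_sheaf = "'a set \<Rightarrow> ('a \<Rightarrow> complex) \<Rightarrow> bool"

definition analytic_iso ::
    "'a topology \<Rightarrow> 'a fun_sheaf \<Rightarrow> 'b topology \<Rightarrow> 'b fun_sheaf \<Rightarrow> ('a \<Rightarrow> 'b) \<Rightarrow> bool" where
  "analytic_iso X OX Z OZ h \<longleftrightarrow> homeomorphic_map X Z h \<and>
     (\<forall>W f. openin Z W \<longrightarrow> (OZ W f \<longleftrightarrow> OX {x \<in> topspace X. h x \<in> W} (f \<circ> h)))"

text \<open>Holomorphy on an open set of \<open>\<complex>\<^sup>d\<close>: complex differentiability at every point.\<close>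

definition holomorphic :: "(complex ^ 'd::finite) fun_sheaf" where
  "holomorphic W f \<longleftrightarrow>
     (\<forall>x \<in> W. \<exists>D. (f has_derivative D) (at x) \<and> (\<forall>a v. D (a *s v) = a * D v))"

definition holomorphic_map :: "(complex ^ 'd::finite) set \<Rightarrow> (complex ^ 'd \<Rightarrow> complex ^ 'd) \<Rightarrow> bool" where
  "holomorphic_map W \<psi> \<longleftrightarrow> (\<forall>i. holomorphic W (\<lambda>x. \<psi> x $ i))"

definition biholomorphic ::
    "(complex ^ 'd::finite) set \<Rightarrow> (complex ^ 'd) set \<Rightarrow> (complex ^ 'd \<Rightarrow> complex ^ 'd) \<Rightarrow> bool" where
  "biholomorphic W W' \<psi> \<longleftrightarrow> open W \<and> open W' \<and> bij_betw \<psi> W W' \<and>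
     holomorphic_map W \<psi> \<and> holomorphic_map W' (inv_into W \<psi>)"

text \<open>Functions on a subset of \<open>\<complex>\<^sup>d\<close> that extend locally to holomorphic functions; on an open set
  of a linear subspace \<open>L\<close> these are the holomorphic functions of \<open>L\<close>.\<close>

definition restricted_holomorphic :: "(complex ^ 'd::finite) fun_sheaf" where
  "restricted_holomorphic W f \<longleftrightarrow>
     (\<forall>x \<in> W. \<exists>A F. open A \<and> x \<in> A \<and> holomorphic A F \<and> (\<forall>z \<in> A \<inter> W. F z = f z))"


section \<open>Projective varieties\<close>

text \<open>A point of the projective space of \<open>\<complex>\<^sup>n\<close> is a line through the origin of \<open>\<complex>\<^sup>n\<close>.\<close>

definition pline :: "complex ^ 'n::finite \<Rightarrow> (complex ^ 'n) set" where
  "pline v = vec.span {v}"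

definition proj_space :: "(complex ^ 'n::finite) set topology" where
  "proj_space = quotient_topology (top_of_set (- {0})) pline"

definition proj_holomorphic :: "(complex ^ 'n::finite) set fun_sheaf" where
  "proj_holomorphic W f \<longleftrightarrow> holomorphic {v. v \<noteq> 0 \<and> pline v \<in> W} (f \<circ> pline)"

text \<open>The (reduced) structure sheaf of any locally closed analytic subset of projective space.\<close>

definition var_holomorphic :: "(complex ^ 'n::finite) set fun_sheaf" where
  "var_holomorphic W f \<longleftrightarrow>
     (\<forall>y \<in> W. \<exists>A F. openin proj_space A \<and> y \<in> A \<and> proj_holomorphic A F \<and> (\<forall>z \<in> A \<inter> W. F z = f z))"

inductive_set polynomial_funs :: "(complex ^ 'n::finite \<Rightarrow> complex) set" where
  const: "(\<lambda>v. a) \<in> polynomial_funs"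
| coord: "(\<lambda>v. v $ i) \<in> polynomial_funs"
| add: "\<lbrakk>f \<in> polynomial_funs; g \<in> polynomial_funs\<rbrakk> \<Longrightarrow> (\<lambda>v. f v + g v) \<in> polynomial_funs"
| mult: "\<lbrakk>f \<in> polynomial_funs; g \<in> polynomial_funs\<rbrakk> \<Longrightarrow> (\<lambda>v. f v * g v) \<in> polynomial_funs"

definition homogeneous_polynomial :: "(complex ^ 'n::finite \<Rightarrow> complex) \<Rightarrow> bool" where
  "homogeneous_polynomial f \<longleftrightarrow> f \<in> polynomial_funs \<and> (\<exists>m. \<forall>a v. f (a *s v) = a ^ m * f v)"

definition projective_algebraic_set :: "(complex ^ 'n::finite) set set \<Rightarrow> bool" where
  "projective_algebraic_set Y \<longleftrightarrow>
     (\<exists>F. (\<forall>f \<in> F. homogeneous_polynomial f) \<and> Y = {pline v | v. v \<noteq> 0 \<and> (\<forall>f \<in> F. f v = 0)})"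

definition projective_variety :: "(complex ^ 'n::finite) set set \<Rightarrow> bool" where
  "projective_variety Y \<longleftrightarrow> projective_algebraic_set Y \<and> Y \<noteq> {} \<and>
     (\<forall>Y1 Y2. projective_algebraic_set Y1 \<and> projective_algebraic_set Y2 \<and> Y = Y1 \<union> Y2 \<longrightarrow>
        Y = Y1 \<or> Y = Y2)"

text \<open>Smoothness: being locally isomorphic to an open set of some \<open>\<complex>\<^sup>m\<close>. Since \<open>m\<close> is at most the
  dimension of the ambient space, \<open>\<complex>\<^sup>m\<close> can be taken to be a linear subspace \<open>L\<close> of \<open>\<complex>\<^sup>n\<close>.\<close>

definition smooth_at :: "(complex ^ 'n::finite) set set \<Rightarrow> (complex ^ 'n) set \<Rightarrow> bool" where
  "smooth_at Z z \<longleftrightarrow>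
     (\<exists>U (L :: (complex ^ 'n) set) D h. openin (subtopology proj_space Z) U \<and> z \<in> U \<and>
        vec.subspace L \<and> openin (top_of_set L) D \<and>
        analytic_iso (subtopology proj_space U) var_holomorphic (top_of_set D) restricted_holomorphic h)"

definition sing_locus :: "(complex ^ 'n::finite) set set \<Rightarrow> (complex ^ 'n) set set" where
  "sing_locus Y = {y \<in> Y. \<not> smooth_at Y y}"


section \<open>Transversal ADE singularities\<close>

text \<open>To allow \<open>k = 0\<close>, the product \<open>\<complex>\<^sup>k \<times> \<complex>\<^sup>2\<close> is realised as \<open>\<complex>\<^sup>d\<close> with \<open>k = d - 2\<close>, an injection
  \<open>e\<close> of the two-element index type into the index type \<open>'d\<close> selecting the coordinates of the
  factor \<open>\<complex>\<^sup>2\<close>.\<close>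

definition first_factor :: "(2 \<Rightarrow> 'd::finite) \<Rightarrow> (complex ^ 'd) set" where
  "first_factor e = {v. \<forall>j. v $ e j = 0}"

definition act2 :: "(2 \<Rightarrow> 'd::finite) \<Rightarrow> complex ^ 2 ^ 2 \<Rightarrow> complex ^ 'd \<Rightarrow> complex ^ 'd" where
  "act2 e M v = (\<chi> i. if i \<in> range e then (M *v (\<chi> j. v $ e j)) $ inv_into UNIV e i else v $ i)"

text \<open>The finite subgroups of \<open>SL(2,\<complex>)\<close>; the nontrivial ones are exactly those whose quotient
  \<open>\<complex>\<^sup>2/\<Gamma>\<close> is a rational double point.\<close>

definition finite_SL2_subgroup :: "(complex ^ 2 ^ 2) set \<Rightarrow> bool" where
  "finite_SL2_subgroup \<Gamma> \<longleftrightarrow> finite \<Gamma> \<and> Finite_Cartesian_Product.mat 1 \<in> \<Gamma> \<and>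
     (\<forall>M \<in> \<Gamma>. Determinants.det M = 1 \<and> matrix_inv M \<in> \<Gamma> \<and> (\<forall>M' \<in> \<Gamma>. M ** M' \<in> \<Gamma>))"

definition ADE_group :: "(complex ^ 2 ^ 2) set \<Rightarrow> bool" where
  "ADE_group \<Gamma> \<longleftrightarrow> finite_SL2_subgroup \<Gamma> \<and> \<Gamma> \<noteq> {Finite_Cartesian_Product.mat 1}"

text \<open>The complex space \<open>\<complex>\<^sup>k \<times> \<complex>\<^sup>2/\<Gamma>\<close>, whose points are the orbits of \<open>\<Gamma>\<close> on \<open>\<complex>\<^sup>k \<times> \<complex>\<^sup>2\<close>.\<close>

definition ADE_orbit :: "(2 \<Rightarrow> 'd::finite) \<Rightarrow> (complex ^ 2 ^ 2) set \<Rightarrow> complex ^ 'd \<Rightarrow> (complex ^ 'd) set" where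
  "ADE_orbit e \<Gamma> v = (\<lambda>M. act2 e M v) ` \<Gamma>"

definition ADE_model :: "(2 \<Rightarrow> 'd::finite) \<Rightarrow> (complex ^ 2 ^ 2) set \<Rightarrow> (complex ^ 'd) set topology" where
  "ADE_model e \<Gamma> = quotient_topology euclidean (ADE_orbit e \<Gamma>)"

definition ADE_model_holomorphic ::
    "(2 \<Rightarrow> 'd::finite) \<Rightarrow> (complex ^ 2 ^ 2) set \<Rightarrow> (complex ^ 'd) set fun_sheaf" where
  "ADE_model_holomorphic e \<Gamma> W f \<longleftrightarrow> holomorphic {v. ADE_orbit e \<Gamma> v \<in> W} (f \<circ> ADE_orbit e \<Gamma>)"

definition transversal_ADE :: "(2 \<Rightarrow> 'd::finite) \<Rightarrow> (complex ^ 'n::finite) set set \<Rightarrow> bool" where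
  "transversal_ADE e Y \<longleftrightarrow>
     connectedin proj_space (sing_locus Y) \<and>
     (\<forall>y \<in> sing_locus Y. smooth_at (sing_locus Y) y) \<and>
     (\<exists>\<Gamma>. ADE_group \<Gamma> \<and>
       (\<forall>y \<in> sing_locus Y. \<exists>U W h.
          openin (subtopology proj_space Y) U \<and> y \<in> U \<and> openin (ADE_model e \<Gamma>) W \<and>
          analytic_iso (subtopology proj_space U) var_holomorphic
            (subtopology (ADE_model e \<Gamma>) W) (ADE_model_holomorphic e \<Gamma>) h \<and>
          h ` (sing_locus Y \<inter> U) = W \<inter> ADE_orbit e \<Gamma> ` first_factor e))"


section \<open>Complex orbifolds\<close>

text \<open>Only effective orbifolds are needed. The group of a chart is a group of transformations
  of its domain, in the sense of \<^const>\<open>BijGroup\<close> (extensional bijections).\<close>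

record ('d, 'y) orb_chart =
  cdom :: "(complex ^ 'd) set"
  cgrp :: "(complex ^ 'd \<Rightarrow> complex ^ 'd) set"
  cmap :: "complex ^ 'd \<Rightarrow> 'y"

definition orbifold_chart :: "'y topology \<Rightarrow> ('d::finite, 'y) orb_chart \<Rightarrow> bool" where
  "orbifold_chart X c \<longleftrightarrow>
     open (cdom c) \<and> connected (cdom c) \<and> cdom c \<noteq> {} \<and>
     subgroup (cgrp c) (BijGroup (cdom c)) \<and> finite (cgrp c) \<and>
     (\<forall>g \<in> cgrp c. holomorphic_map (cdom c) g) \<and>
     continuous_map (top_of_set (cdom c)) X (cmap c) \<and>
     open_map (top_of_set (cdom c)) X (cmap c) \<and>
     (\<forall>x \<in> cdom c. \<forall>x' \<in> cdom c. cmap c x = cmap c x' \<longleftrightarrow> (\<exists>g \<in> cgrp c. g x = x'))"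

text \<open>A germ at \<open>x\<close> of change of charts from \<open>c\<close> to \<open>c'\<close>.\<close>

definition chart_change ::
    "('d::finite, 'y) orb_chart \<Rightarrow> complex ^ 'd \<Rightarrow> ('d, 'y) orb_chart \<Rightarrow> complex ^ 'd \<Rightarrow>
     (complex ^ 'd \<Rightarrow> complex ^ 'd) \<Rightarrow> bool" where
  "chart_change c x c' x' \<psi> \<longleftrightarrow>
     (\<exists>W W'. x \<in> W \<and> W \<subseteq> cdom c \<and> W' \<subseteq> cdom c' \<and> biholomorphic W W' \<psi> \<and> \<psi> x = x' \<and>
        (\<forall>z \<in> W. cmap c' (\<psi> z) = cmap c z))"

definition orbifold_atlas :: "'y topology \<Rightarrow> ('d::finite, 'y) orb_chart set \<Rightarrow> bool" where
  "orbifold_atlas X A \<longleftrightarrow>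
     (\<forall>c \<in> A. orbifold_chart X c) \<and>
     topspace X = (\<Union>c \<in> A. cmap c ` cdom c) \<and>
     (\<forall>c \<in> A. \<forall>c' \<in> A. \<forall>x \<in> cdom c. \<forall>x' \<in> cdom c'.
        cmap c x = cmap c' x' \<longrightarrow> (\<exists>\<psi>. chart_change c x c' x' \<psi>))"

definition local_group ::
    "('d::finite, 'y) orb_chart \<Rightarrow> complex ^ 'd \<Rightarrow> (complex ^ 'd \<Rightarrow> complex ^ 'd) monoid" where
  "local_group c x = (BijGroup (cdom c))\<lparr>carrier := {g \<in> cgrp c. g x = x}\<rparr>"

definition ADE_chart :: "(2 \<Rightarrow> 'd::finite) \<Rightarrow> 'y set \<Rightarrow> ('d, 'y) orb_chart \<Rightarrow> bool" where
  "ADE_chart e S c \<longleftrightarrow>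
     (\<exists>\<Gamma>. ADE_group \<Gamma> \<and> cgrp c = (\<lambda>M. restrict (act2 e M) (cdom c)) ` \<Gamma>) \<and>
     {x \<in> cdom c. cmap c x \<in> S} = cdom c \<inter> first_factor e"

text \<open>The orbifold \<open>[Y]\<close>. The second condition says that the orbifold structure is one on the complex
  space \<open>Y\<close>: for a chart \<open>(V, G, \<pi>)\<close> the homeomorphism \<open>V/G \<rightarrow> \<pi>(V)\<close> is an isomorphism of
  complex spaces.\<close>

definition ADE_orbifold ::
    "(2 \<Rightarrow> 'd::finite) \<Rightarrow> (complex ^ 'n::finite) set set \<Rightarrow> ('d, (complex ^ 'n) set) orb_chart set \<Rightarrow> bool" where
  "ADE_orbifold e Y A \<longleftrightarrow>
     orbifold_atlas (subtopology proj_space Y) A \<and>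
     (\<forall>c \<in> A. \<forall>U f. openin (subtopology proj_space Y) U \<and> U \<subseteq> cmap c ` cdom c \<longrightarrow>
        (var_holomorphic U f \<longleftrightarrow> holomorphic {x \<in> cdom c. cmap c x \<in> U} (f \<circ> cmap c))) \<and>
     (\<forall>c \<in> A. \<forall>x \<in> cdom c.
        if cmap c x \<in> sing_locus Y then ADE_chart e (sing_locus Y) c
        else carrier (local_group c x) = {\<one>\<^bsub>local_group c x\<^esub>})"


section \<open>The inertia orbifold\<close>

text \<open>The disjoint union, over the charts \<open>c\<close> and the elements \<open>g\<close> of their groups, of the fixed
  point sets of \<open>g\<close>; its points are written \<open>((c, g), x)\<close>.\<close>

type_synonym ('d, 'y) inertia_pt =
  "(('d, 'y) orb_chart \<times> (complex ^ 'd \<Rightarrow> complex ^ 'd)) \<times> (complex ^ 'd)"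

definition inertia_cover ::
    "('d::finite, 'y) orb_chart set \<Rightarrow> ('d, 'y) inertia_pt topology" where
  "inertia_cover A =
     sum_topology (\<lambda>(c, g). top_of_set {x \<in> cdom c. g x = x}) (SIGMA c:A. cgrp c)"

text \<open>\<open>(x, g)\<close> and \<open>(x', g')\<close> represent the same point of the coarse space if \<open>x\<close> and \<open>x'\<close> lie over
  the same point \<open>y\<close> and some germ of change of charts conjugates \<open>g\<close> into \<open>g'\<close>. The equivalence class
  of \<open>(x, g)\<close> is thus the conjugacy class \<open>(g)\<^sub>y\<close>, independently of the chart in which the local
  group of \<open>y\<close> is computed.\<close>

definition inertia_equiv ::
    "('d::finite, 'y) inertia_pt \<Rightarrow> ('d, 'y) inertia_pt \<Rightarrow> bool" where
  "inertia_equiv = (\<lambda>((c, g), x) ((c', g'), x').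
     \<exists>\<psi>. chart_change c x c' x' \<psi> \<and> (\<forall>\<^sub>F z in nhds x. \<psi> (g z) = g' (\<psi> z)))"

definition inertia_proj ::
    "('d::finite, 'y) orb_chart set \<Rightarrow> ('d, 'y) inertia_pt \<Rightarrow> 'y \<times> ('d, 'y) inertia_pt set" where
  "inertia_proj A = (\<lambda>((c, g), x).
     (cmap c x, {u \<in> topspace (inertia_cover A). inertia_equiv ((c, g), x) u}))"

text \<open>The coarse space \<open>Y\<^sub>1\<close> of pairs \<open>(y, (g)\<^sub>y)\<close>; the map \<open>\<tau>\<close> is \<^const>\<open>fst\<close>.\<close>

definition inertia_space ::
    "('d::finite, 'y) orb_chart set \<Rightarrow> ('y \<times> ('d, 'y) inertia_pt set) topology" where
  "inertia_space A = quotient_topology (inertia_cover A) (inertia_proj A)"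

definition twisted_sectors ::
    "('d::finite, 'y) orb_chart set \<Rightarrow> ('y \<times> ('d, 'y) inertia_pt set) set set" where
  "twisted_sectors A = {K \<in> connected_components_of (inertia_space A).
     \<forall>(y, C) \<in> K. \<forall>((c, g), x) \<in> C. g \<noteq> \<one>\<^bsub>local_group c x\<^esub>}"

definition twisted_space ::
    "('d::finite, 'y) orb_chart set \<Rightarrow> ('y \<times> ('d, 'y) inertia_pt set) topology" where
  "twisted_space A = subtopology (inertia_space A) (\<Union> (twisted_sectors A))"

definition twisted_fiber ::
    "('d::finite, 'y) orb_chart set \<Rightarrow> 'y \<Rightarrow> ('y \<times> ('d, 'y) inertia_pt set) set" where
  "twisted_fiber A y = {u \<in> topspace (twisted_space A). fst u = y}"

text \<open>\<open>(y, (g)\<^sub>y)\<close> seen as a conjugacy class of the local group of \<open>y\<close> computed at a point \<open>x\<close> over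
  \<open>y\<close> in the chart \<open>c\<close>.\<close>

definition class_at ::
    "('d::finite, 'y) orb_chart \<Rightarrow> complex ^ 'd \<Rightarrow> 'y \<times> ('d, 'y) inertia_pt set \<Rightarrow>
     (complex ^ 'd \<Rightarrow> complex ^ 'd) set" where
  "class_at c x u = {g. ((c, g), x) \<in> snd u}"


section \<open>Conjugacy classes, representations and the McKay graph\<close>

definition nontriv_conj_classes :: "'g monoid \<Rightarrow> 'g set set" where
  "nontriv_conj_classes G =
     orbits G (carrier G) (\<lambda>g. \<lambda>h \<in> carrier G. g \<otimes>\<^bsub>G\<^esub> h \<otimes>\<^bsub>G\<^esub> inv\<^bsub>G\<^esub> g) - {{\<one>\<^bsub>G\<^esub>}}"

text \<open>Complex matrix representations of degree \<open>n\<close>; only the values on the carrier matter.\<close>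

definition representation :: "'g monoid \<Rightarrow> nat \<Rightarrow> ('g \<Rightarrow> complex Matrix.mat) \<Rightarrow> bool" where
  "representation G n \<rho> \<longleftrightarrow>
     (\<forall>g \<in> carrier G. \<rho> g \<in> carrier_mat n n) \<and> \<rho> \<one>\<^bsub>G\<^esub> = 1\<^sub>m n \<and>
     (\<forall>g \<in> carrier G. \<forall>h \<in> carrier G. \<rho> (g \<otimes>\<^bsub>G\<^esub> h) = \<rho> g * \<rho> h)"

definition degree_rep :: "'g monoid \<Rightarrow> ('g \<Rightarrow> complex Matrix.mat) \<Rightarrow> nat" where
  "degree_rep G \<rho> = dim_row (\<rho> \<one>\<^bsub>G\<^esub>)"

definition Hom_rep ::
    "'g monoid \<Rightarrow> ('g \<Rightarrow> complex Matrix.mat) \<Rightarrow> ('g \<Rightarrow> complex Matrix.mat) \<Rightarrow> complex Matrix.mat set" where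
  "Hom_rep G \<rho> \<sigma> = {T \<in> carrier_mat (degree_rep G \<sigma>) (degree_rep G \<rho>).
     \<forall>g \<in> carrier G. T * \<rho> g = \<sigma> g * T}"

definition dim_Hom_rep ::
    "'g monoid \<Rightarrow> ('g \<Rightarrow> complex Matrix.mat) \<Rightarrow> ('g \<Rightarrow> complex Matrix.mat) \<Rightarrow> nat" where
  "dim_Hom_rep G \<rho> \<sigma> = vectorspace.dim (class_ring :: complex ring)
     ((module_mat TYPE(complex) (degree_rep G \<sigma>) (degree_rep G \<rho>))\<lparr>carrier := Hom_rep G \<rho> \<sigma>\<rparr>)"

definition equiv_rep ::
    "'g monoid \<Rightarrow> ('g \<Rightarrow> complex Matrix.mat) \<Rightarrow> ('g \<Rightarrow> complex Matrix.mat) \<Rightarrow> bool" where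
  "equiv_rep G \<rho> \<sigma> \<longleftrightarrow> (\<exists>T \<in> Hom_rep G \<rho> \<sigma>. invertible_mat T)"

definition irreducible_rep :: "'g monoid \<Rightarrow> ('g \<Rightarrow> complex Matrix.mat) \<Rightarrow> bool" where
  "irreducible_rep G \<rho> \<longleftrightarrow> (\<exists>n > 0. representation G n \<rho> \<and>
     (\<forall>W. VectorSpace.subspace class_ring W (module_vec TYPE(complex) n) \<and>
          (\<forall>g \<in> carrier G. \<forall>w \<in> W. \<rho> g *\<^sub>v w \<in> W) \<longrightarrow>
        W = {0\<^sub>v n} \<or> W = carrier_vec n))"

text \<open>The Kronecker product, which describes the tensor product of linear maps.\<close>

definition kronecker :: "complex Matrix.mat \<Rightarrow> complex Matrix.mat \<Rightarrow> complex Matrix.mat" where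
  "kronecker M N = Matrix.mat (dim_row M * dim_row N) (dim_col M * dim_col N)
     (\<lambda>(i, j). M $$ (i div dim_row N, j div dim_col N) * N $$ (i mod dim_row N, j mod dim_col N))"

definition tensor_rep ::
    "('g \<Rightarrow> complex Matrix.mat) \<Rightarrow> ('g \<Rightarrow> complex Matrix.mat) \<Rightarrow> 'g \<Rightarrow> complex Matrix.mat" where
  "tensor_rep \<rho> \<sigma> g = kronecker (\<rho> g) (\<sigma> g)"

definition irrep_class :: "'g monoid \<Rightarrow> ('g \<Rightarrow> complex Matrix.mat) \<Rightarrow> ('g \<Rightarrow> complex Matrix.mat) set" where
  "irrep_class G \<rho> = {\<sigma>. irreducible_rep G \<sigma> \<and> equiv_rep G \<rho> \<sigma>}"

definition nontriv_irreps :: "'g monoid \<Rightarrow> ('g \<Rightarrow> complex Matrix.mat) set set" where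
  "nontriv_irreps G = {irrep_class G \<rho> | \<rho>. irreducible_rep G \<rho>} - {irrep_class G (\<lambda>_. 1\<^sub>m 1)}"

text \<open>The McKay graph of \<open>G\<close> with respect to \<open>Q\<close> has the vertex set \<^const>\<open>nontriv_irreps\<close> and
  \<open>mckay_arrows G Q X Z\<close> arrows joining \<open>X\<close> and \<open>Z\<close>; this number does not depend on the
  representatives chosen.\<close>

definition mckay_arrows ::
    "'g monoid \<Rightarrow> ('g \<Rightarrow> complex Matrix.mat) \<Rightarrow>
     ('g \<Rightarrow> complex Matrix.mat) set \<Rightarrow> ('g \<Rightarrow> complex Matrix.mat) set \<Rightarrow> nat" where
  "mckay_arrows G Q X Z = dim_Hom_rep G (SOME \<rho>. \<rho> \<in> X) (tensor_rep Q (SOME \<sigma>. \<sigma> \<in> Z))"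

definition mckay_automorphisms ::
    "'g monoid \<Rightarrow> ('g \<Rightarrow> complex Matrix.mat) \<Rightarrow>
     (('g \<Rightarrow> complex Matrix.mat) set \<Rightarrow> ('g \<Rightarrow> complex Matrix.mat) set) set" where
  "mckay_automorphisms G Q = {\<alpha> \<in> Bij (nontriv_irreps G).
     \<forall>X \<in> nontriv_irreps G. \<forall>Z \<in> nontriv_irreps G.
       mckay_arrows G Q (\<alpha> X) (\<alpha> Z) = mckay_arrows G Q X Z}"

text \<open>The pairs \<open>(G, Q)\<close> that occur as local group and normal representation: a finite group with a
  faithful representation in \<open>SL(2,\<complex>)\<close>.\<close>

definition SL2_pair :: "'g monoid \<Rightarrow> ('g \<Rightarrow> complex Matrix.mat) \<Rightarrow> bool" where
  "SL2_pair G Q \<longleftrightarrow> group G \<and> finite (carrier G) \<and> representation G 2 Q \<and>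
     inj_on Q (carrier G) \<and> (\<forall>g \<in> carrier G. Determinant.det (Q g) = 1)"

text \<open>A canonical identification of the nontrivial conjugacy classes with the nontrivial irreducible
  representations: it depends on \<open>(G, Q)\<close> only and is compatible with all isomorphisms of such pairs.\<close>

definition canonical_identification ::
    "('g monoid \<Rightarrow> ('g \<Rightarrow> complex Matrix.mat) \<Rightarrow> 'g set \<Rightarrow> ('g \<Rightarrow> complex Matrix.mat) set) \<Rightarrow> bool" where
  "canonical_identification \<theta> \<longleftrightarrow>
     (\<forall>G Q. SL2_pair G Q \<longrightarrow> bij_betw (\<theta> G Q) (nontriv_conj_classes G) (nontriv_irreps G)) \<and>
     (\<forall>G Q G' Q' \<phi>. SL2_pair G Q \<and> SL2_pair G' Q' \<and> \<phi> \<in> iso G G' \<and> equiv_rep G (Q' \<circ> \<phi>) Q \<longrightarrow>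
        (\<forall>C \<in> nontriv_conj_classes G.
           \<theta> G' Q' (\<phi> ` C) = {\<mu>. irreducible_rep G' \<mu> \<and> \<mu> \<circ> \<phi> \<in> \<theta> G Q C}))"


section \<open>The normal bundle of the singular suborbifold\<close>

text \<open>The tangent space at \<open>x\<close> of a submanifold \<open>Z\<close>, as the set of velocities of curves in \<open>Z\<close>.\<close>

definition tangent_space :: "(complex ^ 'd::finite) set \<Rightarrow> complex ^ 'd \<Rightarrow> (complex ^ 'd) set" where
  "tangent_space Z x = {v. \<exists>\<gamma> :: real \<Rightarrow> complex ^ 'd.
     (\<gamma> has_vector_derivative v) (at 0) \<and> \<gamma> 0 = x \<and> (\<forall>\<^sub>F t in nhds 0. \<gamma> t \<in> Z)}"

text \<open>\<open>Q\<close> is a matrix form, of degree \<open>n\<close>, of the representation of the local group on the fiber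
  \<open>T\<^sub>xV / T\<^sub>x(\<pi>\<^sup>-\<^sup>1 S)\<close> of the normal bundle of \<open>[S]\<close>: the linear map \<open>L\<close> induces an
  isomorphism of this quotient with \<open>\<complex>\<^sup>n\<close>.\<close>

definition normal_rep ::
    "'y set \<Rightarrow> ('d::finite, 'y) orb_chart \<Rightarrow> complex ^ 'd \<Rightarrow> nat \<Rightarrow>
     ((complex ^ 'd \<Rightarrow> complex ^ 'd) \<Rightarrow> complex Matrix.mat) \<Rightarrow> bool" where
  "normal_rep S c x n Q \<longleftrightarrow>
     representation (local_group c x) n Q \<and>
     (\<exists>L :: complex ^ 'd \<Rightarrow> complex Matrix.vec.
        L ` UNIV = carrier_vec n \<and> (\<forall>v w. L (v + w) = L v + L w) \<and> (\<forall>a v. L (a *s v) = a \<cdot>\<^sub>v L v) \<and>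
        {v. L v = 0\<^sub>v n} = tangent_space {z \<in> cdom c. cmap c z \<in> S} x \<and>
        (\<forall>g \<in> carrier (local_group c x). \<forall>v. L (frechet_derivative g (at x) v) = Q g *\<^sub>v L v))"

end

theory Submission
  imports Defs "Jordan_Normal_Form.Spectral_Radius" "HOL-Algebra.Multiplicative_Group" "HOL-Real_Asymp.Real_Asymp"
begin

text \<open>A chart of \<open>[Y]\<close> over a point of \<open>S\<close> is an open set of \<open>\<complex>\<^sup>k \<times> \<complex>\<^sup>2\<close> on which a finite subgroup of
  SL(2) acts linearly. Such a group acts freely off \<open>\<complex>\<^sup>k \<times> {0}\<close>, whose complement in a ball is
  connected, so a germ of change of charts conjugates the two groups by a well-defined isomorphism;
  the normal derivative of the change of charts intertwines the two normal representations. Along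
  \<open>S\<close> the twisted sectors are therefore locally the product of \<open>S\<close> with the set of nontrivial
  conjugacy classes, and the monodromy of a loop is induced by an automorphism \<open>\<phi>\<close> of \<open>G\<close> with
  \<open>Q \<circ> \<phi>\<close> equivalent to \<open>Q\<close>. The permutation of the irreducible representations induced by such a
  \<open>\<phi>\<close> preserves the McKay graph, because the number of arrows depends only on \<open>Q\<close> up to equivalence.

  It remains to choose the bijection between classes and representations equivariantly under the
  group of these \<open>\<phi>\<close>. By Brauer's permutation lemma each \<open>\<phi>\<close> fixes as many nontrivial classes as
  nontrivial irreducible representations. Counting the poles of \<open>G\<close> on the projective line shows that
  there are at most three orbits of poles and that their permutation determines the action of \<open>\<phi>\<close> on
  classes; so \<open>\<phi>\<close> runs through a group of order at most two, or else there are four nontrivial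
  classes, one of them fixed. In both cases the equality of the numbers of fixed points suffices to
  construct an equivariant bijection. It is transported to all isomorphic pairs \<open>(G, Q)\<close> from a
  chosen one.\<close>

text \<open>The obstacle is that the bijection must be equivariant for all automorphisms at once.
  Brauer's lemma compares fixed points of one automorphism at a time, and two finite sets on which
  every group element has equally many fixed points need not be isomorphic as sets with an action,
  unless the acting group is cyclic. Hence the detour through poles: it shows, without the ADE
  classification, that very few permutations of the classes occur. What enters about an automorphism
  is that it preserves eigenvalues, because \<open>Q\<close> composed with it is equivalent to
  \<open>Q\<close>; the squaring map of a cyclic group of order five, for instance, is excluded by
  this. Naturality is required for every isomorphism of pairs, so choices are made once per
  isomorphism class, and equivariance under self-isomorphisms is exactly what makes the transport
  independent of the isomorphism used. On the geometric side, a permutation of classes alone would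
  say nothing about representations; the transport along a path is therefore realised by one group
  isomorphism that serves all sheets simultaneously.\<close>

type_synonym cmat = "complex Matrix.mat"
type_synonym cvec = "complex Matrix.vec"

notation Matrix.vec_index (infixl "$v" 100)

section \<open>Matrices\<close>

definition mtrace :: "cmat \<Rightarrow> complex" where
  "mtrace A = (\<Sum>i<dim_row A. A $$ (i, i))"

lemma index_mult_sum:
  assumes "A \<in> carrier_mat n m" "B \<in> carrier_mat m k" "i < n" "j < k"
  shows "(A * B) $$ (i, j) = (\<Sum>l<m. A $$ (i, l) * B $$ (l, j))"
  using assms by (auto simp: scalar_prod_def atLeast0LessThan)

lemma mtrace_comm:
  assumes "A \<in> carrier_mat n m" "B \<in> carrier_mat m n"
  shows "mtrace (A * B) = mtrace (B * A)"
proof -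
  have "mtrace (A * B) = (\<Sum>i<n. \<Sum>l<m. A $$ (i, l) * B $$ (l, i))"
    using assms by (auto simp: mtrace_def index_mult_sum[OF assms] simp del: index_mult_mat(1) intro!: sum.cong)
  also have "\<dots> = (\<Sum>l<m. \<Sum>i<n. B $$ (l, i) * A $$ (i, l))"
    by (subst sum.swap) (simp add: mult.commute)
  also have "\<dots> = mtrace (B * A)"
    using assms by (auto simp: mtrace_def index_mult_sum[OF assms(2,1)] simp del: index_mult_mat(1) intro!: sum.cong)
  finally show ?thesis .
qed

lemma mtrace_one: "mtrace (1\<^sub>m n) = of_nat n"
  by (simp add: mtrace_def)

lemma mtrace_smult: "mtrace (c \<cdot>\<^sub>m A) = c * mtrace A" if "A \<in> carrier_mat n n"
  using that by (auto simp: mtrace_def sum_distrib_left)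

lemma mtrace_add: "mtrace (A + B) = mtrace A + mtrace B"
  if "A \<in> carrier_mat n n" "B \<in> carrier_mat n n"
  using that by (auto simp: mtrace_def sum.distrib)

text \<open>The traces of \<open>A * B\<close> and \<open>B * A\<close> agree, and in characteristic
  zero the trace of an identity matrix determines its size. This settles equality of degrees without
  dimension theory.\<close>

lemma mutually_inverse_square:
  fixes A B :: "cmat"
  assumes "A \<in> carrier_mat n m" "B \<in> carrier_mat m n" "A * B = 1\<^sub>m n" "B * A = 1\<^sub>m m"
  shows "n = m"
  using mtrace_comm[OF assms(1,2)] assms(3,4) by (simp add: mtrace_one)

lemma mat_eq_mult_vecI:
  fixes A B :: "cmat"
  assumes A: "A \<in> carrier_mat n m" and B: "B \<in> carrier_mat n m"
    and eq: "\<And>v. v \<in> carrier_vec m \<Longrightarrow> A *\<^sub>v v = B *\<^sub>v v"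
  shows "A = B"
proof (rule eq_matI)
  fix i j assume "i < dim_row B" "j < dim_col B"
  then have ij: "i < n" "j < m" using B by auto
  have "(A *\<^sub>v unit_vec m j) $v i = (B *\<^sub>v unit_vec m j) $v i"
    using eq[of "unit_vec m j"] by simp
  then show "A $$ (i, j) = B $$ (i, j)" using A B ij by (simp add: scalar_prod_right_unit)
qed (use A B in auto)

text \<open>If \<open>n < r\<close>, padding \<open>A\<close> by zero rows and \<open>B\<close> by
  zero columns to size \<open>r\<close> leaves the product \<open>B * A\<close> unchanged. For
  square matrices a left inverse is a right inverse, but row \<open>n\<close> of the padded
  \<open>A\<close> is zero.\<close>

lemma left_inverse_le:
  fixes A B :: "cmat"
  assumes A: "A \<in> carrier_mat n r" and B: "B \<in> carrier_mat r n" and BA: "B * A = 1\<^sub>m r"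
  shows "r \<le> n"
proof (rule ccontr)
  assume "\<not> r \<le> n"
  then have nr: "n < r" by simp
  define A' where "A' = Matrix.mat r r (\<lambda>(i, j). if i < n then A $$ (i, j) else 0)"
  define B' where "B' = Matrix.mat r r (\<lambda>(i, j). if j < n then B $$ (i, j) else 0)"
  have c: "A' \<in> carrier_mat r r" "B' \<in> carrier_mat r r" by (auto simp: A'_def B'_def)
  have "B' * A' = B * A"
  proof (rule eq_matI)
    fix i j assume "i < dim_row (B * A)" "j < dim_col (B * A)"
    then have ij: "i < r" "j < r" using A B by auto
    have "(B' * A') $$ (i, j) = (\<Sum>l<r. B' $$ (i, l) * A' $$ (l, j))"
      using index_mult_sum[OF c(2,1)] ij by simp
    also have "\<dots> = (\<Sum>l<n. B $$ (i, l) * A $$ (l, j))"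
      by (rule sum.mono_neutral_cong_right) (use nr ij in \<open>auto simp: A'_def B'_def\<close>)
    also have "\<dots> = (B * A) $$ (i, j)" using index_mult_sum[OF B A] ij by simp
    finally show "(B' * A') $$ (i, j) = (B * A) $$ (i, j)" .
  qed (use A B c in auto)
  then have "B' * A' = 1\<^sub>m r" using BA by simp
  then have "A' * B' = 1\<^sub>m r" using c mat_mult_left_right_inverse by blast
  then have "(A' * B') $$ (n, n) = 1" using nr by simp
  moreover have "(A' * B') $$ (n, n) = 0"
    using index_mult_sum[OF c, of n n] nr by (simp add: A'_def)
  ultimately show False by simp
qed

section \<open>Subspaces of coordinate space as ranges of split injections\<close>

lemma subspace_module_vec_iff:
  "VectorSpace.subspace class_ring W (module_vec TYPE(complex) n) \<longleftrightarrow>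
     W \<subseteq> carrier_vec n \<and> 0\<^sub>v n \<in> W \<and> (\<forall>v\<in>W. \<forall>w\<in>W. v + w \<in> W) \<and> (\<forall>a. \<forall>v\<in>W. a \<cdot>\<^sub>v v \<in> W)"
proof -
  have "vectorspace (class_ring :: complex ring) (module_vec TYPE(complex) n)"
    by (rule vec_vs)
  moreover have "Module.module (class_ring :: complex ring) (module_vec TYPE(complex) n)"
    using calculation by (simp add: vectorspace_def)
  ultimately show ?thesis
    by (auto simp: VectorSpace.subspace_def LinearCombinations.submodule_def module_vec_simps class_ring_simps)
qed

text \<open>A substitute for bases: \<open>A\<close> parametrises \<open>W\<close>, and
  \<open>A * B\<close> is a projection onto \<open>W\<close>. Take \<open>r\<close> maximal such
  that a left-invertible \<open>A\<close> maps into \<open>W\<close>; \<open>left_inverse_le\<close>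
  bounds \<open>r\<close>. A vector of \<open>W\<close> not fixed by \<open>A * B\<close> would
  allow one more column.\<close>

lemma subspace_factorization:
  assumes W: "VectorSpace.subspace class_ring W (module_vec TYPE(complex) n)"
  obtains r A B where "A \<in> carrier_mat n r" "B \<in> carrier_mat r n" "B * A = 1\<^sub>m r"
    "\<And>v. v \<in> carrier_vec r \<Longrightarrow> A *\<^sub>v v \<in> W" "\<And>w. w \<in> W \<Longrightarrow> A *\<^sub>v (B *\<^sub>v w) = w"
proof -
  note W = W[unfolded subspace_module_vec_iff]
  define P where "P r \<longleftrightarrow> (\<exists>A B. A \<in> carrier_mat n r \<and> B \<in> carrier_mat r n \<and> B * A = 1\<^sub>m r \<and>
     (\<forall>v \<in> carrier_vec r. A *\<^sub>v v \<in> W))" for r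
  have "P 0" unfolding P_def
  proof (intro exI conjI ballI)
    show "(0\<^sub>m n 0 :: cmat) \<in> carrier_mat n 0" "(0\<^sub>m 0 n :: cmat) \<in> carrier_mat 0 n" by auto
    show "0\<^sub>m n 0 *\<^sub>v v \<in> W" if "v \<in> carrier_vec 0" for v :: "cvec"
    proof -
      have "0\<^sub>m n 0 *\<^sub>v v = 0\<^sub>v n" using that by (intro eq_vecI) (auto simp: scalar_prod_def)
      then show ?thesis using W by simp
    qed
  qed auto
  moreover have "r \<le> n" if "P r" for r using that left_inverse_le unfolding P_def by blast
  ultimately obtain r where r: "P r" and max: "\<And>s. P s \<Longrightarrow> s \<le> r"
    by (metis (full_types) GreatestI_nat Greatest_le_nat)
  then obtain A B where A: "A \<in> carrier_mat n r" and B: "B \<in> carrier_mat r n" and BA: "B * A = 1\<^sub>m r"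
    and AW: "\<And>v. v \<in> carrier_vec r \<Longrightarrow> A *\<^sub>v v \<in> W" unfolding P_def by blast
  have "A *\<^sub>v (B *\<^sub>v w) = w" if w: "w \<in> W" for w
  proof (rule ccontr)
    assume ne: "A *\<^sub>v (B *\<^sub>v w) \<noteq> w"
    have wc: "w \<in> carrier_vec n" using W w by auto
    \<comment> \<open>A nonzero vector of \<open>W\<close> in the kernel of \<open>B\<close>, hence
      independent of the columns of \<open>A\<close>; it becomes the new column.\<close>
    define u where "u = w + (-1) \<cdot>\<^sub>v (A *\<^sub>v (B *\<^sub>v w))"
    have u: "u \<in> W" unfolding u_def using W w AW B wc by auto
    have uc: "u \<in> carrier_vec n" using u W by auto
    have u0: "u \<noteq> 0\<^sub>v n"
    proof
      assume "u = 0\<^sub>v n"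
      then have "\<And>i. i < n \<Longrightarrow> u $v i = 0" by simp
      then have "\<And>i. i < n \<Longrightarrow> w $v i = (A *\<^sub>v (B *\<^sub>v w)) $v i"
        unfolding u_def using A wc by (auto simp del: index_mult_mat_vec)
      then have "A *\<^sub>v (B *\<^sub>v w) = w" using A wc by (intro eq_vecI) auto
      then show False using ne by simp
    qed
    have Bu: "B *\<^sub>v u = 0\<^sub>v r"
    proof -
      have "B *\<^sub>v u = B *\<^sub>v w + (-1) \<cdot>\<^sub>v (B *\<^sub>v (A *\<^sub>v (B *\<^sub>v w)))"
        unfolding u_def using A B wc by (simp add: mult_add_distrib_mat_vec mult_mat_vec)
      also have "B *\<^sub>v (A *\<^sub>v (B *\<^sub>v w)) = (B * A) *\<^sub>v (B *\<^sub>v w)"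
        using A B wc by (metis assoc_mult_mat_vec mult_mat_vec_carrier)
      also have "\<dots> = B *\<^sub>v w" using BA B wc by simp
      finally show ?thesis using B wc by auto
    qed
    define N where "N = (\<Sum>i<n. cnj (u $v i) * u $v i)"
    have N0: "N \<noteq> 0"
    proof
      assume "N = 0"
      have "N = complex_of_real (\<Sum>i<n. (cmod (u $v i))\<^sup>2)"
        by (simp add: N_def complex_norm_square mult.commute del: of_real_power)
      with \<open>N = 0\<close> have "(\<Sum>i<n. (cmod (u $v i))\<^sup>2) = 0" by (metis of_real_eq_0_iff)
      then have "\<forall>i<n. u $v i = 0" by (subst (asm) sum_nonneg_eq_0_iff) auto
      then show False using u0 uc by (metis carrier_vecD eq_vecI index_zero_vec)
    qed
    define U where "U = Matrix.mat n 1 (\<lambda>(i, j). u $v i)"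
    \<comment> \<open>\<open>C0\<close> is the Hermitian dual of \<open>u\<close>, scaled to take
      the value 1 on \<open>u\<close>. The correction in \<open>C\<close> kills the range of
      \<open>A\<close> and keeps the value on \<open>u\<close>, because \<open>B * U\<close> is
      zero. So the row \<open>C\<close> extends \<open>B\<close> to a left inverse of the enlarged
      \<open>A\<close>.\<close>
    define C0 where "C0 = Matrix.mat 1 n (\<lambda>(i, j). cnj (u $v j) / N)"
    define C where "C = C0 - C0 * A * B"
    have cU: "U \<in> carrier_mat n 1" and cC0: "C0 \<in> carrier_mat 1 n" and cC: "C \<in> carrier_mat 1 n"
      using A B by (auto simp: U_def C0_def C_def)
    have BU: "B * U = 0\<^sub>m r 1"
    proof (rule eq_matI)
      fix i j assume "i < dim_row (0\<^sub>m r 1 :: cmat)" "j < dim_col (0\<^sub>m r 1 :: cmat)"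
      then have ij: "i < r" "j = 0" by auto
      have "(B * U) $$ (i, 0) = (B *\<^sub>v u) $v i"
        using ij B uc cU by (simp add: scalar_prod_def U_def)
      then show "(B * U) $$ (i, j) = 0\<^sub>m r 1 $$ (i, j)" using Bu ij by simp
    qed (use B cU in auto)
    have C0U: "C0 * U = 1\<^sub>m 1"
    proof (rule eq_matI)
      fix i j assume "i < dim_row (1\<^sub>m 1 :: cmat)" "j < dim_col (1\<^sub>m 1 :: cmat)"
      then have ij: "i = 0" "j = 0" by auto
      have "(C0 * U) $$ (0, 0) = (\<Sum>l<n. cnj (u $v l) / N * u $v l)"
        using index_mult_sum[OF cC0 cU, of 0 0] by (simp add: C0_def U_def)
      also have "\<dots> = N / N" by (subst (2) N_def) (simp add: sum_divide_distrib)
      finally show "(C0 * U) $$ (i, j) = 1\<^sub>m 1 $$ (i, j)" using ij N0 by simp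
    qed (use cC0 cU in auto)
    have CU: "C * U = 1\<^sub>m 1"
    proof -
      have "C * U = C0 * U - C0 * A * B * U" unfolding C_def
        using A B cU cC0 by (intro minus_mult_distrib_mat) auto
      also have "C0 * A * B * U = C0 * A * (B * U)"
        using A B cU cC0 by (intro assoc_mult_mat) auto
      also have "\<dots> = 0\<^sub>m 1 1" unfolding BU using A cC0 by (simp add: right_mult_zero_mat)
      finally show ?thesis using C0U by auto
    qed
    have CA: "C * A = 0\<^sub>m 1 r"
    proof -
      have "C * A = C0 * A - C0 * A * B * A" unfolding C_def
        using A B cC0 by (intro minus_mult_distrib_mat) auto
      also have "C0 * A * B * A = C0 * A * (B * A)"
        using A B cC0 by (intro assoc_mult_mat) auto
      also have "\<dots> = C0 * A" unfolding BA using A cC0 by simp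
      finally show ?thesis using A cC0 by auto
    qed
    define A' where "A' = four_block_mat A U (0\<^sub>m 0 r) (0\<^sub>m 0 1)"
    define B' where "B' = four_block_mat B (0\<^sub>m r 0) C (0\<^sub>m 1 0)"
    have A': "A' \<in> carrier_mat n (Suc r)" and B': "B' \<in> carrier_mat (Suc r) n"
      unfolding A'_def B'_def using A B cU cC by auto
    have "B' * A' = four_block_mat (B * A + 0\<^sub>m r 0 * 0\<^sub>m 0 r) (B * U + 0\<^sub>m r 0 * 0\<^sub>m 0 1)
       (C * A + 0\<^sub>m 1 0 * 0\<^sub>m 0 r) (C * U + 0\<^sub>m 1 0 * 0\<^sub>m 0 1)"
      unfolding A'_def B'_def by (rule mult_four_block_mat) (use A B cU cC in auto)
    also have "\<dots> = four_block_mat (1\<^sub>m r) (0\<^sub>m r 1) (0\<^sub>m 1 r) (1\<^sub>m 1)"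
      unfolding BA BU CA CU by simp
    also have "\<dots> = 1\<^sub>m (Suc r)" by (rule eq_matI) auto
    finally have BA': "B' * A' = 1\<^sub>m (Suc r)" .
    have "A' *\<^sub>v v \<in> W" if v: "v \<in> carrier_vec (Suc r)" for v
    proof -
      define x where "x = vec_first v r"
      have x: "x \<in> carrier_vec r" by (simp add: x_def)
      have "A' *\<^sub>v v = A *\<^sub>v x + v $v r \<cdot>\<^sub>v u"
      proof (rule eq_vecI)
        fix i assume "i < dim_vec (A *\<^sub>v x + v $v r \<cdot>\<^sub>v u)"
        then have i: "i < n" using uc by auto
        have "(A' *\<^sub>v v) $v i = (\<Sum>j<Suc r. A' $$ (i, j) * v $v j)"
          using i A' v by (simp add: scalar_prod_def atLeast0LessThan)
        also have "\<dots> = (\<Sum>j<r. A $$ (i, j) * x $v j) + u $v i * v $v r"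
          using i A v cU by (auto simp: A'_def x_def vec_first_def U_def intro!: sum.cong)
        also have "\<dots> = (A *\<^sub>v x + v $v r \<cdot>\<^sub>v u) $v i"
          using i A x uc by (simp add: scalar_prod_def atLeast0LessThan)
        finally show "(A' *\<^sub>v v) $v i = (A *\<^sub>v x + v $v r \<cdot>\<^sub>v u) $v i" .
      qed (use A' A uc in auto)
      then show ?thesis using W AW[OF x] u by auto
    qed
    then have "P (Suc r)" unfolding P_def using A' B' BA' by blast
    then show False using max by fastforce
  qed
  then show ?thesis using that A B BA AW by blast
qed

section \<open>Sums of matrices\<close>

text \<open>The size is an argument because matrices of all sizes share one type, which has no
  common zero to start an ordinary sum from.\<close>

definition sum_mat :: "nat \<Rightarrow> nat \<Rightarrow> ('g \<Rightarrow> cmat) \<Rightarrow> 'g set \<Rightarrow> cmat" where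
  "sum_mat n m f S = Matrix.mat n m (\<lambda>ij. \<Sum>g\<in>S. f g $$ ij)"

lemma sum_mat_carrier [simp]: "sum_mat n m f S \<in> carrier_mat n m"
  by (simp add: sum_mat_def)

lemma sum_mat_cong: "(\<And>g. g \<in> S \<Longrightarrow> f g = f' g) \<Longrightarrow> sum_mat n m f S = sum_mat n m f' S"
  by (simp add: sum_mat_def)

lemma sum_mat_reindex: "bij_betw h S S' \<Longrightarrow> sum_mat n m (f \<circ> h) S = sum_mat n m f S'"
  by (simp add: sum_mat_def sum.reindex_bij_betw[of h S S', symmetric])

lemma mult_sum_mat:
  assumes "A \<in> carrier_mat k n" "\<And>g. g \<in> S \<Longrightarrow> f g \<in> carrier_mat n m"
  shows "A * sum_mat n m f S = sum_mat k m (\<lambda>g. A * f g) S"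
proof (rule eq_matI)
  fix i j assume "i < dim_row (sum_mat k m (\<lambda>g. A * f g) S)" "j < dim_col (sum_mat k m (\<lambda>g. A * f g) S)"
  then have ij: "i < k" "j < m" by (auto simp: sum_mat_def)
  have "(A * sum_mat n m f S) $$ (i, j) = (\<Sum>l<n. \<Sum>g\<in>S. A $$ (i, l) * f g $$ (l, j))"
    using index_mult_sum[OF assms(1) sum_mat_carrier ij] ij by (simp add: sum_mat_def sum_distrib_left)
  also have "\<dots> = (\<Sum>g\<in>S. \<Sum>l<n. A $$ (i, l) * f g $$ (l, j))" by (rule sum.swap)
  also have "\<dots> = (\<Sum>g\<in>S. (A * f g) $$ (i, j))"
    using index_mult_sum[OF assms(1) assms(2) ij] by simp
  finally show "(A * sum_mat n m f S) $$ (i, j) = sum_mat k m (\<lambda>g. A * f g) S $$ (i, j)"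
    using ij by (simp add: sum_mat_def)
qed (use assms(1) in \<open>auto simp: sum_mat_def\<close>)

lemma sum_mat_mult:
  assumes "A \<in> carrier_mat m k" "\<And>g. g \<in> S \<Longrightarrow> f g \<in> carrier_mat n m"
  shows "sum_mat n m f S * A = sum_mat n k (\<lambda>g. f g * A) S"
proof (rule eq_matI)
  fix i j assume "i < dim_row (sum_mat n k (\<lambda>g. f g * A) S)" "j < dim_col (sum_mat n k (\<lambda>g. f g * A) S)"
  then have ij: "i < n" "j < k" by (auto simp: sum_mat_def)
  have "(sum_mat n m f S * A) $$ (i, j) = (\<Sum>l<m. \<Sum>g\<in>S. f g $$ (i, l) * A $$ (l, j))"
    using index_mult_sum[OF sum_mat_carrier assms(1) ij] ij by (simp add: sum_mat_def sum_distrib_right)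
  also have "\<dots> = (\<Sum>g\<in>S. \<Sum>l<m. f g $$ (i, l) * A $$ (l, j))" by (rule sum.swap)
  also have "\<dots> = (\<Sum>g\<in>S. (f g * A) $$ (i, j))"
    using index_mult_sum[OF assms(2) assms(1) ij] by simp
  finally show "(sum_mat n m f S * A) $$ (i, j) = sum_mat n k (\<lambda>g. f g * A) S $$ (i, j)"
    using ij by (simp add: sum_mat_def)
qed (use assms(1) in \<open>auto simp: sum_mat_def\<close>)

lemma mtrace_sum_mat:
  assumes "\<And>g. g \<in> S \<Longrightarrow> f g \<in> carrier_mat n n"
  shows "mtrace (sum_mat n n f S) = (\<Sum>g\<in>S. mtrace (f g))"
proof -
  have "mtrace (sum_mat n n f S) = (\<Sum>i<n. \<Sum>g\<in>S. f g $$ (i, i))"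
    by (simp add: mtrace_def sum_mat_def)
  also have "\<dots> = (\<Sum>g\<in>S. \<Sum>i<n. f g $$ (i, i))" by (rule sum.swap)
  also have "\<dots> = (\<Sum>g\<in>S. mtrace (f g))"
  proof (rule sum.cong)
    fix g assume "g \<in> S"
    then have "dim_row (f g) = n" using assms by auto
    then show "(\<Sum>i<n. f g $$ (i, i)) = mtrace (f g)" by (simp add: mtrace_def)
  qed simp
  finally show ?thesis .
qed

section \<open>Representations of finite groups\<close>

lemma representation_degree: "representation G n \<rho> \<Longrightarrow> degree_rep G \<rho> = n"
  by (simp add: representation_def degree_rep_def)

lemma Hom_rep_iff:
  assumes "representation G n \<rho>" "representation G m \<sigma>"
  shows "T \<in> Hom_rep G \<rho> \<sigma> \<longleftrightarrow> T \<in> carrier_mat m n \<and> (\<forall>g \<in> carrier G. T * \<rho> g = \<sigma> g * T)"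
  using assms by (simp add: Hom_rep_def representation_degree)

lemma irreducible_repE:
  assumes "irreducible_rep G \<rho>"
  obtains n where "n > 0" "representation G n \<rho>" "degree_rep G \<rho> = n"
  using assms unfolding irreducible_rep_def by (metis representation_degree)

lemma irreducible_rep_invariant:
  assumes "irreducible_rep G \<rho>" "representation G n \<rho>"
    and W: "W \<subseteq> carrier_vec n" "0\<^sub>v n \<in> W" "\<And>v w. v \<in> W \<Longrightarrow> w \<in> W \<Longrightarrow> v + w \<in> W"
      "\<And>a v. v \<in> W \<Longrightarrow> a \<cdot>\<^sub>v v \<in> W" "\<And>g v. g \<in> carrier G \<Longrightarrow> v \<in> W \<Longrightarrow> \<rho> g *\<^sub>v v \<in> W"
  shows "W = {0\<^sub>v n} \<or> W = carrier_vec n"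
proof -
  obtain m where m: "representation G m \<rho>"
    "\<forall>W. (W \<subseteq> carrier_vec m \<and> 0\<^sub>v m \<in> W \<and> (\<forall>v\<in>W. \<forall>w\<in>W. v + w \<in> W) \<and> (\<forall>a. \<forall>v\<in>W. a \<cdot>\<^sub>v v \<in> W)) \<and>
          (\<forall>g \<in> carrier G. \<forall>w \<in> W. \<rho> g *\<^sub>v w \<in> W) \<longrightarrow> W = {0\<^sub>v m} \<or> W = carrier_vec m"
    using assms(1) unfolding irreducible_rep_def subspace_module_vec_iff by auto
  have "m = n" using representation_degree[OF m(1)] representation_degree[OF assms(2)] by simp
  then show ?thesis using m(2)[rule_format, of W] W by auto
qed

text \<open>The columns of the inverse are chosen preimages of the unit vectors. That gives a right
  inverse, and the trivial kernel makes it a left inverse.\<close>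

lemma mat_inverse_of_bijective:
  fixes T :: "cmat"
  assumes T: "T \<in> carrier_mat m n"
    and ker: "\<And>v. v \<in> carrier_vec n \<Longrightarrow> T *\<^sub>v v = 0\<^sub>v m \<Longrightarrow> v = 0\<^sub>v n"
    and im: "\<And>w. w \<in> carrier_vec m \<Longrightarrow> \<exists>v \<in> carrier_vec n. T *\<^sub>v v = w"
  obtains S where "S \<in> carrier_mat n m" "T * S = 1\<^sub>m m" "S * T = 1\<^sub>m n"
proof -
  have "\<forall>j. \<exists>v. v \<in> carrier_vec n \<and> T *\<^sub>v v = unit_vec m j" using im by (metis unit_vec_carrier)
  then obtain p where p: "\<And>j. p j \<in> carrier_vec n" "\<And>j. T *\<^sub>v p j = unit_vec m j" by metis
  define S where "S = Matrix.mat n m (\<lambda>(i, j). (p j) $v i)"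
  have S: "S \<in> carrier_mat n m" by (simp add: S_def)
  have TS: "T * S = 1\<^sub>m m"
  proof (rule eq_matI)
    fix i j assume "i < dim_row (1\<^sub>m m :: cmat)" "j < dim_col (1\<^sub>m m :: cmat)"
    then have ij: "i < m" "j < m" by auto
    have "col S j = p j" using p(1)[of j] ij by (auto simp: S_def)
    then have "(T * S) $$ (i, j) = (T *\<^sub>v p j) $v i"
      using ij T S by simp
    then show "(T * S) $$ (i, j) = 1\<^sub>m m $$ (i, j)" using p(2) ij by (auto simp: unit_vec_def)
  qed (use T S in auto)
  have "S * T = 1\<^sub>m n"
  proof (rule mat_eq_mult_vecI)
    fix v :: "cvec" assume v: "v \<in> carrier_vec n"
    have "T *\<^sub>v (S * T *\<^sub>v v - v) = T *\<^sub>v (S * T *\<^sub>v v) - T *\<^sub>v v"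
      using T S v by (intro mult_minus_distrib_mat_vec[OF T]) auto
    also have "T *\<^sub>v (S * T *\<^sub>v v) = (T * S) *\<^sub>v (T *\<^sub>v v)"
      using T S v by (simp add: assoc_mult_mat_vec[of S n m T n v] assoc_mult_mat_vec[of T m n S m])
    also have "\<dots> = T *\<^sub>v v" using TS T v by simp
    finally have "T *\<^sub>v (S * T *\<^sub>v v - v) = 0\<^sub>v m" using T v by auto
    then have z: "S * T *\<^sub>v v - v = 0\<^sub>v n" using ker T S v by auto
    show "S * T *\<^sub>v v = 1\<^sub>m n *\<^sub>v v"
    proof (rule eq_vecI)
      fix i assume "i < dim_vec (1\<^sub>m n *\<^sub>v v)"
      then have i: "i < n" by simp
      then have "(S * T *\<^sub>v v - v) $v i = 0" using z by simp
      then show "(S * T *\<^sub>v v) $v i = (1\<^sub>m n *\<^sub>v v) $v i"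
        using i v by (simp del: index_mult_mat_vec)
    qed (use S in auto)
  qed (use S T in auto)
  then show ?thesis using that S TS by blast
qed

lemma invertible_mat_obtain:
  assumes "invertible_mat T" "T \<in> carrier_mat m n"
  obtains S where "S \<in> carrier_mat n m" "T * S = 1\<^sub>m m" "S * T = 1\<^sub>m n" "n = m"
proof -
  have nm: "n = m" using assms by (auto simp: invertible_mat_def)
  obtain S where S: "inverts_mat T S" "inverts_mat S T" using assms by (auto simp: invertible_mat_def)
  have TS: "T * S = 1\<^sub>m m" using S assms by (auto simp: inverts_mat_def)
  have "dim_col S = m" using arg_cong[OF TS, of dim_col] by simp
  moreover have ST: "S * T = 1\<^sub>m (dim_row S)" using S by (simp add: inverts_mat_def)
  have "dim_row S = n" using arg_cong[OF ST, of dim_col] assms(2) by simp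
  ultimately show ?thesis using that[of S] TS ST nm by auto
qed

lemma invertible_matI:
  fixes T S :: "cmat"
  assumes "T \<in> carrier_mat m n" "S \<in> carrier_mat n m" "T * S = 1\<^sub>m m" "S * T = 1\<^sub>m n"
  shows "invertible_mat T"
  using mutually_inverse_square[OF assms] assms by (auto simp: invertible_mat_def inverts_mat_def square_mat.simps)

lemma equiv_repE:
  assumes "equiv_rep G \<rho> \<sigma>" "representation G n \<rho>" "representation G m \<sigma>"
  obtains T S where "n = m" "T \<in> carrier_mat n n" "S \<in> carrier_mat n n" "T * S = 1\<^sub>m n" "S * T = 1\<^sub>m n"
    "\<And>g. g \<in> carrier G \<Longrightarrow> T * \<rho> g = \<sigma> g * T"
proof -
  obtain T where T: "T \<in> Hom_rep G \<rho> \<sigma>" "invertible_mat T" using assms(1) by (auto simp: equiv_rep_def)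
  then have Tc: "T \<in> carrier_mat m n" "\<And>g. g \<in> carrier G \<Longrightarrow> T * \<rho> g = \<sigma> g * T"
    using Hom_rep_iff[OF assms(2,3)] by auto
  show ?thesis using invertible_mat_obtain[OF T(2) Tc(1)] that Tc by metis
qed

lemma equiv_repI:
  assumes "representation G n \<rho>" "representation G m \<sigma>"
    "T \<in> carrier_mat m n" "S \<in> carrier_mat n m" "T * S = 1\<^sub>m m" "S * T = 1\<^sub>m n"
    "\<And>g. g \<in> carrier G \<Longrightarrow> T * \<rho> g = \<sigma> g * T"
  shows "equiv_rep G \<rho> \<sigma>"
  unfolding equiv_rep_def using invertible_matI[OF assms(3-6)] Hom_rep_iff[OF assms(1,2)] assms(3,7) by blast

lemma equiv_rep_refl: "representation G n \<rho> \<Longrightarrow> equiv_rep G \<rho> \<rho>"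
  by (rule equiv_repI[of _ n _ n _ "1\<^sub>m n" "1\<^sub>m n"]) (auto simp: representation_def)

lemma intertwiner_inverse:
  fixes T S :: "cmat"
  assumes "representation G n \<rho>" "representation G n \<sigma>" "g \<in> carrier G"
    and "T \<in> carrier_mat n n" "S \<in> carrier_mat n n" "T * S = 1\<^sub>m n" "S * T = 1\<^sub>m n" "T * \<rho> g = \<sigma> g * T"
  shows "S * \<sigma> g = \<rho> g * S"
proof -
  have c: "\<rho> g \<in> carrier_mat n n" "\<sigma> g \<in> carrier_mat n n" using assms(1-3) by (auto simp: representation_def)
  note as = assoc_mult_mat[of _ n n _ n _ n]
  have "S * \<sigma> g = S * (\<sigma> g * T) * S" using assms(4-6) c by (simp add: as)
  also have "\<dots> = (S * T) * \<rho> g * S" unfolding assms(8)[symmetric] using assms(4,5) c by (simp add: as)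
  finally show ?thesis using assms(5,7) c by simp
qed

lemma equiv_rep_sym:
  assumes "equiv_rep G \<rho> \<sigma>" "representation G n \<rho>" "representation G m \<sigma>"
  shows "equiv_rep G \<sigma> \<rho>"
proof -
  obtain T S where TS: "n = m" "T \<in> carrier_mat n n" "S \<in> carrier_mat n n" "T * S = 1\<^sub>m n" "S * T = 1\<^sub>m n"
    "\<And>g. g \<in> carrier G \<Longrightarrow> T * \<rho> g = \<sigma> g * T"
    using equiv_repE[OF assms] by metis
  have "S * \<sigma> g = \<rho> g * S" if "g \<in> carrier G" for g
    using intertwiner_inverse[OF assms(2) _ that TS(2-5)] TS(1,6) assms(3) that by blast
  then show ?thesis using equiv_repI[OF assms(3,2), of S T] TS by auto
qed

lemma equiv_rep_trans:
  assumes "equiv_rep G \<rho> \<sigma>" "equiv_rep G \<sigma> \<tau>" "representation G n \<rho>" "representation G m \<sigma>" "representation G k \<tau>"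
  shows "equiv_rep G \<rho> \<tau>"
proof -
  obtain T S where TS: "n = m" "T \<in> carrier_mat n n" "S \<in> carrier_mat n n" "T * S = 1\<^sub>m n" "S * T = 1\<^sub>m n"
    "\<And>g. g \<in> carrier G \<Longrightarrow> T * \<rho> g = \<sigma> g * T"
    using equiv_repE[OF assms(1,3,4)] by metis
  obtain T' S' where TS': "m = k" "T' \<in> carrier_mat m m" "S' \<in> carrier_mat m m" "T' * S' = 1\<^sub>m m" "S' * T' = 1\<^sub>m m"
    "\<And>g. g \<in> carrier G \<Longrightarrow> T' * \<sigma> g = \<tau> g * T'"
    using equiv_repE[OF assms(2,4,5)] by metis
  note as = assoc_mult_mat[of _ n n _ n _ n]
  show ?thesis
  proof (rule equiv_repI[OF assms(3,5)])
    show "T' * T \<in> carrier_mat k n" "S * S' \<in> carrier_mat n k" using TS TS' by auto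
    have "T' * T * (S * S') = T' * (T * S) * S'" using TS(1-3) TS'(1-3) by (simp add: as)
    then show "T' * T * (S * S') = 1\<^sub>m k" using TS TS' by simp
    have "S * S' * (T' * T) = S * (S' * T') * T" using TS(1-3) TS'(1-3) by (simp add: as)
    then show "S * S' * (T' * T) = 1\<^sub>m n" using TS TS' by simp
    fix g assume g: "g \<in> carrier G"
    have c: "\<rho> g \<in> carrier_mat n n" "\<sigma> g \<in> carrier_mat n n" "\<tau> g \<in> carrier_mat n n"
      using assms(3-5) TS(1) TS'(1) g by (auto simp: representation_def)
    have "T' * T * \<rho> g = T' * (T * \<rho> g)" using TS TS' c by (simp add: as)
    also have "\<dots> = (T' * \<sigma> g) * T" using TS TS'(1,2) c g by (simp add: as)
    also have "\<dots> = \<tau> g * (T' * T)" using TS TS' c g by (simp add: as)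
    finally show "T' * T * \<rho> g = \<tau> g * (T' * T)" .
  qed
qed

lemma equiv_rep_mtrace:
  assumes "equiv_rep G \<rho> \<sigma>" "representation G n \<rho>" "representation G m \<sigma>" "g \<in> carrier G"
  shows "mtrace (\<rho> g) = mtrace (\<sigma> g)"
proof -
  obtain T S where TS: "n = m" "T \<in> carrier_mat n n" "S \<in> carrier_mat n n" "T * S = 1\<^sub>m n" "S * T = 1\<^sub>m n"
    "\<And>g. g \<in> carrier G \<Longrightarrow> T * \<rho> g = \<sigma> g * T"
    using equiv_repE[OF assms(1-3)] by metis
  have c: "\<rho> g \<in> carrier_mat n n" "\<sigma> g \<in> carrier_mat n n" using assms(2-4) TS(1) by (auto simp: representation_def)
  have "\<rho> g = S * (T * \<rho> g)" using TS(2-5) c assoc_mult_mat[of S n n T n "\<rho> g" n] by simp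
  then have "mtrace (\<rho> g) = mtrace (T * \<rho> g * S)" using TS(2,3) c mtrace_comm[of S n n "T * \<rho> g"] by simp
  also have "T * \<rho> g * S = \<sigma> g"
    using TS assms(4) c assoc_mult_mat[of "\<sigma> g" n n T n S n] by simp
  finally show ?thesis .
qed

text \<open>Kernel and range of an intertwiner are invariant. Since \<open>T\<close> is nonzero, the
  kernel \<open>K\<close> is not everything and the range \<open>R\<close> is not zero, so
  irreducibility makes \<open>T\<close> bijective.\<close>

lemma Schur_equiv:
  assumes "irreducible_rep G \<rho>" "irreducible_rep G \<sigma>" "T \<in> Hom_rep G \<rho> \<sigma>"
    and ne: "T \<noteq> 0\<^sub>m (degree_rep G \<sigma>) (degree_rep G \<rho>)"
  shows "invertible_mat T" "equiv_rep G \<rho> \<sigma>"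
proof -
  obtain n where n: "n > 0" "representation G n \<rho>" "degree_rep G \<rho> = n"
    by (rule irreducible_repE[OF assms(1)])
  obtain m where m: "m > 0" "representation G m \<sigma>" "degree_rep G \<sigma> = m"
    by (rule irreducible_repE[OF assms(2)])
  have T: "T \<in> carrier_mat m n" and com: "\<And>g. g \<in> carrier G \<Longrightarrow> T * \<rho> g = \<sigma> g * T"
    using assms(3) Hom_rep_iff[OF n(2) m(2)] by auto
  have rc: "\<rho> g \<in> carrier_mat n n" "\<sigma> g \<in> carrier_mat m m" if "g \<in> carrier G" for g
    using n(2) m(2) that by (auto simp: representation_def)
  have cv: "T *\<^sub>v (\<rho> g *\<^sub>v v) = \<sigma> g *\<^sub>v (T *\<^sub>v v)" if "g \<in> carrier G" "v \<in> carrier_vec n" for g v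
    using com[OF that(1)] rc[OF that(1)] T that(2) by (metis assoc_mult_mat_vec)
  have T0: "T *\<^sub>v 0\<^sub>v n = 0\<^sub>v m" using T by (intro eq_vecI) auto
  define K R where "K = {v \<in> carrier_vec n. T *\<^sub>v v = 0\<^sub>v m}" and "R = (*\<^sub>v) T ` carrier_vec n"
  have "K = {0\<^sub>v n} \<or> K = carrier_vec n"
  proof (rule irreducible_rep_invariant[OF assms(1) n(2)])
    show "v + w \<in> K" if "v \<in> K" "w \<in> K" for v w using that T by (auto simp: K_def mult_add_distrib_mat_vec)
    show "a \<cdot>\<^sub>v v \<in> K" if "v \<in> K" for a v using that T by (auto simp: K_def mult_mat_vec)
    fix g v assume "g \<in> carrier G" "v \<in> K"
    moreover have "\<sigma> g *\<^sub>v 0\<^sub>v m = 0\<^sub>v m" if "g \<in> carrier G" using rc[OF that] by (intro eq_vecI) auto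
    ultimately show "\<rho> g *\<^sub>v v \<in> K"
      using cv by (auto simp: K_def intro: mult_mat_vec_carrier[OF rc(1)])
  qed (use T0 in \<open>auto simp: K_def\<close>)
  moreover have "K \<noteq> carrier_vec n"
  proof
    assume "K = carrier_vec n"
    then have "T *\<^sub>v v = 0\<^sub>m m n *\<^sub>v v" if "v \<in> carrier_vec n" for v
    proof -
      have "T *\<^sub>v v = 0\<^sub>v m" using that \<open>_ = carrier_vec n\<close> by (auto simp: K_def)
      then show ?thesis using that by (auto intro!: eq_vecI)
    qed
    then have "T = 0\<^sub>m m n" using T by (intro mat_eq_mult_vecI) auto
    then show False using ne n m by simp
  qed
  ultimately have ker: "K = {0\<^sub>v n}" by blast
  have "R = {0\<^sub>v m} \<or> R = carrier_vec m"
  proof (rule irreducible_rep_invariant[OF assms(2) m(2)])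
    show "0\<^sub>v m \<in> R" unfolding R_def using T0 by (metis image_eqI zero_carrier_vec)
    fix v w assume v: "v \<in> R" 
    then obtain v' where v': "v' \<in> carrier_vec n" "v = T *\<^sub>v v'" by (auto simp: R_def)
    show "a \<cdot>\<^sub>v v \<in> R" for a
      unfolding R_def using v' T by (intro image_eqI[of _ _ "a \<cdot>\<^sub>v v'"]) (auto simp: mult_mat_vec)
    show "\<sigma> g *\<^sub>v v \<in> R" if "g \<in> carrier G" for g
      unfolding R_def using v' cv that by (intro image_eqI[of _ _ "\<rho> g *\<^sub>v v'"]) (auto intro: mult_mat_vec_carrier[OF rc(1)])
    assume "w \<in> R" 
    then obtain w' where w': "w' \<in> carrier_vec n" "w = T *\<^sub>v w'" by (auto simp: R_def)
    show "v + w \<in> R"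
      unfolding R_def using v' w' T by (intro image_eqI[of _ _ "v' + w'"]) (auto simp: mult_add_distrib_mat_vec)
  qed (use T in \<open>auto simp: R_def\<close>)
  moreover have "R \<noteq> {0\<^sub>v m}"
  proof
    assume "R = {0\<^sub>v m}"
    then have "carrier_vec n = {0\<^sub>v n :: cvec}" using ker by (auto simp: K_def R_def)
    moreover have "unit_vec n 0 \<in> carrier_vec n" "unit_vec n 0 \<noteq> (0\<^sub>v n :: cvec)"
      using n(1) by (auto simp: unit_vec_def dest!: arg_cong[of _ _ "\<lambda>v. v $v 0"])
    ultimately show False by blast
  qed
  ultimately have im: "R = carrier_vec m" by blast
  obtain S where "S \<in> carrier_mat n m" "T * S = 1\<^sub>m m" "S * T = 1\<^sub>m n"
  proof (rule mat_inverse_of_bijective[OF T])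
    show "\<And>v. v \<in> carrier_vec n \<Longrightarrow> T *\<^sub>v v = 0\<^sub>v m \<Longrightarrow> v = 0\<^sub>v n" using ker by (auto simp: K_def)
    show "\<And>w. w \<in> carrier_vec m \<Longrightarrow> \<exists>v \<in> carrier_vec n. T *\<^sub>v v = w" using im by (metis R_def imageE)
  qed blast
  then show "invertible_mat T" by (rule invertible_matI[OF T])
  then show "equiv_rep G \<rho> \<sigma>" using assms(3) by (auto simp: equiv_rep_def)
qed

text \<open>Over the complex numbers \<open>T\<close> has an eigenvalue \<open>k\<close>;
  \<open>T - k\<close> is a singular intertwiner and thus zero. The scalar is expressed through the
  trace, since that is what averaging controls.\<close>

lemma Schur_scalar:
  assumes irr: "irreducible_rep G \<rho>" and T: "T \<in> Hom_rep G \<rho> \<rho>" and n: "degree_rep G \<rho> = n"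
  shows "T = (mtrace T / of_nat n) \<cdot>\<^sub>m 1\<^sub>m n"
proof -
  have n0: "n > 0" and rep: "representation G n \<rho>"
    using irreducible_repE[OF irr] n by metis+
  have Tc: "T \<in> carrier_mat n n" and com: "\<And>g. g \<in> carrier G \<Longrightarrow> T * \<rho> g = \<rho> g * T"
    using T Hom_rep_iff[OF rep rep] by auto
  obtain k where k: "eigenvalue T k" using spectrum_non_empty[OF Tc n0] by (auto simp: spectrum_def)
  then obtain v where v: "v \<in> carrier_vec n" "v \<noteq> 0\<^sub>v n" "T *\<^sub>v v = k \<cdot>\<^sub>v v"
    using Tc by (auto simp: eigenvalue_def eigenvector_def)
  define T' where "T' = T + (-k) \<cdot>\<^sub>m 1\<^sub>m n"
  have T'c: "T' \<in> carrier_mat n n" using Tc by (simp add: T'_def)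
  have "T' \<in> Hom_rep G \<rho> \<rho>"
    unfolding Hom_rep_iff[OF rep rep]
  proof (intro conjI ballI)
    fix g assume g: "g \<in> carrier G"
    then have c: "\<rho> g \<in> carrier_mat n n" using rep by (auto simp: representation_def)
    show "T' * \<rho> g = \<rho> g * T'"
      unfolding T'_def using Tc c com[OF g]
      by (simp add: add_mult_distrib_mat[of _ n n] mult_add_distrib_mat[of _ n n] mult_smult_distrib[of _ n n _ n] mult_smult_assoc_mat[of _ n n _ n])
  qed (use T'c in auto)
  moreover have "\<not> invertible_mat T'"
  proof
    assume "invertible_mat T'"
    then obtain S where S: "S \<in> carrier_mat n n" "S * T' = 1\<^sub>m n" using invertible_mat_obtain[OF _ T'c] by metis
    have "T' *\<^sub>v v = T *\<^sub>v v + ((-k) \<cdot>\<^sub>m 1\<^sub>m n) *\<^sub>v v"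
      unfolding T'_def using Tc v by (intro add_mult_distrib_mat_vec) auto
    also have "((-k) \<cdot>\<^sub>m 1\<^sub>m n) *\<^sub>v v = (-k) \<cdot>\<^sub>v v" using v(1) by (intro eq_vecI) auto
    finally have "T' *\<^sub>v v = 0\<^sub>v n" using v by auto
    then have "S * T' *\<^sub>v v = S *\<^sub>v 0\<^sub>v n" using S T'c v by (metis assoc_mult_mat_vec)
    also have "\<dots> = 0\<^sub>v n" using S by (intro eq_vecI) auto
    finally show False using S v by simp
  qed
  ultimately have "T' = 0\<^sub>m n n" using Schur_equiv(1)[OF irr irr] n by metis
  then have Teq: "T = k \<cdot>\<^sub>m 1\<^sub>m n"
  proof -
    have "T $$ (i, j) = (k \<cdot>\<^sub>m 1\<^sub>m n) $$ (i, j)" if "i < n" "j < n" for i j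
    proof -
      have "T' $$ (i, j) = 0" using \<open>T' = 0\<^sub>m n n\<close> that by simp
      then show ?thesis unfolding T'_def using that Tc by auto
    qed
    then show ?thesis using Tc by (intro eq_matI) auto
  qed
  then have "mtrace T = k * of_nat n" by (simp add: mtrace_smult[of _ n] mtrace_one)
  then show ?thesis using Teq n0 by simp
qed

section \<open>Characters\<close>

locale finite_group = group G for G :: "'a monoid" (structure) +
  assumes finite_carrier: "finite (carrier G)"
begin

lemma card_pos: "card (carrier G) > 0"
  using finite_carrier one_closed by (auto simp: card_gt_0_iff)

lemma rep_carrier: "representation G n \<rho> \<Longrightarrow> g \<in> carrier G \<Longrightarrow> \<rho> g \<in> carrier_mat n n"
  by (auto simp: representation_def)

lemma rep_mult: "representation G n \<rho> \<Longrightarrow> g \<in> carrier G \<Longrightarrow> h \<in> carrier G \<Longrightarrow> \<rho> (g \<otimes> h) = \<rho> g * \<rho> h"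
  by (auto simp: representation_def)

lemma rep_one: "representation G n \<rho> \<Longrightarrow> \<rho> \<one> = 1\<^sub>m n"
  by (auto simp: representation_def)

lemma rep_inv:
  assumes "representation G n \<rho>" "g \<in> carrier G"
  shows "\<rho> g * \<rho> (inv g) = 1\<^sub>m n" "\<rho> (inv g) * \<rho> g = 1\<^sub>m n"
  using rep_mult[OF assms(1), of g "inv g"] rep_mult[OF assms(1), of "inv g" g] rep_one[OF assms(1)] assms(2)
  by simp_all

lemma conj_carrier:
  assumes "representation G n \<rho>" "representation G m \<sigma>" "T \<in> carrier_mat n m" "g \<in> carrier G"
  shows "\<rho> g * T * \<sigma> (inv g) \<in> carrier_mat n m"
  using rep_carrier[OF assms(1,4)] rep_carrier[OF assms(2), of "inv g"] assms(3,4) by (auto intro!: mult_carrier_mat)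

text \<open>The usual averaging operator without division by the group order; it sends every matrix
  to an intertwiner from \<sigma> to \<rho> (\<open>avg_Hom\<close>).\<close>

definition avg :: "nat \<Rightarrow> nat \<Rightarrow> ('a \<Rightarrow> cmat) \<Rightarrow> ('a \<Rightarrow> cmat) \<Rightarrow> cmat \<Rightarrow> cmat" where
  "avg n m \<rho> \<sigma> T = sum_mat n m (\<lambda>g. \<rho> g * T * \<sigma> (inv g)) (carrier G)"

lemma avg_Hom:
  assumes \<rho>: "representation G n \<rho>" and \<sigma>: "representation G m \<sigma>" and T: "T \<in> carrier_mat n m"
  shows "avg n m \<rho> \<sigma> T \<in> Hom_rep G \<sigma> \<rho>"
  unfolding Hom_rep_iff[OF \<sigma> \<rho>]
proof (intro conjI ballI)
  fix h assume h: "h \<in> carrier G"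
  have c: "\<rho> g \<in> carrier_mat n n" "\<sigma> g \<in> carrier_mat m m" if "g \<in> carrier G" for g
    using rep_carrier \<rho> \<sigma> that by auto
  have "\<rho> h * avg n m \<rho> \<sigma> T = sum_mat n m (\<lambda>g. \<rho> h * (\<rho> g * T * \<sigma> (inv g))) (carrier G)"
    unfolding avg_def by (rule mult_sum_mat[OF c(1)[OF h] conj_carrier[OF \<rho> \<sigma> T]])
  \<comment> \<open>Substituting \<open>h \<otimes> g\<close> for the summation variable moves the
    factor \<open>\<rho> h\<close> on the left to \<open>\<sigma> h\<close> on the right.\<close>
  also have "\<dots> = sum_mat n m ((\<lambda>g. \<rho> g * T * \<sigma> (inv g) * \<sigma> h) \<circ> (\<lambda>g. h \<otimes> g)) (carrier G)"
  proof (rule sum_mat_cong)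
    fix g assume g: "g \<in> carrier G"
    have "\<rho> (h \<otimes> g) * T * \<sigma> (inv (h \<otimes> g)) * \<sigma> h = \<rho> (h \<otimes> g) * T * (\<sigma> (inv (h \<otimes> g)) * \<sigma> h)"
      using c(1)[of "h \<otimes> g"] c(2)[of "inv (h \<otimes> g)"] c(2)[OF h] T g h by (intro assoc_mult_mat[of _ n m _ m _ m]) auto
    also have "\<sigma> (inv (h \<otimes> g)) * \<sigma> h = \<sigma> (inv g)"
      using rep_mult[OF \<sigma>, of "inv (h \<otimes> g)" h] g h by (simp add: inv_mult_group m_assoc)
    also have "\<rho> (h \<otimes> g) * T * \<sigma> (inv g) = \<rho> h * (\<rho> g * T * \<sigma> (inv g))"
    proof -
      have "\<rho> (h \<otimes> g) * T = \<rho> h * (\<rho> g * T)"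
        unfolding rep_mult[OF \<rho> h g] using c T g h by (intro assoc_mult_mat) auto
      then show ?thesis using c[OF h] c[OF g] c[of "inv g"] T g
          assoc_mult_mat[of "\<rho> h" n n "\<rho> g * T" m "\<sigma> (inv g)" m] by simp
    qed
    finally show "\<rho> h * (\<rho> g * T * \<sigma> (inv g)) = ((\<lambda>g. \<rho> g * T * \<sigma> (inv g) * \<sigma> h) \<circ> (\<lambda>g. h \<otimes> g)) g" by simp
  qed
  also have "\<dots> = sum_mat n m (\<lambda>g. \<rho> g * T * \<sigma> (inv g) * \<sigma> h) (carrier G)"
  proof (rule sum_mat_reindex)
    show "bij_betw (\<lambda>g. h \<otimes> g) (carrier G) (carrier G)"
      by (rule bij_betw_byWitness[where f' = "\<lambda>g. inv h \<otimes> g"]) (use h in \<open>auto simp: m_assoc[symmetric]\<close>)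
  qed
  also have "\<dots> = avg n m \<rho> \<sigma> T * \<sigma> h"
    unfolding avg_def by (rule sum_mat_mult[OF c(2)[OF h] conj_carrier[OF \<rho> \<sigma> T], symmetric])
  finally show "avg n m \<rho> \<sigma> T * \<sigma> h = \<rho> h * avg n m \<rho> \<sigma> T" by simp
qed (auto simp: avg_def)

lemma mtrace_conj:
  assumes "representation G n \<rho>" "g \<in> carrier G" "T \<in> carrier_mat n n"
  shows "mtrace (\<rho> g * T * \<rho> (inv g)) = mtrace T"
proof -
  have c: "\<rho> g \<in> carrier_mat n n" "\<rho> (inv g) \<in> carrier_mat n n" using rep_carrier assms by auto
  have "mtrace (\<rho> g * T * \<rho> (inv g)) = mtrace (\<rho> (inv g) * (\<rho> g * T))"
    using c assms(3) by (intro mtrace_comm) auto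
  also have "\<rho> (inv g) * (\<rho> g * T) = (\<rho> (inv g) * \<rho> g) * T"
    using c assms(3) by (intro assoc_mult_mat[symmetric]) auto
  finally show ?thesis using rep_inv(2)[OF assms(1,2)] assms(3) by simp
qed

lemma avg_scalar:
  assumes irr: "irreducible_rep G \<rho>" and n: "degree_rep G \<rho> = n" and T: "T \<in> carrier_mat n n"
  shows "avg n n \<rho> \<rho> T = (of_nat (card (carrier G)) * mtrace T / of_nat n) \<cdot>\<^sub>m 1\<^sub>m n"
proof -
  have rep: "representation G n \<rho>" using irreducible_repE[OF irr] n by metis
  have "mtrace (avg n n \<rho> \<rho> T) = (\<Sum>g\<in>carrier G. mtrace (\<rho> g * T * \<rho> (inv g)))"
    unfolding avg_def by (rule mtrace_sum_mat[OF conj_carrier[OF rep rep T]])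
  also have "\<dots> = of_nat (card (carrier G)) * mtrace T" using mtrace_conj[OF rep _ T] by simp
  finally show ?thesis using Schur_scalar[OF irr avg_Hom[OF rep rep T] n] by simp
qed

text \<open>The middle factor is the elementary matrix at \<open>(i, k)\<close>, and the entry at
  \<open>(i, k)\<close> of the product is \<open>A $$ (i, i) * B $$ (k, k)\<close>. A product of two
  traces is thus rewritten in terms linear in a middle matrix, to which \<open>avg\<close>
  applies.\<close>

lemma mtrace_mult_expand:
  assumes "A \<in> carrier_mat n n" "B \<in> carrier_mat m m"
  shows "mtrace A * mtrace B = (\<Sum>i<n. \<Sum>k<m. (A * Matrix.mat n m (\<lambda>ij. if ij = (i, k) then 1 else 0) * B) $$ (i, k))"
proof -
  have "(A * Matrix.mat n m (\<lambda>ij. if ij = (i, k) then 1 else 0) * B) $$ (i, k) = A $$ (i, i) * B $$ (k, k)"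
    if ik: "i < n" "k < m" for i k
  proof -
    define E :: "cmat" where "E = Matrix.mat n m (\<lambda>ij. if ij = (i, k) then 1 else 0)"
    have E: "E \<in> carrier_mat n m" by (simp add: E_def)
    have AE: "(A * E) $$ (i, l) = (if l = k then A $$ (i, i) else 0)" if "l < m" for l
    proof -
      have "(A * E) $$ (i, l) = (\<Sum>j<n. if j = i then (if l = k then A $$ (i, i) else 0) else 0)"
        unfolding index_mult_sum[OF assms(1) E ik(1) that] using that ik
        by (intro sum.cong) (auto simp: E_def)
      then show ?thesis using ik by simp
    qed
    have "(A * E * B) $$ (i, k) = (\<Sum>l<m. (A * E) $$ (i, l) * B $$ (l, k))"
      by (rule index_mult_sum[OF _ assms(2) ik]) (use assms E in auto)
    also have "\<dots> = (\<Sum>l<m. if l = k then A $$ (i, i) * B $$ (k, k) else 0)"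
      using AE by (intro sum.cong) auto
    finally show ?thesis using ik by (simp add: E_def)
  qed
  then show ?thesis using assms
    by (simp add: mtrace_def sum_product)
qed

text \<open>The inverse group element stands in for complex conjugation, so no invariant Hermitian
  form has to be found. Inequivalent representations give zero because every average is a zero
  intertwiner; equivalent ones have equal characters and reduce to the scalar averages of
  \<open>avg_scalar\<close>.\<close>

lemma character_orthogonality:
  assumes irr: "irreducible_rep G \<rho>" "irreducible_rep G \<sigma>"
  shows "(\<Sum>g\<in>carrier G. mtrace (\<rho> g) * mtrace (\<sigma> (inv g))) =
    (if equiv_rep G \<rho> \<sigma> then of_nat (card (carrier G)) else 0)"
proof -
  define E where "E n m = (\<lambda>i k. Matrix.mat n m (\<lambda>ij. if ij = (i, k) then 1 else 0 :: complex))" for n m :: nat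
  have gen: "(\<Sum>g\<in>carrier G. mtrace (\<rho> g) * mtrace (\<sigma> (inv g))) = (\<Sum>i<n. \<Sum>k<m. avg n m \<rho> \<sigma> (E n m i k) $$ (i, k))"
    if rep: "representation G n \<rho>" "representation G m \<sigma>" for n m \<rho> \<sigma>
  proof -
    have "(\<Sum>g\<in>carrier G. mtrace (\<rho> g) * mtrace (\<sigma> (inv g))) =
        (\<Sum>g\<in>carrier G. \<Sum>i<n. \<Sum>k<m. (\<rho> g * E n m i k * \<sigma> (inv g)) $$ (i, k))"
      unfolding E_def by (intro sum.cong refl mtrace_mult_expand rep_carrier[OF rep(1)] rep_carrier[OF rep(2)]) auto
    also have "\<dots> = (\<Sum>i<n. \<Sum>g\<in>carrier G. \<Sum>k<m. (\<rho> g * E n m i k * \<sigma> (inv g)) $$ (i, k))" by (rule sum.swap)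
    also have "\<dots> = (\<Sum>i<n. \<Sum>k<m. \<Sum>g\<in>carrier G. (\<rho> g * E n m i k * \<sigma> (inv g)) $$ (i, k))"
      by (intro sum.cong sum.swap refl)
    also have "\<dots> = (\<Sum>i<n. \<Sum>k<m. avg n m \<rho> \<sigma> (E n m i k) $$ (i, k))"
      by (intro sum.cong refl) (auto simp: avg_def sum_mat_def)
    finally show ?thesis .
  qed
  obtain n where n: "n > 0" "representation G n \<rho>" "degree_rep G \<rho> = n" using irreducible_repE[OF irr(1)] .
  obtain m where m: "m > 0" "representation G m \<sigma>" "degree_rep G \<sigma> = m" using irreducible_repE[OF irr(2)] .
  show ?thesis
  proof (cases "equiv_rep G \<rho> \<sigma>")
    case False
    have "avg n m \<rho> \<sigma> (E n m i k) = 0\<^sub>m n m" for i k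
    proof (rule ccontr)
      assume "avg n m \<rho> \<sigma> (E n m i k) \<noteq> 0\<^sub>m n m"
      moreover have "avg n m \<rho> \<sigma> (E n m i k) \<in> Hom_rep G \<sigma> \<rho>"
        by (rule avg_Hom[OF n(2) m(2)]) (simp add: E_def)
      ultimately have "equiv_rep G \<sigma> \<rho>" using Schur_equiv(2)[OF irr(2,1)] n m by metis
      then show False using equiv_rep_sym m n False by metis
    qed
    then show ?thesis using gen[OF n(2) m(2)] False by simp
  next
    case True
    have "(\<Sum>g\<in>carrier G. mtrace (\<rho> g) * mtrace (\<sigma> (inv g))) = (\<Sum>g\<in>carrier G. mtrace (\<rho> g) * mtrace (\<rho> (inv g)))"
      using equiv_rep_mtrace[OF True n(2) m(2)] by simp
    also have "\<dots> = (\<Sum>i<n. \<Sum>k<n. avg n n \<rho> \<rho> (E n n i k) $$ (i, k))" by (rule gen[OF n(2) n(2)])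
    also have "\<dots> = (\<Sum>i<n. \<Sum>k<n. if k = i then of_nat (card (carrier G)) / of_nat n else 0)"
    proof (intro sum.cong refl)
      fix i k assume ik: "i \<in> {..<n}" "k \<in> {..<n}"
      have "mtrace (E n n i k) = (\<Sum>j<n. if j = i then if k = i then 1 else 0 else 0)"
        unfolding mtrace_def by (intro sum.cong) (auto simp: E_def)
      then have tr: "mtrace (E n n i k) = (if k = i then 1 else 0)" using ik by simp
      have "E n n i k \<in> carrier_mat n n" by (simp add: E_def)
      from avg_scalar[OF irr(1) n(3) this] show
        "avg n n \<rho> \<rho> (E n n i k) $$ (i, k) = (if k = i then of_nat (card (carrier G)) / of_nat n else 0)"
        using ik tr by simp
    qed
    also have "\<dots> = of_nat (card (carrier G))" using n(1) by simp
    finally show ?thesis using True by simp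
  qed
qed

text \<open>\<open>A * B\<close> is an invariant projection, so compressing by \<open>B\<close> and
  \<open>A\<close> stays multiplicative. The trace formula turns a decomposition of the identity
  into projections into a decomposition of characters.\<close>

lemma subrepresentation:
  assumes rep: "representation G n \<rho>" and A: "A \<in> carrier_mat n r" and B: "B \<in> carrier_mat r n"
    and BA: "B * A = 1\<^sub>m r" and com: "\<And>g. g \<in> carrier G \<Longrightarrow> A * B * \<rho> g = \<rho> g * (A * B)"
  shows "representation G r (\<lambda>g. B * \<rho> g * A)"
    "g \<in> carrier G \<Longrightarrow> mtrace (B * \<rho> g * A) = mtrace (\<rho> g * (A * B))"
proof -
  note c = rep_carrier[OF rep]
  show "representation G r (\<lambda>g. B * \<rho> g * A)"
    unfolding representation_def
  proof (intro conjI ballI)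
    show "B * \<rho> \<one> * A = 1\<^sub>m r" using rep_one[OF rep] BA A B by simp
    fix g h assume g: "g \<in> carrier G"
    show "B * \<rho> g * A \<in> carrier_mat r r" using A B c[OF g] by auto
    assume h: "h \<in> carrier G"
    have "B * \<rho> g * A * (B * \<rho> h * A) = B * (\<rho> g * (A * B) * \<rho> h) * A"
      using A B c[OF g] c[OF h]
      by (simp add: assoc_mult_mat[of _ r n _ r _ r] assoc_mult_mat[of _ r n _ n _ r] assoc_mult_mat[of _ n r _ n _ r]
          assoc_mult_mat[of _ n n _ r _ r] assoc_mult_mat[of _ n n _ n _ r] assoc_mult_mat[of _ n n _ n _ n] assoc_mult_mat[of _ r r _ n _ r] assoc_mult_mat[of _ n r _ n _ n] assoc_mult_mat[of _ r n _ n _ n])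
    also have "\<rho> g * (A * B) * \<rho> h = A * B * \<rho> (g \<otimes> h)"
      unfolding com[OF g, symmetric] rep_mult[OF rep g h] using A B c[OF g] c[OF h] by (intro assoc_mult_mat) auto
    also have "B * (A * B * \<rho> (g \<otimes> h)) * A = (B * A) * (B * \<rho> (g \<otimes> h) * A)"
      using A B c[of "g \<otimes> h"] g h
      by (simp add: assoc_mult_mat[of _ r n _ n _ r] assoc_mult_mat[of _ n r _ n _ n] assoc_mult_mat[of _ n r _ n _ r] assoc_mult_mat[of _ r n _ r _ r])
    also have "\<dots> = B * \<rho> (g \<otimes> h) * A" unfolding BA using A B c[of "g \<otimes> h"] g h by simp
    finally show "B * \<rho> (g \<otimes> h) * A = B * \<rho> g * A * (B * \<rho> h * A)" by simp
  qed
  assume g: "g \<in> carrier G"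
  have "mtrace (B * (\<rho> g * A)) = mtrace (\<rho> g * A * B)" using A B c[OF g] by (intro mtrace_comm) auto
  then show "mtrace (B * \<rho> g * A) = mtrace (\<rho> g * (A * B))"
    using A B c[OF g] by (simp add: assoc_mult_mat[of _ r n _ n _ r] assoc_mult_mat[of _ n n _ r _ n])
qed

text \<open>The range of an idempotent is its fixed space. Applying
  \<open>subspace_factorization\<close> to it yields \<open>A\<close>; the left inverse
  \<open>B\<close> found there need not have \<open>P\<close> as the associated projection, hence
  the replacement by \<open>B * P\<close>.\<close>

lemma idempotent_factorization:
  fixes P :: "cmat"
  assumes P: "P \<in> carrier_mat n n" and PP: "P * P = P"
  obtains r A B where "A \<in> carrier_mat n r" "B \<in> carrier_mat r n" "B * A = 1\<^sub>m r" "A * B = P"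
proof -
  define W where "W = (*\<^sub>v) P ` carrier_vec n"
  have W: "W = {v \<in> carrier_vec n. P *\<^sub>v v = v}"
  proof (intro subset_antisym subsetI)
    fix w assume "w \<in> W"
    then obtain v where v: "v \<in> carrier_vec n" "w = P *\<^sub>v v" by (auto simp: W_def)
    have "P *\<^sub>v w = (P * P) *\<^sub>v v" unfolding v(2) by (rule assoc_mult_mat_vec[symmetric, OF P P v(1)])
    then show "w \<in> {v \<in> carrier_vec n. P *\<^sub>v v = v}" using PP v P by auto
  next
    fix w assume "w \<in> {v \<in> carrier_vec n. P *\<^sub>v v = v}"
    then show "w \<in> W" by (auto simp: W_def intro!: image_eqI[of _ _ w])
  qed
  have "VectorSpace.subspace class_ring W (module_vec TYPE(complex) n)"
    unfolding subspace_module_vec_iff W using P by (auto simp: mult_add_distrib_mat_vec mult_mat_vec)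
  from subspace_factorization[OF this] obtain r A B where AB: "A \<in> carrier_mat n r" "B \<in> carrier_mat r n" "B * A = 1\<^sub>m r"
    "\<And>v. v \<in> carrier_vec r \<Longrightarrow> A *\<^sub>v v \<in> W" "\<And>w. w \<in> W \<Longrightarrow> A *\<^sub>v (B *\<^sub>v w) = w" by metis
  have PA: "P * A = A"
  proof (rule mat_eq_mult_vecI)
    fix v :: "cvec" assume v: "v \<in> carrier_vec r"
    have "P * A *\<^sub>v v = P *\<^sub>v (A *\<^sub>v v)" by (rule assoc_mult_mat_vec[OF P AB(1) v])
    also have "\<dots> = A *\<^sub>v v" using AB(4)[OF v] W by auto
    finally show "P * A *\<^sub>v v = A *\<^sub>v v" .
  qed (use P AB in auto)
  have ABP: "A * B * P = P"
  proof (rule mat_eq_mult_vecI)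
    fix v :: "cvec" assume v: "v \<in> carrier_vec n"
    have "A * B * P *\<^sub>v v = A *\<^sub>v (B *\<^sub>v (P *\<^sub>v v))"
      using assoc_mult_mat_vec[of "A * B" n n P n v] assoc_mult_mat_vec[of A n r B n "P *\<^sub>v v"] P AB v by auto
    also have "\<dots> = P *\<^sub>v v" using AB(5) v by (auto simp: W_def)
    finally show "A * B * P *\<^sub>v v = P *\<^sub>v v" .
  qed (use P AB in auto)
  show ?thesis
  proof (rule that[of A r "B * P"])
    have "B * P * A = B * (P * A)" using P AB by (intro assoc_mult_mat) auto
    then show "B * P * A = 1\<^sub>m r" using PA AB by simp
    have "A * (B * P) = A * B * P" using P AB by (intro assoc_mult_mat[symmetric]) auto
    then show "A * (B * P) = P" using ABP by simp
  qed (use P AB in auto)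
qed

text \<open>Maschke's theorem on the level of characters: an invariant projection splits the trace.\<close>

lemma character_sum_of_irreducibles:
  assumes "representation G n \<rho>"
  shows "\<exists>l. (\<forall>\<sigma>\<in>set l. irreducible_rep G \<sigma>) \<and> (\<forall>g\<in>carrier G. mtrace (\<rho> g) = (\<Sum>\<sigma>\<leftarrow>l. mtrace (\<sigma> g)))"
  using assms
proof (induction n arbitrary: \<rho> rule: less_induct)
  case (less n)
  note rep = less.prems
  note c = rep_carrier[OF rep]
  consider "n = 0" | "n > 0" "irreducible_rep G \<rho>" | "n > 0" "\<not> irreducible_rep G \<rho>" by blast
  then show ?case
  proof cases
    case 1
    have "mtrace (\<rho> g) = 0" if "g \<in> carrier G" for g using c[OF that] 1 by (simp add: mtrace_def)
    then show ?thesis by (intro exI[of _ "[]"]) auto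
  next
    case 2
    then show ?thesis by (intro exI[of _ "[\<rho>]"]) auto
  next
    case 3
    then obtain W where Wsub: "VectorSpace.subspace class_ring W (module_vec TYPE(complex) n)"
      and inv: "\<And>g w. g \<in> carrier G \<Longrightarrow> w \<in> W \<Longrightarrow> \<rho> g *\<^sub>v w \<in> W" and W: "W \<noteq> {0\<^sub>v n}" "W \<noteq> carrier_vec n"
      using rep unfolding irreducible_rep_def by metis
    note Wc = Wsub[unfolded subspace_module_vec_iff]
    from subspace_factorization[OF Wsub] obtain r A B where A: "A \<in> carrier_mat n r" and B: "B \<in> carrier_mat r n"
      and BA: "B * A = 1\<^sub>m r" and AW: "\<And>v. v \<in> carrier_vec r \<Longrightarrow> A *\<^sub>v v \<in> W"
      and ABW: "\<And>w. w \<in> W \<Longrightarrow> A *\<^sub>v (B *\<^sub>v w) = w" by metis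
    define N :: complex where "N = of_nat (card (carrier G))"
    have N0: "N \<noteq> 0" using card_pos by (simp add: N_def)
    \<comment> \<open>The average of the projection \<open>A * B\<close> onto \<open>W\<close>; it
      commutes with the group and is again a projection onto \<open>W\<close>.\<close>
    define P where "P = (1 / N) \<cdot>\<^sub>m avg n n \<rho> \<rho> (A * B)"
    have ABc: "A * B \<in> carrier_mat n n" using A B by auto
    have Pc: "P \<in> carrier_mat n n" by (simp add: P_def avg_def)
    have Pcom: "P * \<rho> g = \<rho> g * P" if "g \<in> carrier G" for g
      using avg_Hom[OF rep rep ABc] that c[OF that] unfolding Hom_rep_iff[OF rep rep] P_def
      by (auto simp: mult_smult_distrib[of _ n n _ n] mult_smult_assoc_mat[of _ n n _ n])
    \<comment> \<open>\<open>W\<close> is invariant, so the columns of \<open>\<rho> g * A\<close>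
      lie in \<open>W\<close>, where \<open>A * B\<close> acts as the identity.\<close>
    have fix_col: "A * B * (\<rho> g * A) = \<rho> g * A" if g: "g \<in> carrier G" for g
    proof (rule mat_eq_mult_vecI)
      fix v :: "cvec" assume v: "v \<in> carrier_vec r"
      have e: "\<rho> g * A *\<^sub>v v = \<rho> g *\<^sub>v (A *\<^sub>v v)" by (rule assoc_mult_mat_vec[OF c[OF g] A v])
      have w: "\<rho> g * A *\<^sub>v v \<in> W" unfolding e using inv[OF g AW[OF v]] .
      have "A * B * (\<rho> g * A) *\<^sub>v v = A * B *\<^sub>v (\<rho> g * A *\<^sub>v v)"
        using A B c[OF g] v by (intro assoc_mult_mat_vec) auto
      also have "\<dots> = A *\<^sub>v (B *\<^sub>v (\<rho> g * A *\<^sub>v v))" using A B w Wc by (intro assoc_mult_mat_vec) auto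
      also have "\<dots> = \<rho> g * A *\<^sub>v v" by (rule ABW[OF w])
      finally show "A * B * (\<rho> g * A) *\<^sub>v v = \<rho> g * A *\<^sub>v v" .
    qed (use A B c[OF g] in auto)
    have ABP: "A * B * P = P"
    proof -
      have "A * B * avg n n \<rho> \<rho> (A * B) = sum_mat n n (\<lambda>g. A * B * (\<rho> g * (A * B) * \<rho> (inv g))) (carrier G)"
        unfolding avg_def by (rule mult_sum_mat[OF ABc conj_carrier[OF rep rep ABc]])
      also have "\<dots> = avg n n \<rho> \<rho> (A * B)" unfolding avg_def
      proof (rule sum_mat_cong)
        fix g assume g: "g \<in> carrier G"
        have "\<rho> g * (A * B) * \<rho> (inv g) = \<rho> g * A * (B * \<rho> (inv g))"
          using A B c[OF g] c[of "inv g"] g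
          by (simp add: assoc_mult_mat[of _ n n _ r _ n] assoc_mult_mat[of _ n r _ n _ n] assoc_mult_mat[of _ n n _ n _ n])
        moreover have "A * B * (\<rho> g * A * (B * \<rho> (inv g))) = A * B * (\<rho> g * A) * (B * \<rho> (inv g))"
          using A B c[OF g] c[of "inv g"] g by (intro assoc_mult_mat[symmetric]) auto
        ultimately show "A * B * (\<rho> g * (A * B) * \<rho> (inv g)) = \<rho> g * (A * B) * \<rho> (inv g)"
          using fix_col[OF g] by simp
      qed
      finally show ?thesis unfolding P_def using ABc
        by (simp add: mult_smult_distrib[of _ n n _ n] avg_def)
    qed
    have PA: "P * A = A"
    proof -
      have "avg n n \<rho> \<rho> (A * B) * A = sum_mat n r (\<lambda>g. \<rho> g * (A * B) * \<rho> (inv g) * A) (carrier G)"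
        unfolding avg_def by (rule sum_mat_mult[OF A conj_carrier[OF rep rep ABc]])
      also have "\<dots> = sum_mat n r (\<lambda>g. A) (carrier G)"
      proof (rule sum_mat_cong)
        fix g assume g: "g \<in> carrier G"
        have "\<rho> g * (A * B) * \<rho> (inv g) * A = \<rho> g * (A * B * (\<rho> (inv g) * A))"
          using ABc A c[OF g] c[of "inv g"] g
          by (simp add: assoc_mult_mat[of _ n n _ n _ r] assoc_mult_mat[of _ n n _ n _ n])
        also have "\<dots> = \<rho> g * \<rho> (inv g) * A"
          using fix_col[of "inv g"] A c[OF g] c[of "inv g"] g by (simp add: assoc_mult_mat[of _ n n _ n _ r])
        finally show "\<rho> g * (A * B) * \<rho> (inv g) * A = A" using rep_inv(1)[OF rep g] A by simp
      qed
      also have "\<dots> = N \<cdot>\<^sub>m A" by (rule eq_matI) (use A in \<open>auto simp: sum_mat_def N_def\<close>)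
      finally show ?thesis unfolding P_def using A N0
        by (auto simp: mult_smult_assoc_mat[of _ n n _ r] avg_def intro!: eq_matI)
    qed
    have PP: "P * P = P"
    proof -
      have "P * (A * (B * P)) = (P * A) * (B * P)" using A B Pc by (intro assoc_mult_mat[symmetric]) auto
      moreover have "A * (B * P) = P" using ABP A B Pc by (metis assoc_mult_mat)
      ultimately show ?thesis unfolding PA by simp
    qed
    define P' where "P' = 1\<^sub>m n - P"
    have P'c: "P' \<in> carrier_mat n n" unfolding P'_def by (rule minus_carrier_mat[OF Pc])
    have P'P': "P' * P' = P'"
    proof -
      have "P' * P' = 1\<^sub>m n * P' - P * P'" unfolding P'_def using Pc by (intro minus_mult_distrib_mat) auto
      also have "P * P' = P * 1\<^sub>m n - P * P" unfolding P'_def using Pc by (intro mult_minus_distrib_mat) auto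
      finally show ?thesis using P'c Pc PP by (auto simp: P'_def intro!: eq_matI)
    qed
    have P'com: "P' * \<rho> g = \<rho> g * P'" if g: "g \<in> carrier G" for g
      using minus_mult_distrib_mat[OF _ Pc c[OF g], of "1\<^sub>m n"] mult_minus_distrib_mat[OF c[OF g] _ Pc, of "1\<^sub>m n"]
        Pcom[OF g] c[OF g] by (simp add: P'_def)
    obtain r1 A1 B1 where 1: "A1 \<in> carrier_mat n r1" "B1 \<in> carrier_mat r1 n" "B1 * A1 = 1\<^sub>m r1" "A1 * B1 = P"
      using idempotent_factorization[OF Pc PP] by metis
    obtain r2 A2 B2 where 2: "A2 \<in> carrier_mat n r2" "B2 \<in> carrier_mat r2 n" "B2 * A2 = 1\<^sub>m r2" "A2 * B2 = P'"
      using idempotent_factorization[OF P'c P'P'] by metis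
    have tr: "mtrace (\<rho> g * P) + mtrace (\<rho> g * P') = mtrace (\<rho> g)" if g: "g \<in> carrier G" for g
    proof -
      have "\<rho> g * P + \<rho> g * P' = \<rho> g * (P + P')" using c[OF g] Pc P'c by (simp add: mult_add_distrib_mat[of _ n n])
      also have "P + P' = 1\<^sub>m n" using Pc by (auto simp: P'_def intro!: eq_matI)
      finally show ?thesis using c[OF g] Pc P'c mtrace_add[of "\<rho> g * P" n "\<rho> g * P'"] by simp
    qed
    have dims: "r1 + r2 = n"
    proof -
      have "mtrace P = of_nat r1" using mtrace_comm[OF 1(1,2)] 1 by (simp add: mtrace_one)
      moreover have "mtrace P' = of_nat r2" using mtrace_comm[OF 2(1,2)] 2 by (simp add: mtrace_one)
      moreover have "P + P' = 1\<^sub>m n" using Pc by (auto simp: P'_def intro!: eq_matI)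
      ultimately have "of_nat r1 + of_nat r2 = (of_nat n :: complex)"
        using mtrace_add[OF Pc P'c] by (simp add: mtrace_one)
      then show ?thesis by (metis of_nat_add of_nat_eq_iff)
    qed
    \<comment> \<open>Both ranks are positive because \<open>W\<close> is neither zero nor
      everything; as they add up to \<open>n\<close>, the induction hypothesis applies to both
      pieces.\<close>
    have "r1 \<noteq> 0"
    proof
      assume "r1 = 0"
      then have P0: "P = 0\<^sub>m n n" using 1 by (auto simp: scalar_prod_def)
      obtain w where w: "w \<in> W" "w \<noteq> 0\<^sub>v n" using W(1) Wc by blast
      have "w = A *\<^sub>v (B *\<^sub>v w)" using ABW[OF w(1)] by simp
      also have "\<dots> = P * A *\<^sub>v (B *\<^sub>v w)" unfolding PA ..
      also have "\<dots> = 0\<^sub>v n" using A B w Wc by (auto simp: P0 intro!: eq_vecI)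
      finally show False using w by simp
    qed
    moreover have "r2 \<noteq> 0"
    proof
      assume "r2 = 0"
      then have P0: "P' = 0\<^sub>m n n" using 2 by (auto simp: scalar_prod_def)
      have P1: "P = 1\<^sub>m n"
      proof (rule eq_matI)
        fix i j assume "i < dim_row (1\<^sub>m n :: cmat)" "j < dim_col (1\<^sub>m n :: cmat)"
        then have ij: "i < n" "j < n" by auto
        have "P' $$ (i, j) = 0" using P0 ij by simp
        then show "P $$ (i, j) = 1\<^sub>m n $$ (i, j)" unfolding P'_def using ij Pc by auto
      qed (use Pc in auto)
      have "v \<in> W" if v: "v \<in> carrier_vec n" for v
      proof -
        have "A * B = 1\<^sub>m n" using ABP ABc unfolding P1 by (metis right_mult_one_mat)
        then have "v = A * B *\<^sub>v v" using v by simp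
        also have "\<dots> = A *\<^sub>v (B *\<^sub>v v)" by (rule assoc_mult_mat_vec[OF A B v])
        also have "\<dots> \<in> W" using AW B v by auto
        finally show ?thesis .
      qed
      then show False using W(2) Wc by blast
    qed
    ultimately have lt: "r1 < n" "r2 < n" using dims by auto
    note s1 = subrepresentation[OF rep 1(1-3), unfolded 1(4), OF Pcom]
    note s2 = subrepresentation[OF rep 2(1-3), unfolded 2(4), OF P'com]
    obtain l1 where l1: "\<forall>\<sigma>\<in>set l1. irreducible_rep G \<sigma>" "\<forall>g\<in>carrier G. mtrace (B1 * \<rho> g * A1) = (\<Sum>\<sigma>\<leftarrow>l1. mtrace (\<sigma> g))"
      using less.IH[OF lt(1) s1(1)] by auto
    obtain l2 where l2: "\<forall>\<sigma>\<in>set l2. irreducible_rep G \<sigma>" "\<forall>g\<in>carrier G. mtrace (B2 * \<rho> g * A2) = (\<Sum>\<sigma>\<leftarrow>l2. mtrace (\<sigma> g))"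
      using less.IH[OF lt(2) s2(1)] by auto
    show ?thesis
    proof (intro exI[of _ "l1 @ l2"] conjI ballI)
      fix g assume g: "g \<in> carrier G"
      have "mtrace (\<rho> g) = mtrace (B1 * \<rho> g * A1) + mtrace (B2 * \<rho> g * A2)"
        using s1(2)[OF _ g] s2(2)[OF _ g] tr[OF g] by simp
      then show "mtrace (\<rho> g) = (\<Sum>\<sigma>\<leftarrow>l1 @ l2. mtrace (\<sigma> g))" using l1 l2 g by simp
    qed (use l1 l2 in auto)
  qed
qed

end

section \<open>Counting conjugacy classes and irreducible representations\<close>

definition conj_class :: "'g monoid \<Rightarrow> 'g \<Rightarrow> 'g set" where
  "conj_class G g = {h \<otimes>\<^bsub>G\<^esub> g \<otimes>\<^bsub>G\<^esub> inv\<^bsub>G\<^esub> h | h. h \<in> carrier G}"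

text \<open>Push-forward of a class along \<phi>, stated by pulling back so that no inverse of
  \<phi> appears. This is the shape in which \<open>canonical_identification\<close> demands
  compatibility.\<close>

definition irrep_transport ::
    "'g monoid \<Rightarrow> ('h \<Rightarrow> 'g) \<Rightarrow> ('h \<Rightarrow> cmat) set \<Rightarrow> ('g \<Rightarrow> cmat) set" where
  "irrep_transport G' \<phi> r = {\<mu>. irreducible_rep G' \<mu> \<and> \<mu> \<circ> \<phi> \<in> r}"

lemma nontriv_conj_classes_eq: "nontriv_conj_classes G = conj_class G ` carrier G - {{\<one>\<^bsub>G\<^esub>}}"
  unfolding nontriv_conj_classes_def orbits_def orbit_def conj_class_def by force

section \<open>Representations twisted by an isomorphism of groups\<close>

lemma representation_cong:
  assumes "Group.group G" "\<And>g. g \<in> carrier G \<Longrightarrow> \<rho> g = \<sigma> g"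
  shows "representation G n \<rho> \<longleftrightarrow> representation G n \<sigma>"
proof -
  interpret Group.group G by fact
  have "representation G n \<tau>" if "representation G n \<nu>" "\<And>g. g \<in> carrier G \<Longrightarrow> \<nu> g = \<tau> g" for \<nu> \<tau>
  proof -
    have "\<tau> g = \<nu> g" if "g \<in> carrier G" for g using \<open>g \<in> carrier G \<Longrightarrow> \<nu> g = \<tau> g\<close> that by simp
    then show ?thesis using that(1) unfolding representation_def by (metis one_closed m_closed)
  qed
  from this[of \<rho> \<sigma>] this[of \<sigma> \<rho>] show ?thesis using assms(2) by auto
qed

lemma irreducible_rep_cong:
  assumes "Group.group G" "\<And>g. g \<in> carrier G \<Longrightarrow> \<rho> g = \<sigma> g"
  shows "irreducible_rep G \<rho> \<longleftrightarrow> irreducible_rep G \<sigma>"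
proof -
  have r: "representation G n \<rho> = representation G n \<sigma>" for n by (rule representation_cong[OF assms])
  have i: "(\<forall>g \<in> carrier G. \<forall>w \<in> W. \<rho> g *\<^sub>v w \<in> W) = (\<forall>g \<in> carrier G. \<forall>w \<in> W. \<sigma> g *\<^sub>v w \<in> W)" for W
    using assms(2) by simp
  show ?thesis unfolding irreducible_rep_def r i ..
qed

lemma equiv_rep_of_eq:
  assumes "Group.group G" "\<And>g. g \<in> carrier G \<Longrightarrow> \<rho> g = \<sigma> g" "representation G n \<rho>"
  shows "equiv_rep G \<rho> \<sigma>"
proof -
  have \<sigma>: "representation G n \<sigma>" using representation_cong[OF assms(1), of \<rho> \<sigma> n] assms(2,3) by blast
  show ?thesis
  proof (rule equiv_repI[OF assms(3) \<sigma>, of "1\<^sub>m n" "1\<^sub>m n"])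
    fix g assume g: "g \<in> carrier G"
    then have "\<rho> g \<in> carrier_mat n n" using assms(3) by (auto simp: representation_def)
    then show "1\<^sub>m n * \<rho> g = \<sigma> g * 1\<^sub>m n" using assms(2)[OF g] by simp
  qed auto
qed

lemma representation_twist:
  assumes "Group.group G" "Group.group G'" "\<phi> \<in> iso G G'"
  shows "representation G n (\<mu> \<circ> \<phi>) \<longleftrightarrow> representation G' n \<mu>"
proof -
  interpret G: Group.group G by fact
  interpret G': Group.group G' by fact
  interpret group_hom G G' \<phi> using assms(3) by unfold_locales (auto simp: iso_def)
  have im: "\<phi> ` carrier G = carrier G'" using assms(3) by (auto simp: iso_def bij_betw_def)
  show ?thesis unfolding representation_def im[symmetric] by auto
qed

lemma irreducible_rep_twist:
  assumes "Group.group G" "Group.group G'" "\<phi> \<in> iso G G'"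
  shows "irreducible_rep G (\<mu> \<circ> \<phi>) \<longleftrightarrow> irreducible_rep G' \<mu>"
proof -
  have im: "carrier G' = \<phi> ` carrier G" using assms(3) by (auto simp: iso_def bij_betw_def)
  show ?thesis unfolding irreducible_rep_def representation_twist[OF assms] im by simp
qed

lemma Hom_rep_twist:
  assumes "Group.group G" "Group.group G'" "\<phi> \<in> iso G G'"
  shows "Hom_rep G (\<mu> \<circ> \<phi>) (\<nu> \<circ> \<phi>) = Hom_rep G' \<mu> \<nu>"
proof -
  interpret G: Group.group G by fact
  interpret G': Group.group G' by fact
  interpret group_hom G G' \<phi> using assms(3) by unfold_locales (auto simp: iso_def)
  have im: "carrier G' = \<phi> ` carrier G" using assms(3) by (auto simp: iso_def bij_betw_def)
  show ?thesis unfolding Hom_rep_def degree_rep_def im by simp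
qed

lemma equiv_rep_twist:
  assumes "Group.group G" "Group.group G'" "\<phi> \<in> iso G G'"
  shows "equiv_rep G (\<mu> \<circ> \<phi>) (\<nu> \<circ> \<phi>) \<longleftrightarrow> equiv_rep G' \<mu> \<nu>"
  unfolding equiv_rep_def Hom_rep_twist[OF assms] ..

lemma irreducible_representation:
  "irreducible_rep G \<rho> \<Longrightarrow> representation G (degree_rep G \<rho>) \<rho>"
  by (metis irreducible_repE)

lemma irrep_class_eq_iff:
  assumes "irreducible_rep G \<rho>" "irreducible_rep G \<sigma>"
  shows "irrep_class G \<rho> = irrep_class G \<sigma> \<longleftrightarrow> equiv_rep G \<rho> \<sigma>"
proof
  assume "irrep_class G \<rho> = irrep_class G \<sigma>"
  moreover have "\<sigma> \<in> irrep_class G \<sigma>"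
    using assms(2) equiv_rep_refl[OF irreducible_representation[OF assms(2)]] by (simp add: irrep_class_def)
  ultimately show "equiv_rep G \<rho> \<sigma>" by (auto simp: irrep_class_def)
next
  assume "equiv_rep G \<rho> \<sigma>"
  then show "irrep_class G \<rho> = irrep_class G \<sigma>"
    unfolding irrep_class_def using assms by (metis (no_types, lifting) irreducible_representation equiv_rep_sym equiv_rep_trans)
qed

lemma irrep_class_self: "irreducible_rep G \<rho> \<Longrightarrow> \<rho> \<in> irrep_class G \<rho>"
  by (simp add: irrep_class_def equiv_rep_refl[OF irreducible_representation])

lemma irrep_class_member:
  assumes "irreducible_rep G \<rho>" "\<sigma> \<in> irrep_class G \<rho>"
  shows "irrep_class G \<sigma> = irrep_class G \<rho>" "irreducible_rep G \<sigma>"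
  using assms irrep_class_eq_iff[of G \<rho> \<sigma>] by (auto simp: irrep_class_def)

lemma irrep_transport_class:
  assumes "Group.group G" "Group.group G'" "\<phi> \<in> iso G G'" "irreducible_rep G' \<mu>"
  shows "irrep_transport G' \<phi> (irrep_class G (\<mu> \<circ> \<phi>)) = irrep_class G' \<mu>"
  unfolding irrep_transport_def irrep_class_def
  using equiv_rep_twist[OF assms(1-3)] irreducible_rep_twist[OF assms(1-3)] assms(4) by auto

lemma irrep_transport_fixed_iff:
  assumes "Group.group G" "\<phi> \<in> iso G G" "irreducible_rep G \<sigma>"
  shows "irrep_transport G \<phi> (irrep_class G \<sigma>) = irrep_class G \<sigma> \<longleftrightarrow> equiv_rep G (\<sigma> \<circ> \<phi>) \<sigma>"
proof
  have irr: "irreducible_rep G (\<sigma> \<circ> \<phi>)" using irreducible_rep_twist[OF assms(1,1,2)] assms(3) by simp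
  assume "irrep_transport G \<phi> (irrep_class G \<sigma>) = irrep_class G \<sigma>"
  then have "\<sigma> \<circ> \<phi> \<in> irrep_class G \<sigma>" using irrep_class_self[OF assms(3)] by (auto simp: irrep_transport_def)
  then show "equiv_rep G (\<sigma> \<circ> \<phi>) \<sigma>" using irrep_class_eq_iff[OF irr assms(3)] irrep_class_member[OF assms(3)] by metis
next
  have irr: "irreducible_rep G (\<sigma> \<circ> \<phi>)" using irreducible_rep_twist[OF assms(1,1,2)] assms(3) by simp
  assume "equiv_rep G (\<sigma> \<circ> \<phi>) \<sigma>"
  then have "irrep_class G (\<sigma> \<circ> \<phi>) = irrep_class G \<sigma>" using irrep_class_eq_iff[OF irr assms(3)] by simp
  then show "irrep_transport G \<phi> (irrep_class G \<sigma>) = irrep_class G \<sigma>"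
    using irrep_transport_class[OF assms(1,1,2,3)] by simp
qed

lemma trivial_rep_irreducible:
  assumes "Group.group G"
  shows "irreducible_rep G (\<lambda>_. 1\<^sub>m 1)"
proof -
  interpret Group.group G by fact
  have "W = {0\<^sub>v 1} \<or> W = carrier_vec 1"
    if W: "W \<subseteq> carrier_vec 1" "0\<^sub>v 1 \<in> W" "\<forall>a. \<forall>v\<in>W. a \<cdot>\<^sub>v v \<in> W" for W :: "cvec set"
  proof (cases "W = {0\<^sub>v 1}")
    case False
    then obtain w where w: "w \<in> W" "w \<noteq> 0\<^sub>v 1" using W by blast
    then have wc: "w \<in> carrier_vec 1" using W by auto
    then have w0: "w $v 0 \<noteq> 0" using w(2) by (metis One_nat_def carrier_vecD eq_vecI index_zero_vec less_Suc0)
    have "v \<in> W" if v: "v \<in> carrier_vec 1" for v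
    proof -
      have "v = (v $v 0 / w $v 0) \<cdot>\<^sub>v w"
        using v wc w0 by (intro eq_vecI) auto
      then show ?thesis using W(3) w(1) by metis
    qed
    then show ?thesis using W by blast
  qed simp
  then show ?thesis
    unfolding irreducible_rep_def subspace_module_vec_iff
    by (intro exI[of _ 1]) (auto simp: representation_def)
qed

context finite_group
begin

text \<open>From the permutation matrices of left multiplication, whose trace counts fixed points.
  The list \<open>l\<close> records irreducible constituents with repetitions, known only through
  the sum of their characters; it is the bookkeeping device for everything up to
  \<open>card_fixed_irreps\<close>.\<close>

lemma regular_character:
  obtains l where "\<forall>\<sigma>\<in>set l. irreducible_rep G \<sigma>"
    "\<And>g. g \<in> carrier G \<Longrightarrow> (\<Sum>\<sigma>\<leftarrow>l. mtrace (\<sigma> g)) = (if g = \<one> then of_nat (card (carrier G)) else 0)"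
proof -
  define N where "N = card (carrier G)"
  obtain f where f: "bij_betw f {0..<N} (carrier G)" using ex_bij_betw_nat_finite[OF finite_carrier] by (auto simp: N_def)
  define R where "R g = Matrix.mat N N (\<lambda>(i, j). if f i = g \<otimes> f j then 1 else 0 :: complex)" for g
  have fc: "f i \<in> carrier G" if "i < N" for i using f that by (auto simp: bij_betw_def)
  have inj: "f i = f j \<longleftrightarrow> i = j" if "i < N" "j < N" for i j
    using f that by (auto simp: bij_betw_def inj_on_def)
  have sur: "\<exists>i<N. f i = x" if "x \<in> carrier G" for x
    using f that by (metis atLeastLessThan_iff bij_betw_iff_bijections)
  have "representation G N R"
    unfolding representation_def
  proof (intro conjI ballI)
    show "R \<one> = 1\<^sub>m N" by (rule eq_matI) (auto simp: R_def inj fc)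
    fix g h assume g: "g \<in> carrier G"
    show "R g \<in> carrier_mat N N" by (simp add: R_def)
    assume h: "h \<in> carrier G"
    show "R (g \<otimes> h) = R g * R h"
    proof (rule eq_matI)
      fix i j assume "i < dim_row (R g * R h)" "j < dim_col (R g * R h)"
      then have ij: "i < N" "j < N" by (auto simp: R_def)
      obtain k where k: "k < N" "f k = h \<otimes> f j" using sur[of "h \<otimes> f j"] h fc[OF ij(2)] by auto
      have "(R g * R h) $$ (i, j) = (\<Sum>l<N. R g $$ (i, l) * R h $$ (l, j))"
        by (rule index_mult_sum) (use ij in \<open>auto simp: R_def\<close>)
      also have "\<dots> = (\<Sum>l<N. if l = k then if f i = g \<otimes> f k then 1 else 0 else 0)"
        using ij inj k by (intro sum.cong) (auto simp: R_def k(2)[symmetric])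
      also have "\<dots> = R (g \<otimes> h) $$ (i, j)" using ij k g h fc[OF ij(2)] by (simp add: R_def m_assoc)
      finally show "R (g \<otimes> h) $$ (i, j) = (R g * R h) $$ (i, j)" by simp
    qed (auto simp: R_def)
  qed
  then obtain l where l: "\<forall>\<sigma>\<in>set l. irreducible_rep G \<sigma>" "\<forall>g\<in>carrier G. mtrace (R g) = (\<Sum>\<sigma>\<leftarrow>l. mtrace (\<sigma> g))"
    using character_sum_of_irreducibles by blast
  have "mtrace (R g) = (if g = \<one> then of_nat N else 0)" if g: "g \<in> carrier G" for g
  proof -
    have "mtrace (R g) = (\<Sum>i<N. if f i = g \<otimes> f i then 1 else 0)" by (simp add: mtrace_def R_def)
    also have "\<dots> = (\<Sum>i<N. if g = \<one> then 1 else 0)"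
      using g fc by (intro sum.cong) (auto simp: r_cancel_one')
    finally show ?thesis by simp
  qed
  then show ?thesis using that l by (auto simp: N_def)
qed

text \<open>The sum of \<open>\<sigma> (h \<otimes> a \<otimes> inv h)\<close> over \<open>h\<close>
  is an average and therefore scalar by Schur; its trace fixes the scalar.\<close>

lemma sum_conj_character:
  assumes irr: "irreducible_rep G \<sigma>" and a: "a \<in> carrier G" and b: "b \<in> carrier G"
  shows "(\<Sum>h\<in>carrier G. mtrace (\<sigma> (h \<otimes> a \<otimes> inv h \<otimes> b))) =
    of_nat (card (carrier G)) * (mtrace (\<sigma> a) * mtrace (\<sigma> b) / of_nat (degree_rep G \<sigma>))"
proof -
  define n where "n = degree_rep G \<sigma>"
  have rep: "representation G n \<sigma>" using irreducible_representation[OF irr] by (simp add: n_def)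
  note c = rep_carrier[OF rep]
  have e: "\<sigma> (h \<otimes> a \<otimes> inv h \<otimes> b) = \<sigma> h * \<sigma> a * \<sigma> (inv h) * \<sigma> b" if "h \<in> carrier G" for h
    using that a b by (simp add: rep_mult[OF rep])
  have cc: "\<sigma> h * \<sigma> a * \<sigma> (inv h) \<in> carrier_mat n n" if "h \<in> carrier G" for h
    using conj_carrier[OF rep rep c[OF a] that] .
  have "(\<Sum>h\<in>carrier G. mtrace (\<sigma> (h \<otimes> a \<otimes> inv h \<otimes> b))) = mtrace (sum_mat n n (\<lambda>h. \<sigma> h * \<sigma> a * \<sigma> (inv h) * \<sigma> b) (carrier G))"
    by (subst mtrace_sum_mat[OF mult_carrier_mat[OF cc c[OF b]]]) (auto simp: e)
  also have "sum_mat n n (\<lambda>h. \<sigma> h * \<sigma> a * \<sigma> (inv h) * \<sigma> b) (carrier G) = avg n n \<sigma> \<sigma> (\<sigma> a) * \<sigma> b"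
    unfolding avg_def by (rule sum_mat_mult[OF c[OF b] cc, symmetric])
  also have "avg n n \<sigma> \<sigma> (\<sigma> a) = (of_nat (card (carrier G)) * mtrace (\<sigma> a) / of_nat n) \<cdot>\<^sub>m 1\<^sub>m n"
    by (rule avg_scalar[OF irr _ c[OF a]]) (simp add: n_def)
  also have "mtrace (\<dots> * \<sigma> b) = of_nat (card (carrier G)) * mtrace (\<sigma> a) / of_nat n * mtrace (\<sigma> b)"
    using c[OF b] by (simp add: mult_smult_assoc_mat[of _ n n _ n] mtrace_smult[of _ n])
  finally show ?thesis by (simp add: n_def)
qed

text \<open>Column orthogonality: evaluate the regular character at
  \<open>h \<otimes> a \<otimes> inv h \<otimes> inv b\<close>, which is the identity exactly when
  \<open>h\<close> conjugates \<open>a\<close> to \<open>b\<close>, and sum over \<open>h\<close>.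
  The denominators come from \<open>sum_conj_character\<close>.\<close>

lemma character_column_relation:
  assumes l: "\<forall>\<sigma>\<in>set l. irreducible_rep G \<sigma>"
    "\<And>g. g \<in> carrier G \<Longrightarrow> (\<Sum>\<sigma>\<leftarrow>l. mtrace (\<sigma> g)) = (if g = \<one> then of_nat (card (carrier G)) else 0)"
    and a: "a \<in> carrier G" and b: "b \<in> carrier G"
  shows "(\<Sum>\<sigma>\<leftarrow>l. mtrace (\<sigma> a) * mtrace (\<sigma> (inv b)) / of_nat (degree_rep G \<sigma>)) =
    of_nat (card {h \<in> carrier G. h \<otimes> a \<otimes> inv h = b})"
proof -
  define N :: complex where "N = of_nat (card (carrier G))"
  have N0: "N \<noteq> 0" using card_pos by (simp add: N_def)
  have swap: "(\<Sum>\<sigma>\<leftarrow>l. \<Sum>h\<in>carrier G. f \<sigma> h) = (\<Sum>h\<in>carrier G. \<Sum>\<sigma>\<leftarrow>l. f \<sigma> h)" for f :: "_ \<Rightarrow> _ \<Rightarrow> complex"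
    by (induction l) (auto simp: sum.distrib)
  have "N * (\<Sum>\<sigma>\<leftarrow>l. mtrace (\<sigma> a) * mtrace (\<sigma> (inv b)) / of_nat (degree_rep G \<sigma>)) =
      (\<Sum>\<sigma>\<leftarrow>l. \<Sum>h\<in>carrier G. mtrace (\<sigma> (h \<otimes> a \<otimes> inv h \<otimes> inv b)))"
    unfolding sum_list_const_mult[symmetric] N_def
    using l(1) sum_conj_character[OF _ a, of _ "inv b"] b by (intro arg_cong[of _ _ sum_list] map_cong refl) auto
  also have "\<dots> = (\<Sum>h\<in>carrier G. if h \<otimes> a \<otimes> inv h = b then N else 0)"
    unfolding swap
  proof (rule sum.cong)
    fix h assume h: "h \<in> carrier G"
    have "h \<otimes> a \<otimes> inv h \<otimes> inv b = \<one> \<longleftrightarrow> h \<otimes> a \<otimes> inv h = b"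
      using a b h by (metis inv_closed inv_inv inv_equality m_closed r_inv)
    then show "(\<Sum>\<sigma>\<leftarrow>l. mtrace (\<sigma> (h \<otimes> a \<otimes> inv h \<otimes> inv b))) = (if h \<otimes> a \<otimes> inv h = b then N else 0)"
      using l(2)[of "h \<otimes> a \<otimes> inv h \<otimes> inv b"] a b h by (simp add: N_def)
  qed simp
  also have "\<dots> = N * of_nat (card {h \<in> carrier G. h \<otimes> a \<otimes> inv h = b})"
    using finite_carrier by (simp add: sum.If_cases Int_def mult.commute)
  finally show ?thesis using N0 by simp
qed

text \<open>Pairing the regular character with that of \<rho> leaves only the term at the identity,
  which is the group order times the degree of \<rho>; orthogonality reads the same pairing as the
  group order times the number of constituents equivalent to \<rho>.\<close>

lemma multiplicity_regular:
  assumes l: "\<forall>\<sigma>\<in>set l. irreducible_rep G \<sigma>"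
    "\<And>g. g \<in> carrier G \<Longrightarrow> (\<Sum>\<sigma>\<leftarrow>l. mtrace (\<sigma> g)) = (if g = \<one> then of_nat (card (carrier G)) else 0)"
    and irr: "irreducible_rep G \<rho>"
  shows "length (filter (\<lambda>\<sigma>. equiv_rep G \<sigma> \<rho>) l) = degree_rep G \<rho>"
proof -
  define N :: complex where "N = of_nat (card (carrier G))"
  have N0: "N \<noteq> 0" using card_pos by (simp add: N_def)
  have swap: "(\<Sum>\<sigma>\<leftarrow>l. \<Sum>h\<in>carrier G. f \<sigma> h) = (\<Sum>h\<in>carrier G. \<Sum>\<sigma>\<leftarrow>l. f \<sigma> h)" for f :: "_ \<Rightarrow> _ \<Rightarrow> complex"
    by (induction l) (auto simp: sum.distrib)
  have "N * of_nat (length (filter (\<lambda>\<sigma>. equiv_rep G \<sigma> \<rho>) l)) = (\<Sum>\<sigma>\<leftarrow>l. if equiv_rep G \<sigma> \<rho> then N else 0)"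
    by (induction l) (auto simp: algebra_simps)
  also have "\<dots> = (\<Sum>\<sigma>\<leftarrow>l. \<Sum>g\<in>carrier G. mtrace (\<sigma> g) * mtrace (\<rho> (inv g)))"
    using l(1) character_orthogonality[OF _ irr] by (intro arg_cong[of _ _ sum_list] map_cong refl) (auto simp: N_def)
  also have "\<dots> = (\<Sum>g\<in>carrier G. (\<Sum>\<sigma>\<leftarrow>l. mtrace (\<sigma> g)) * mtrace (\<rho> (inv g)))"
    unfolding swap sum_list_mult_const ..
  also have "\<dots> = (\<Sum>g\<in>carrier G. if g = \<one> then N * mtrace (\<rho> \<one>) else 0)"
    using l(2) by (intro sum.cong) (auto simp: N_def)
  also have "\<dots> = N * mtrace (\<rho> \<one>)" using finite_carrier by simp
  also have "mtrace (\<rho> \<one>) = of_nat (degree_rep G \<rho>)"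
    using rep_one[OF irreducible_representation[OF irr]] by (simp add: mtrace_one)
  finally show ?thesis using N0 by (metis mult_cancel_left of_nat_eq_iff)
qed

abbreviation Irr :: "('a \<Rightarrow> cmat) set set" where
  "Irr \<equiv> {irrep_class G \<rho> | \<rho>. irreducible_rep G \<rho>}"

text \<open>Each class occurs in \<open>l\<close> as often as its degree, so the weight
  \<open>1 / of_nat (degree_rep G \<sigma>)\<close> turns a sum over the list into a sum over
  classes. Exactly these weights appear in \<open>character_column_relation\<close>.\<close>

lemma
  assumes l: "\<forall>\<sigma>\<in>set l. irreducible_rep G \<sigma>"
    "\<And>g. g \<in> carrier G \<Longrightarrow> (\<Sum>\<sigma>\<leftarrow>l. mtrace (\<sigma> g)) = (if g = \<one> then of_nat (card (carrier G)) else 0)"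
  shows Irr_list: "Irr = irrep_class G ` set l"
    and sum_Irr: "(\<Sum>\<sigma>\<leftarrow>l. F (irrep_class G \<sigma>) / of_nat (degree_rep G \<sigma>)) = (\<Sum>r\<in>Irr. F r :: complex)"
proof -
  show Irr: "Irr = irrep_class G ` set l"
  proof (intro subset_antisym subsetI)
    fix r assume "r \<in> Irr"
    then obtain \<rho> where \<rho>: "irreducible_rep G \<rho>" "r = irrep_class G \<rho>" by auto
    have "degree_rep G \<rho> > 0" using irreducible_repE[OF \<rho>(1)] by metis
    then have "filter (\<lambda>\<sigma>. equiv_rep G \<sigma> \<rho>) l \<noteq> []" using multiplicity_regular[OF l \<rho>(1)] by auto
    then obtain \<sigma> where "\<sigma> \<in> set l" "equiv_rep G \<sigma> \<rho>" by (auto simp: filter_empty_conv)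
    then show "r \<in> irrep_class G ` set l" using irrep_class_eq_iff[of G \<sigma> \<rho>] l(1) \<rho> by auto
  qed (use l(1) in auto)
  have fin: "finite Irr" unfolding Irr by simp
  have split: "(\<Sum>\<sigma>\<leftarrow>k. f \<sigma>) = (\<Sum>r\<in>Irr. \<Sum>\<sigma>\<leftarrow>filter (\<lambda>\<sigma>. irrep_class G \<sigma> = r) k. f \<sigma>)"
    if "set k \<subseteq> set l" for k and f :: "_ \<Rightarrow> complex"
    using that
  proof (induction k)
    case (Cons a k)
    have "(\<Sum>r\<in>Irr. \<Sum>\<sigma>\<leftarrow>filter (\<lambda>\<sigma>. irrep_class G \<sigma> = r) (a # k). f \<sigma>) =
        (\<Sum>r\<in>Irr. (if r = irrep_class G a then f a else 0) + (\<Sum>\<sigma>\<leftarrow>filter (\<lambda>\<sigma>. irrep_class G \<sigma> = r) k. f \<sigma>))"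
      by (intro sum.cong) auto
    also have "\<dots> = (\<Sum>r\<in>Irr. if r = irrep_class G a then f a else 0) + (\<Sum>\<sigma>\<leftarrow>k. f \<sigma>)"
      using Cons by (simp add: sum.distrib)
    also have "(\<Sum>r\<in>Irr. if r = irrep_class G a then f a else 0) = f a"
      using fin Cons.prems l(1) by (subst sum.delta) auto
    finally show ?case by simp
  qed simp
  show "(\<Sum>\<sigma>\<leftarrow>l. F (irrep_class G \<sigma>) / of_nat (degree_rep G \<sigma>)) = (\<Sum>r\<in>Irr. F r :: complex)"
    unfolding split[of l, OF subset_refl]
  proof (rule sum.cong)
    fix r assume "r \<in> Irr"
    then obtain \<rho> where \<rho>: "irreducible_rep G \<rho>" "r = irrep_class G \<rho>" by auto
    have pos: "degree_rep G \<rho> > 0" using irreducible_repE[OF \<rho>(1)] by metis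
    have eq: "filter (\<lambda>\<sigma>. irrep_class G \<sigma> = r) l = filter (\<lambda>\<sigma>. equiv_rep G \<sigma> \<rho>) l"
      using irrep_class_eq_iff[OF _ \<rho>(1)] l(1) \<rho>(2) by (intro filter_cong) auto
    have "(\<Sum>\<sigma>\<leftarrow>filter (\<lambda>\<sigma>. irrep_class G \<sigma> = r) l. F (irrep_class G \<sigma>) / of_nat (degree_rep G \<sigma>)) =
        (\<Sum>\<sigma>\<leftarrow>filter (\<lambda>\<sigma>. irrep_class G \<sigma> = r) l. F r / of_nat (degree_rep G \<rho>))"
    proof (intro arg_cong[of _ _ sum_list] map_cong refl)
      fix \<sigma> assume \<sigma>: "\<sigma> \<in> set (filter (\<lambda>\<sigma>. irrep_class G \<sigma> = r) l)"
      then have "equiv_rep G \<sigma> \<rho>" "irreducible_rep G \<sigma>" using irrep_class_eq_iff[OF _ \<rho>(1)] l(1) \<rho>(2) by auto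
      then have "degree_rep G \<sigma> = degree_rep G \<rho>"
        using equiv_repE irreducible_representation \<rho>(1) by metis
      then show "F (irrep_class G \<sigma>) / of_nat (degree_rep G \<sigma>) = F r / of_nat (degree_rep G \<rho>)" using \<sigma> by auto
    qed
    also have "\<dots> = of_nat (degree_rep G \<rho>) * (F r / of_nat (degree_rep G \<rho>))"
      unfolding eq using multiplicity_regular[OF l \<rho>(1)] by (simp add: sum_list_triv)
    finally show "(\<Sum>\<sigma>\<leftarrow>filter (\<lambda>\<sigma>. irrep_class G \<sigma> = r) l. F (irrep_class G \<sigma>) / of_nat (degree_rep G \<sigma>)) = F r"
      using pos by simp
  qed simp
qed

lemma finite_Irr: "finite Irr"
proof -
  obtain l where "\<forall>\<sigma>\<in>set l. irreducible_rep G \<sigma>"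
    "\<And>g. g \<in> carrier G \<Longrightarrow> (\<Sum>\<sigma>\<leftarrow>l. mtrace (\<sigma> g)) = (if g = \<one> then of_nat (card (carrier G)) else 0)"
    using regular_character by metis
  from Irr_list[OF this] show ?thesis by simp
qed

text \<open>By orthogonality the characters of \<open>\<sigma> \<circ> \<phi>\<close> and \<sigma>
  pair to the group order if the class of \<sigma> is fixed and to 0 otherwise. Exchanging the sums
  and applying the column relation to \<open>\<phi> g\<close> and \<open>g\<close> gives the
  right-hand side, which \<open>card_fixed_classes\<close> reaches from the other direction.\<close>

lemma card_fixed_irreps:
  assumes \<phi>: "\<phi> \<in> iso G G"
  shows "card (carrier G) * card {r \<in> Irr. irrep_transport G \<phi> r = r} =
    (\<Sum>g\<in>carrier G. card {h \<in> carrier G. h \<otimes> \<phi> g \<otimes> inv h = g})"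
proof -
  obtain l where l: "\<forall>\<sigma>\<in>set l. irreducible_rep G \<sigma>"
    "\<And>g. g \<in> carrier G \<Longrightarrow> (\<Sum>\<sigma>\<leftarrow>l. mtrace (\<sigma> g)) = (if g = \<one> then of_nat (card (carrier G)) else 0)"
    using regular_character by metis
  define N :: complex where "N = of_nat (card (carrier G))"
  have swap: "(\<Sum>\<sigma>\<leftarrow>l. \<Sum>h\<in>carrier G. f \<sigma> h) = (\<Sum>h\<in>carrier G. \<Sum>\<sigma>\<leftarrow>l. f \<sigma> h)" for f :: "_ \<Rightarrow> _ \<Rightarrow> complex"
    by (induction l) (auto simp: sum.distrib)
  have \<phi>c: "\<phi> g \<in> carrier G" if "g \<in> carrier G" for g using \<phi> that by (auto simp: iso_def hom_def)
  have "N * of_nat (card {r \<in> Irr. irrep_transport G \<phi> r = r}) = (\<Sum>r\<in>Irr. if irrep_transport G \<phi> r = r then N else 0)"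
    using finite_Irr by (simp add: sum.If_cases Int_def conj_commute mult.commute)
  also have "\<dots> = (\<Sum>\<sigma>\<leftarrow>l. (if irrep_transport G \<phi> (irrep_class G \<sigma>) = irrep_class G \<sigma> then N else 0) / of_nat (degree_rep G \<sigma>))"
    by (rule sum_Irr[OF l, symmetric])
  also have "\<dots> = (\<Sum>\<sigma>\<leftarrow>l. \<Sum>g\<in>carrier G. mtrace (\<sigma> (\<phi> g)) * mtrace (\<sigma> (inv g)) / of_nat (degree_rep G \<sigma>))"
  proof (intro arg_cong[of _ _ sum_list] map_cong refl)
    fix \<sigma> assume "\<sigma> \<in> set l"
    then have irr: "irreducible_rep G \<sigma>" using l by auto
    then have irr': "irreducible_rep G (\<sigma> \<circ> \<phi>)" using irreducible_rep_twist[OF group_axioms group_axioms \<phi>] by simp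
    show "(if irrep_transport G \<phi> (irrep_class G \<sigma>) = irrep_class G \<sigma> then N else 0) / of_nat (degree_rep G \<sigma>) =
      (\<Sum>g\<in>carrier G. mtrace (\<sigma> (\<phi> g)) * mtrace (\<sigma> (inv g)) / of_nat (degree_rep G \<sigma>))"
      unfolding irrep_transport_fixed_iff[OF group_axioms \<phi> irr] sum_divide_distrib[symmetric] N_def
        character_orthogonality[OF irr' irr, symmetric] by simp
  qed
  also have "\<dots> = (\<Sum>g\<in>carrier G. of_nat (card {h \<in> carrier G. h \<otimes> \<phi> g \<otimes> inv h = g}))"
    unfolding swap using character_column_relation[OF l \<phi>c] by (intro sum.cong) auto
  finally have "of_nat (card (carrier G) * card {r \<in> Irr. irrep_transport G \<phi> r = r}) =
    (of_nat (\<Sum>g\<in>carrier G. card {h \<in> carrier G. h \<otimes> \<phi> g \<otimes> inv h = g}) :: complex)"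
    by (simp add: N_def)
  then show ?thesis using of_nat_eq_iff by blast
qed

lemma conj_class_self: "g \<in> carrier G \<Longrightarrow> g \<in> conj_class G g"
  unfolding conj_class_def by (rule CollectI, rule exI[of _ \<one>]) auto

lemma conj_class_subset: "g \<in> carrier G \<Longrightarrow> conj_class G g \<subseteq> carrier G"
  by (auto simp: conj_class_def)

lemma conj_class_eq:
  assumes "g \<in> carrier G" "x \<in> conj_class G g"
  shows "conj_class G x = conj_class G g"
proof -
  obtain k where k: "k \<in> carrier G" "x = k \<otimes> g \<otimes> inv k" using assms by (auto simp: conj_class_def)
  have 1: "h \<otimes> x \<otimes> inv h = (h \<otimes> k) \<otimes> g \<otimes> inv (h \<otimes> k)" if "h \<in> carrier G" for h
    using that k assms(1) by (simp add: inv_mult_group m_assoc)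
  have 2: "h \<otimes> g \<otimes> inv h = (h \<otimes> inv k) \<otimes> x \<otimes> inv (h \<otimes> inv k)" if "h \<in> carrier G" for h
    unfolding 1[of "h \<otimes> inv k", OF m_closed[OF that inv_closed[OF k(1)]]] using that k(1) assms(1) by (simp add: m_assoc)
  show ?thesis
  proof (intro subset_antisym subsetI)
    fix y assume "y \<in> conj_class G x"
    then obtain h where h: "h \<in> carrier G" "y = h \<otimes> x \<otimes> inv h" by (auto simp: conj_class_def)
    then show "y \<in> conj_class G g" using 1[OF h(1)] k(1) unfolding conj_class_def by blast
  next
    fix y assume "y \<in> conj_class G g"
    then obtain h where h: "h \<in> carrier G" "y = h \<otimes> g \<otimes> inv h" by (auto simp: conj_class_def)
    then show "y \<in> conj_class G x" using 2[OF h(1)] k(1) unfolding conj_class_def by blast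
  qed
qed

lemma conj_class_image:
  assumes "Group.group G'" "\<phi> \<in> iso G G'" "g \<in> carrier G"
  shows "\<phi> ` conj_class G g = conj_class G' (\<phi> g)"
proof -
  interpret G': Group.group G' by fact
  interpret group_hom G G' \<phi> using assms(2) by unfold_locales (auto simp: iso_def)
  have im: "\<phi> ` carrier G = carrier G'" using assms(2) by (auto simp: iso_def bij_betw_def)
  have "\<phi> (h \<otimes> g \<otimes> inv h) = \<phi> h \<otimes>\<^bsub>G'\<^esub> \<phi> g \<otimes>\<^bsub>G'\<^esub> inv\<^bsub>G'\<^esub> (\<phi> h)" if "h \<in> carrier G" for h
    using that assms(3) by simp
  then show ?thesis unfolding conj_class_def im[symmetric] by (auto simp: image_iff) metis+
qed

lemma pairwise_disjnt_image:
  assumes "\<And>p q. p \<in> D \<Longrightarrow> q \<in> f p \<Longrightarrow> f q = f p"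
  shows "pairwise disjnt (f ` D)"
proof (rule pairwiseI, rule ccontr)
  fix c d assume "c \<in> f ` D" "d \<in> f ` D" "c \<noteq> d" "\<not> disjnt c d"
  then obtain p q r where pq: "p \<in> D" "q \<in> D" "c = f p" "d = f q" "r \<in> f p" "r \<in> f q" unfolding disjnt_iff by blast
  then have "f r = c" "f r = d" using assms by metis+
  then show False using \<open>c \<noteq> d\<close> by simp
qed

text \<open>Orbit counting with an arbitrary fibre in place of the stabiliser: translation by
  \<open>k\<close> identifies the stabiliser with the set of elements moving \<open>x\<close> to
  \<open>y\<close>. The action laws are assumed at the single point \<open>x\<close>, so that
  \<open>cj\<close>, whose laws are proved on \<open>Pol\<close>, qualifies.\<close>

lemma card_fiber_orbit:
  assumes one: "act \<one> x = x"
    and mult: "\<And>g h. g \<in> carrier G \<Longrightarrow> h \<in> carrier G \<Longrightarrow> act (g \<otimes> h) x = act g (act h x)"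
    and y: "y \<in> (\<lambda>h. act h x) ` carrier G"
  shows "card {h \<in> carrier G. act h x = y} * card ((\<lambda>h. act h x) ` carrier G) = card (carrier G)"
proof -
  define T where "T y = {h \<in> carrier G. act h x = y}" for y
  define O' where "O' = (\<lambda>h. act h x) ` carrier G"
  have eq: "card (T y) = card (T x)" if y: "y \<in> O'" for y
  proof -
    obtain k where k: "k \<in> carrier G" "y = act k x" using y by (auto simp: O'_def)
    have "bij_betw (\<lambda>h. k \<otimes> h) (T x) (T y)"
    proof (rule bij_betw_byWitness[where f' = "\<lambda>h. inv k \<otimes> h"])
      show "(\<otimes>) k ` T x \<subseteq> T y" using k mult by (auto simp: T_def)
      show "(\<otimes>) (inv k) ` T y \<subseteq> T x"
      proof clarify
        fix h assume "h \<in> T y"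
        then have h: "h \<in> carrier G" "act h x = act k x" by (auto simp: T_def k(2))
        have "act (inv k \<otimes> h) x = act (inv k \<otimes> k) x"
          using mult[OF inv_closed[OF k(1)] h(1)] mult[OF inv_closed[OF k(1)] k(1)] h(2) by simp
        then show "inv k \<otimes> h \<in> T x" using h k one by (simp add: T_def)
      qed
    qed (use k in \<open>auto simp: T_def m_assoc[symmetric]\<close>)
    then show ?thesis by (metis bij_betw_same_card)
  qed
  have fin: "finite O'" using finite_carrier by (simp add: O'_def)
  have "carrier G = (\<Union>y\<in>O'. T y)" unfolding O'_def T_def by auto
  then have "card (carrier G) = card (\<Union>y\<in>O'. T y)" by simp
  also have "\<dots> = (\<Sum>y\<in>O'. card (T y))"
    by (rule card_UN_disjoint[OF fin]) (use finite_carrier in \<open>auto simp: T_def\<close>)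
  also have "\<dots> = (\<Sum>y\<in>O'. card (T x))" by (rule sum.cong[OF refl eq])
  also have "\<dots> = card (T x) * card O'" by simp
  finally show ?thesis using eq[of y] y by (simp add: T_def O'_def)
qed

lemma card_transporter:
  assumes x: "x \<in> carrier G" and g: "g \<in> conj_class G x"
  shows "card {h \<in> carrier G. h \<otimes> x \<otimes> inv h = g} * card (conj_class G x) = card (carrier G)"
proof -
  have e: "conj_class G x = (\<lambda>h. h \<otimes> x \<otimes> inv h) ` carrier G" unfolding conj_class_def by auto
  show ?thesis unfolding e
    by (rule card_fiber_orbit) (use x g in \<open>auto simp: inv_mult_group m_assoc e\<close>)
qed

text \<open>Sum class by class. If \<phi> preserves \<open>C\<close>, each \<open>g\<close> in
  \<open>C\<close> is conjugate to \<open>\<phi> g\<close> and has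
  \<open>card (carrier G) / card C\<close> transporters, for a total of the group order; otherwise
  no element of \<open>C\<close> is conjugate to its image.\<close>

lemma card_fixed_classes:
  assumes \<phi>: "\<phi> \<in> iso G G"
  shows "card (carrier G) * card {C \<in> conj_class G ` carrier G. \<phi> ` C = C} =
    (\<Sum>g\<in>carrier G. card {h \<in> carrier G. h \<otimes> \<phi> g \<otimes> inv h = g})"
proof -
  define N where "N g = {h \<in> carrier G. h \<otimes> \<phi> g \<otimes> inv h = g}" for g
  define K where "K = conj_class G ` carrier G"
  have \<phi>c: "\<phi> g \<in> carrier G" if "g \<in> carrier G" for g using \<phi> that by (auto simp: iso_def hom_def)
  have finK: "finite K" using finite_carrier by (simp add: K_def)
  have un: "\<Union>K = carrier G" using conj_class_self conj_class_subset by (auto simp: K_def)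
  have dis: "C \<inter> D = {}" if "C \<in> K" "D \<in> K" "C \<noteq> D" for C D
    using that conj_class_eq unfolding K_def by (metis (no_types, lifting) disjoint_iff imageE)
  have "(\<Sum>g\<in>carrier G. card (N g)) =
      (\<Sum>C\<in>K. \<Sum>g\<in>C. card (N g))"
    unfolding un[symmetric] using finK dis finite_carrier conj_class_subset
    by (subst sum.Union_disjoint) (auto simp: K_def intro: finite_subset[OF conj_class_subset finite_carrier])
  also have "\<dots> = (\<Sum>C\<in>K. if \<phi> ` C = C then card (carrier G) else 0)"
  proof (rule sum.cong)
    fix C assume C: "C \<in> K"
    then obtain x where x: "x \<in> carrier G" "C = conj_class G x" by (auto simp: K_def)
    show "(\<Sum>g\<in>C. card (N g)) = (if \<phi> ` C = C then card (carrier G) else 0)"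
    proof (cases "\<phi> ` C = C")
      case True
      have "card (N g) * card C = card (carrier G)" if g: "g \<in> C" for g
      proof -
        have gc: "g \<in> carrier G" using g x conj_class_subset by auto
        have "\<phi> g \<in> conj_class G x" using True g x by auto
        then have e: "conj_class G (\<phi> g) = C" using conj_class_eq[OF x(1)] x(2) by auto
        show ?thesis using card_transporter[OF \<phi>c[OF gc], of g] g unfolding e N_def by simp
      qed
      moreover have "finite C" "C \<noteq> {}" using x conj_class_subset finite_carrier conj_class_self finite_subset by blast+
      ultimately have "card C * (\<Sum>g\<in>C. card (N g)) = card C * card (carrier G)" "card C > 0"
        by (auto simp: sum_distrib_left mult.commute card_gt_0_iff)
      then show ?thesis using True by simp
    next
      case False
      have empty: "N g = {}" if g: "g \<in> C" for g
      proof (rule ccontr)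
        have gc: "g \<in> carrier G" using g x conj_class_subset by auto
        assume "N g \<noteq> {}"
        then obtain h where "h \<in> carrier G" "h \<otimes> \<phi> g \<otimes> inv h = g" unfolding N_def by blast
        then have "g \<in> conj_class G (\<phi> g)" unfolding conj_class_def by (intro CollectI exI[of _ h]) simp
        then have "conj_class G g = conj_class G (\<phi> g)" using conj_class_eq[OF \<phi>c[OF gc]] by simp
        then have "\<phi> ` conj_class G g = conj_class G g" using conj_class_image[OF group_axioms \<phi> gc] by simp
        moreover have "conj_class G g = C" using conj_class_eq[OF x(1)] g x(2) by simp
        ultimately show False using False by simp
      qed
      have "(\<Sum>g\<in>C. card (N g)) = (\<Sum>g\<in>C. 0)"
        by (intro sum.cong refl) (simp only: empty card.empty)
      then show ?thesis using False by simp
    qed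
  qed simp
  also have "\<dots> = card (carrier G) * card {C \<in> K. \<phi> ` C = C}"
    using finK by (simp add: sum.If_cases Int_def conj_commute mult.commute)
  finally show ?thesis by (simp add: K_def N_def)
qed

text \<open>Brauer's permutation lemma, with the trivial class and the trivial representation removed.\<close>

lemma card_fixed_nontriv:
  assumes \<phi>: "\<phi> \<in> iso G G"
  shows "card {C \<in> nontriv_conj_classes G. \<phi> ` C = C} = card {r \<in> nontriv_irreps G. irrep_transport G \<phi> r = r}"
proof -
  interpret H: group_hom G G \<phi> using \<phi> by unfold_locales (auto simp: iso_def)
  have eq: "card {C \<in> conj_class G ` carrier G. \<phi> ` C = C} = card {r \<in> Irr. irrep_transport G \<phi> r = r}"
  proof -
    have e: "card (carrier G) * card {C \<in> conj_class G ` carrier G. \<phi> ` C = C} =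
        card (carrier G) * card {r \<in> Irr. irrep_transport G \<phi> r = r}"
      unfolding card_fixed_irreps[OF \<phi>] card_fixed_classes[OF \<phi>] ..
    show ?thesis using mult_cancel1[THEN iffD1, OF e] card_pos by (elim disjE) (assumption, simp)
  qed
  have one: "conj_class G \<one> = {\<one>}" using conj_class_self[OF one_closed] by (auto simp: conj_class_def)
  have 1: "{C \<in> nontriv_conj_classes G. \<phi> ` C = C} = {C \<in> conj_class G ` carrier G. \<phi> ` C = C} - {{\<one>}}"
    unfolding nontriv_conj_classes_eq by auto
  have m1: "{\<one>} \<in> {C \<in> conj_class G ` carrier G. \<phi> ` C = C}" using one by (auto intro!: image_eqI[of _ _ \<one>])
  have t: "irreducible_rep G (\<lambda>_. 1\<^sub>m 1)" by (rule trivial_rep_irreducible[OF group_axioms])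
  have "(\<lambda>_. 1\<^sub>m 1) \<circ> \<phi> = (\<lambda>_. 1\<^sub>m 1 :: cmat)" by auto
  then have "equiv_rep G ((\<lambda>_. 1\<^sub>m 1) \<circ> \<phi>) (\<lambda>_. 1\<^sub>m 1)"
    using equiv_rep_refl[OF irreducible_representation[OF t]] by simp
  then have tf: "irrep_transport G \<phi> (irrep_class G (\<lambda>_. 1\<^sub>m 1)) = irrep_class G (\<lambda>_. 1\<^sub>m 1)"
    using irrep_transport_fixed_iff[OF group_axioms \<phi> t] by simp
  have 2: "{r \<in> nontriv_irreps G. irrep_transport G \<phi> r = r} =
      {r \<in> Irr. irrep_transport G \<phi> r = r} - {irrep_class G (\<lambda>_. 1\<^sub>m 1)}"
    unfolding nontriv_irreps_def by auto
  have m2: "irrep_class G (\<lambda>_. 1\<^sub>m 1) \<in> {r \<in> Irr. irrep_transport G \<phi> r = r}" using t tf by auto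
  show ?thesis unfolding 1 2 using m1 m2 eq by (simp add: card_Diff_singleton)
qed

end

section \<open>Finite subgroups of SL(2)\<close>

lemma bij_betw_two_elements_unique:
  assumes "finite D" "card D \<le> 2" "bij_betw \<alpha> D D" "bij_betw \<beta> D D"
    and "x \<in> D" "\<alpha> x \<noteq> x" "y \<in> D" "\<beta> y \<noteq> y" "z \<in> D"
  shows "\<alpha> z = \<beta> z"
proof -
  have swap: "\<gamma> u = (if u = v then \<gamma> v else v)" "D = {v, \<gamma> v}"
    if \<gamma>: "bij_betw \<gamma> D D" and v: "v \<in> D" "\<gamma> v \<noteq> v" and u: "u \<in> D" for \<gamma> u v
  proof -
    have gv: "\<gamma> v \<in> D" using \<gamma> v by (auto simp: bij_betw_def)
    have "card {v, \<gamma> v} = 2" using v by auto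
    then show D: "D = {v, \<gamma> v}" using card_subset_eq[OF assms(1), of "{v, \<gamma> v}"] gv v assms(1,2)
      by (metis card_mono empty_subsetI insert_subset le_antisym)
    have "\<gamma> (\<gamma> v) = v"
    proof -
      have "\<gamma> (\<gamma> v) \<in> D" using \<gamma> gv by (auto simp: bij_betw_def)
      moreover have "\<gamma> (\<gamma> v) \<noteq> \<gamma> v" using \<gamma> gv v by (auto simp: bij_betw_def inj_on_def)
      ultimately show ?thesis using D by blast
    qed
    then show "\<gamma> u = (if u = v then \<gamma> v else v)" using u D by auto
  qed
  have D: "D = {x, \<alpha> x}" using swap(2)[OF assms(3,5,6,5)] .
  have "\<alpha> x = \<beta> x \<and> \<alpha> (\<alpha> x) = \<beta> (\<alpha> x)"
  proof -
    have "\<beta> x \<noteq> x"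
      using swap(1)[OF assms(4,7,8,5)] swap(2)[OF assms(4,7,8,5)] assms(5,8) by (metis (full_types))
    then have "D = {x, \<beta> x}" using swap(2)[OF assms(4,5) _ assms(5)] by blast
    then have "\<alpha> x = \<beta> x" using D assms(6) by (metis insert_iff singletonD)
    moreover have "\<alpha> x \<in> D" using D by blast
    then have "\<alpha> (\<alpha> x) = x" "\<beta> (\<alpha> x) = x"
      using swap(1)[OF assms(3,5,6), of "\<alpha> x"] swap(1)[OF assms(4,5) \<open>\<beta> x \<noteq> x\<close>, of "\<alpha> x"] assms(6) by auto
    ultimately show ?thesis by simp
  qed
  then show ?thesis using D assms(9) by blast
qed

text \<open>Two nontrivial permutations that differ need at least three points. If the preserved
  label \<open>s\<close> were not constant, some label would occur only once, its point would be
  fixed by both, and on the two remaining points there is just one nontrivial permutation.\<close>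

lemma distinct_permutations_three:
  fixes s :: "'x \<Rightarrow> nat"
  assumes fin: "finite D" and card: "card D \<le> 3" and \<alpha>: "bij_betw \<alpha> D D" and \<beta>: "bij_betw \<beta> D D"
    and s: "\<And>x. x \<in> D \<Longrightarrow> s (\<alpha> x) = s x" "\<And>x. x \<in> D \<Longrightarrow> s (\<beta> x) = s x"
    and mv: "x \<in> D" "\<alpha> x \<noteq> x" "y \<in> D" "\<beta> y \<noteq> y" and ne: "z \<in> D" "\<alpha> z \<noteq> \<beta> z"
  shows "card D = 3 \<and> (\<forall>u\<in>D. \<forall>v\<in>D. s u = s v)"
proof (intro conjI ballI)
  show c3: "card D = 3"
  proof (rule ccontr)
    assume "card D \<noteq> 3"
    then have "card D \<le> 2" using card by simp
    then show False using bij_betw_two_elements_unique[OF fin _ \<alpha> \<beta> mv ne(1)] ne(2) by blast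
  qed
  fix u v assume uv: "u \<in> D" "v \<in> D"
  show "s u = s v"
  proof (rule ccontr)
    assume suv: "s u \<noteq> s v"
    then have "u \<noteq> v" by auto
    then have "card (D - {u, v}) = 1" using c3 uv by (simp add: card_Diff_subset)
    then obtain w where w: "D - {u, v} = {w}" using card_1_singletonE by blast
    then have D: "D = {u, v, w}" "w \<noteq> u" "w \<noteq> v" using uv by auto
    have "\<exists>t\<in>D. \<forall>t'\<in>D. s t' = s t \<longrightarrow> t' = t"
    proof (cases "s w = s u")
      case True
      then show ?thesis using D suv by (intro bexI[of _ v]) auto
    next
      case False
      then show ?thesis using D suv by (intro bexI[of _ u]) auto
    qed
    then obtain t where t: "t \<in> D" "\<And>t'. t' \<in> D \<Longrightarrow> s t' = s t \<Longrightarrow> t' = t" by blast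
    have at: "\<alpha> t = t" "\<beta> t = t" using t(2)[OF bij_betwE[OF \<alpha>, rule_format, OF t(1)]] t(2)[OF bij_betwE[OF \<beta>, rule_format, OF t(1)]] s t(1) by auto
    have r: "bij_betw \<gamma> (D - {t}) (D - {t})" if "bij_betw \<gamma> D D" "\<gamma> t = t" for \<gamma>
      using bij_betw_DiffI[OF that(1), of "{t}" "{t}"] that(2) t(1) by (auto simp: bij_betw_def)
    have cc: "card (D - {t}) \<le> 2" using c3 t fin by simp
    have "x \<noteq> t" "y \<noteq> t" "z \<noteq> t" using mv at ne by auto
    then show False
      using bij_betw_two_elements_unique[OF _ cc r[OF \<alpha> at(1)] r[OF \<beta> at(2)], of x y z] fin mv ne by auto
  qed
qed

section \<open>Eigenvectors of two by two matrices\<close>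

lemma mult_vec_2:
  fixes M :: "cmat"
  assumes "M \<in> carrier_mat 2 2" "v \<in> carrier_vec 2"
  shows "M *\<^sub>v v = \<mu> \<cdot>\<^sub>v v \<longleftrightarrow>
    M $$ (0,0) * v $v 0 + M $$ (0,1) * v $v 1 = \<mu> * v $v 0 \<and>
    M $$ (1,0) * v $v 0 + M $$ (1,1) * v $v 1 = \<mu> * v $v 1"
proof -
  have "M *\<^sub>v v = \<mu> \<cdot>\<^sub>v v \<longleftrightarrow> (\<forall>i<2. (M *\<^sub>v v) $v i = (\<mu> \<cdot>\<^sub>v v) $v i)"
    using assms by (auto simp: vec_eq_iff simp del: index_mult_mat_vec)
  also have "\<dots> \<longleftrightarrow> (M *\<^sub>v v) $v 0 = (\<mu> \<cdot>\<^sub>v v) $v 0 \<and>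
      (M *\<^sub>v v) $v 1 = (\<mu> \<cdot>\<^sub>v v) $v 1"
    by (auto simp: less_2_cases_iff)
  also have "(M *\<^sub>v v) $v i = M $$ (i,0) * v $v 0 + M $$ (i,1) * v $v 1" if "i < 2" for i
    using assms that by (simp add: scalar_prod_def numeral_2_eq_2)
  ultimately show ?thesis using assms by simp
qed

lemma mat_2_eq_iff:
  fixes M N :: "cmat"
  assumes "M \<in> carrier_mat 2 2" "N \<in> carrier_mat 2 2"
  shows "M = N \<longleftrightarrow> M $$ (0,0) = N $$ (0,0) \<and> M $$ (0,1) = N $$ (0,1) \<and> M $$ (1,0) = N $$ (1,0) \<and> M $$ (1,1) = N $$ (1,1)"
  using assms by (auto simp: mat_eq_iff less_2_cases_iff)

lemma det_2_entries:
  fixes M :: "cmat"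
  assumes "M \<in> carrier_mat 2 2"
  shows "Determinant.det M = M $$ (0,0) * M $$ (1,1) - M $$ (0,1) * M $$ (1,0)"
proof -
  have c: "mat_delete M i 0 \<in> carrier_mat 1 1" for i using assms by (auto simp: mat_delete_def)
  have "Determinant.det M = (\<Sum>i<2. M $$ (i, 0) * ((-1) ^ i * Determinant.det (mat_delete M i 0)))"
    using laplace_expansion_column[OF assms, of 0] by (simp add: cofactor_def)
  also have "\<dots> = M $$ (0,0) * mat_delete M 0 0 $$ (0,0) - M $$ (1,0) * mat_delete M 1 0 $$ (0,0)"
    by (simp add: det_single[OF c] numeral_2_eq_2)
  finally show ?thesis using assms by (simp add: mat_delete_def)
qed

lemma vec_2_nonzero:
  assumes "v \<in> carrier_vec 2"
  shows "v \<noteq> 0\<^sub>v 2 \<longleftrightarrow> v $v 0 \<noteq> 0 \<or> v $v 1 \<noteq> (0 :: complex)"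
  using assms by (auto simp: vec_eq_iff less_2_cases_iff)

text \<open>The hypothesis on \<mu> is the characteristic equation for determinant 1. A solution can
  be read off one of the rows of \<open>M - \<mu>\<close>, unless \<open>M\<close> is already
  scalar.\<close>

lemma eigenvector_exists_2:
  fixes M :: "cmat"
  assumes M: "M \<in> carrier_mat 2 2" "Determinant.det M = 1"
    and \<mu>: "\<mu>\<^sup>2 - (M $$ (0,0) + M $$ (1,1)) * \<mu> + 1 = 0"
  obtains v where "v \<in> carrier_vec 2" "v \<noteq> 0\<^sub>v 2" "M *\<^sub>v v = \<mu> \<cdot>\<^sub>v v"
proof -
  define a b c d where "a = M $$ (0,0)" and "b = M $$ (0,1)" and "c = M $$ (1,0)" and "d = M $$ (1,1)"
  have det: "a * d - b * c = 1" using det_2_entries[OF M(1)] M(2) by (simp add: a_def b_def c_def d_def)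
  have ch: "\<mu>\<^sup>2 - (a + d) * \<mu> + (a * d - b * c) = 0" using \<mu> det by (simp add: a_def d_def)
  have mk: "\<exists>v. v \<in> carrier_vec 2 \<and> v \<noteq> 0\<^sub>v 2 \<and> M *\<^sub>v v = \<mu> \<cdot>\<^sub>v v"
    if "x \<noteq> 0 \<or> y \<noteq> 0" "a * x + b * y = \<mu> * x" "c * x + d * y = \<mu> * y" for x y
  proof -
    define v where "v = Matrix.vec 2 (\<lambda>i. if i = 0 then x else y)"
    have v: "v \<in> carrier_vec 2" "v $v 0 = x" "v $v 1 = y" by (auto simp: v_def)
    then show ?thesis using that vec_2_nonzero[OF v(1)] mult_vec_2[OF M(1) v(1)] unfolding a_def b_def c_def d_def by auto
  qed
  consider "b \<noteq> 0 \<or> \<mu> - a \<noteq> 0" | "c \<noteq> 0 \<or> \<mu> - d \<noteq> 0" | "b = 0" "c = 0" "\<mu> = a" "\<mu> = d" by auto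
  then have "\<exists>v. v \<in> carrier_vec 2 \<and> v \<noteq> 0\<^sub>v 2 \<and> M *\<^sub>v v = \<mu> \<cdot>\<^sub>v v"
  proof cases
    case 1
    show ?thesis
      by (rule mk[of b "\<mu> - a"]) (use 1 ch in \<open>auto simp: algebra_simps power2_eq_square\<close>)
  next
    case 2
    show ?thesis
      by (rule mk[of "\<mu> - d" c]) (use 2 ch in \<open>auto simp: algebra_simps power2_eq_square\<close>)
  next
    case 3
    show ?thesis by (rule mk[of 1 0]) (use 3 in auto)
  qed
  then show ?thesis using that by blast
qed

text \<open>Applying the adjugate of \<open>M - \<mu>\<close> to the eigenvector equation multiplies
  each coordinate of \<open>v\<close> by the characteristic polynomial, and some coordinate is
  nonzero.\<close>

lemma eigenvalue_equation_2:
  fixes M :: "cmat"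
  assumes M: "M \<in> carrier_mat 2 2" "Determinant.det M = 1"
    and v: "v \<in> carrier_vec 2" "v \<noteq> 0\<^sub>v 2" "M *\<^sub>v v = \<mu> \<cdot>\<^sub>v v"
  shows "\<mu>\<^sup>2 - (M $$ (0,0) + M $$ (1,1)) * \<mu> + 1 = 0"
proof -
  define a b c d x y where "a = M $$ (0,0)" and "b = M $$ (0,1)" and "c = M $$ (1,0)" and "d = M $$ (1,1)"
    and "x = v $v 0" and "y = v $v 1"
  note defs = a_def b_def c_def d_def x_def y_def
  have det: "a * d - b * c = 1" using det_2_entries[OF M(1)] M(2) by (simp add: defs)
  have e: "a * x + b * y = \<mu> * x" "c * x + d * y = \<mu> * y"
    using v(3) mult_vec_2[OF M(1) v(1)] by (auto simp: defs)
  have "(\<mu>\<^sup>2 - (a + d) * \<mu> + (a * d - b * c)) * x = 0" "(\<mu>\<^sup>2 - (a + d) * \<mu> + (a * d - b * c)) * y = 0"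
  proof -
    have "(\<mu>\<^sup>2 - (a + d) * \<mu> + (a * d - b * c)) * x = (d - \<mu>) * (a * x + b * y - \<mu> * x) - b * (c * x + d * y - \<mu> * y)"
      "(\<mu>\<^sup>2 - (a + d) * \<mu> + (a * d - b * c)) * y = (a - \<mu>) * (c * x + d * y - \<mu> * y) - c * (a * x + b * y - \<mu> * x)"
      by (simp_all add: algebra_simps power2_eq_square)
    then show "(\<mu>\<^sup>2 - (a + d) * \<mu> + (a * d - b * c)) * x = 0" "(\<mu>\<^sup>2 - (a + d) * \<mu> + (a * d - b * c)) * y = 0"
      using e by simp_all
  qed
  then show ?thesis using v(2) vec_2_nonzero[OF v(1)] det by (auto simp: defs)
qed

text \<open>Cramer's rule with the determinant \<open>D\<close> of the two vectors shows that the
  entries of \<open>M - \<mu>\<close> are zero.\<close>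

lemma two_eigenvectors_scalar:
  fixes M :: "cmat"
  assumes M: "M \<in> carrier_mat 2 2"
    and v: "v \<in> carrier_vec 2" "M *\<^sub>v v = \<mu> \<cdot>\<^sub>v v" and w: "w \<in> carrier_vec 2" "M *\<^sub>v w = \<mu> \<cdot>\<^sub>v w"
    and ind: "v $v 0 * w $v 1 \<noteq> v $v 1 * w $v 0"
  shows "M = \<mu> \<cdot>\<^sub>m 1\<^sub>m 2"
proof -
  define a b c d where "a = M $$ (0,0)" and "b = M $$ (0,1)" and "c = M $$ (1,0)" and "d = M $$ (1,1)"
  define x y where "x = v $v 0" and "y = v $v 1"
  define x' y' where "x' = w $v 0" and "y' = w $v 1"
  note defs = a_def b_def c_def d_def x_def y_def x'_def y'_def
  have e: "a * x + b * y = \<mu> * x" "c * x + d * y = \<mu> * y" "a * x' + b * y' = \<mu> * x'" "c * x' + d * y' = \<mu> * y'"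
    using v(2) w(2) mult_vec_2[OF M v(1)] mult_vec_2[OF M w(1)] by (auto simp: defs)
  define D where "D = x * y' - y * x'"
  have D: "D \<noteq> 0" using ind by (simp add: D_def defs)
  have "(a - \<mu>) * D = 0" "b * D = 0" "c * D = 0" "(d - \<mu>) * D = 0"
  proof -
    have "(a - \<mu>) * D = y' * (a * x + b * y - \<mu> * x) - y * (a * x' + b * y' - \<mu> * x')"
      "b * D = x * (a * x' + b * y' - \<mu> * x') - x' * (a * x + b * y - \<mu> * x)"
      "c * D = y' * (c * x + d * y - \<mu> * y) - y * (c * x' + d * y' - \<mu> * y')"
      "(d - \<mu>) * D = x * (c * x' + d * y' - \<mu> * y') - x' * (c * x + d * y - \<mu> * y)"
      by (simp_all add: D_def algebra_simps)
    then show "(a - \<mu>) * D = 0" "b * D = 0" "c * D = 0" "(d - \<mu>) * D = 0" using e by simp_all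
  qed
  then have "a = \<mu>" "b = 0" "c = 0" "d = \<mu>" using D by auto
  then show ?thesis by (subst mat_2_eq_iff[OF M]) (auto simp: defs)
qed

lemma parallel_2:
  fixes v w :: "cvec"
  assumes v: "v \<in> carrier_vec 2" "v \<noteq> 0\<^sub>v 2" and w: "w \<in> carrier_vec 2" "w \<noteq> 0\<^sub>v 2"
    and par: "v $v 0 * w $v 1 = v $v 1 * w $v 0"
  obtains c where "c \<noteq> 0" "w = c \<cdot>\<^sub>v v"
proof (cases "v $v 0 = 0")
  case True
  then have v1: "v $v 1 \<noteq> 0" using v vec_2_nonzero by blast
  then have "w $v 0 = 0" using par True by simp
  then have "w $v 1 \<noteq> 0" using w vec_2_nonzero by blast
  show ?thesis
    by (rule that[of "w $v 1 / v $v 1"])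
      (use v w v1 True \<open>w $v 0 = 0\<close> \<open>w $v 1 \<noteq> 0\<close> in \<open>auto simp: vec_eq_iff less_2_cases_iff\<close>)
next
  case False
  have "w $v 0 \<noteq> 0"
  proof
    assume "w $v 0 = 0"
    then have "w $v 1 = 0" using par False by simp
    then show False using w vec_2_nonzero \<open>w $v 0 = 0\<close> by blast
  qed
  then show ?thesis
    by (intro that[of "w $v 0 / v $v 0"])
      (use v w False par in \<open>auto simp: vec_eq_iff less_2_cases_iff field_simps\<close>)
qed

text \<open>Otherwise \<open>M\<close> would be \<open>\<epsilon>\<close> times a nontrivial unipotent matrix, which has infinite order.\<close>

lemma finite_order_unipotent:
  fixes M :: "cmat"
  assumes M: "M \<in> carrier_mat 2 2" "Determinant.det M = 1" and m: "m > 0" "M ^\<^sub>m m = 1\<^sub>m 2"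
    and tr: "M $$ (0,0) + M $$ (1,1) = 2 * \<epsilon>" and \<epsilon>: "\<epsilon> * \<epsilon> = 1"
  shows "M = \<epsilon> \<cdot>\<^sub>m 1\<^sub>m 2"
proof -
  \<comment> \<open>\<open>M\<close> is written as \<epsilon> times \<open>1 + N\<close>, where
    \<open>N\<close> has rows \<open>(a, b)\<close> and \<open>(c, - a)\<close>. Trace 2 \<epsilon>
    makes \<open>N\<close> traceless and determinant 1 then makes it square to zero, so the k-th
    power of \<open>1 + N\<close> is \<open>1 + k N\<close>.\<close>
  define a b c where "a = \<epsilon> * M $$ (0,0) - 1" and "b = \<epsilon> * M $$ (0,1)" and "c = \<epsilon> * M $$ (1,0)"
  have \<epsilon>': "\<epsilon> * (\<epsilon> * x) = x" for x using \<epsilon> by (simp add: mult.assoc[symmetric])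
  have M': "M $$ (0,0) = \<epsilon> * (1 + a)" "M $$ (0,1) = \<epsilon> * b" "M $$ (1,0) = \<epsilon> * c" "M $$ (1,1) = \<epsilon> * (1 - a)"
    using tr by (simp_all add: a_def b_def c_def \<epsilon>' right_diff_distrib) (simp add: algebra_simps)
  have "M $$ (0,0) * M $$ (1,1) - M $$ (0,1) * M $$ (1,0) = 1" using det_2_entries[OF M(1)] M(2) by simp
  moreover have "\<epsilon> * (1 + a) * (\<epsilon> * (1 - a)) - \<epsilon> * b * (\<epsilon> * c) = (\<epsilon> * \<epsilon>) * (1 - (a * a + b * c))"
    by (simp add: algebra_simps)
  moreover have "x = 0" if "1 - x = 1" for x :: complex using that by simp
  ultimately have nil: "a * a + b * c = 0" unfolding M' \<epsilon> by (metis mult_1)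
  have pow: "(M ^\<^sub>m k) $$ (0,0) = \<epsilon> ^ k * (1 + of_nat k * a) \<and> (M ^\<^sub>m k) $$ (0,1) = \<epsilon> ^ k * (of_nat k * b) \<and>
      (M ^\<^sub>m k) $$ (1,0) = \<epsilon> ^ k * (of_nat k * c) \<and> (M ^\<^sub>m k) $$ (1,1) = \<epsilon> ^ k * (1 - of_nat k * a)" for k
  proof (induction k)
    case (Suc k)
    have x: "(M ^\<^sub>m Suc k) $$ (i, j) = (M ^\<^sub>m k) $$ (i, 0) * M $$ (0, j) + (M ^\<^sub>m k) $$ (i, 1) * M $$ (1, j)"
      if "i < 2" "j < 2" for i j using index_mult_sum[of "M ^\<^sub>m k" 2 2 M 2 i j] M(1) that by (simp add: numeral_2_eq_2)
    define K E where "K = (of_nat k :: complex)" and "E = \<epsilon> ^ k"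
    have "E * (1 + K * a) * (\<epsilon> * (1 + a)) + E * (K * b) * (\<epsilon> * c) = \<epsilon> * E * (1 + (1 + K) * a) + \<epsilon> * E * K * (a * a + b * c)"
      "E * (1 + K * a) * (\<epsilon> * b) + E * (K * b) * (\<epsilon> * (1 - a)) = \<epsilon> * E * ((1 + K) * b)"
      "E * (K * c) * (\<epsilon> * (1 + a)) + E * (1 - K * a) * (\<epsilon> * c) = \<epsilon> * E * ((1 + K) * c)"
      "E * (K * c) * (\<epsilon> * b) + E * (1 - K * a) * (\<epsilon> * (1 - a)) = \<epsilon> * E * (1 - (1 + K) * a) + \<epsilon> * E * K * (a * a + b * c)"
      by (simp_all add: algebra_simps)
    note e = this[unfolded nil mult_zero_right add_0_right]
    have p: "\<epsilon> ^ Suc k = \<epsilon> * E" "of_nat (Suc k) = 1 + K" by (simp_all add: E_def K_def)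
    have 01: "(0::nat) < 2" "(1::nat) < 2" by auto
    note x' = x[OF 01(1) 01(1)] x[OF 01(1) 01(2)] x[OF 01(2) 01(1)] x[OF 01(2) 01(2)]
    show ?case unfolding x' M' p using Suc[folded K_def E_def] e by (simp only: simp_thms)
  qed (use M in auto)
  have "\<epsilon> \<noteq> 0" using \<epsilon> by auto
  moreover have "\<epsilon> ^ m * (of_nat m * b) = 0" "\<epsilon> ^ m * (of_nat m * c) = 0" using pow[of m] m by auto
  ultimately have bc: "b = 0" "c = 0" using m by auto
  then show ?thesis using nil by (subst mat_2_eq_iff[OF M(1)]) (simp_all add: M' del: One_nat_def)
qed

section \<open>Poles of the group on the projective line\<close>

definition pair_automorphisms :: "'g monoid \<Rightarrow> ('g \<Rightarrow> cmat) \<Rightarrow> ('g \<Rightarrow> 'g) set" where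
  "pair_automorphisms G Q = {\<phi> \<in> iso G G. equiv_rep G (Q \<circ> \<phi>) Q}"

locale sl2_group = finite_group G for G :: "'a monoid" (structure) +
  fixes Q :: "'a \<Rightarrow> cmat"
  assumes rep: "representation G 2 Q" and inj_Q: "inj_on Q (carrier G)"
    and det_Q: "g \<in> carrier G \<Longrightarrow> Determinant.det (Q g) = 1"
begin

abbreviation Aut :: "('a \<Rightarrow> 'a) set" where "Aut \<equiv> pair_automorphisms G Q"

lemmas Qc = rep_carrier[OF rep]
lemmas Qm = rep_mult[OF rep]

text \<open>The elements acting trivially on the projective line, namely those acting as plus or
  minus the identity (\<open>Z_scalar\<close>). In a cyclic group they can form a proper subgroup of
  the centre.\<close>

definition Z :: "'a set" where
  "Z = {g \<in> carrier G. \<exists>c. Q g = c \<cdot>\<^sub>m 1\<^sub>m 2}"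

text \<open>The eigenline of \<open>v\<close>, that is, a pole of the action on the projective line, is encoded by the
  group elements that fix it together with their eigenvalues.\<close>

definition pole :: "cvec \<Rightarrow> ('a \<times> complex) set" where
  "pole v = {(h, \<mu>). h \<in> carrier G \<and> Q h *\<^sub>v v = \<mu> \<cdot>\<^sub>v v}"

definition Pol :: "('a \<times> complex) set set" where
  "Pol = {pole v | v. v \<in> carrier_vec 2 \<and> v \<noteq> 0\<^sub>v 2 \<and> \<not> fst ` pole v \<subseteq> Z}"

text \<open>The action of \<open>k\<close> on lines in encoded form: \<open>cj_pole\<close>
  identifies the result with the pole of \<open>Q k *\<^sub>v v\<close>.\<close>

definition cj :: "'a \<Rightarrow> ('a \<times> complex) set \<Rightarrow> ('a \<times> complex) set" where
  "cj k p = (\<lambda>(h, \<mu>). (k \<otimes> h \<otimes> inv k, \<mu>)) ` p"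

definition orb :: "('a \<times> complex) set \<Rightarrow> ('a \<times> complex) set set" where
  "orb p = (\<lambda>k. cj k p) ` carrier G"

lemma one_smult_one_mat: "1 \<cdot>\<^sub>m 1\<^sub>m 2 = (1\<^sub>m 2 :: cmat)"
  by (intro eq_matI) auto

lemma smult_cancel_vec:
  fixes v :: "cvec"
  assumes "v \<in> carrier_vec 2" "v \<noteq> 0\<^sub>v 2" "a \<cdot>\<^sub>v v = b \<cdot>\<^sub>v v"
  shows "a = b"
proof -
  have "a * v $v i = b * v $v i" if "i < 2" for i
    using arg_cong[OF assms(3), of "\<lambda>w. w $v i"] assms(1) that by simp
  from this[of 0] this[of 1] show ?thesis using vec_2_nonzero[OF assms(1)] assms(2) by auto
qed

lemma Q_mult_vec:
  assumes "h \<in> carrier G" "k \<in> carrier G" "v \<in> carrier_vec 2"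
  shows "Q (h \<otimes> k) *\<^sub>v v = Q h *\<^sub>v (Q k *\<^sub>v v)"
  unfolding Qm[OF assms(1,2)] by (rule assoc_mult_mat_vec[OF Qc[OF assms(1)] Qc[OF assms(2)] assms(3)])

lemma Q_vec_carrier: "h \<in> carrier G \<Longrightarrow> v \<in> carrier_vec 2 \<Longrightarrow> Q h *\<^sub>v v \<in> carrier_vec 2"
  by (rule mult_mat_vec_carrier[OF Qc])

lemma Q_inv_vec:
  assumes "h \<in> carrier G" "v \<in> carrier_vec 2"
  shows "Q (inv h) *\<^sub>v (Q h *\<^sub>v v) = v" "Q h *\<^sub>v (Q (inv h) *\<^sub>v v) = v"
  using Q_mult_vec[of "inv h" h v] Q_mult_vec[of h "inv h" v] assms rep_one[OF rep] by simp_all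

lemma Q_vec_nonzero: "h \<in> carrier G \<Longrightarrow> v \<in> carrier_vec 2 \<Longrightarrow> v \<noteq> 0\<^sub>v 2 \<Longrightarrow> Q h *\<^sub>v v \<noteq> 0\<^sub>v 2"
proof
  assume h: "h \<in> carrier G" and v: "v \<in> carrier_vec 2" "v \<noteq> 0\<^sub>v 2" and "Q h *\<^sub>v v = 0\<^sub>v 2"
  then have "v = Q (inv h) *\<^sub>v 0\<^sub>v 2" using Q_inv_vec(1)[OF h v(1)] by simp
  also have "\<dots> = 0\<^sub>v 2" using Qc[OF inv_closed[OF h]] by (intro eq_vecI) auto
  finally show False using v by simp
qed

lemma pole_mult:
  assumes v: "v \<in> carrier_vec 2" and "(h, \<mu>) \<in> pole v" "(k, \<nu>) \<in> pole v"
  shows "(h \<otimes> k, \<mu> * \<nu>) \<in> pole v"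
proof -
  have h: "h \<in> carrier G" "Q h *\<^sub>v v = \<mu> \<cdot>\<^sub>v v" and k: "k \<in> carrier G" "Q k *\<^sub>v v = \<nu> \<cdot>\<^sub>v v"
    using assms by (auto simp: pole_def)
  have "Q (h \<otimes> k) *\<^sub>v v = \<nu> \<cdot>\<^sub>v (Q h *\<^sub>v v)"
    unfolding Q_mult_vec[OF h(1) k(1) v] k(2) by (rule mult_mat_vec[OF Qc[OF h(1)] v])
  also have "\<dots> = (\<mu> * \<nu>) \<cdot>\<^sub>v v" unfolding h(2) by (simp add: smult_smult_assoc mult.commute)
  finally show ?thesis using h k by (simp add: pole_def)
qed

lemma pole_unique:
  "v \<in> carrier_vec 2 \<Longrightarrow> v \<noteq> 0\<^sub>v 2 \<Longrightarrow> (h, \<mu>) \<in> pole v \<Longrightarrow> (h, \<nu>) \<in> pole v \<Longrightarrow> \<mu> = \<nu>"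
  using smult_cancel_vec by (auto simp: pole_def)

lemma pole_inv:
  assumes v: "v \<in> carrier_vec 2" "v \<noteq> 0\<^sub>v 2" and h: "(h, \<mu>) \<in> pole v"
  shows "\<mu> \<noteq> 0" "(inv h, inverse \<mu>) \<in> pole v"
proof -
  have hc: "h \<in> carrier G" "Q h *\<^sub>v v = \<mu> \<cdot>\<^sub>v v" using h by (auto simp: pole_def)
  show \<mu>: "\<mu> \<noteq> 0"
  proof
    assume "\<mu> = 0"
    then have "Q h *\<^sub>v v = 0\<^sub>v 2" using hc(2) v(1) by (auto intro!: eq_vecI)
    then show False using Q_vec_nonzero[OF hc(1) v] by simp
  qed
  have "v = \<mu> \<cdot>\<^sub>v (Q (inv h) *\<^sub>v v)"
    using Q_inv_vec(1)[OF hc(1) v(1)] mult_mat_vec[OF Qc[OF inv_closed[OF hc(1)]] v(1), of \<mu>] hc(2) by simp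
  then have "inverse \<mu> \<cdot>\<^sub>v v = inverse \<mu> \<cdot>\<^sub>v (\<mu> \<cdot>\<^sub>v (Q (inv h) *\<^sub>v v))" by simp
  also have "\<dots> = Q (inv h) *\<^sub>v v" using \<mu> by (simp add: smult_smult_assoc)
  finally show "(inv h, inverse \<mu>) \<in> pole v" using hc by (simp add: pole_def)
qed

lemma Q_finite_order: "g \<in> carrier G \<Longrightarrow> Q g ^\<^sub>m card (carrier G) = 1\<^sub>m 2"
proof -
  assume g: "g \<in> carrier G"
  have "Q (g [^] k) = Q g ^\<^sub>m k" for k :: nat
    by (induction k) (use g rep_one[OF rep] Qc[OF g] in \<open>auto simp: Qm\<close>)
  then show ?thesis using pow_order_eq_1[OF g] rep_one[OF rep] by (metis order_def)
qed

text \<open>With determinant 1 the eigenvalue \<epsilon>, being its own inverse, is a double root,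
  so the trace is 2 \<epsilon> and finite order leaves only a scalar matrix. Freeness off the fixed
  locus and distinctness of the two poles both rest on this.\<close>

lemma double_eigenvalue:
  assumes g: "g \<in> carrier G" and v: "v \<in> carrier_vec 2" "v \<noteq> 0\<^sub>v 2" "Q g *\<^sub>v v = \<epsilon> \<cdot>\<^sub>v v" and \<epsilon>: "\<epsilon> * \<epsilon> = 1"
  shows "Q g = \<epsilon> \<cdot>\<^sub>m 1\<^sub>m 2"
proof (rule finite_order_unipotent[OF Qc[OF g] det_Q[OF g] card_pos Q_finite_order[OF g] _ \<epsilon>])
  define t where "t = Q g $$ (0,0) + Q g $$ (1,1)"
  have "\<epsilon>\<^sup>2 - t * \<epsilon> + 1 = 0"
    using eigenvalue_equation_2[OF Qc[OF g] det_Q[OF g] v] by (simp add: t_def)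
  then have te: "t * \<epsilon> = 2" using \<epsilon> by (simp add: power2_eq_square)
  have "t = t * (\<epsilon> * \<epsilon>)" using \<epsilon> by simp
  also have "\<dots> = 2 * \<epsilon>" using te by (simp add: mult.assoc[symmetric])
  finally show "Q g $$ (0,0) + Q g $$ (1,1) = 2 * \<epsilon>" by (simp add: t_def)
qed

text \<open>The eigenvalue embeds the stabiliser of a line into the multiplicative group: the
  quotient of two elements with equal eigenvalue has eigenvalue 1 and is the identity. Commutativity
  of stabilisers follows.\<close>

lemma pole_inj:
  assumes v: "v \<in> carrier_vec 2" "v \<noteq> 0\<^sub>v 2" and "(h, \<mu>) \<in> pole v" "(k, \<mu>) \<in> pole v"
  shows "h = k"
proof -
  have hk: "h \<in> carrier G" "k \<in> carrier G" using assms by (auto simp: pole_def)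
  have "(h \<otimes> inv k, 1) \<in> pole v"
    using pole_mult[OF v(1) assms(3) pole_inv(2)[OF v assms(4)]] pole_inv(1)[OF v assms(4)] by simp
  then have "Q (h \<otimes> inv k) *\<^sub>v v = 1 \<cdot>\<^sub>v v" by (auto simp: pole_def)
  from double_eigenvalue[OF _ v this] have "Q (h \<otimes> inv k) = Q \<one>" using hk rep_one[OF rep] one_smult_one_mat by simp
  then have "h \<otimes> inv k = \<one>" using inj_Q hk by (auto simp: inj_on_def)
  then show ?thesis using hk by (metis inv_closed inv_inv inv_equality)
qed

lemma pole_commute:
  assumes v: "v \<in> carrier_vec 2" "v \<noteq> 0\<^sub>v 2" and "(h, \<mu>) \<in> pole v" "(k, \<nu>) \<in> pole v"
  shows "h \<otimes> k = k \<otimes> h"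
  using pole_inj[OF v] pole_mult[OF v(1) assms(3,4)] pole_mult[OF v(1) assms(4,3)] by (metis mult.commute)

lemma Z_scalar:
  assumes "g \<in> Z"
  obtains \<epsilon> where "Q g = \<epsilon> \<cdot>\<^sub>m 1\<^sub>m 2" "\<epsilon> = 1 \<or> \<epsilon> = -1"
proof -
  obtain c where c: "Q g = c \<cdot>\<^sub>m 1\<^sub>m 2" "g \<in> carrier G" using assms by (auto simp: Z_def)
  have "c * c = 1" using det_Q[OF c(2)] det_2_entries[OF Qc[OF c(2)]] unfolding c(1) by simp
  then have "c = 1 \<or> c = -1" by (metis square_eq_1_iff)
  then show ?thesis using that c by blast
qed

lemma scalar_mult_vec: "v \<in> carrier_vec 2 \<Longrightarrow> (c \<cdot>\<^sub>m 1\<^sub>m 2) *\<^sub>v v = c \<cdot>\<^sub>v (v :: cvec)"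
  by (intro eq_vecI) auto

lemma Z_in_pole: "g \<in> Z \<Longrightarrow> v \<in> carrier_vec 2 \<Longrightarrow> g \<in> fst ` pole v"
proof -
  assume g: "g \<in> Z" and v: "v \<in> carrier_vec 2"
  obtain c where "Q g = c \<cdot>\<^sub>m 1\<^sub>m 2" "g \<in> carrier G" using g by (auto simp: Z_def)
  then have "(g, c) \<in> pole v" using scalar_mult_vec[OF v] by (simp add: pole_def)
  then show ?thesis by force
qed

lemma Z_central: "g \<in> Z \<Longrightarrow> h \<in> carrier G \<Longrightarrow> g \<otimes> h = h \<otimes> g"
proof -
  assume g: "g \<in> Z" and h: "h \<in> carrier G"
  obtain c where c: "Q g = c \<cdot>\<^sub>m 1\<^sub>m 2" "g \<in> carrier G" using g by (auto simp: Z_def)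
  have "Q (g \<otimes> h) = Q (h \<otimes> g)"
    unfolding Qm[OF c(2) h] Qm[OF h c(2)] c(1) using Qc[OF h]
    by (simp add: mult_smult_distrib[of _ 2 2 _ 2] mult_smult_assoc_mat[of _ 2 2 _ 2])
  then show ?thesis using inj_Q c(2) h by (auto simp: inj_on_def)
qed

lemma Z_subgroup: "subgroup Z G"
proof (rule subgroupI)
  show "Z \<subseteq> carrier G" by (auto simp: Z_def)
  have "Q \<one> = 1 \<cdot>\<^sub>m 1\<^sub>m 2" using rep_one[OF rep] one_smult_one_mat by simp
  then have "\<one> \<in> Z" unfolding Z_def using one_closed by blast
  then show "Z \<noteq> {}" by blast
  fix g assume g: "g \<in> Z"
  then obtain \<epsilon> where \<epsilon>: "Q g = \<epsilon> \<cdot>\<^sub>m 1\<^sub>m 2" "\<epsilon> = 1 \<or> \<epsilon> = -1" using Z_scalar by blast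
  have gc: "g \<in> carrier G" using g by (auto simp: Z_def)
  show "g \<otimes> h \<in> Z" if h: "h \<in> Z" for h
  proof -
    obtain \<delta> where \<delta>: "Q h = \<delta> \<cdot>\<^sub>m 1\<^sub>m 2" "h \<in> carrier G" using h by (auto simp: Z_def)
    have "Q (g \<otimes> h) = (\<epsilon> * \<delta>) \<cdot>\<^sub>m 1\<^sub>m 2" unfolding Qm[OF gc \<delta>(2)] \<epsilon>(1) \<delta>(1) by (intro eq_matI) (auto simp: mult_smult_assoc_mat[of _ 2 2 _ 2])
    then show ?thesis using gc \<delta>(2) unfolding Z_def by blast
  qed
  have "Q (g \<otimes> g) = (\<epsilon> * \<epsilon>) \<cdot>\<^sub>m 1\<^sub>m 2" unfolding Qm[OF gc gc] \<epsilon>(1) by (intro eq_matI) (auto simp: mult_smult_assoc_mat[of _ 2 2 _ 2])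
  then have "Q (g \<otimes> g) = Q \<one>" using \<epsilon>(2) rep_one[OF rep] one_smult_one_mat by auto
  then have "g \<otimes> g = \<one>" using inj_Q gc by (auto simp: inj_on_def)
  then have "inv g = g" using gc by (simp add: inv_equality)
  then show "inv g \<in> Z" using g by simp
qed

lemma card_Z: "card Z \<le> 2" "card Z > 0" "finite Z"
proof -
  show fin: "finite Z" using finite_carrier by (auto simp: Z_def)
  have "Q ` Z \<subseteq> {1 \<cdot>\<^sub>m 1\<^sub>m 2, (-1) \<cdot>\<^sub>m 1\<^sub>m 2}" using Z_scalar by blast
  then have "card (Q ` Z) \<le> card {1 \<cdot>\<^sub>m 1\<^sub>m 2, (-1) \<cdot>\<^sub>m 1\<^sub>m 2 :: cmat}" by (rule card_mono[rotated]) simp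
  also have "\<dots> \<le> 2" by (simp add: card_insert_if)
  finally have "card (Q ` Z) \<le> 2" .
  moreover have "inj_on Q Z" using inj_Q by (rule inj_on_subset) (auto simp: Z_def)
  ultimately show "card Z \<le> 2" by (simp add: card_image)
  show "card Z > 0" using subgroup.one_closed[OF Z_subgroup] fin by (auto simp: card_gt_0_iff)
qed

lemma Z_conj:
  assumes "g \<in> carrier G" "k \<in> carrier G"
  shows "k \<otimes> g \<otimes> inv k \<in> Z \<longleftrightarrow> g \<in> Z"
proof
  assume g: "g \<in> Z"
  have "k \<otimes> g \<otimes> inv k = g" unfolding Z_central[OF g assms(2), symmetric] using assms by (simp add: m_assoc)
  then show "k \<otimes> g \<otimes> inv k \<in> Z" using g by simp
next
  assume z: "k \<otimes> g \<otimes> inv k \<in> Z"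
  have "g = inv k \<otimes> (k \<otimes> g \<otimes> inv k) \<otimes> k" using assms by (simp add: m_assoc) (simp add: m_assoc[symmetric])
  also have "\<dots> = k \<otimes> g \<otimes> inv k \<otimes> inv k \<otimes> k" using Z_central[OF z, of "inv k"] assms by simp
  also have "\<dots> = k \<otimes> g \<otimes> inv k" using assms by (simp add: m_assoc)
  finally show "g \<in> Z" using z by simp
qed

text \<open>A nonscalar matrix has at most one line for each eigenvalue, so \<open>w\<close> is a
  multiple of \<open>v\<close>, and proportional vectors have the same encoding. A pole is thus
  determined by any one of its nonscalar entries.\<close>

lemma same_pole:
  assumes v: "v \<in> carrier_vec 2" "v \<noteq> 0\<^sub>v 2" and w: "w \<in> carrier_vec 2" "w \<noteq> 0\<^sub>v 2"
    and g: "(g, \<mu>) \<in> pole v" "(g, \<mu>) \<in> pole w" "g \<notin> Z"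
  shows "pole v = pole w"
proof -
  have gc: "g \<in> carrier G" "Q g *\<^sub>v v = \<mu> \<cdot>\<^sub>v v" "Q g *\<^sub>v w = \<mu> \<cdot>\<^sub>v w" using g by (auto simp: pole_def)
  have "v $v 0 * w $v 1 = v $v 1 * w $v 0"
    using two_eigenvectors_scalar[OF Qc[OF gc(1)] v(1) gc(2) w(1) gc(3)] g(3) gc(1) by (auto simp: Z_def)
  then obtain c where c: "c \<noteq> 0" "w = c \<cdot>\<^sub>v v" using parallel_2[OF v w] by metis
  have "Q h *\<^sub>v w = \<nu> \<cdot>\<^sub>v w \<longleftrightarrow> Q h *\<^sub>v v = \<nu> \<cdot>\<^sub>v v" if h: "h \<in> carrier G" for h \<nu>
  proof -
    have "Q h *\<^sub>v w = c \<cdot>\<^sub>v (Q h *\<^sub>v v)" unfolding c(2) by (rule mult_mat_vec[OF Qc[OF h] v(1)])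
    moreover have "\<nu> \<cdot>\<^sub>v w = c \<cdot>\<^sub>v (\<nu> \<cdot>\<^sub>v v)" unfolding c(2) by (simp add: smult_smult_assoc mult.commute)
    moreover have "a = b" if "c \<cdot>\<^sub>v a = c \<cdot>\<^sub>v b" for a b :: "cvec"
    proof -
      have "inverse c \<cdot>\<^sub>v (c \<cdot>\<^sub>v a) = inverse c \<cdot>\<^sub>v (c \<cdot>\<^sub>v b)" using that by simp
      then show ?thesis using c(1) by (simp add: smult_smult_assoc)
    qed
    ultimately show ?thesis by metis
  qed
  then show ?thesis unfolding pole_def by auto
qed

lemma PolE:
  assumes "p \<in> Pol"
  obtains v h \<mu> where "v \<in> carrier_vec 2" "v \<noteq> 0\<^sub>v 2" "p = pole v" "(h, \<mu>) \<in> p" "h \<in> carrier G" "h \<notin> Z"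
proof -
  obtain v where v: "v \<in> carrier_vec 2" "v \<noteq> 0\<^sub>v 2" "p = pole v" "\<not> fst ` pole v \<subseteq> Z"
    using assms unfolding Pol_def by blast
  then obtain h where h: "h \<in> fst ` pole v" "h \<notin> Z" by blast
  from h(1) obtain \<mu> where "(h, \<mu>) \<in> pole v" by auto
  with h(2) show ?thesis using that[of v h \<mu>] v by (auto simp: pole_def)
qed

text \<open>The two roots of the characteristic equation are \<mu> and \<nu> = t - \<mu>, inverse to
  each other. They differ, since a double root would make \<open>g\<close> scalar, and by
  \<open>same_pole\<close> each root carries exactly one pole.\<close>

lemma poles_of_element:
  assumes g: "g \<in> carrier G" "g \<notin> Z"
  shows "card {p \<in> Pol. g \<in> fst ` p} = 2"
proof -
  define t where "t = Q g $$ (0,0) + Q g $$ (1,1)"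
  define \<mu> where "\<mu> = (t + csqrt (t\<^sup>2 - 4)) / 2"
  have \<mu>: "\<mu>\<^sup>2 - t * \<mu> + 1 = 0"
  proof -
    have "4 * (\<mu>\<^sup>2 - t * \<mu> + 1) = (2 * \<mu> - t)\<^sup>2 - (t\<^sup>2 - 4)" by (simp add: algebra_simps power2_eq_square)
    also have "2 * \<mu> - t = csqrt (t\<^sup>2 - 4)" by (simp add: \<mu>_def field_simps)
    finally have "4 * (\<mu>\<^sup>2 - t * \<mu> + 1) = 0" by (simp only: power2_csqrt diff_self)
    then show ?thesis unfolding mult_eq_0_iff by simp
  qed
  then have \<mu>0: "\<mu> \<noteq> 0" by auto
  define \<nu> where "\<nu> = t - \<mu>"
  have \<nu>\<mu>: "\<nu> * \<mu> = 1" using \<mu> by (simp add: \<nu>_def algebra_simps power2_eq_square)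
  have roots: "x = \<mu> \<or> x = \<nu>" if "x\<^sup>2 - t * x + 1 = 0" for x
  proof -
    have "(x - \<mu>) * (x - \<nu>) = (x\<^sup>2 - t * x + 1) - (\<mu>\<^sup>2 - t * \<mu> + 1)"
      by (simp add: \<nu>_def algebra_simps power2_eq_square)
    then show ?thesis using that \<mu> by simp
  qed
  have \<nu>: "\<nu>\<^sup>2 - t * \<nu> + 1 = 0" using \<mu> by (simp add: \<nu>_def algebra_simps power2_eq_square)
  obtain v where v: "v \<in> carrier_vec 2" "v \<noteq> 0\<^sub>v 2" "Q g *\<^sub>v v = \<mu> \<cdot>\<^sub>v v"
    using eigenvector_exists_2[OF Qc[OF g(1)] det_Q[OF g(1)] \<mu>[unfolded t_def]] by metis
  obtain w where w: "w \<in> carrier_vec 2" "w \<noteq> 0\<^sub>v 2" "Q g *\<^sub>v w = \<nu> \<cdot>\<^sub>v w"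
    using eigenvector_exists_2[OF Qc[OF g(1)] det_Q[OF g(1)] \<nu>[unfolded t_def]] by metis
  have ne: "\<mu> \<noteq> \<nu>"
  proof
    assume "\<mu> = \<nu>"
    then have "Q g = \<mu> \<cdot>\<^sub>m 1\<^sub>m 2" using double_eigenvalue[OF g(1) v] \<nu>\<mu> by simp
    then show False using g by (auto simp: Z_def)
  qed
  have gv: "(g, \<mu>) \<in> pole v" and gw: "(g, \<nu>) \<in> pole w" using v w g by (auto simp: pole_def)
  have pq: "pole v \<noteq> pole w" using pole_unique[OF v(1,2) gv] gw ne by metis
  have "{p \<in> Pol. g \<in> fst ` p} = {pole v, pole w}"
  proof (intro subset_antisym subsetI)
    fix p assume p: "p \<in> {p \<in> Pol. g \<in> fst ` p}"
    then obtain u where u: "u \<in> carrier_vec 2" "u \<noteq> 0\<^sub>v 2" "p = pole u" using PolE by blast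
    obtain x where x: "(g, x) \<in> pole u" using p u by auto
    then have "x\<^sup>2 - t * x + 1 = 0"
      using eigenvalue_equation_2[OF Qc[OF g(1)] det_Q[OF g(1)] u(1,2)] by (auto simp: t_def pole_def)
    then show "p \<in> {pole v, pole w}"
      using roots x same_pole[OF u(1,2) v(1,2) _ gv g(2)] same_pole[OF u(1,2) w(1,2) _ gw g(2)] u(3) by blast
  next
    fix p assume "p \<in> {pole v, pole w}"
    then obtain u x where u: "p = pole u" "u \<in> carrier_vec 2" "u \<noteq> 0\<^sub>v 2" "(g, x) \<in> pole u"
      using v(1,2) w(1,2) gv gw by blast
    from u(4) have "g \<in> fst ` pole u" by (rule image_eqI[rotated]) simp
    then show "p \<in> {p \<in> Pol. g \<in> fst ` p}" using u g(2) unfolding Pol_def by blast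
  qed
  then show ?thesis using pq by simp
qed

lemma finite_Pol: "finite Pol"
proof -
  have "Pol \<subseteq> (\<Union>g\<in>carrier G - Z. {p \<in> Pol. g \<in> fst ` p})"
  proof
    fix p assume p: "p \<in> Pol"
    then obtain v h \<mu> where "(h, \<mu>) \<in> p" "h \<in> carrier G" "h \<notin> Z" using PolE by metis
    then show "p \<in> (\<Union>g\<in>carrier G - Z. {p \<in> Pol. g \<in> fst ` p})" using p by force
  qed
  moreover have "finite {p \<in> Pol. g \<in> fst ` p}" if "g \<in> carrier G - Z" for g
    using poles_of_element[of g] that by (intro card_ge_0_finite) auto
  ultimately show ?thesis using finite_carrier by (meson finite_Diff finite_UN finite_subset)
qed

lemma Pol_subset: "p \<in> Pol \<Longrightarrow> fst ` p \<subseteq> carrier G"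
  by (auto simp: Pol_def pole_def)

lemma cj_pole:
  assumes k: "k \<in> carrier G" and v: "v \<in> carrier_vec 2"
  shows "cj k (pole v) = pole (Q k *\<^sub>v v)"
proof (intro subset_antisym subsetI)
  have *: "(k \<otimes> h \<otimes> inv k, \<mu>) \<in> pole (Q k *\<^sub>v v)" if k: "k \<in> carrier G" and v: "v \<in> carrier_vec 2" and "(h, \<mu>) \<in> pole v" for k h \<mu> v
  proof -
    have h: "h \<in> carrier G" "Q h *\<^sub>v v = \<mu> \<cdot>\<^sub>v v" using that by (auto simp: pole_def)
    have "Q (k \<otimes> h \<otimes> inv k) *\<^sub>v (Q k *\<^sub>v v) = Q k *\<^sub>v (Q h *\<^sub>v v)"
      using Q_mult_vec[of "k \<otimes> h" "inv k" "Q k *\<^sub>v v"] Q_mult_vec[of k h v] Q_inv_vec[OF k v] Q_vec_carrier[OF k v] h k v by simp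
    also have "\<dots> = \<mu> \<cdot>\<^sub>v (Q k *\<^sub>v v)" unfolding h(2) by (rule mult_mat_vec[OF Qc[OF k] v])
    finally show ?thesis using k h by (simp add: pole_def)
  qed
  show "x \<in> pole (Q k *\<^sub>v v)" if "x \<in> cj k (pole v)" for x using that *[OF k v] by (auto simp: cj_def)
  fix x assume x: "x \<in> pole (Q k *\<^sub>v v)"
  obtain h \<mu> where h: "x = (h, \<mu>)" "h \<in> carrier G" using x by (auto simp: pole_def)
  have "(inv k \<otimes> h \<otimes> inv (inv k), \<mu>) \<in> pole v"
    using *[OF inv_closed[OF k] Q_vec_carrier[OF k v], of h \<mu>] x h(1) Q_inv_vec(1)[OF k v] by simp
  moreover have "k \<otimes> (inv k \<otimes> h \<otimes> inv (inv k)) \<otimes> inv k = h"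
  proof -
    have "k \<otimes> (inv k \<otimes> h \<otimes> inv (inv k)) \<otimes> inv k = k \<otimes> (inv k \<otimes> h)" using k h(2) by (simp add: m_assoc)
    then show ?thesis using k h by (simp add: m_assoc[symmetric])
  qed
  ultimately show "x \<in> cj k (pole v)" unfolding cj_def h(1) by force
qed

lemma cj_Pol: "k \<in> carrier G \<Longrightarrow> p \<in> Pol \<Longrightarrow> cj k p \<in> Pol"
proof -
  assume k: "k \<in> carrier G" and p: "p \<in> Pol"
  obtain v h \<mu> where v: "v \<in> carrier_vec 2" "v \<noteq> 0\<^sub>v 2" "p = pole v" and h: "(h, \<mu>) \<in> p" "h \<in> carrier G" "h \<notin> Z"
    using PolE[OF p] by metis
  have "(k \<otimes> h \<otimes> inv k, \<mu>) \<in> cj k p" using h by (force simp: cj_def)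
  then have "\<not> fst ` pole (Q k *\<^sub>v v) \<subseteq> Z" using Z_conj[OF h(2) k] h(3) cj_pole[OF k v(1)] v(3) by force
  then show ?thesis unfolding v(3) cj_pole[OF k v(1)] Pol_def
    using Q_vec_carrier[OF k v(1)] Q_vec_nonzero[OF k v(1,2)] by blast
qed

lemma cj_one: "p \<in> Pol \<Longrightarrow> cj \<one> p = p"
  by (erule PolE) (simp add: cj_pole[OF one_closed] rep_one[OF rep])

lemma cj_mult: "g \<in> carrier G \<Longrightarrow> h \<in> carrier G \<Longrightarrow> p \<in> Pol \<Longrightarrow> cj (g \<otimes> h) p = cj g (cj h p)"
  by (erule PolE) (simp add: cj_pole Q_vec_carrier Q_mult_vec)

text \<open>Conjugation by \<open>h\<close> carries the \<mu>-eigenline of \<open>g\<close> to that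
  of the conjugate. If the conjugate is \<open>g\<close> itself, the line is preserved because it is
  the only one for \<mu>; conversely the stabiliser of a line is commutative.\<close>

lemma centralizer_pole:
  assumes p: "p \<in> Pol" and g: "(g, \<mu>) \<in> p" "g \<notin> Z" and h: "h \<in> carrier G"
  shows "h \<otimes> g \<otimes> inv h = g \<longleftrightarrow> h \<in> fst ` p"
proof -
  obtain v where v: "v \<in> carrier_vec 2" "v \<noteq> 0\<^sub>v 2" "p = pole v" using PolE[OF p] by metis
  have gc: "g \<in> carrier G" "Q g *\<^sub>v v = \<mu> \<cdot>\<^sub>v v" using g v by (auto simp: pole_def)
  show ?thesis
  proof
    assume "h \<otimes> g \<otimes> inv h = g"
    then have "(g, \<mu>) \<in> cj h p" using g(1) by (force simp: cj_def)
    then have "(g, \<mu>) \<in> pole (Q h *\<^sub>v v)" using cj_pole[OF h v(1)] v(3) by simp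
    then have gh: "Q g *\<^sub>v (Q h *\<^sub>v v) = \<mu> \<cdot>\<^sub>v (Q h *\<^sub>v v)" by (auto simp: pole_def)
    note hv = Q_vec_carrier[OF h v(1)] Q_vec_nonzero[OF h v(1,2)]
    have "v $v 0 * (Q h *\<^sub>v v) $v 1 = v $v 1 * (Q h *\<^sub>v v) $v 0"
      using two_eigenvectors_scalar[OF Qc[OF gc(1)] v(1) gc(2) hv(1) gh] g(2) gc(1) by (auto simp: Z_def simp del: index_mult_mat_vec)
    then obtain c where "Q h *\<^sub>v v = c \<cdot>\<^sub>v v" using parallel_2[OF v(1,2) hv] by metis
    then have "(h, c) \<in> p" using h v(3) by (simp add: pole_def)
    then show "h \<in> fst ` p" by force
  next
    assume "h \<in> fst ` p"
    then obtain c where "(h, c) \<in> p" by auto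
    then have "h \<otimes> g = g \<otimes> h" using pole_commute[OF v(1,2)] g(1) v(3) by metis
    then show "h \<otimes> g \<otimes> inv h = g" using gc h by (simp add: m_assoc)
  qed
qed

lemma stabilizer_pole:
  assumes p: "p \<in> Pol"
  shows "{k \<in> carrier G. cj k p = p} = fst ` p"
proof -
  obtain v h \<mu> where v: "v \<in> carrier_vec 2" "v \<noteq> 0\<^sub>v 2" "p = pole v" and h: "(h, \<mu>) \<in> p" "h \<in> carrier G" "h \<notin> Z"
    using PolE[OF p] by metis
  show ?thesis
  proof (intro subset_antisym subsetI)
    fix k assume "k \<in> {k \<in> carrier G. cj k p = p}"
    then have k: "k \<in> carrier G" "cj k p = p" by auto
    have "(k \<otimes> h \<otimes> inv k, \<mu>) \<in> p" using h(1) k(2) unfolding cj_def by force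
    then have "k \<otimes> h \<otimes> inv k = h" using pole_inj[OF v(1,2)] h(1) v(3) by metis
    then show "k \<in> fst ` p" using centralizer_pole[OF p h(1,3) k(1)] by simp
  next
    fix k assume "k \<in> fst ` p"
    then obtain c where kc: "(k, c) \<in> p" by auto
    then have k: "k \<in> carrier G" using v(3) by (auto simp: pole_def)
    have "k \<otimes> x \<otimes> inv k = x" if "(x, y) \<in> p" for x y
    proof -
      have "x \<in> carrier G" using that v(3) by (auto simp: pole_def)
      moreover have "k \<otimes> x = x \<otimes> k" using pole_commute[OF v(1,2)] kc that v(3) by metis
      ultimately show ?thesis using k by (simp add: m_assoc)
    qed
    then have "cj k p = p" unfolding cj_def by force
    then show "k \<in> {k \<in> carrier G. cj k p = p}" using k by simp
  qed
qed

lemma card_orb: 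
  assumes p: "p \<in> Pol"
  shows "card (fst ` p) * card (orb p) = card (carrier G)"
proof -
  have "p \<in> (\<lambda>k. cj k p) ` carrier G" using cj_one[OF p] one_closed by (metis imageI)
  then show ?thesis
    using card_fiber_orbit[of cj p p, OF cj_one[OF p] cj_mult[OF _ _ p]] stabilizer_pole[OF p] by (simp add: orb_def)
qed

lemma orb_self: "p \<in> Pol \<Longrightarrow> p \<in> orb p"
  unfolding orb_def using cj_one one_closed by (metis imageI)

lemma orb_Pol: "p \<in> Pol \<Longrightarrow> orb p \<subseteq> Pol"
  using cj_Pol by (auto simp: orb_def)

lemma orb_eq:
  assumes p: "p \<in> Pol" and q: "q \<in> orb p"
  shows "orb q = orb p"
proof -
  obtain k where k: "k \<in> carrier G" "q = cj k p" using q by (auto simp: orb_def)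
  have "cj h q = cj (h \<otimes> k) p" if "h \<in> carrier G" for h using cj_mult[OF that k(1) p] k(2) by simp
  moreover have "cj h p = cj (h \<otimes> inv k) q" if h: "h \<in> carrier G" for h
    using cj_mult[of "h \<otimes> inv k" k p] h k p by (simp add: m_assoc)
  ultimately show ?thesis unfolding orb_def using k(1) by (auto simp: image_iff)
qed

lemma card_fst_orb: "p \<in> Pol \<Longrightarrow> q \<in> orb p \<Longrightarrow> card (fst ` q) = card (fst ` p)"
proof -
  assume p: "p \<in> Pol" and q: "q \<in> orb p"
  have "card (fst ` q) * card (orb p) = card (fst ` p) * card (orb p)"
    using card_orb[OF p] card_orb[of q] orb_Pol[OF p] q orb_eq[OF p q] by auto
  moreover have "card (orb p) \<noteq> 0" using card_orb[OF p] card_pos by (metis mult_0_right less_not_refl)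
  ultimately show ?thesis by simp
qed

text \<open>The scalars form a subgroup of each stabiliser, proper because a pole is by definition
  fixed by some nonscalar element. The factor \<open>k\<close> is the order of the stabiliser as a
  group of transformations of the projective line.\<close>

lemma Z_dvd_card_pole:
  assumes p: "p \<in> Pol"
  obtains k where "card (fst ` p) = k * card Z" "k \<ge> 2"
proof -
  obtain v h \<mu> where v: "v \<in> carrier_vec 2" "v \<noteq> 0\<^sub>v 2" "p = pole v" and h: "(h, \<mu>) \<in> p" "h \<in> carrier G" "h \<notin> Z"
    using PolE[OF p] by metis
  have sub: "subgroup (fst ` p) G"
  proof (rule subgroupI)
    show "fst ` p \<subseteq> carrier G" by (rule Pol_subset[OF p])
    show "fst ` p \<noteq> {}" using h by auto
    show "inv g \<in> fst ` p" if "g \<in> fst ` p" for g using that pole_inv(2)[OF v(1,2)] v(3) by force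
    show "g \<otimes> k \<in> fst ` p" if "g \<in> fst ` p" "k \<in> fst ` p" for g k using that pole_mult[OF v(1)] v(3) by force
  qed
  have Zp: "Z \<subset> fst ` p" using Z_in_pole[OF _ v(1)] v(3) h by force
  interpret H: Group.group "G\<lparr>carrier := fst ` p\<rparr>" by (rule subgroup.subgroup_is_group[OF sub group_axioms])
  have "subgroup Z (G\<lparr>carrier := fst ` p\<rparr>)" using subgroup_incl[OF Z_subgroup sub] Zp by blast
  from H.lagrange[OF this] have "card (rcosets\<^bsub>G\<lparr>carrier := fst ` p\<rparr>\<^esub> Z) * card Z = card (fst ` p)" by (simp add: order_def)
  then obtain k where k: "card (fst ` p) = k * card Z" by metis
  have "card Z < card (fst ` p)" using Zp finite_subset[OF Pol_subset[OF p] finite_carrier] by (rule psubset_card_mono[rotated])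
  then have "k \<noteq> 0" "k \<noteq> 1" using k by auto
  then have "k \<ge> 2" by simp
  then show ?thesis using that k by blast
qed

text \<open>Well defined on orbits: conjugate poles have stabilisers of equal size
  (\<open>card_fst_orb\<close>).\<close>

definition stab_order :: "('a \<times> complex) set set \<Rightarrow> nat" where
  "stab_order c = card (fst ` (SOME p. p \<in> c))"

lemma stab_order_orb: "p \<in> Pol \<Longrightarrow> stab_order (orb p) = card (fst ` p)"
  unfolding stab_order_def by (rule card_fst_orb, assumption, rule someI, erule orb_self)

text \<open>Counting the pairs of a nonscalar element and one of its two poles.\<close>

lemma orbit_count:
  "(\<Sum>c\<in>orb ` Pol. card (carrier G) - card c * card Z) = 2 * (card (carrier G) - card Z)"
  "c \<in> orb ` Pol \<Longrightarrow> \<exists>k\<ge>2. stab_order c = k * card Z \<and> card c * stab_order c = card (carrier G)"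
proof -
  show "c \<in> orb ` Pol \<Longrightarrow> \<exists>k\<ge>2. stab_order c = k * card Z \<and> card c * stab_order c = card (carrier G)"
    using stab_order_orb card_orb Z_dvd_card_pole by (auto simp: mult.commute) (metis mult.commute)
  have dis: "pairwise disjnt (orb ` Pol)" by (rule pairwise_disjnt_image[OF orb_eq])
  have un: "\<Union>(orb ` Pol) = Pol" using orb_self orb_Pol by auto
  have fin: "finite c" if "c \<in> orb ` Pol" for c using that finite_Pol orb_Pol finite_subset by blast
  have "(\<Sum>p\<in>Pol. card {g \<in> carrier G - Z. g \<in> fst ` p}) = (\<Sum>g\<in>carrier G - Z. 2)"
    by (rule sum_multicount_gen) (use finite_Pol finite_carrier poles_of_element in auto)
  also have "\<dots> = 2 * (card (carrier G) - card Z)"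
    using card_Diff_subset[OF card_Z(3) subgroup.subset[OF Z_subgroup]] by simp
  finally have 1: "(\<Sum>p\<in>Pol. card {g \<in> carrier G - Z. g \<in> fst ` p}) = 2 * (card (carrier G) - card Z)" .
  have 2: "card {g \<in> carrier G - Z. g \<in> fst ` p} = card (fst ` p) - card Z" if p: "p \<in> Pol" for p
  proof -
    have "{g \<in> carrier G - Z. g \<in> fst ` p} = fst ` p - Z" using Pol_subset[OF p] by auto
    moreover have "Z \<subseteq> fst ` p" using p Z_in_pole by (metis PolE subsetI)
    ultimately show ?thesis using card_Diff_subset[OF card_Z(3)] by simp
  qed
  have "(\<Sum>p\<in>Pol. card {g \<in> carrier G - Z. g \<in> fst ` p}) = (\<Sum>c\<in>orb ` Pol. \<Sum>p\<in>c. card (fst ` p) - card Z)"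
  proof -
    have "(\<Sum>p\<in>Pol. card {g \<in> carrier G - Z. g \<in> fst ` p}) = (\<Sum>p\<in>\<Union>(orb ` Pol). card (fst ` p) - card Z)"
      unfolding un by (rule sum.cong[OF refl 2])
    also have "\<dots> = (\<Sum>c\<in>orb ` Pol. \<Sum>p\<in>c. card (fst ` p) - card Z)"
      using dis fin by (subst sum.Union_disjoint) (auto simp: pairwise_def disjnt_def)
    finally show ?thesis .
  qed
  also have "\<dots> = (\<Sum>c\<in>orb ` Pol. card (carrier G) - card c * card Z)"
  proof (rule sum.cong)
    fix c assume "c \<in> orb ` Pol"
    then obtain p where p: "p \<in> Pol" "c = orb p" by auto
    have "(\<Sum>q\<in>c. card (fst ` q) - card Z) = (\<Sum>q\<in>c. card (fst ` p) - card Z)"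
      using card_fst_orb[OF p(1)] p(2) by (intro sum.cong) auto
    also have "\<dots> = card (carrier G) - card c * card Z"
      using card_orb[OF p(1)] p(2) by (simp add: diff_mult_distrib2 mult.commute)
    finally show "(\<Sum>q\<in>c. card (fst ` q) - card Z) = card (carrier G) - card c * card Z" .
  qed simp
  finally show "(\<Sum>c\<in>orb ` Pol. card (carrier G) - card c * card Z) = 2 * (card (carrier G) - card Z)"
    using 1 by simp
qed

text \<open>Every stabiliser is at least twice as large as \<open>Z\<close>, so each orbit
  contributes at least half the group order to a total that is less than twice the group
  order.\<close>

lemma card_orbits: "card (orb ` Pol) \<le> 3"
proof -
  define N z where "N = card (carrier G)" and "z = card Z"
  have "card (orb ` Pol) * N = (\<Sum>c\<in>orb ` Pol. N)" by simp
  also have "\<dots> \<le> (\<Sum>c\<in>orb ` Pol. 2 * (N - card c * z))"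
  proof (rule sum_mono)
    fix c assume "c \<in> orb ` Pol"
    then obtain k where k: "k \<ge> 2" "stab_order c = k * z" "card c * stab_order c = N"
      using orbit_count(2)[OF \<open>c \<in> orb ` Pol\<close>] unfolding N_def z_def by blast
    have "2 * (card c * z) \<le> k * (card c * z)" using k(1) by simp
    also have "\<dots> = N" using k by (simp add: algebra_simps)
    finally show "N \<le> 2 * (N - card c * z)" by simp
  qed
  also have "\<dots> = 2 * (2 * (N - z))" using orbit_count(1) by (simp add: sum_distrib_left[symmetric] N_def z_def)
  also have "\<dots> < 4 * N" using card_Z(2) card_pos by (simp add: N_def z_def)
  finally show ?thesis by simp
qed

text \<open>Here \<open>m\<close> is the common size of the orbits and \<open>k\<close> the common
  stabiliser order modulo \<open>Z\<close>. The orbit count becomes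
  \<open>m * k + 2 = 3 * m\<close>, whose only solution with \<open>k \<ge> 2\<close> is
  \<open>k = m = 2\<close>: modulo \<open>Z\<close> the group has order four.\<close>

lemma three_equal_orbits:
  assumes "card (orb ` Pol) = 3" "\<And>c d. c \<in> orb ` Pol \<Longrightarrow> d \<in> orb ` Pol \<Longrightarrow> stab_order c = stab_order d"
  shows "card (carrier G) = 4 * card Z" "p \<in> Pol \<Longrightarrow> card (fst ` p) = 2 * card Z"
proof -
  define N z where "N = card (carrier G)" and "z = card Z"
  have z0: "z > 0" and N0: "N > 0" using card_Z(2) card_pos by (auto simp: z_def N_def)
  have "orb ` Pol \<noteq> {}" using assms(1) by auto
  then obtain c where c: "c \<in> orb ` Pol" by blast
  then obtain k where k: "k \<ge> 2" "stab_order c = k * z" "card c * stab_order c = N"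
    using orbit_count(2)[OF c] unfolding N_def z_def by blast
  have kz: "k * z > 0" using k(1) z0 by simp
  have cc: "card d = card c" if d: "d \<in> orb ` Pol" for d
  proof -
    have "card d * stab_order c = card c * stab_order c"
      using orbit_count(2)[OF d] assms(2)[OF d c] k by (auto simp: N_def)
    then show ?thesis using kz k(2) by simp
  qed
  define m where "m = card c"
  have "(\<Sum>d\<in>orb ` Pol. N - card d * z) = (\<Sum>d\<in>orb ` Pol. N - m * z)"
    using cc by (intro sum.cong) (auto simp: m_def)
  then have e: "3 * (N - m * z) = 2 * (N - z)" using orbit_count(1) assms(1) by (simp add: N_def z_def)
  have N: "N = m * k * z" using k by (simp add: m_def)
  have m0: "m > 0" using N N0 by (cases m) auto
  have "m * z \<le> N" unfolding N using k(1) by simp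
  moreover have "z \<le> N" unfolding N using k(1) m0 by simp
  ultimately have "3 * N + 2 * z = 2 * N + 3 * (m * z)" using e by linarith
  then have "N + 2 * z = 3 * (m * z)" by linarith
  then have "z * (m * k + 2) = z * (3 * m)" unfolding N by (simp add: algebra_simps)
  then have mk: "m * k + 2 = 3 * m" using z0 mult_cancel1[of z "m * k + 2" "3 * m"] by linarith
  have "k < 3"
  proof (rule ccontr)
    assume "\<not> k < 3"
    then have "m * 3 \<le> m * k" by simp
    then show False using mk by linarith
  qed
  then have k2: "k = 2" using k(1) by simp
  then have "m = 2" using mk by simp
  then show "card (carrier G) = 4 * card Z" using N k2 by (simp add: N_def z_def)
  show "card (fst ` p) = 2 * card Z" if "p \<in> Pol"
    using assms(2)[of "orb p" c] c stab_order_orb[OF that] k k2 that by (simp add: z_def)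
qed

end

section \<open>Action of the automorphisms on the poles\<close>

context sl2_group
begin

definition tr :: "('a \<Rightarrow> 'a) \<Rightarrow> ('a \<times> complex) set \<Rightarrow> ('a \<times> complex) set" where
  "tr \<phi> p = (\<lambda>(h, \<mu>). (\<phi> h, \<mu>)) ` p"

lemma pair_automorphismE:
  assumes "\<phi> \<in> Aut"
  obtains S T where "S \<in> carrier_mat 2 2" "T \<in> carrier_mat 2 2" "S * T = 1\<^sub>m 2" "T * S = 1\<^sub>m 2"
    "\<And>g. g \<in> carrier G \<Longrightarrow> Q (\<phi> g) * S = S * Q g" "\<And>g. g \<in> carrier G \<Longrightarrow> Q (\<phi> g) = S * Q g * T"
proof -
  have iso: "\<phi> \<in> iso G G" and eq: "equiv_rep G (Q \<circ> \<phi>) Q" using assms by (auto simp: pair_automorphisms_def)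
  have rep': "representation G 2 (Q \<circ> \<phi>)" using representation_twist[OF group_axioms group_axioms iso] rep by simp
  obtain T S where TS: "T \<in> carrier_mat 2 2" "S \<in> carrier_mat 2 2" "T * S = 1\<^sub>m 2" "S * T = 1\<^sub>m 2"
    "\<And>g. g \<in> carrier G \<Longrightarrow> T * (Q \<circ> \<phi>) g = Q g * T"
    using equiv_repE[OF eq rep' rep] by metis
  note as = assoc_mult_mat[of _ 2 2 _ 2 _ 2]
  have 1: "Q (\<phi> g) * S = S * Q g" if g: "g \<in> carrier G" for g
  proof -
    have c: "Q (\<phi> g) \<in> carrier_mat 2 2" using rep_carrier[OF rep' g] by simp
    have "Q (\<phi> g) * S = S * T * Q (\<phi> g) * S" using TS c by simp
    also have "\<dots> = S * (T * Q (\<phi> g)) * S" using TS(1,2) c by (simp add: as)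
    also have "\<dots> = S * Q g * (T * S)" using TS(5)[OF g] TS(1,2) Qc[OF g] by (simp add: as)
    finally show ?thesis using TS Qc[OF g] by simp
  qed
  have 2: "Q (\<phi> g) = S * Q g * T" if g: "g \<in> carrier G" for g
  proof -
    have c: "Q (\<phi> g) \<in> carrier_mat 2 2" using rep_carrier[OF rep' g] by simp
    have "S * Q g * T = Q (\<phi> g) * (S * T)" unfolding 1[OF g, symmetric] using TS(1,2) c by (simp add: as)
    then show ?thesis using TS c by simp
  qed
  show ?thesis using that[OF TS(2,1,4,3) 1 2] .
qed

lemma
  assumes \<phi>: "\<phi> \<in> Aut"
  shows aut_carrier: "g \<in> carrier G \<Longrightarrow> \<phi> g \<in> carrier G"
    and aut_mult: "g \<in> carrier G \<Longrightarrow> h \<in> carrier G \<Longrightarrow> \<phi> (g \<otimes> h) = \<phi> g \<otimes> \<phi> h"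
    and aut_inv: "g \<in> carrier G \<Longrightarrow> \<phi> (inv g) = inv (\<phi> g)"
    and aut_inj: "inj_on \<phi> (carrier G)"
    and aut_surj: "\<phi> ` carrier G = carrier G"
proof -
  interpret group_hom G G \<phi> using \<phi> by unfold_locales (auto simp: pair_automorphisms_def iso_def)
  show "g \<in> carrier G \<Longrightarrow> \<phi> g \<in> carrier G" "g \<in> carrier G \<Longrightarrow> h \<in> carrier G \<Longrightarrow> \<phi> (g \<otimes> h) = \<phi> g \<otimes> \<phi> h"
    "g \<in> carrier G \<Longrightarrow> \<phi> (inv g) = inv (\<phi> g)" by auto
  show "inj_on \<phi> (carrier G)" "\<phi> ` carrier G = carrier G"
    using \<phi> by (auto simp: pair_automorphisms_def iso_def bij_betw_def)
qed

text \<open>\<open>Q \<circ> \<phi>\<close> is conjugate to \<open>Q\<close> by one matrix, and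
  conjugation does not change scalar matrices.\<close>

lemma aut_Z_fixed:
  assumes \<phi>: "\<phi> \<in> Aut" and g: "g \<in> Z"
  shows "\<phi> g = g"
proof -
  obtain S T where ST: "S \<in> carrier_mat 2 2" "T \<in> carrier_mat 2 2" "S * T = 1\<^sub>m 2"
    "\<And>g. g \<in> carrier G \<Longrightarrow> Q (\<phi> g) = S * Q g * T" using pair_automorphismE[OF \<phi>] by metis
  obtain c where c: "Q g = c \<cdot>\<^sub>m 1\<^sub>m 2" "g \<in> carrier G" using g by (auto simp: Z_def)
  have "Q (\<phi> g) = Q g" unfolding ST(4)[OF c(2)] c(1) using ST(1-3)
    by (simp add: mult_smult_distrib[of _ 2 2 _ 2] mult_smult_assoc_mat[of _ 2 2 _ 2])
  then show ?thesis using inj_Q c(2) aut_carrier[OF \<phi>] by (auto simp: inj_on_def)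
qed

lemma aut_Z:
  assumes \<phi>: "\<phi> \<in> Aut" and g: "g \<in> carrier G"
  shows "\<phi> g \<in> Z \<longleftrightarrow> g \<in> Z"
proof
  assume z: "\<phi> g \<in> Z"
  then have "\<phi> (\<phi> g) = \<phi> g" by (rule aut_Z_fixed[OF \<phi>])
  then have "\<phi> g = g" using aut_inj[OF \<phi>] aut_carrier[OF \<phi>] g by (auto simp: inj_on_def)
  then show "g \<in> Z" using z by simp
qed (use aut_Z_fixed[OF \<phi>] in auto)

text \<open>The matrix \<open>S\<close> that conjugates \<open>Q g\<close> to
  \<open>Q (\<phi> g)\<close> carries eigenvectors to eigenvectors with the same eigenvalue, so the
  image of the pole of \<open>v\<close> is the pole of \<open>S *\<^sub>v v\<close>. This is where
  equivalence of \<open>Q \<circ> \<phi>\<close> and \<open>Q\<close> enters the count.\<close>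

lemma tr_Pol:
  assumes \<phi>: "\<phi> \<in> Aut" and p: "p \<in> Pol"
  shows "tr \<phi> p \<in> Pol"
proof -
  obtain S T where ST: "S \<in> carrier_mat 2 2" "T \<in> carrier_mat 2 2" "S * T = 1\<^sub>m 2" "T * S = 1\<^sub>m 2"
    "\<And>g. g \<in> carrier G \<Longrightarrow> Q (\<phi> g) * S = S * Q g" using pair_automorphismE[OF \<phi>] by metis
  obtain v h \<mu> where v: "v \<in> carrier_vec 2" "v \<noteq> 0\<^sub>v 2" "p = pole v" and h: "(h, \<mu>) \<in> p" "h \<in> carrier G" "h \<notin> Z"
    using PolE[OF p] by metis
  have TSv: "T *\<^sub>v (S *\<^sub>v w) = w" if "w \<in> carrier_vec 2" for w
    using assoc_mult_mat_vec[OF ST(2,1) that] ST(4) that by simp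
  have Sc: "S *\<^sub>v w \<in> carrier_vec 2" if "w \<in> carrier_vec 2" for w using mult_mat_vec_carrier[OF ST(1) that] .
  have Sinj: "x = y" if "x \<in> carrier_vec 2" "y \<in> carrier_vec 2" "S *\<^sub>v x = S *\<^sub>v y" for x y
    using TSv[OF that(1)] TSv[OF that(2)] that(3) by metis
  have eq: "Q (\<phi> g) *\<^sub>v (S *\<^sub>v v) = \<nu> \<cdot>\<^sub>v (S *\<^sub>v v) \<longleftrightarrow> Q g *\<^sub>v v = \<nu> \<cdot>\<^sub>v v" if g: "g \<in> carrier G" for g \<nu>
  proof -
    have "Q (\<phi> g) *\<^sub>v (S *\<^sub>v v) = S *\<^sub>v (Q g *\<^sub>v v)"
      using assoc_mult_mat_vec[OF Qc[OF aut_carrier[OF \<phi> g]] ST(1) v(1)] assoc_mult_mat_vec[OF ST(1) Qc[OF g] v(1)] ST(5)[OF g] by simp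
    moreover have "\<nu> \<cdot>\<^sub>v (S *\<^sub>v v) = S *\<^sub>v (\<nu> \<cdot>\<^sub>v v)" by (rule mult_mat_vec[OF ST(1) v(1), symmetric])
    ultimately show ?thesis using Sinj[OF Q_vec_carrier[OF g v(1)], of "\<nu> \<cdot>\<^sub>v v"] v(1) by auto
  qed
  have "tr \<phi> p = pole (S *\<^sub>v v)"
  proof (intro subset_antisym subsetI)
    fix x assume "x \<in> tr \<phi> p"
    then show "x \<in> pole (S *\<^sub>v v)" using eq aut_carrier[OF \<phi>] by (auto simp: tr_def v(3) pole_def)
  next
    fix x assume x: "x \<in> pole (S *\<^sub>v v)"
    obtain g \<nu> where g: "g \<in> carrier G" "x = (\<phi> g, \<nu>)" "Q (\<phi> g) *\<^sub>v (S *\<^sub>v v) = \<nu> \<cdot>\<^sub>v (S *\<^sub>v v)"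
      using x aut_surj[OF \<phi>] unfolding pole_def by (auto simp: image_iff) (metis (no_types, lifting) image_iff)
    then have "(g, \<nu>) \<in> p" using eq[OF g(1)] by (simp add: v(3) pole_def)
    then show "x \<in> tr \<phi> p" unfolding tr_def g(2) by force
  qed
  moreover have "(\<phi> h, \<mu>) \<in> tr \<phi> p" using h by (force simp: tr_def)
  moreover have "\<phi> h \<notin> Z" using aut_Z[OF \<phi> h(2)] h(3) by simp
  moreover have "S *\<^sub>v v \<noteq> 0\<^sub>v 2"
  proof
    assume "S *\<^sub>v v = 0\<^sub>v 2"
    then have "v = T *\<^sub>v 0\<^sub>v 2" using TSv[OF v(1)] by simp
    also have "\<dots> = 0\<^sub>v 2" using ST(2) by (intro eq_vecI) auto
    finally show False using v by simp
  qed
  ultimately show ?thesis unfolding Pol_def using Sc[OF v(1)] by force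
qed

lemma tr_cj:
  assumes \<phi>: "\<phi> \<in> Aut" and p: "p \<in> Pol" and k: "k \<in> carrier G"
  shows "tr \<phi> (cj k p) = cj (\<phi> k) (tr \<phi> p)"
proof -
  have "\<phi> (k \<otimes> h \<otimes> inv k) = \<phi> k \<otimes> \<phi> h \<otimes> inv (\<phi> k)" if "h \<in> carrier G" for h
    using that k by (simp add: aut_mult[OF \<phi>] aut_inv[OF \<phi>])
  moreover have "h \<in> carrier G" if "(h, \<mu>) \<in> p" for h \<mu> using that Pol_subset[OF p] by force
  ultimately show ?thesis unfolding tr_def cj_def image_image by (intro image_cong) auto
qed

lemma tr_orb:
  assumes \<phi>: "\<phi> \<in> Aut" and p: "p \<in> Pol"
  shows "tr \<phi> ` orb p = orb (tr \<phi> p)"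
proof -
  have "tr \<phi> ` orb p = (\<lambda>k. cj (\<phi> k) (tr \<phi> p)) ` carrier G"
    unfolding orb_def image_image using tr_cj[OF \<phi> p] by (intro image_cong) auto
  also have "\<dots> = (\<lambda>k. cj k (tr \<phi> p)) ` (\<phi> ` carrier G)" by (simp add: image_image)
  finally show ?thesis unfolding aut_surj[OF \<phi>] orb_def .
qed

lemma tr_orbits_bij:
  assumes \<phi>: "\<phi> \<in> Aut"
  shows "bij_betw ((`) (tr \<phi>)) (orb ` Pol) (orb ` Pol)"
    and "c \<in> orb ` Pol \<Longrightarrow> stab_order (tr \<phi> ` c) = stab_order c"
proof -
  have inj_tr: "p = q" if "p \<in> Pol" "q \<in> Pol" "tr \<phi> p = tr \<phi> q" for p q
  proof -
    have inj: "inj_on (\<lambda>(h, \<mu>). (\<phi> h, \<mu>)) (carrier G \<times> UNIV)"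
      using aut_inj[OF \<phi>] by (auto simp: inj_on_def)
    have "p \<subseteq> carrier G \<times> UNIV" "q \<subseteq> carrier G \<times> UNIV" using that by (auto simp: Pol_def pole_def)
    then show ?thesis using that(3) inj unfolding tr_def by (metis inj_on_image_eq_iff)
  qed
  have sub: "(`) (tr \<phi>) ` (orb ` Pol) \<subseteq> orb ` Pol" using tr_orb[OF \<phi>] tr_Pol[OF \<phi>] by auto
  have "inj_on ((`) (tr \<phi>)) (orb ` Pol)"
  proof (rule inj_onI)
    fix c d assume cd: "c \<in> orb ` Pol" "d \<in> orb ` Pol" "tr \<phi> ` c = tr \<phi> ` d"
    have "inj_on (tr \<phi>) Pol" using inj_tr by (auto simp: inj_on_def)
    moreover have "c \<subseteq> Pol" "d \<subseteq> Pol" using cd(1,2) orb_Pol by blast+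
    ultimately show "c = d" using cd(3) by (metis inj_on_image_eq_iff)
  qed
  then show "bij_betw ((`) (tr \<phi>)) (orb ` Pol) (orb ` Pol)"
    using endo_inj_surj[OF _ sub] finite_Pol by (auto simp: bij_betw_def)
  assume "c \<in> orb ` Pol"
  then obtain p where p: "p \<in> Pol" "c = orb p" by auto
  have "fst ` tr \<phi> p = \<phi> ` fst ` p" by (force simp: tr_def)
  moreover have "inj_on \<phi> (fst ` p)" using aut_inj[OF \<phi>] Pol_subset[OF p(1)] by (rule inj_on_subset)
  ultimately have "card (fst ` tr \<phi> p) = card (fst ` p)" by (simp add: card_image)
  then show "stab_order (tr \<phi> ` c) = stab_order c"
    unfolding p(2) tr_orb[OF \<phi> p(1)] stab_order_orb[OF p(1)] stab_order_orb[OF tr_Pol[OF \<phi> p(1)]] .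
qed

lemma aut_iso: "\<phi> \<in> Aut \<Longrightarrow> \<phi> \<in> iso G G"
  by (auto simp: pair_automorphisms_def)

lemma id_aut: "id \<in> Aut"
  using equiv_rep_refl[OF rep] by (auto simp: pair_automorphisms_def iso_def hom_def bij_betw_def)

lemma tr_id: "tr id = id"
  by (auto simp: tr_def)

text \<open>A nonscalar \<open>g\<close> is recovered from one of its poles and its eigenvalue
  there. If both automorphisms send that pole into the same orbit, then \<open>\<phi> g\<close> and
  some conjugate of \<open>\<psi> g\<close> have the same eigenvalue at the same pole and coincide.
  Scalar elements are fixed by both.\<close>

lemma orbits_determine_class_action:
  assumes \<phi>: "\<phi> \<in> Aut" and \<psi>: "\<psi> \<in> Aut"
    and eq: "\<And>c. c \<in> orb ` Pol \<Longrightarrow> tr \<phi> ` c = tr \<psi> ` c" and C: "C \<in> nontriv_conj_classes G"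
  shows "\<phi> ` C = \<psi> ` C"
proof -
  obtain g where g: "g \<in> carrier G" "C = conj_class G g" using C by (auto simp: nontriv_conj_classes_eq)
  have cl: "\<phi> ` C = conj_class G (\<phi> g)" "\<psi> ` C = conj_class G (\<psi> g)"
    using conj_class_image[OF group_axioms aut_iso g(1)] \<phi> \<psi> g(2) by auto
  show ?thesis
  proof (cases "g \<in> Z")
    case True
    show ?thesis unfolding cl aut_Z_fixed[OF \<phi> True] aut_Z_fixed[OF \<psi> True] ..
  next
    case False
    have "card {p \<in> Pol. g \<in> fst ` p} \<noteq> 0" using poles_of_element[OF g(1) False] by simp
    then obtain p where p: "p \<in> Pol" "g \<in> fst ` p" using card.empty by (metis (mono_tags, lifting) empty_Collect_eq)
    then obtain \<mu> where \<mu>: "(g, \<mu>) \<in> p" by auto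
    have "tr \<phi> p \<in> tr \<phi> ` orb p" using orb_self[OF p(1)] by simp
    also have "\<dots> = orb (tr \<psi> p)" using eq[of "orb p"] p(1) tr_orb[OF \<psi> p(1)] by simp
    finally obtain k where k: "k \<in> carrier G" "tr \<phi> p = cj k (tr \<psi> p)" by (auto simp: orb_def)
    have "(\<phi> g, \<mu>) \<in> tr \<phi> p" "(\<psi> g, \<mu>) \<in> tr \<psi> p" using \<mu> by (force simp: tr_def)+
    then have "(k \<otimes> \<psi> g \<otimes> inv k, \<mu>) \<in> tr \<phi> p" unfolding k(2) by (force simp: cj_def)
    obtain v where "v \<in> carrier_vec 2" "v \<noteq> 0\<^sub>v 2" "tr \<phi> p = pole v" using PolE[OF tr_Pol[OF \<phi> p(1)]] by metis
    then have "\<phi> g = k \<otimes> \<psi> g \<otimes> inv k"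
      using pole_inj \<open>(\<phi> g, \<mu>) \<in> tr \<phi> p\<close> \<open>(k \<otimes> \<psi> g \<otimes> inv k, \<mu>) \<in> tr \<phi> p\<close> by metis
    then have "\<phi> g \<in> conj_class G (\<psi> g)" using k(1) by (auto simp: conj_class_def)
    then show ?thesis using cl conj_class_eq[OF aut_carrier[OF \<psi> g(1)]] by simp
  qed
qed

text \<open>The second alternative occurs for the quaternion group (type \<open>D\<^sub>4\<close>) only; for all other groups
  the automorphisms act on the classes through a group of order at most two.\<close>

lemma class_action_dichotomy:
  "(\<forall>\<phi>\<in>Aut. \<forall>\<psi>\<in>Aut. \<forall>C\<in>nontriv_conj_classes G. \<forall>D\<in>nontriv_conj_classes G.
      \<phi> ` C \<noteq> C \<longrightarrow> \<psi> ` D \<noteq> D \<longrightarrow> (\<forall>E\<in>nontriv_conj_classes G. \<phi> ` E = \<psi> ` E)) \<or>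
   card (nontriv_conj_classes G) = 4 \<and> (\<exists>C\<in>nontriv_conj_classes G. \<forall>\<phi>\<in>Aut. \<phi> ` C = C)"
proof (rule disjCI)
  assume "\<not> (card (nontriv_conj_classes G) = 4 \<and> (\<exists>C\<in>nontriv_conj_classes G. \<forall>\<phi>\<in>Aut. \<phi> ` C = C))"
  then have not4: "card (nontriv_conj_classes G) = 4 \<Longrightarrow> C \<in> nontriv_conj_classes G \<Longrightarrow> (\<And>\<phi>. \<phi> \<in> Aut \<Longrightarrow> \<phi> ` C = C) \<Longrightarrow> False" for C
    by blast
  show "\<forall>\<phi>\<in>Aut. \<forall>\<psi>\<in>Aut. \<forall>C\<in>nontriv_conj_classes G. \<forall>D\<in>nontriv_conj_classes G.
      \<phi> ` C \<noteq> C \<longrightarrow> \<psi> ` D \<noteq> D \<longrightarrow> (\<forall>E\<in>nontriv_conj_classes G. \<phi> ` E = \<psi> ` E)"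
  proof (intro ballI impI, rule ccontr)
    fix \<phi> \<psi> C D E
    assume \<phi>: "\<phi> \<in> Aut" and \<psi>: "\<psi> \<in> Aut"
      and C: "C \<in> nontriv_conj_classes G" "\<phi> ` C \<noteq> C" and D: "D \<in> nontriv_conj_classes G" "\<psi> ` D \<noteq> D"
      and E: "E \<in> nontriv_conj_classes G" "\<phi> ` E \<noteq> \<psi> ` E"
    obtain x where x: "x \<in> orb ` Pol" "tr \<phi> ` x \<noteq> x"
      using orbits_determine_class_action[OF \<phi> id_aut _ C(1)] C(2) unfolding tr_id by auto
    obtain y where y: "y \<in> orb ` Pol" "tr \<psi> ` y \<noteq> y"
      using orbits_determine_class_action[OF \<psi> id_aut _ D(1)] D(2) unfolding tr_id by auto
    obtain w where w: "w \<in> orb ` Pol" "tr \<phi> ` w \<noteq> tr \<psi> ` w"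
      using orbits_determine_class_action[OF \<phi> \<psi> _ E(1)] E(2) by blast
    \<comment> \<open>Two distinct nontrivial actions force three orbits with equal stabilisers,
      since automorphisms preserve \<open>stab_order\<close>.\<close>
    have "card (orb ` Pol) = 3 \<and> (\<forall>c\<in>orb ` Pol. \<forall>d\<in>orb ` Pol. stab_order c = stab_order d)"
      by (rule distinct_permutations_three[OF _ card_orbits tr_orbits_bij(1)[OF \<phi>] tr_orbits_bij(1)[OF \<psi>]
            tr_orbits_bij(2)[OF \<phi>] tr_orbits_bij(2)[OF \<psi>] x y w]) (use finite_Pol in auto)
    then have N: "card (carrier G) = 4 * card Z" and st: "\<And>p. p \<in> Pol \<Longrightarrow> card (fst ` p) = 2 * card Z"
      using three_equal_orbits by blast+
    \<comment> \<open>The centraliser of a nonscalar \<open>g\<close> is the stabiliser of its pole,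
      of order \<open>2 * card Z\<close> in a group of order \<open>4 * card Z\<close>.\<close>
    have size2: "card (conj_class G g) = 2" if g: "g \<in> carrier G" "g \<notin> Z" for g
    proof -
      have "card {p \<in> Pol. g \<in> fst ` p} \<noteq> 0" using poles_of_element[OF g] by simp
      then obtain p where p: "p \<in> Pol" "g \<in> fst ` p" using card.empty by (metis (mono_tags, lifting) empty_Collect_eq)
      then obtain \<mu> where \<mu>: "(g, \<mu>) \<in> p" by auto
      have "{h \<in> carrier G. h \<otimes> g \<otimes> inv h = g} = fst ` p"
        using centralizer_pole[OF p(1) \<mu> g(2)] Pol_subset[OF p(1)] by auto
      then have "2 * card Z * card (conj_class G g) = 4 * card Z"
        using card_transporter[OF g(1) conj_class_self[OF g(1)]] N st[OF p(1)] by simp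
      then show ?thesis using card_Z(2) by simp
    qed
    define X where "X = conj_class G ` (carrier G - Z)"
    have finX: "finite X" using finite_carrier by (simp add: X_def)
    have disj: "pairwise disjnt X" unfolding X_def by (rule pairwise_disjnt_image, rule conj_class_eq) auto
    have un: "\<Union>X = carrier G - Z"
      unfolding X_def using conj_class_self Z_conj by (auto simp: conj_class_def)
    have "card (\<Union>X) = sum card X"
      by (rule card_Union_disjoint[OF disj]) (auto simp: X_def intro: finite_subset[OF conj_class_subset finite_carrier])
    also have "\<dots> = (\<Sum>A\<in>X. 2)" using size2 by (intro sum.cong) (auto simp: X_def)
    \<comment> \<open>By parity \<open>card Z\<close> is even, hence 2. So there are three nonscalar
      classes, and one more nontrivial class consisting of the scalar \<open>m\<close>, which every
      automorphism fixes.\<close>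
    finally have "3 * card Z = 2 * card X"
      using card_Diff_subset[OF card_Z(3) subgroup.subset[OF Z_subgroup]] N un by simp
    moreover have "card Z = 1 \<or> card Z = 2" using card_Z by linarith
    moreover have "3 * k = 2 * n \<Longrightarrow> k = 1 \<or> k = 2 \<Longrightarrow> k = 2 \<and> n = 3" for k n :: nat by presburger
    ultimately have "card Z = 2 \<and> card X = 3" by blast
    then have Z2: "card Z = 2" and X3: "card X = 3" by auto
    have "card (Z - {\<one>}) = 1" using Z2 subgroup.one_closed[OF Z_subgroup] card_Z(3) by simp
    then obtain m where m: "Z - {\<one>} = {m}" using card_1_singletonE by blast
    then have mZ: "m \<in> Z" "m \<noteq> \<one>" by auto
    have mc: "m \<in> carrier G" using mZ by (auto simp: Z_def)
    have zc: "conj_class G z = {z}" if z: "z \<in> Z" for z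
    proof -
      have zc: "z \<in> carrier G" using z by (auto simp: Z_def)
      have "h \<otimes> z \<otimes> inv h = z" if "h \<in> carrier G" for h
        unfolding Z_central[OF z that, symmetric] using zc that by (simp add: m_assoc)
      then show ?thesis using conj_class_self[OF zc] unfolding conj_class_def by auto
    qed
    have "nontriv_conj_classes G = insert {m} X"
    proof (intro subset_antisym subsetI)
      fix A assume "A \<in> nontriv_conj_classes G"
      then obtain a where a: "a \<in> carrier G" "A = conj_class G a" "A \<noteq> {\<one>}" by (auto simp: nontriv_conj_classes_eq)
      show "A \<in> insert {m} X"
      proof (cases "a \<in> Z")
        case True
        then have "A = {a}" "a \<noteq> \<one>" using zc a by auto
        then have "a = m" using True m by blast
        then show ?thesis using \<open>A = {a}\<close> by simp
      qed (use a in \<open>auto simp: X_def\<close>)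
    next
      fix A assume "A \<in> insert {m} X"
      then consider "A = {m}" | a where "a \<in> carrier G" "a \<notin> Z" "A = conj_class G a" by (auto simp: X_def)
      then show "A \<in> nontriv_conj_classes G"
      proof cases
        case 1
        then show ?thesis using zc[OF mZ(1)] mc mZ(2) unfolding nontriv_conj_classes_eq by blast
      next
        case 2
        then have "a \<in> A" "a \<noteq> \<one>" using conj_class_self subgroup.one_closed[OF Z_subgroup] by auto
        then show ?thesis using 2 unfolding nontriv_conj_classes_eq by blast
      qed
    qed
    moreover have "{m} \<notin> X"
    proof
      assume "{m} \<in> X"
      then have "m \<in> \<Union>X" by blast
      then show False using un mZ by blast
    qed
    ultimately have "card (nontriv_conj_classes G) = 4" "{m} \<in> nontriv_conj_classes G" using X3 finX by auto
    then show False using not4[of "{m}"] aut_Z_fixed[OF _ mZ(1)] by simp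
  qed
qed

end

section \<open>Equivariant bijections\<close>

text \<open>Two involutions with equally many fixed points on sets of equal size have the same cycle
  type. The induction removes one transposed pair from each side, which leaves the fixed points
  untouched.\<close>

lemma involution_equivariant_bij:
  assumes "finite X" "finite Y" "card X = card Y"
    and "\<And>x. x \<in> X \<Longrightarrow> s x \<in> X \<and> s (s x) = x" "\<And>y. y \<in> Y \<Longrightarrow> t y \<in> Y \<and> t (t y) = y"
    and "card {x \<in> X. s x = x} = card {y \<in> Y. t y = y}"
  shows "\<exists>f. bij_betw f X Y \<and> (\<forall>x\<in>X. f (s x) = t (f x))"
  using assms
proof (induction "card X" arbitrary: X Y rule: less_induct)
  case less
  note finX = less.prems(1) and finY = less.prems(2) and cXY = less.prems(3)
    and s = less.prems(4) and t = less.prems(5) and fixeq = less.prems(6)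
  show ?case
  proof (cases "\<forall>x\<in>X. s x = x")
    case True
    then have "card {y \<in> Y. t y = y} = card Y" using fixeq cXY by (metis (mono_tags, lifting) Collect_cong Collect_mem_eq)
    then have "{y \<in> Y. t y = y} = Y" using finY by (intro card_subset_eq) auto
    then have "\<forall>y\<in>Y. t y = y" by blast
    moreover obtain f where "bij_betw f X Y" using finite_same_card_bij[OF finX finY cXY] by blast
    ultimately show ?thesis using True by (intro exI[of _ f]) (auto simp: bij_betw_def)
  next
    case False
    then obtain x where x: "x \<in> X" "s x \<noteq> x" by blast
    have "card {x \<in> X. s x = x} < card X" using x finX by (intro psubset_card_mono) auto
    then have "{y \<in> Y. t y = y} \<noteq> Y" using fixeq cXY by auto
    then obtain y where y: "y \<in> Y" "t y \<noteq> y" by blast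
    define X' Y' where "X' = X - {x, s x}" and "Y' = Y - {y, t y}"
    have cX': "card X' < card X" unfolding X'_def using x finX by (intro psubset_card_mono) auto
    have "card X' = card Y'" unfolding X'_def Y'_def
      using x y s[OF x(1)] t[OF y(1)] finX finY cXY by (simp add: card_Diff_subset)
    moreover have "s z \<in> X' \<and> s (s z) = z" if "z \<in> X'" for z
      using that s x(1) unfolding X'_def by (metis Diff_iff insert_iff singletonD)
    moreover have "t z \<in> Y' \<and> t (t z) = z" if "z \<in> Y'" for z
      using that t y(1) unfolding Y'_def by (metis Diff_iff insert_iff singletonD)
    moreover have "{z \<in> X'. s z = z} = {z \<in> X. s z = z}" using x s[OF x(1)] by (auto simp: X'_def)
    moreover have "{z \<in> Y'. t z = z} = {z \<in> Y. t z = z}" using y t[OF y(1)] by (auto simp: Y'_def)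
    ultimately obtain f where f: "bij_betw f X' Y'" "\<And>z. z \<in> X' \<Longrightarrow> f (s z) = t (f z)"
      using less.hyps[OF cX', of Y'] finX finY fixeq by (auto simp: X'_def Y'_def)
    define g where "g = f(x := y, s x := t y)"
    have gX': "g z = f z" if "z \<in> X'" for z using that by (auto simp: g_def X'_def)
    have gx: "g x = y" "g (s x) = t y" using x by (auto simp: g_def)
    have "bij_betw g X' Y'" using f(1) by (subst bij_betw_cong[OF gX'])
    moreover have "bij_betw g {x, s x} {y, t y}" using x y gx by (auto simp: bij_betw_def inj_on_def)
    moreover have "X' \<union> {x, s x} = X" "Y' \<union> {y, t y} = Y" "Y' \<inter> {y, t y} = {}"
      using x y s t by (auto simp: X'_def Y'_def)
    ultimately have "bij_betw g X Y" using bij_betw_combine[of g X' Y' "{x, s x}" "{y, t y}"] by simp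
    moreover have "g (s z) = t (g z)" if z: "z \<in> X" for z
    proof -
      consider "z \<in> X'" | "z = x" | "z = s x" using z by (auto simp: X'_def)
      then show ?thesis
      proof cases
        case 1
        then have "s z \<in> X'" using s x(1) unfolding X'_def by (metis Diff_iff insert_iff singletonD)
        then show ?thesis using gX' 1 f(2) by simp
      qed (use gx s[OF x(1)] t[OF y(1)] in auto)
    qed
    ultimately show ?thesis by blast
  qed
qed

text \<open>If \<open>s (s x)\<close> were equal to \<open>x\<close>, the third point would have
  nowhere to go but itself.\<close>

lemma three_cycle:
  assumes X: "finite X" "card X = 3" and s: "bij_betw s X X" and nf: "\<And>x. x \<in> X \<Longrightarrow> s x \<noteq> x" and x: "x \<in> X"
  shows "X = {x, s x, s (s x)}" "distinct [x, s x, s (s x)]" "s (s (s x)) = x"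
proof -
  have sX: "s y \<in> X" if "y \<in> X" for y using s that by (auto simp: bij_betw_def)
  have inj: "y = z" if "s y = s z" "y \<in> X" "z \<in> X" for y z using s that by (auto simp: bij_betw_def inj_on_def)
  have 1: "s x \<noteq> x" "s (s x) \<noteq> s x" using nf sX x by auto
  have 2: "s (s x) \<noteq> x"
  proof
    assume e: "s (s x) = x"
    have "card (X - {x, s x}) = 1" using X sX[OF x] x 1 by (simp add: card_Diff_subset)
    then obtain w where w: "X - {x, s x} = {w}" using card_1_singletonE by blast
    then have wX: "w \<in> X" "w \<noteq> x" "w \<noteq> s x" by auto
    have "s w \<noteq> x" using inj[of w "s x"] e wX sX[OF x] by auto
    moreover have "s w \<noteq> s x" using inj[of w x] wX x by auto
    ultimately have "s w = w" using w sX[OF wX(1)] by blast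
    then show False using nf wX by simp
  qed
  show d: "distinct [x, s x, s (s x)]" using 1 2 by auto
  have "card {x, s x, s (s x)} = 3" using 1 2 by auto
  then show XX: "X = {x, s x, s (s x)}" using card_subset_eq[OF X(1), of "{x, s x, s (s x)}"] X(2) sX x by auto
  have "s (s (s x)) \<noteq> s x" using inj[of "s (s x)" x] 2 sX x by auto
  moreover have "s (s (s x)) \<noteq> s (s x)" using inj[of "s (s x)" "s x"] 1 sX x by auto
  moreover have "s (s (s x)) \<in> X" using sX x by auto
  ultimately show "s (s (s x)) = x" using XX by blast
qed

text \<open>The index set carries only as much group structure as its actions show: composites and
  inverses are required to behave well on \<open>X\<close> and \<open>Y\<close>, not as equations
  between indices. This suits automorphisms represented by total functions, where
  \<open>inv_into\<close> is an inverse on the carrier only.\<close>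

locale two_actions =
  fixes \<Gamma> :: "'i set" and op :: "'i \<Rightarrow> 'i \<Rightarrow> 'i" and iv :: "'i \<Rightarrow> 'i" and e :: 'i
    and X :: "'x set" and a :: "'i \<Rightarrow> 'x \<Rightarrow> 'x" and Y :: "'y set" and b :: "'i \<Rightarrow> 'y \<Rightarrow> 'y"
  assumes op: "p \<in> \<Gamma> \<Longrightarrow> q \<in> \<Gamma> \<Longrightarrow> op p q \<in> \<Gamma>" and iv: "p \<in> \<Gamma> \<Longrightarrow> iv p \<in> \<Gamma>" and e: "e \<in> \<Gamma>"
    and aX: "p \<in> \<Gamma> \<Longrightarrow> x \<in> X \<Longrightarrow> a p x \<in> X" and bY: "p \<in> \<Gamma> \<Longrightarrow> y \<in> Y \<Longrightarrow> b p y \<in> Y"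
    and a_op: "p \<in> \<Gamma> \<Longrightarrow> q \<in> \<Gamma> \<Longrightarrow> x \<in> X \<Longrightarrow> a (op p q) x = a p (a q x)"
    and b_op: "p \<in> \<Gamma> \<Longrightarrow> q \<in> \<Gamma> \<Longrightarrow> y \<in> Y \<Longrightarrow> b (op p q) y = b p (b q y)"
    and a_e: "x \<in> X \<Longrightarrow> a e x = x" and b_e: "y \<in> Y \<Longrightarrow> b e y = y"
    and a_iv: "p \<in> \<Gamma> \<Longrightarrow> x \<in> X \<Longrightarrow> a p (a (iv p) x) = x \<and> a (iv p) (a p x) = x"
    and b_iv: "p \<in> \<Gamma> \<Longrightarrow> y \<in> Y \<Longrightarrow> b p (b (iv p) y) = y \<and> b (iv p) (b p y) = y"
    and finX: "finite X" and finY: "finite Y"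
    and fixed: "p \<in> \<Gamma> \<Longrightarrow> card {x \<in> X. a p x = x} = card {y \<in> Y. b p y = y}"
begin

lemma card_eq: "card X = card Y"
proof -
  have "{x \<in> X. a e x = x} = X" "{y \<in> Y. b e y = y} = Y" using a_e b_e by auto
  then show ?thesis using fixed[OF e] by simp
qed

lemma a_bij: "p \<in> \<Gamma> \<Longrightarrow> bij_betw (a p) X X"
  by (rule bij_betw_byWitness[where f' = "a (iv p)"]) (use a_iv aX iv in auto)

lemma b_bij: "p \<in> \<Gamma> \<Longrightarrow> bij_betw (b p) Y Y"
  by (rule bij_betw_byWitness[where f' = "b (iv p)"]) (use b_iv bY iv in auto)

text \<open>An index acting trivially on \<open>X\<close> has \<open>card X\<close> fixed points
  there, hence fixes all of \<open>Y\<close>. Applied to the quotient \<open>r\<close> of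
  \<open>p\<close> and \<open>q\<close>, this makes the action on \<open>Y\<close> factor through
  the one on \<open>X\<close>, so equivariance is checked once per permutation of
  \<open>X\<close>.\<close>

lemma same_action:
  assumes p: "p \<in> \<Gamma>" and q: "q \<in> \<Gamma>" and eq: "\<And>x. x \<in> X \<Longrightarrow> a p x = a q x" and y: "y \<in> Y"
  shows "b p y = b q y"
proof -
  define r where "r = op (iv q) p"
  have r: "r \<in> \<Gamma>" using p q op iv by (simp add: r_def)
  have "a r x = x" if "x \<in> X" for x
    using a_op[OF iv[OF q] p that] eq[OF that] a_iv[OF q that] by (simp add: r_def)
  then have "{x \<in> X. a r x = x} = X" by auto
  then have "card {y \<in> Y. b r y = y} = card Y" using fixed[OF r] card_eq by simp
  then have "{y \<in> Y. b r y = y} = Y" using finY by (intro card_subset_eq) auto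
  then have "b r y = y" using y by blast
  then have "b (iv q) (b p y) = y" using b_op[OF iv[OF q] p y] by (simp add: r_def)
  then show ?thesis using b_iv[OF q bY[OF p y]] by metis
qed

definition equivariant :: "('x \<Rightarrow> 'y) \<Rightarrow> 'i \<Rightarrow> bool" where
  "equivariant f p \<longleftrightarrow> (\<forall>x\<in>X. f (a p x) = b p (f x))"

lemma equivariant_op:
  assumes "bij_betw f X Y" "equivariant f p" "equivariant f q" "p \<in> \<Gamma>" "q \<in> \<Gamma>"
  shows "equivariant f (op p q)"
  unfolding equivariant_def
proof
  fix x assume x: "x \<in> X"
  then have "f x \<in> Y" using assms(1) by (auto simp: bij_betw_def)
  then show "f (a (op p q) x) = b (op p q) (f x)"
    using assms(2,3) a_op[OF assms(4,5) x] b_op[OF assms(4,5)] aX[OF assms(5) x] x unfolding equivariant_def by simp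
qed

lemma equivariant_same:
  assumes "bij_betw f X Y" "equivariant f q" "p \<in> \<Gamma>" "q \<in> \<Gamma>" "\<And>x. x \<in> X \<Longrightarrow> a p x = a q x"
  shows "equivariant f p"
  unfolding equivariant_def
proof
  fix x assume x: "x \<in> X"
  then have "f x \<in> Y" using assms(1) by (auto simp: bij_betw_def)
  then show "f (a p x) = b p (f x)"
    using assms(2) same_action[OF assms(3-5)] assms(5)[OF x] x unfolding equivariant_def by simp
qed

text \<open>The assumption says that at most one nontrivial permutation of \<open>X\<close> occurs.
  It is an involution, since its square is again among the permutations and cannot equal it; then
  \<open>involution_equivariant_bij\<close> applies, and \<open>same_action\<close> extends
  equivariance to all indices.\<close>

lemma equivariant_bij_order_two:
  assumes two: "\<And>p q x y z. p \<in> \<Gamma> \<Longrightarrow> q \<in> \<Gamma> \<Longrightarrow> x \<in> X \<Longrightarrow> y \<in> X \<Longrightarrow> z \<in> X \<Longrightarrow> a p x \<noteq> x \<Longrightarrow> a q y \<noteq> y \<Longrightarrow> a p z = a q z"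
  shows "\<exists>f. bij_betw f X Y \<and> (\<forall>p\<in>\<Gamma>. equivariant f p)"
proof (cases "\<forall>p\<in>\<Gamma>. \<forall>x\<in>X. a p x = x")
  case True
  obtain f where f: "bij_betw f X Y" using finite_same_card_bij[OF finX finY card_eq] by blast
  have "equivariant f e" using a_e b_e f unfolding equivariant_def by (metis bij_betwE)
  then show ?thesis using equivariant_same[OF f _ _ e] True a_e f by metis
next
  case False
  then obtain s x where s: "s \<in> \<Gamma>" "x \<in> X" "a s x \<noteq> x" by blast
  have inv: "a s (a s z) = z" if z: "z \<in> X" for z
  proof (rule ccontr)
    assume "a s (a s z) \<noteq> z"
    then have "a (op s s) z \<noteq> z" using a_op[OF s(1) s(1) z] by simp
    then have "a (op s s) x = a s x" using two[OF op[OF s(1) s(1)] s(1) z s(2) s(2)] s(3) by blast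
    then have "a s (a s x) = a s x" using a_op[OF s(1) s(1) s(2)] by simp
    then have "a s x = x" using a_bij[OF s(1)] aX s by (metis bij_betw_inv_into_left)
    then show False using s by simp
  qed
  have invb: "b s (b s y) = y" if y: "y \<in> Y" for y
    using same_action[OF op[OF s(1) s(1)] e _ y] a_op[OF s(1) s(1)] inv a_e b_op[OF s(1) s(1) y] b_e[OF y] by simp
  have "\<exists>f. bij_betw f X Y \<and> (\<forall>x\<in>X. f (a s x) = b s (f x))"
    by (rule involution_equivariant_bij[OF finX finY card_eq _ _ fixed[OF s(1)]]) (use inv invb aX[OF s(1)] bY[OF s(1)] in auto)
  then obtain f where f: "bij_betw f X Y" "\<forall>x\<in>X. f (a s x) = b s (f x)" by blast
  have fs: "equivariant f s" using f by (simp add: equivariant_def)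
  have fe: "equivariant f e" using a_e b_e f unfolding equivariant_def by (metis bij_betwE)
  have "equivariant f p" if p: "p \<in> \<Gamma>" for p
  proof (cases "\<forall>x\<in>X. a p x = x")
    case True
    then show ?thesis using equivariant_same[OF f(1) fe p e] a_e by simp
  next
    case False
    then show ?thesis using equivariant_same[OF f(1) fs p s(1)] two[OF p s(1) _ s(2) _ _ s(3)] by blast
  qed
  then show ?thesis using f(1) by blast
qed

text \<open>Off the fixed point \<open>pt\<close> the action is by permutations of three points.
  Without a 3-cycle at most one transposition occurs, which is the previous case. With a 3-cycle
  \<open>s\<close> both sides are labelled by powers of \<open>s\<close>; the only freedom is the
  starting point on \<open>Y\<close>, which must be fixed by the reflections that fix
  \<open>x0\<close>.\<close>

lemma equivariant_bij_four:
  assumes c4: "card X = 4" and pt: "pt \<in> X" "\<And>p. p \<in> \<Gamma> \<Longrightarrow> a p pt = pt"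
  shows "\<exists>f. bij_betw f X Y \<and> (\<forall>p\<in>\<Gamma>. equivariant f p)"
proof -
  define X' where "X' = X - {pt}"
  have X': "finite X'" "card X' = 3" using c4 pt(1) finX by (auto simp: X'_def)
  have bX': "bij_betw (a p) X' X'" if p: "p \<in> \<Gamma>" for p
    using bij_betw_DiffI[OF a_bij[OF p], of "{pt}" "{pt}"] pt p by (auto simp: X'_def bij_betw_def)
  show ?thesis
  proof (cases "\<exists>s\<in>\<Gamma>. \<forall>x\<in>X'. a s x \<noteq> x")
    case False
    have ex: "\<exists>x\<in>X'. a p x = x" if "p \<in> \<Gamma>" for p using False that by blast
    have "a p z = a q z" if A: "p \<in> \<Gamma>" "q \<in> \<Gamma>" "x \<in> X" "y \<in> X" "z \<in> X" "a p x \<noteq> x" "a q y \<noteq> y" for p q x y z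
    proof (rule ccontr)
      assume ne: "a p z \<noteq> a q z"
      obtain u where u: "u \<in> X'" "a p u = u" using ex[OF A(1)] by blast
      obtain v where v: "v \<in> X'" "a q v = v" using ex[OF A(2)] by blast
      have r: "bij_betw (a t) (X' - {w}) (X' - {w})" if "t \<in> \<Gamma>" "a t w = w" "w \<in> X'" for t w
        using bij_betw_DiffI[OF bX'[OF that(1)], of "{w}" "{w}"] that by (auto simp: bij_betw_def)
      have cc: "finite (X' - {w})" "card (X' - {w}) \<le> 2" if "w \<in> X'" for w using X' that by auto
      have xyz: "x \<in> X'" "y \<in> X'" "z \<in> X'" using A pt ne by (auto simp: X'_def)
      have "u \<noteq> v"
      proof
        assume uv: "u = v"
        have "a p z = a q z"
          by (rule bij_betw_two_elements_unique[OF cc[OF u(1)] r[OF A(1) u(2,1)] r[OF A(2), of u], of x y z])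
            (use uv u v A xyz ne in auto)
        then show False using ne by simp
      qed
      have swp: "a t w1 = w2 \<and> a t w2 = w1"
        if t: "t \<in> \<Gamma>" "a t w0 = w0" and nt: "x0 \<in> X'" "a t x0 \<noteq> x0" and W: "X' = {w0, w1, w2}" "distinct [w0, w1, w2]"
        for t w0 w1 w2 x0
      proof -
        have img: "a t w1 \<in> X'" "a t w2 \<in> X'" using bX'[OF t(1)] W by (auto simp: bij_betw_def)
        have "inj_on (a t) X'" using bX'[OF t(1)] by (auto simp: bij_betw_def)
        then have "a t w1 \<noteq> w0" "a t w2 \<noteq> w0" "a t w1 \<noteq> a t w2" using W t(2) unfolding inj_on_def by auto
        then show ?thesis using img nt W t(2) by auto
      qed
      have "card (X' - {u, v}) = 1" using X' u v \<open>u \<noteq> v\<close> by (simp add: card_Diff_subset)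
      then obtain w where w: "X' - {u, v} = {w}" using card_1_singletonE by blast
      have W: "X' = {u, v, w}" "X' = {v, u, w}" "w \<noteq> u" "w \<noteq> v" using w u v by auto
      have 1: "a p v = w \<and> a p w = v" by (rule swp[OF A(1) u(2) xyz(1) A(6) W(1)]) (use W \<open>u \<noteq> v\<close> in auto)
      have 2: "a q u = w \<and> a q w = u" by (rule swp[OF A(2) v(2) xyz(2) A(7) W(2)]) (use W \<open>u \<noteq> v\<close> in auto)
      have X: "u \<in> X" "v \<in> X" "w \<in> X" using W X'_def by auto
      \<comment> \<open>Two different transpositions of three points compose to a 3-cycle, contrary
        to the case assumption.\<close>
      have "a (op p q) t \<noteq> t" if "t \<in> X'" for t
        using that a_op[OF A(1,2)] X 1 2 u v W \<open>u \<noteq> v\<close> by auto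
      then show False using ex[OF op[OF A(1,2)]] by blast
    qed
    then show ?thesis by (rule equivariant_bij_order_two)
  next
    case True
    then obtain s where s: "s \<in> \<Gamma>" "\<And>x. x \<in> X' \<Longrightarrow> a s x \<noteq> x" by blast
    have "{x \<in> X. a s x = x} = {pt}" using s pt by (auto simp: X'_def)
    then have "card {y \<in> Y. b s y = y} = 1" using fixed[OF s(1)] by simp
    then obtain pt' where pt': "{y \<in> Y. b s y = y} = {pt'}" using card_1_singletonE by blast
    then have o'Y: "pt' \<in> Y" "b s pt' = pt'" by auto
    define Y' where "Y' = Y - {pt'}"
    have Y': "finite Y'" "card Y' = 3" using c4 card_eq o'Y finY by (auto simp: Y'_def)
    have bY': "bij_betw (b s) Y' Y'"
      using bij_betw_DiffI[OF b_bij[OF s(1)], of "{pt'}" "{pt'}"] o'Y by (auto simp: Y'_def bij_betw_def)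
    have nfY: "b s y \<noteq> y" if "y \<in> Y'" for y using that pt' by (auto simp: Y'_def)
    have "X' \<noteq> {}" using X' by auto
    then obtain x0 where x0: "x0 \<in> X'" by blast
    define x1 x2 where "x1 = a s x0" and "x2 = a s x1"
    have cX: "X' = {x0, x1, x2}" "distinct [x0, x1, x2]" "a s x2 = x0"
      using three_cycle[OF X' bX'[OF s(1)] s(2) x0] by (auto simp: x1_def x2_def)
    have xX: "x0 \<in> X" "x1 \<in> X" "x2 \<in> X" using cX(1) by (auto simp: X'_def)
    have XX: "X = {pt, x0, x1, x2}" "distinct [pt, x0, x1, x2]" using cX pt(1) by (auto simp: X'_def)
    have as: "a s pt = pt" "a s x0 = x1" "a s x1 = x2" "a s x2 = x0" using pt(2)[OF s(1)] cX by (auto simp: x1_def x2_def)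
    define refl where "refl t \<longleftrightarrow> t \<in> \<Gamma> \<and> a t x0 = x0 \<and> a t x1 = x2 \<and> a t x2 = x1" for t
    have "\<exists>y0\<in>Y'. \<forall>t. refl t \<longrightarrow> b t pt' = pt' \<and> b t y0 = y0 \<and> b t (b s y0) = b s (b s y0) \<and> b t (b s (b s y0)) = b s y0"
    proof (cases "\<exists>t. refl t")
      case False
      have "Y' \<noteq> {}" using Y' by auto
      then show ?thesis using False by blast
    next
      case True
      then obtain t where t: "refl t" by blast
      then have tG: "t \<in> \<Gamma>" by (simp add: refl_def)
      have ss: "op s s \<in> \<Gamma>" using op s by blast
      have tv: "a t pt = pt" "a t x0 = x0" "a t x1 = x2" "a t x2 = x1" using t pt(2)[OF tG] by (auto simp: refl_def)
      \<comment> \<open>The dihedral relation, checked point by point on \<open>X\<close> and then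
        transferred to \<open>Y\<close> by \<open>same_action\<close>.\<close>
      have "a (op t s) x = a (op (op s s) t) x" if x: "x \<in> X" for x
      proof -
        have "a t (a s x) = a s (a s (a t x))" using x unfolding XX(1) by (elim insertE emptyE) (simp_all add: as tv)
        then show ?thesis unfolding a_op[OF tG s(1) x] a_op[OF ss tG x] a_op[OF s(1) s(1) aX[OF tG x]] .
      qed
      then have conj: "b t (b s y) = b s (b s (b t y))" if "y \<in> Y" for y
        using same_action[OF op[OF tG s(1)] op[OF ss tG] _ that] b_op[OF tG s(1) that] b_op[OF ss tG that]
          b_op[OF s(1) s(1) bY[OF tG that]] by simp
      \<comment> \<open>The dihedral relation makes \<open>b t pt'\<close> a fixed point of the
        square of \<open>s\<close>, and a 3-cycle on \<open>Y'\<close> allows none there. As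
        \<open>t\<close> has two fixed points on \<open>Y\<close>, the other one serves as
        \<open>y0\<close>.\<close>
      have to: "b t pt' = pt'"
      proof (rule ccontr)
        assume ne: "b t pt' \<noteq> pt'"
        then have m: "b t pt' \<in> Y'" using bY[OF tG o'Y(1)] by (simp add: Y'_def)
        have "b s (b s (b t pt')) = b t pt'" using conj[OF o'Y(1)] o'Y(2) by simp
        then show False using three_cycle(2)[OF Y' bY' nfY m] by simp
      qed
      have "{x \<in> X. a t x = x} = {pt, x0}"
        using tv XX by auto
      moreover have "pt \<noteq> x0" using x0 by (auto simp: X'_def)
      ultimately have "card {y \<in> Y. b t y = y} = 2" using fixed[OF tG] by simp
      then have "{y \<in> Y. b t y = y} \<noteq> {pt'}" by auto
      then obtain y0 where y0: "y0 \<in> Y" "b t y0 = y0" "y0 \<noteq> pt'" using to o'Y(1) by blast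
      have y0': "y0 \<in> Y'" using y0 by (simp add: Y'_def)
      have all: "b t' y = b t y" if "refl t'" "y \<in> Y" for t' y
      proof (rule same_action[OF _ tG _ that(2)])
        show t': "t' \<in> \<Gamma>" using \<open>refl t'\<close> by (simp add: refl_def)
        show "a t' x = a t x" if x: "x \<in> X" for x
          using x \<open>refl t'\<close> unfolding XX(1) refl_def by (elim insertE emptyE) (simp_all add: pt(2)[OF t'] tv)
      qed
      have yY: "b s y0 \<in> Y" "b s (b s y0) \<in> Y" using bY[OF s(1)] y0(1) by auto
      have c1: "b t (b s y0) = b s (b s y0)" using conj[OF y0(1)] y0(2) by simp
      have c2: "b t (b s (b s y0)) = b s y0"
        using conj[OF yY(1)] c1 three_cycle(3)[OF Y' bY' nfY y0'] by simp
      show ?thesis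
      proof (intro bexI[OF _ y0'] allI impI)
        fix t' assume "refl t'"
        note r = all[OF this]
        show "b t' pt' = pt' \<and> b t' y0 = y0 \<and> b t' (b s y0) = b s (b s y0) \<and> b t' (b s (b s y0)) = b s y0"
          unfolding r[OF o'Y(1)] r[OF y0(1)] r[OF yY(1)] r[OF yY(2)] using to y0(2) c1 c2 by blast
      qed
    qed
    then obtain y0 where y0: "y0 \<in> Y'" and refl: "\<And>t. refl t \<Longrightarrow> b t pt' = pt' \<and> b t y0 = y0 \<and> b t (b s y0) = b s (b s y0) \<and> b t (b s (b s y0)) = b s y0"
      by blast
    define y1 y2 where "y1 = b s y0" and "y2 = b s y1"
    have cY: "Y' = {y0, y1, y2}" "distinct [y0, y1, y2]" "b s y2 = y0"
      using three_cycle[OF Y' bY' nfY y0] by (auto simp: y1_def y2_def)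
    define f where "f x = (if x = pt then pt' else if x = x0 then y0 else if x = x1 then y1 else y2)" for x
    have YY: "Y = {pt', y0, y1, y2}" "distinct [pt', y0, y1, y2]" using cY o'Y(1) by (auto simp: Y'_def)
    have fv: "f pt = pt'" "f x0 = y0" "f x1 = y1" "f x2 = y2" using XX(2) by (auto simp: f_def)
    have f: "bij_betw f X Y"
      unfolding bij_betw_def inj_on_def XX(1) YY(1) using XX(2) YY(2) fv by auto
    have fs: "equivariant f s" unfolding equivariant_def unfolding XX(1) using as fv o'Y(2) cY(3) by (auto simp: y1_def y2_def)
    have fe: "equivariant f e" using a_e b_e f unfolding equivariant_def by (metis bij_betwE)
    have fss: "equivariant f (op s s)" by (rule equivariant_op[OF f fs fs s(1) s(1)])
    have ft: "equivariant f t" if t: "refl t" for t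
      unfolding equivariant_def unfolding XX(1) using refl[OF t] t pt(2)[of t] fv by (auto simp: refl_def y1_def y2_def)
    have stab: "equivariant f p" if p: "p \<in> \<Gamma>" "a p x0 = x0" for p
    proof -
      have inj: "inj_on (a p) X" using a_bij[OF p(1)] by (auto simp: bij_betw_def)
      have "a p x1 \<in> X" "a p x2 \<in> X" using aX[OF p(1)] xX by auto
      moreover have "a p x1 \<noteq> x0" "a p x2 \<noteq> x0" "a p x1 \<noteq> pt" "a p x2 \<noteq> pt" "a p x1 \<noteq> a p x2"
        using inj p(2) pt(2)[OF p(1)] XX unfolding inj_on_def by auto
      ultimately consider "a p x1 = x1" "a p x2 = x2" | "a p x1 = x2" "a p x2 = x1" using XX(1) by auto
      then show ?thesis
      proof cases
        case 1
        then show ?thesis using equivariant_same[OF f fe p(1) e] a_e p(2) pt(2)[OF p(1)] XX(1) by auto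
      next
        case 2
        then show ?thesis using ft[of p] p by (simp add: refl_def)
      qed
    qed
    have "equivariant f p" if p: "p \<in> \<Gamma>" for p
    proof -
      have injs: "u = v" if "t \<in> \<Gamma>" "a t u = a t v" "u \<in> X" "v \<in> X" for t u v
        using a_bij[OF that(1)] that(2-4) unfolding bij_betw_def by (blast dest: inj_onD)
      have "a p x0 \<noteq> pt" using injs[OF p _ xX(1) pt(1)] pt(2)[OF p] XX(2) by auto
      moreover have "a p x0 \<in> X" by (rule aX[OF p xX(1)])
      ultimately have "a p x0 = a e x0 \<or> a p x0 = a s x0 \<or> a p x0 = a (op s s) x0"
        using XX(1) a_e[OF xX(1)] a_op[OF s(1) s(1) xX(1)] as by auto
      \<comment> \<open>A power \<open>i\<close> of \<open>s\<close> agrees with \<open>p\<close> at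
        \<open>x0\<close>, so \<open>p\<close> acts as \<open>i\<close> after an index
        \<open>q\<close> that fixes \<open>x0\<close>; equivariance is already known for both
        factors.\<close>
      then obtain i where i: "i \<in> \<Gamma>" "equivariant f i" "a p x0 = a i x0" using e s(1) op fe fs fss by metis
      define q where "q = op (iv i) p"
      have q: "q \<in> \<Gamma>" using op iv i(1) p by (simp add: q_def)
      have aq: "a i (a q x) = a p x" if "x \<in> X" for x
        using a_op[OF iv[OF i(1)] p that] a_iv[OF i(1) aX[OF p that]] by (simp add: q_def)
      have "a q x0 = x0" by (rule injs[OF i(1) _ aX[OF q xX(1)] xX(1)]) (simp add: aq[OF xX(1)] i(3))
      then have "equivariant f (op i q)" using equivariant_op[OF f i(2) stab[OF q] i(1) q] by simp
      then show ?thesis by (rule equivariant_same[OF f _ p op[OF i(1) q]]) (simp add: aq a_op[OF i(1) q])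
    qed
    then show ?thesis using f by blast
  qed
qed

end

section \<open>The canonical identification\<close>

lemma irrep_transport_comp:
  assumes "Group.group G'" "Group.group G''" "\<psi> \<in> iso G' G''"
  shows "irrep_transport G'' (\<psi> \<circ> \<phi>) r = irrep_transport G'' \<psi> (irrep_transport G' \<phi> r)"
  unfolding irrep_transport_def using irreducible_rep_twist[OF assms] by (auto simp: comp_assoc)

text \<open>Representations are total functions with arbitrary values off the carrier, and a class
  contains all such variants. Consequently isomorphisms that agree on the carrier transport classes
  alike.\<close>

lemma irrep_class_closed_cong:
  assumes "Group.group G" "irreducible_rep G \<rho>" "\<And>g. g \<in> carrier G \<Longrightarrow> \<mu> g = \<nu> g" "\<mu> \<in> irrep_class G \<rho>"
  shows "\<nu> \<in> irrep_class G \<rho>"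
proof -
  have \<mu>: "irreducible_rep G \<mu>" "irrep_class G \<mu> = irrep_class G \<rho>" using irrep_class_member[OF assms(2,4)] by auto
  have \<nu>: "irreducible_rep G \<nu>" using irreducible_rep_cong[OF assms(1), of \<mu> \<nu>] assms(3) \<mu>(1) by blast
  have "equiv_rep G \<mu> \<nu>" by (rule equiv_rep_of_eq[OF assms(1,3) irreducible_representation[OF \<mu>(1)]])
  then show ?thesis using irrep_class_eq_iff[OF \<mu>(1) \<nu>] \<mu>(2) irrep_class_self[OF \<nu>] by simp
qed

lemma nontriv_irrepsE:
  assumes "r \<in> nontriv_irreps G"
  obtains \<rho> where "irreducible_rep G \<rho>" "r = irrep_class G \<rho>" "\<not> equiv_rep G \<rho> (\<lambda>_. 1\<^sub>m 1)"
proof -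
  obtain \<rho> where \<rho>: "irreducible_rep G \<rho>" "r = irrep_class G \<rho>" "r \<noteq> irrep_class G (\<lambda>_. 1\<^sub>m 1)"
    using assms by (auto simp: nontriv_irreps_def)
  have "\<not> equiv_rep G \<rho> (\<lambda>_. 1\<^sub>m 1)"
  proof
    assume e: "equiv_rep G \<rho> (\<lambda>_. 1\<^sub>m 1)"
    have rep: "representation G (degree_rep G \<rho>) \<rho>" by (rule irreducible_representation[OF \<rho>(1)])
    have t: "representation G 1 (\<lambda>_. 1\<^sub>m 1)" by (auto simp: representation_def)
    have "irrep_class G \<rho> = irrep_class G (\<lambda>_. 1\<^sub>m 1)"
      unfolding irrep_class_def
      using equiv_rep_trans[OF e _ rep t] equiv_rep_trans[OF equiv_rep_sym[OF e rep t] _ t rep] irreducible_representation by blast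
    then show False using \<rho> by simp
  qed
  then show ?thesis using that \<rho> by blast
qed

lemma nontriv_irrepsI:
  assumes "irreducible_rep G \<rho>" "\<not> equiv_rep G \<rho> (\<lambda>_. 1\<^sub>m 1)"
  shows "irrep_class G \<rho> \<in> nontriv_irreps G"
proof -
  have "irrep_class G \<rho> \<noteq> irrep_class G (\<lambda>_. 1\<^sub>m 1)"
  proof
    assume "irrep_class G \<rho> = irrep_class G (\<lambda>_. 1\<^sub>m 1)"
    then have "\<rho> \<in> irrep_class G (\<lambda>_. 1\<^sub>m 1)" using irrep_class_self[OF assms(1)] by simp
    then have "equiv_rep G (\<lambda>_. 1\<^sub>m 1) \<rho>" by (simp add: irrep_class_def)
    moreover have "representation G 1 (\<lambda>_. 1\<^sub>m 1)" by (auto simp: representation_def)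
    ultimately show False using equiv_rep_sym irreducible_representation[OF assms(1)] assms(2) by metis
  qed
  then show ?thesis using assms(1) by (auto simp: nontriv_irreps_def)
qed

lemma irrep_transport_cong:
  assumes "Group.group G" "r \<in> nontriv_irreps G" "\<And>g. g \<in> carrier G \<Longrightarrow> \<phi> g = \<psi> g"
  shows "irrep_transport G' \<phi> r = irrep_transport G' \<psi> r"
proof -
  obtain \<rho> where \<rho>: "irreducible_rep G \<rho>" "r = irrep_class G \<rho>" using nontriv_irrepsE[OF assms(2)] by metis
  have "\<mu> \<circ> \<phi> \<in> r \<longleftrightarrow> \<mu> \<circ> \<psi> \<in> r" for \<mu>
    using irrep_class_closed_cong[OF assms(1) \<rho>(1), of "\<mu> \<circ> \<phi>" "\<mu> \<circ> \<psi>"]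
      irrep_class_closed_cong[OF assms(1) \<rho>(1), of "\<mu> \<circ> \<psi>" "\<mu> \<circ> \<phi>"] assms(3) \<rho>(2) by auto
  then show ?thesis by (simp add: irrep_transport_def)
qed

lemma irrep_transport_ident:
  assumes "Group.group G" "r \<in> nontriv_irreps G" "\<And>g. g \<in> carrier G \<Longrightarrow> \<phi> g = g"
  shows "irrep_transport G \<phi> r = r"
proof -
  obtain \<rho> where \<rho>: "irreducible_rep G \<rho>" "r = irrep_class G \<rho>" using nontriv_irrepsE[OF assms(2)] by metis
  have "irrep_transport G \<phi> r = irrep_transport G id r" by (rule irrep_transport_cong[OF assms(1,2)]) (simp add: assms(3))
  also have "\<dots> = r" using irrep_class_member(2)[OF \<rho>(1)] \<rho>(2) by (auto simp: irrep_transport_def)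
  finally show ?thesis .
qed

lemma inv_into_iso:
  assumes "Group.group G" "\<phi> \<in> iso G G'"
  shows "inv_into (carrier G) \<phi> \<in> iso G' G"
    "g \<in> carrier G \<Longrightarrow> inv_into (carrier G) \<phi> (\<phi> g) = g" "g' \<in> carrier G' \<Longrightarrow> \<phi> (inv_into (carrier G) \<phi> g') = g'"
  using group.iso_set_sym[OF assms] assms(2)
  by (auto simp: iso_def bij_betw_inv_into_left bij_betw_inv_into_right)

lemma iso_carrier: "\<phi> \<in> iso G G' \<Longrightarrow> g \<in> carrier G \<Longrightarrow> \<phi> g \<in> carrier G'"
  by (auto simp: iso_def hom_def)

text \<open>The image is the class of \<rho> composed with the inverse of \<phi>; an equivalence
  with the trivial representation would pull back along \<phi>.\<close>

lemma irrep_transport_nontriv: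
  assumes "Group.group G" "Group.group G'" "\<phi> \<in> iso G G'" "r \<in> nontriv_irreps G"
  shows "irrep_transport G' \<phi> r \<in> nontriv_irreps G'"
proof -
  obtain \<rho> where \<rho>: "irreducible_rep G \<rho>" "r = irrep_class G \<rho>" "\<not> equiv_rep G \<rho> (\<lambda>_. 1\<^sub>m 1)" using nontriv_irrepsE[OF assms(4)] by metis
  define \<mu> where "\<mu> = \<rho> \<circ> inv_into (carrier G) \<phi>"
  note inv = inv_into_iso[OF assms(1,3)]
  have irr: "irreducible_rep G' \<mu>" using irreducible_rep_twist[OF assms(2,1) inv(1)] \<rho>(1) by (simp add: \<mu>_def)
  have eq: "(\<mu> \<circ> \<phi>) g = \<rho> g" if "g \<in> carrier G" for g using inv(2)[OF that] by (simp add: \<mu>_def)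
  have irr': "irreducible_rep G (\<mu> \<circ> \<phi>)" using irreducible_rep_twist[OF assms(1-3)] irr by simp
  have e: "equiv_rep G (\<mu> \<circ> \<phi>) \<rho>" by (rule equiv_rep_of_eq[OF assms(1) eq irreducible_representation[OF irr']])
  then have "irrep_class G (\<mu> \<circ> \<phi>) = r" using irrep_class_eq_iff[OF irr' \<rho>(1)] \<rho>(2) by simp
  then have "irrep_transport G' \<phi> r = irrep_class G' \<mu>" using irrep_transport_class[OF assms(1-3) irr] by simp
  moreover have "\<not> equiv_rep G' \<mu> (\<lambda>_. 1\<^sub>m 1)"
  proof
    assume "equiv_rep G' \<mu> (\<lambda>_. 1\<^sub>m 1)"
    then have "equiv_rep G (\<mu> \<circ> \<phi>) ((\<lambda>_. 1\<^sub>m 1) \<circ> \<phi>)"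
      using equiv_rep_twist[OF assms(1-3), of \<mu> "\<lambda>_. 1\<^sub>m 1"] by blast
    moreover have "(\<lambda>_. 1\<^sub>m 1) \<circ> \<phi> = (\<lambda>_. 1\<^sub>m 1 :: cmat)" by auto
    ultimately have "equiv_rep G (\<mu> \<circ> \<phi>) (\<lambda>_. 1\<^sub>m 1)" by simp
    moreover have t: "representation G 1 (\<lambda>_. 1\<^sub>m 1)" by (auto simp: representation_def)
    ultimately have "equiv_rep G \<rho> (\<lambda>_. 1\<^sub>m 1)"
      using equiv_rep_trans[OF equiv_rep_sym[OF e]] irreducible_representation[OF irr'] irreducible_representation[OF \<rho>(1)] by metis
    then show False using \<rho>(3) by simp
  qed
  ultimately show ?thesis using nontriv_irrepsI[OF irr] by simp
qed

lemma nontriv_conj_classes_image: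
  assumes "Group.group G" "Group.group G'" "\<phi> \<in> iso G G'" "finite (carrier G)" "C \<in> nontriv_conj_classes G"
  shows "\<phi> ` C \<in> nontriv_conj_classes G'"
proof -
  interpret G: finite_group G using assms(1,4) by (simp add: finite_group_def finite_group_axioms_def)
  interpret G': Group.group G' by fact
  interpret H: group_hom G G' \<phi> using assms(3) by unfold_locales (auto simp: iso_def)
  obtain g where g: "g \<in> carrier G" "C = conj_class G g" "C \<noteq> {\<one>\<^bsub>G\<^esub>}" using assms(5) by (auto simp: nontriv_conj_classes_eq)
  have sub: "C \<subseteq> carrier G" using G.conj_class_subset[OF g(1)] g(2) by simp
  have inj: "inj_on \<phi> (carrier G)" using assms(3) by (auto simp: iso_def bij_betw_def)
  have "\<phi> ` C \<noteq> \<phi> ` {\<one>\<^bsub>G\<^esub>}" using inj_on_image_eq_iff[OF inj sub, of "{\<one>\<^bsub>G\<^esub>}"] g(3) by auto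
  then show ?thesis unfolding nontriv_conj_classes_eq
    using G.conj_class_image[OF assms(2,3) g(1)] g(1,2) by auto
qed

lemma nontriv_conj_classes_subset:
  assumes "Group.group G" "finite (carrier G)" "C \<in> nontriv_conj_classes G"
  shows "C \<subseteq> carrier G"
proof -
  interpret G: finite_group G using assms(1,2) by (simp add: finite_group_def finite_group_axioms_def)
  show ?thesis using assms(3) G.conj_class_subset by (auto simp: nontriv_conj_classes_eq)
qed

section \<open>The groupoid of pairs and their isomorphisms\<close>

definition pair_isos :: "'g monoid \<times> ('g \<Rightarrow> cmat) \<Rightarrow> 'g monoid \<times> ('g \<Rightarrow> cmat) \<Rightarrow> ('g \<Rightarrow> 'g) set" where
  "pair_isos = (\<lambda>(G, Q) (G', Q'). {\<phi> \<in> iso G G'. equiv_rep G (Q' \<circ> \<phi>) Q})"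

definition sl2_pair :: "'g monoid \<times> ('g \<Rightarrow> cmat) \<Rightarrow> bool" where
  "sl2_pair = (\<lambda>(G, Q). SL2_pair G Q)"

lemma sl2_pair_group:
  assumes "sl2_pair X" shows "Group.group (fst X)" "finite (carrier (fst X))" "representation (fst X) 2 (snd X)"
  using assms by (auto simp: sl2_pair_def SL2_pair_def split: prod.splits)

lemma pair_isos_iff: "\<phi> \<in> pair_isos X X' \<longleftrightarrow> \<phi> \<in> iso (fst X) (fst X') \<and> equiv_rep (fst X) (snd X' \<circ> \<phi>) (snd X)"
  by (auto simp: pair_isos_def split: prod.splits)

lemma pair_isos_comp:
  assumes "sl2_pair X" "sl2_pair X'" "sl2_pair X''" "\<phi> \<in> pair_isos X X'" "\<psi> \<in> pair_isos X' X''"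
  shows "\<psi> \<circ> \<phi> \<in> pair_isos X X''"
proof -
  note g = sl2_pair_group[OF assms(1)] and g' = sl2_pair_group[OF assms(2)] and g'' = sl2_pair_group[OF assms(3)]
  have \<phi>: "\<phi> \<in> iso (fst X) (fst X')" "equiv_rep (fst X) (snd X' \<circ> \<phi>) (snd X)" using assms(4) by (auto simp: pair_isos_iff)
  have \<psi>: "\<psi> \<in> iso (fst X') (fst X'')" "equiv_rep (fst X') (snd X'' \<circ> \<psi>) (snd X')" using assms(5) by (auto simp: pair_isos_iff)
  have c: "\<psi> \<circ> \<phi> \<in> iso (fst X) (fst X'')" by (rule iso_set_trans[OF \<phi>(1) \<psi>(1)])
  have "equiv_rep (fst X) ((snd X'' \<circ> \<psi>) \<circ> \<phi>) (snd X' \<circ> \<phi>)"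
    using equiv_rep_twist[OF g(1) g'(1) \<phi>(1)] \<psi>(2) by blast
  moreover have "representation (fst X) 2 (snd X' \<circ> \<phi>)" using representation_twist[OF g(1) g'(1) \<phi>(1)] g'(3) by blast
  moreover have "representation (fst X) 2 ((snd X'' \<circ> \<psi>) \<circ> \<phi>)"
    using representation_twist[OF g(1) g''(1) c] g''(3) by (simp add: comp_assoc)
  ultimately have "equiv_rep (fst X) ((snd X'' \<circ> \<psi>) \<circ> \<phi>) (snd X)" using equiv_rep_trans \<phi>(2) g(3) by metis
  then show ?thesis using c by (simp add: pair_isos_iff comp_assoc)
qed

lemma pair_isos_inv:
  assumes "sl2_pair X" "sl2_pair X'" "\<phi> \<in> pair_isos X X'"
  shows "inv_into (carrier (fst X)) \<phi> \<in> pair_isos X' X"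
proof -
  note g = sl2_pair_group[OF assms(1)] and g' = sl2_pair_group[OF assms(2)]
  have \<phi>: "\<phi> \<in> iso (fst X) (fst X')" "equiv_rep (fst X) (snd X' \<circ> \<phi>) (snd X)" using assms(3) by (auto simp: pair_isos_iff)
  note inv = inv_into_iso[OF g(1) \<phi>(1)]
  define \<psi> where "\<psi> = inv_into (carrier (fst X)) \<phi>"
  have r: "representation (fst X') 2 (snd X \<circ> \<psi>)" using representation_twist[OF g'(1) g(1) inv(1)] g(3) by (simp add: \<psi>_def)
  have r1: "representation (fst X) 2 (snd X' \<circ> \<phi>)" using representation_twist[OF g(1) g'(1) \<phi>(1)] g'(3) by blast
  have r2: "representation (fst X') 2 ((snd X' \<circ> \<phi>) \<circ> \<psi>)" using representation_twist[OF g'(1) g(1) inv(1)] r1 by (simp add: \<psi>_def)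
  have "equiv_rep (fst X') ((snd X' \<circ> \<phi>) \<circ> \<psi>) (snd X \<circ> \<psi>)"
    using equiv_rep_twist[OF g'(1) g(1) inv(1)] \<phi>(2) by (simp add: \<psi>_def)
  moreover have "equiv_rep (fst X') ((snd X' \<circ> \<phi>) \<circ> \<psi>) (snd X')"
    by (rule equiv_rep_of_eq[OF g'(1) _ r2]) (simp add: \<psi>_def inv(3))
  ultimately have "equiv_rep (fst X') (snd X \<circ> \<psi>) (snd X')"
    using equiv_rep_trans[OF equiv_rep_sym[OF _ r2 r] _ r r2 g'(3)] by blast
  then show ?thesis using inv(1) by (simp add: pair_isos_iff \<psi>_def)
qed

lemma pair_isos_id: "sl2_pair X \<Longrightarrow> id \<in> pair_isos X X"
  using sl2_pair_group(3)[of X] equiv_rep_refl id_iso by (auto simp: pair_isos_iff)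

definition equivariant_bij :: "'g monoid \<times> ('g \<Rightarrow> cmat) \<Rightarrow> ('g set \<Rightarrow> ('g \<Rightarrow> cmat) set) \<Rightarrow> bool" where
  "equivariant_bij X f \<longleftrightarrow> bij_betw f (nontriv_conj_classes (fst X)) (nontriv_irreps (fst X)) \<and>
     (\<forall>\<phi>\<in>pair_isos X X. \<forall>C\<in>nontriv_conj_classes (fst X). f (\<phi> ` C) = irrep_transport (fst X) \<phi> (f C))"

text \<open>Brauer's count \<open>card_fixed_nontriv\<close> supplies the fixed-point axiom of
  \<open>two_actions\<close>, and the two alternatives of \<open>class_action_dichotomy\<close>
  match the two existence results proved there.\<close>

lemma equivariant_bij_exists:
  assumes X: "sl2_pair X"
  shows "\<exists>f. equivariant_bij X f"
proof -
  obtain G Q where XGQ: "X = (G, Q)" by fastforce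
  have pair: "SL2_pair G Q" using X by (simp add: XGQ sl2_pair_def)
  interpret sl2_group G Q
    using pair by (auto simp: SL2_pair_def sl2_group_def sl2_group_axioms_def finite_group_def finite_group_axioms_def)
  note grp = sl2_pair_group[OF X, unfolded XGQ fst_conv snd_conv]
  have pa: "pair_isos X X = pair_automorphisms G Q" by (auto simp: XGQ pair_isos_def pair_automorphisms_def)
  have subC: "C \<subseteq> carrier G" if "C \<in> nontriv_conj_classes G" for C using nontriv_conj_classes_subset[OF grp(1,2) that] .
  interpret two_actions "pair_automorphisms G Q" "(\<circ>)" "inv_into (carrier G)" id "nontriv_conj_classes G" "(`)"
    "nontriv_irreps G" "irrep_transport G"
  proof
    fix p q assume p: "p \<in> pair_automorphisms G Q"
    then have pi: "p \<in> iso G G" by (rule aut_iso)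
    note inv = inv_into_iso[OF grp(1) pi]
    show "inv_into (carrier G) p \<in> pair_automorphisms G Q"
      using pair_isos_inv[OF X X, of p] p by (simp add: pa) (simp add: XGQ)
    show "p ` C \<in> nontriv_conj_classes G" if "C \<in> nontriv_conj_classes G" for C
      by (rule nontriv_conj_classes_image[OF grp(1,1) pi grp(2) that])
    show "irrep_transport G p r \<in> nontriv_irreps G" if "r \<in> nontriv_irreps G" for r
      by (rule irrep_transport_nontriv[OF grp(1,1) pi that])
    show "p ` inv_into (carrier G) p ` C = C \<and> inv_into (carrier G) p ` p ` C = C" if "C \<in> nontriv_conj_classes G" for C
      using inv(2,3) subC[OF that] by (auto simp: image_image image_iff subset_iff)
    show "irrep_transport G p (irrep_transport G (inv_into (carrier G) p) r) = r \<and>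
        irrep_transport G (inv_into (carrier G) p) (irrep_transport G p r) = r" if r: "r \<in> nontriv_irreps G" for r
      unfolding irrep_transport_comp[OF grp(1,1) pi, symmetric] irrep_transport_comp[OF grp(1,1) inv(1), symmetric]
      using irrep_transport_ident[OF grp(1) r] inv(2,3) by simp
    show "card {C \<in> nontriv_conj_classes G. p ` C = C} = card {r \<in> nontriv_irreps G. irrep_transport G p r = r}"
      by (rule card_fixed_nontriv[OF pi])
    assume q: "q \<in> pair_automorphisms G Q"
    show "p \<circ> q \<in> pair_automorphisms G Q" using pair_isos_comp[OF X X X, of q p] p q by (simp add: pa)
    show "(p \<circ> q) ` C = p ` q ` C" for C by (simp add: image_comp)
    show "irrep_transport G (p \<circ> q) r = irrep_transport G p (irrep_transport G q r)" for r
      by (rule irrep_transport_comp[OF grp(1,1) pi])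
  next
    show "id \<in> pair_automorphisms G Q" by (rule id_aut)
    show "irrep_transport G id r = r" if "r \<in> nontriv_irreps G" for r using irrep_transport_ident[OF grp(1) that] by simp
    show "finite (nontriv_conj_classes G)" using finite_carrier by (simp add: nontriv_conj_classes_eq)
    show "finite (nontriv_irreps G)" using finite_Irr by (simp add: nontriv_irreps_def)
  qed auto
  have "\<exists>f. bij_betw f (nontriv_conj_classes G) (nontriv_irreps G) \<and> (\<forall>p\<in>pair_automorphisms G Q. equivariant f p)"
    using class_action_dichotomy
  proof (elim disjE conjE bexE)
    assume H: "\<forall>\<phi>\<in>pair_automorphisms G Q. \<forall>\<psi>\<in>pair_automorphisms G Q. \<forall>C\<in>nontriv_conj_classes G. \<forall>D\<in>nontriv_conj_classes G.
      \<phi> ` C \<noteq> C \<longrightarrow> \<psi> ` D \<noteq> D \<longrightarrow> (\<forall>E\<in>nontriv_conj_classes G. \<phi> ` E = \<psi> ` E)"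
    show ?thesis
    proof (rule equivariant_bij_order_two)
      fix p q x y z
      assume "p \<in> pair_automorphisms G Q" "q \<in> pair_automorphisms G Q" "x \<in> nontriv_conj_classes G"
        "y \<in> nontriv_conj_classes G" "z \<in> nontriv_conj_classes G" "p ` x \<noteq> x" "q ` y \<noteq> y"
      then show "p ` z = q ` z" by (intro H[rule_format, of p q x y z])
    qed
  next
    fix C assume "card (nontriv_conj_classes G) = 4" "C \<in> nontriv_conj_classes G" "\<forall>\<phi>\<in>pair_automorphisms G Q. \<phi> ` C = C"
    then show ?thesis by (intro equivariant_bij_four[of C]) auto
  qed
  then show ?thesis unfolding equivariant_bij_def pa unfolding XGQ equivariant_def by auto
qed

text \<open>For each pair, \<open>R\<close> selects a representative of its isomorphism class,
  \<open>J\<close> an isomorphism from it, and \<open>B\<close> an equivariant bijection on it;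
  \<theta> conjugates \<open>B\<close> by \<open>J\<close>. Replacing \<open>J\<close> by another
  isomorphism changes it by a self-isomorphism of the representative, under which \<open>B\<close>
  is equivariant.\<close>

theorem canonical_identification_exists:
  "\<exists>\<theta> :: 'g monoid \<Rightarrow> ('g \<Rightarrow> cmat) \<Rightarrow> 'g set \<Rightarrow> ('g \<Rightarrow> cmat) set. canonical_identification \<theta>"
proof -
  define R :: "'g monoid \<times> ('g \<Rightarrow> cmat) \<Rightarrow> 'g monoid \<times> ('g \<Rightarrow> cmat)"
    where "R X = (SOME X'. sl2_pair X' \<and> pair_isos X' X \<noteq> {})" for X
  define J :: "'g monoid \<times> ('g \<Rightarrow> cmat) \<Rightarrow> 'g \<Rightarrow> 'g"
    where "J X = (SOME \<phi>. \<phi> \<in> pair_isos (R X) X)" for X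
  define B :: "'g monoid \<times> ('g \<Rightarrow> cmat) \<Rightarrow> 'g set \<Rightarrow> ('g \<Rightarrow> cmat) set"
    where "B X = (SOME f. equivariant_bij X f)" for X
  define K where "K X = inv_into (carrier (fst (R X))) (J X)" for X
  define \<theta> where "\<theta> G Q C = irrep_transport G (J (G, Q)) (B (R (G, Q)) (K (G, Q) ` C))" for G Q C
  have R: "sl2_pair (R X) \<and> pair_isos (R X) X \<noteq> {}" if "sl2_pair X" for X
    unfolding R_def using someI[of "\<lambda>X'. sl2_pair X' \<and> pair_isos X' X \<noteq> {}" X] pair_isos_id[OF that] that by blast
  have J: "J X \<in> pair_isos (R X) X" if "sl2_pair X" for X
    unfolding J_def using R[OF that] by (metis ex_in_conv someI)
  have B: "equivariant_bij X (B X)" if "sl2_pair X" for X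
    unfolding B_def using someI_ex[OF equivariant_bij_exists[OF that]] .
  have K: "K X \<in> pair_isos X (R X)" if "sl2_pair X" for X
    unfolding K_def using pair_isos_inv R[OF that] J[OF that] that by blast
  \<comment> \<open>Isomorphic pairs satisfy the same choice predicate, so \<open>SOME\<close>
    returns literally the same representative.\<close>
  have Req: "R X = R X'" if "sl2_pair X" "sl2_pair X'" "\<phi> \<in> pair_isos X X'" for X X' \<phi>
  proof -
    have "(sl2_pair X'' \<and> pair_isos X'' X \<noteq> {}) = (sl2_pair X'' \<and> pair_isos X'' X' \<noteq> {})" for X''
      using pair_isos_comp[OF _ that(1,2) _ that(3), of X''] pair_isos_comp[OF _ that(2,1) _ pair_isos_inv[OF that], of X''] by blast
    then show ?thesis unfolding R_def by simp
  qed
  have JK: "J X (K X g) = g" if "sl2_pair X" "g \<in> carrier (fst X)" for X g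
  proof -
    have "J X \<in> iso (fst (R X)) (fst X)" using J[OF that(1)] by (simp add: pair_isos_iff)
    from inv_into_iso(3)[OF sl2_pair_group(1)[OF conjunct1[OF R[OF that(1)]]] this that(2)] show ?thesis by (simp add: K_def)
  qed
  have KJ: "K X (J X g) = g" if "sl2_pair X" "g \<in> carrier (fst (R X))" for X g
  proof -
    have "J X \<in> iso (fst (R X)) (fst X)" using J[OF that(1)] by (simp add: pair_isos_iff)
    from inv_into_iso(2)[OF sl2_pair_group(1)[OF conjunct1[OF R[OF that(1)]]] this that(2)] show ?thesis by (simp add: K_def)
  qed
  have "canonical_identification \<theta>"
    unfolding canonical_identification_def
  proof (intro conjI allI impI ballI)
    fix G :: "'g monoid" and Q assume "SL2_pair G Q"
    then have X: "sl2_pair (G, Q)" by (simp add: sl2_pair_def)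
    define H where "H = fst (R (G, Q))"
    note gG = sl2_pair_group[OF X, unfolded fst_conv snd_conv]
    have RX: "sl2_pair (R (G, Q))" using R[OF X] by simp
    note gH = sl2_pair_group[OF RX, folded H_def]
    have Ji: "J (G, Q) \<in> iso H G" using J[OF X] by (simp add: pair_isos_iff H_def)
    have Ki: "K (G, Q) \<in> iso G H" using K[OF X] by (simp add: pair_isos_iff H_def)
    have JK': "J (G, Q) (K (G, Q) g) = g" if "g \<in> carrier G" for g using JK[OF X] that by simp
    have KJ': "K (G, Q) (J (G, Q) g) = g" if "g \<in> carrier H" for g using KJ[OF X] that by (simp add: H_def)
    have 1: "bij_betw ((`) (K (G, Q))) (nontriv_conj_classes G) (nontriv_conj_classes H)"
    proof (rule bij_betw_byWitness[where f' = "(`) (J (G, Q))"])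
      show "\<forall>C\<in>nontriv_conj_classes G. J (G, Q) ` K (G, Q) ` C = C"
      proof
        fix C assume "C \<in> nontriv_conj_classes G"
        then have "C \<subseteq> carrier G" by (rule nontriv_conj_classes_subset[OF gG(1,2)])
        then show "J (G, Q) ` K (G, Q) ` C = C" using JK' by (force simp: image_image)
      qed
      show "\<forall>C\<in>nontriv_conj_classes H. K (G, Q) ` J (G, Q) ` C = C"
      proof
        fix C assume "C \<in> nontriv_conj_classes H"
        then have "C \<subseteq> carrier H" by (rule nontriv_conj_classes_subset[OF gH(1,2)])
        then show "K (G, Q) ` J (G, Q) ` C = C" using KJ' by (force simp: image_image)
      qed
      show "(`) (K (G, Q)) ` nontriv_conj_classes G \<subseteq> nontriv_conj_classes H"
        using nontriv_conj_classes_image[OF gG(1) gH(1) Ki gG(2)] by auto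
      show "(`) (J (G, Q)) ` nontriv_conj_classes H \<subseteq> nontriv_conj_classes G"
        using nontriv_conj_classes_image[OF gH(1) gG(1) Ji gH(2)] by auto
    qed
    have 2: "bij_betw (B (R (G, Q))) (nontriv_conj_classes H) (nontriv_irreps H)"
      using B[OF RX] by (simp add: equivariant_bij_def H_def)
    have 3: "bij_betw (irrep_transport G (J (G, Q))) (nontriv_irreps H) (nontriv_irreps G)"
    proof (rule bij_betw_byWitness[where f' = "irrep_transport H (K (G, Q))"])
      show "\<forall>r\<in>nontriv_irreps H. irrep_transport H (K (G, Q)) (irrep_transport G (J (G, Q)) r) = r"
        unfolding irrep_transport_comp[OF gG(1) gH(1) Ki, symmetric]
        using irrep_transport_ident[OF gH(1)] KJ' by simp
      show "\<forall>r\<in>nontriv_irreps G. irrep_transport G (J (G, Q)) (irrep_transport H (K (G, Q)) r) = r"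
        unfolding irrep_transport_comp[OF gH(1) gG(1) Ji, symmetric]
        using irrep_transport_ident[OF gG(1)] JK' by simp
      show "irrep_transport G (J (G, Q)) ` nontriv_irreps H \<subseteq> nontriv_irreps G"
        using irrep_transport_nontriv[OF gH(1) gG(1) Ji] by auto
      show "irrep_transport H (K (G, Q)) ` nontriv_irreps G \<subseteq> nontriv_irreps H"
        using irrep_transport_nontriv[OF gG(1) gH(1) Ki] by auto
    qed
    have "\<theta> G Q = irrep_transport G (J (G, Q)) \<circ> (B (R (G, Q)) \<circ> (`) (K (G, Q)))" by (auto simp: \<theta>_def)
    then show "bij_betw (\<theta> G Q) (nontriv_conj_classes G) (nontriv_irreps G)"
      using bij_betw_trans[OF bij_betw_trans[OF 1 2] 3] by simp
  next
    fix G :: "'g monoid" and Q and G' :: "'g monoid" and Q' \<phi> C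
    assume asm: "SL2_pair G Q \<and> SL2_pair G' Q' \<and> \<phi> \<in> iso G G' \<and> equiv_rep G (Q' \<circ> \<phi>) Q"
      and C: "C \<in> nontriv_conj_classes G"
    define X X' where "X = (G, Q)" and "X' = (G', Q')"
    have X: "sl2_pair X" and X': "sl2_pair X'" and \<phi>: "\<phi> \<in> pair_isos X X'"
      using asm by (auto simp: X_def X'_def sl2_pair_def pair_isos_iff)
    have RR: "R X' = R X" using Req[OF X X' \<phi>] by simp
    define H where "H = fst (R X)"
    have RX: "sl2_pair (R X)" using R[OF X] by simp
    note gG = sl2_pair_group[OF X] and gG' = sl2_pair_group[OF X'] and gH = sl2_pair_group[OF RX, folded H_def]
    have GX: "fst X = G" "fst X' = G'" by (simp_all add: X_def X'_def)
    have Ki: "K X \<in> iso G H" and Ji: "J X \<in> iso H G" and J'i: "J X' \<in> iso H G'" and \<phi>i: "\<phi> \<in> iso G G'"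
      using K[OF X] J[OF X] J[OF X'] \<phi> by (auto simp: pair_isos_iff H_def RR GX)
    \<comment> \<open>The self-isomorphism of the common representative by which the two routes from
      it to \<open>G'\<close> differ.\<close>
    define k where "k = K X' \<circ> (\<phi> \<circ> J X)"
    have kR: "k \<in> pair_isos (R X) (R X)"
      unfolding k_def using pair_isos_comp[OF RX X' RX pair_isos_comp[OF RX X X' J[OF X] \<phi>]] K[OF X'] RR by simp
    define D where "D = K X ` C"
    have D: "D \<in> nontriv_conj_classes H"
      unfolding D_def using nontriv_conj_classes_image[OF gG(1) gH(1)] Ki gG(2) C by (simp add: GX)
    have subC: "C \<subseteq> carrier G" using nontriv_conj_classes_subset[OF gG(1,2)] C by (simp add: GX)
    have kD: "K X' ` \<phi> ` C = k ` D"
    proof -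
      have "K X' (\<phi> g) = k (K X g)" if "g \<in> C" for g using JK[OF X, of g] that subC by (auto simp: k_def GX)
      then show ?thesis unfolding D_def by (auto simp: image_image)
    qed
    have BD: "B (R X) D \<in> nontriv_irreps H" using B[OF RX] D by (auto simp: equivariant_bij_def H_def bij_betw_def)
    have ki: "k \<in> iso H H" using kR by (simp add: pair_isos_iff H_def)
    have "\<theta> G' Q' (\<phi> ` C) = irrep_transport G' (J X') (B (R X) (k ` D))"
      unfolding \<theta>_def X'_def[symmetric] RR kD ..
    also have "B (R X) (k ` D) = irrep_transport H k (B (R X) D)"
      using B[OF RX] kR D by (simp add: equivariant_bij_def H_def)
    also have "irrep_transport G' (J X') (irrep_transport H k (B (R X) D)) = irrep_transport G' (J X' \<circ> k) (B (R X) D)"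
      by (rule irrep_transport_comp[symmetric, OF gH(1) _ J'i]) (use gG'(1) GX in simp)
    also have "\<dots> = irrep_transport G' (\<phi> \<circ> J X) (B (R X) D)"
    proof (rule irrep_transport_cong[OF gH(1) BD])
      fix h assume "h \<in> carrier H"
      then have "\<phi> (J X h) \<in> carrier G'" using iso_carrier[OF \<phi>i] iso_carrier[OF Ji] by blast
      then show "(J X' \<circ> k) h = (\<phi> \<circ> J X) h" using JK[OF X'] by (simp add: k_def GX)
    qed
    also have "\<dots> = irrep_transport G' \<phi> (irrep_transport G (J X) (B (R X) D))"
      using irrep_transport_comp[OF gG(1) gG'(1)] \<phi>i by (simp add: GX)
    also have "\<dots> = irrep_transport G' \<phi> (\<theta> G Q C)" by (simp add: \<theta>_def X_def D_def)
    finally show "\<theta> G' Q' (\<phi> ` C) = {\<mu>. irreducible_rep G' \<mu> \<and> \<mu> \<circ> \<phi> \<in> \<theta> G Q C}"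
      by (simp add: irrep_transport_def)
  qed
  then show ?thesis by blast
qed

section \<open>Automorphisms of the McKay graph\<close>

lemma kronecker_carrier:
  "A \<in> carrier_mat a b \<Longrightarrow> B \<in> carrier_mat c d \<Longrightarrow> kronecker A B \<in> carrier_mat (a * c) (b * d)"
  by (auto simp: kronecker_def)

lemma kronecker_mult:
  assumes "A \<in> carrier_mat a b" "C \<in> carrier_mat b e" "B \<in> carrier_mat c d" "D \<in> carrier_mat d f"
  shows "kronecker A B * kronecker C D = kronecker (A * C) (B * D)"
proof (rule eq_matI)
  fix i j assume "i < dim_row (kronecker (A * C) (B * D))" "j < dim_col (kronecker (A * C) (B * D))"
  then have ij: "i < a * c" "j < e * f" using assms by (auto simp: kronecker_def)
  have pos: "c > 0" "f > 0" using ij by (auto intro: Nat.gr0I)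
  have i: "i div c < a" "i mod c < c" "j div f < e" "j mod f < f"
    using ij pos by (auto simp: less_mult_imp_div_less)
  have "(kronecker A B * kronecker C D) $$ (i, j) = (\<Sum>l<b * d. kronecker A B $$ (i, l) * kronecker C D $$ (l, j))"
    by (rule index_mult_sum[OF kronecker_carrier[OF assms(1,3)] kronecker_carrier[OF assms(2,4)] ij])
  also have "\<dots> = (\<Sum>l<b * d. (A $$ (i div c, l div d) * B $$ (i mod c, l mod d)) * (C $$ (l div d, j div f) * D $$ (l mod d, j mod f)))"
    using assms ij by (intro sum.cong) (auto simp: kronecker_def)
  also have "\<dots> = (\<Sum>p<b. \<Sum>q<d. (A $$ (i div c, p) * B $$ (i mod c, q)) * (C $$ (p, j div f) * D $$ (q, j mod f)))"
  proof -
    \<comment> \<open>The summation index is split into quotient and remainder by \<open>d\<close>,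
      matching the block layout of \<open>kronecker\<close>.\<close>
    have "bij_betw (\<lambda>(p, q). p * d + q) ({..<b} \<times> {..<d}) {..<b * d}"
    proof (rule bij_betw_byWitness[where f' = "\<lambda>l. (l div d, l mod d)"])
      show "(\<lambda>(p, q). p * d + q) ` ({..<b} \<times> {..<d}) \<subseteq> {..<b * d}"
      proof clarify
        fix p q assume "p < b" "q < d"
        then have "p * d + q < Suc p * d" by simp
        also have "\<dots> \<le> b * d" using \<open>p < b\<close> by (intro mult_le_mono1) simp
        finally show "p * d + q < b * d" .
      qed
      show "(\<lambda>l. (l div d, l mod d)) ` {..<b * d} \<subseteq> {..<b} \<times> {..<d}"
        by (auto simp: less_mult_imp_div_less intro!: mod_less_divisor) (metis Nat.gr0I less_nat_zero_code mult_0_right)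
    qed auto
    then show ?thesis
      by (subst sum.reindex_bij_betw[symmetric]) (auto simp: sum.cartesian_product intro!: sum.cong)
  qed
  also have "\<dots> = (\<Sum>p<b. A $$ (i div c, p) * C $$ (p, j div f)) * (\<Sum>q<d. B $$ (i mod c, q) * D $$ (q, j mod f))"
    by (simp add: sum_product mult.assoc mult.left_commute)
  also have "\<dots> = (A * C) $$ (i div c, j div f) * (B * D) $$ (i mod c, j mod f)"
    using index_mult_sum[OF assms(1,2) i(1,3)] index_mult_sum[OF assms(3,4) i(2,4)] by simp
  also have "\<dots> = kronecker (A * C) (B * D) $$ (i, j)"
    using assms ij by (simp add: kronecker_def del: index_mult_mat(1))
  finally show "(kronecker A B * kronecker C D) $$ (i, j) = kronecker (A * C) (B * D) $$ (i, j)" .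
qed (use assms in \<open>auto simp: kronecker_def\<close>)

lemma kronecker_one: "kronecker (1\<^sub>m n) (1\<^sub>m m) = 1\<^sub>m (n * m)"
proof (rule eq_matI)
  fix i j assume "i < dim_row (1\<^sub>m (n * m) :: cmat)" "j < dim_col (1\<^sub>m (n * m) :: cmat)"
  then have ij: "i < n * m" "j < n * m" by auto
  have "m > 0" using ij by (auto intro: Nat.gr0I)
  moreover have "i = j" if "i div m = j div m" "i mod m = j mod m" using that by (metis div_mult_mod_eq)
  ultimately show "kronecker (1\<^sub>m n) (1\<^sub>m m) $$ (i, j) = 1\<^sub>m (n * m) $$ (i, j)"
    using ij by (auto simp: kronecker_def less_mult_imp_div_less)
qed (auto simp: kronecker_def)

lemma tensor_representation:
  assumes "representation G n \<rho>" "representation G m \<sigma>"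
  shows "representation G (n * m) (tensor_rep \<rho> \<sigma>)"
  using assms unfolding representation_def tensor_rep_def
  by (auto simp: kronecker_carrier kronecker_one kronecker_mult[of _ n n _ n _ m m _ m])

lemma tensor_equiv:
  assumes "equiv_rep G \<rho> \<rho>'" "equiv_rep G \<sigma> \<sigma>'" "representation G n \<rho>" "representation G n' \<rho>'"
    "representation G m \<sigma>" "representation G m' \<sigma>'"
  shows "equiv_rep G (tensor_rep \<rho> \<sigma>) (tensor_rep \<rho>' \<sigma>')"
proof -
  obtain T S where TS: "n = n'" "T \<in> carrier_mat n n" "S \<in> carrier_mat n n" "T * S = 1\<^sub>m n" "S * T = 1\<^sub>m n"
    "\<And>g. g \<in> carrier G \<Longrightarrow> T * \<rho> g = \<rho>' g * T"
    using equiv_repE[OF assms(1,3,4)] by metis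
  obtain T' S' where TS': "m = m'" "T' \<in> carrier_mat m m" "S' \<in> carrier_mat m m" "T' * S' = 1\<^sub>m m" "S' * T' = 1\<^sub>m m"
    "\<And>g. g \<in> carrier G \<Longrightarrow> T' * \<sigma> g = \<sigma>' g * T'"
    using equiv_repE[OF assms(2,5,6)] by metis
  note km = kronecker_mult[of _ n n _ n _ m m _ m]
  show ?thesis
  proof (rule equiv_repI[OF tensor_representation[OF assms(3,5)] tensor_representation[OF assms(4,6)],
        of "kronecker T T'" "kronecker S S'"])
    show "kronecker T T' \<in> carrier_mat (n' * m') (n * m)" "kronecker S S' \<in> carrier_mat (n * m) (n' * m')"
      using kronecker_carrier[OF TS(2) TS'(2)] kronecker_carrier[OF TS(3) TS'(3)] TS(1) TS'(1) by auto
    show "kronecker T T' * kronecker S S' = 1\<^sub>m (n' * m')"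
      using km[OF TS(2,3) TS'(2,3)] TS TS' by (simp add: kronecker_one)
    show "kronecker S S' * kronecker T T' = 1\<^sub>m (n * m)"
      using km[OF TS(3,2) TS'(3,2)] TS TS' by (simp add: kronecker_one)
    fix g assume g: "g \<in> carrier G"
    have c: "\<rho> g \<in> carrier_mat n n" "\<rho>' g \<in> carrier_mat n n" "\<sigma> g \<in> carrier_mat m m" "\<sigma>' g \<in> carrier_mat m m"
      using assms(3-6) TS(1) TS'(1) g by (auto simp: representation_def)
    show "kronecker T T' * tensor_rep \<rho> \<sigma> g = tensor_rep \<rho>' \<sigma>' g * kronecker T T'"
      unfolding tensor_rep_def km[OF TS(2) c(1) TS'(2) c(3)] km[OF c(2) TS(2) c(4) TS'(2)] TS(6)[OF g] TS'(6)[OF g] ..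
  qed
qed

lemma Hom_rep_vectorspace:
  assumes "representation G n \<rho>" "representation G m \<sigma>"
  shows "vectorspace (class_ring :: complex ring) ((module_mat TYPE(complex) m n)\<lparr>carrier := Hom_rep G \<rho> \<sigma>\<rparr>)"
proof -
  interpret M: vectorspace "class_ring :: complex ring" "module_mat TYPE(complex) m n" by (rule matrix_vs)
  have c: "\<rho> g \<in> carrier_mat n n" "\<sigma> g \<in> carrier_mat m m" if "g \<in> carrier G" for g
    using assms that by (auto simp: representation_def)
  have "VectorSpace.subspace class_ring (Hom_rep G \<rho> \<sigma>) (module_mat TYPE(complex) m n)"
    unfolding VectorSpace.subspace_def LinearCombinations.submodule_def module_mat_simps Hom_rep_iff[OF assms] class_ring_simps
    using M.vectorspace_axioms M.module_axioms
    by (auto simp: Hom_rep_iff[OF assms] add_mult_distrib_mat[OF _ _ c(1)] mult_add_distrib_mat[OF c(2)]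
        mult_smult_distrib[OF c(2)] mult_smult_assoc_mat[OF _ c(1)] left_mult_zero_mat[OF c(1)] right_mult_zero_mat[OF c(2)])
  then show ?thesis by (rule M.subspace_is_vs)
qed

text \<open>Composition with the two equivalences, \<open>F X = T' * X * S\<close>, is a linear
  bijection of the Hom spaces with inverse \<open>F'\<close>. The finiteness assumption is what
  \<open>linear_map.dim_eq\<close> asks for.\<close>

lemma dim_Hom_rep_equiv_fin_dim:
  assumes eq: "equiv_rep G \<rho> \<rho>'" "equiv_rep G \<sigma> \<sigma>'"
    and rep: "representation G n \<rho>" "representation G n' \<rho>'" "representation G m \<sigma>" "representation G m' \<sigma>'"
    and fin: "vectorspace.fin_dim class_ring ((module_mat TYPE(complex) m n)\<lparr>carrier := Hom_rep G \<rho> \<sigma>\<rparr>)"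
  shows "dim_Hom_rep G \<rho> \<sigma> = dim_Hom_rep G \<rho>' \<sigma>'"
proof -
  obtain T S where TS: "n = n'" "T \<in> carrier_mat n n" "S \<in> carrier_mat n n" "T * S = 1\<^sub>m n" "S * T = 1\<^sub>m n"
    "\<And>g. g \<in> carrier G \<Longrightarrow> T * \<rho> g = \<rho>' g * T"
    using equiv_repE[OF eq(1) rep(1,2)] by metis
  obtain T' S' where TS': "m = m'" "T' \<in> carrier_mat m m" "S' \<in> carrier_mat m m" "T' * S' = 1\<^sub>m m" "S' * T' = 1\<^sub>m m"
    "\<And>g. g \<in> carrier G \<Longrightarrow> T' * \<sigma> g = \<sigma>' g * T'"
    using equiv_repE[OF eq(2) rep(3,4)] by metis
  note rep' = rep[folded TS(1) TS'(1)]
  define V where "V = (module_mat TYPE(complex) m n)\<lparr>carrier := Hom_rep G \<rho> \<sigma>\<rparr>"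
  define W where "W = (module_mat TYPE(complex) m n)\<lparr>carrier := Hom_rep G \<rho>' \<sigma>'\<rparr>"
  define F where "F X = T' * X * S" for X
  define F' where "F' X = S' * X * T" for X
  have vs: "vectorspace class_ring V" "vectorspace class_ring W"
    unfolding V_def W_def by (intro Hom_rep_vectorspace rep')+
  note S = intertwiner_inverse[OF rep'(1,2) _ TS(2-5) TS(6)]
  note S' = intertwiner_inverse[OF rep'(3,4) _ TS'(2-5) TS'(6)]
  have key: "A' * X * B \<in> Hom_rep G \<mu>' \<nu>'"
    if r: "representation G n \<mu>" "representation G m \<nu>" "representation G n \<mu>'" "representation G m \<nu>'"
      and A: "A' \<in> carrier_mat m m" "\<And>g. g \<in> carrier G \<Longrightarrow> A' * \<nu> g = \<nu>' g * A'"
      and B: "B \<in> carrier_mat n n" "\<And>g. g \<in> carrier G \<Longrightarrow> B * \<mu>' g = \<mu> g * B"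
      and X: "X \<in> Hom_rep G \<mu> \<nu>" for A' B X \<mu> \<nu> \<mu>' \<nu>'
    unfolding Hom_rep_iff[OF r(3,4)]
  proof (intro conjI ballI)
    have Xc: "X \<in> carrier_mat m n" "\<And>g. g \<in> carrier G \<Longrightarrow> X * \<mu> g = \<nu> g * X" using X Hom_rep_iff[OF r(1,2)] by auto
    show "A' * X * B \<in> carrier_mat m n" using A(1) B(1) Xc by auto
    fix g assume g: "g \<in> carrier G"
    have c: "\<mu> g \<in> carrier_mat n n" "\<nu> g \<in> carrier_mat m m" "\<mu>' g \<in> carrier_mat n n" "\<nu>' g \<in> carrier_mat m m"
      using r g by (auto simp: representation_def)
    have "A' * X * B * \<mu>' g = A' * X * (B * \<mu>' g)" using A(1) B(1) Xc(1) c by (intro assoc_mult_mat) auto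
    also have "\<dots> = A' * (X * \<mu> g) * B"
      unfolding B(2)[OF g] using A(1) B(1) Xc(1) c
      by (simp add: assoc_mult_mat[of _ m m _ n _ n] assoc_mult_mat[of _ m n _ n _ n])
    also have "\<dots> = (A' * \<nu> g) * X * B"
      unfolding Xc(2)[OF g] using A(1) B(1) Xc(1) c
      by (simp add: assoc_mult_mat[of _ m m _ m _ n])
    also have "\<dots> = \<nu>' g * (A' * X * B)"
      unfolding A(2)[OF g] using A(1) B(1) Xc(1) c
      by (simp add: assoc_mult_mat[of _ m m _ m _ n] assoc_mult_mat[of _ m m _ n _ n])
    finally show "A' * X * B * \<mu>' g = \<nu>' g * (A' * X * B)" .
  qed
  have FV: "F X \<in> Hom_rep G \<rho>' \<sigma>'" if "X \<in> Hom_rep G \<rho> \<sigma>" for X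
    unfolding F_def by (rule key[OF rep'(1,3,2,4) TS'(2,6) TS(3) S that])
  have FW: "F' X \<in> Hom_rep G \<rho> \<sigma>" if "X \<in> Hom_rep G \<rho>' \<sigma>'" for X
    unfolding F'_def by (rule key[OF rep'(2,4,1,3) TS'(3) S' TS(2,6) that])
  have Hc: "X \<in> carrier_mat m n" if "X \<in> Hom_rep G \<rho> \<sigma> \<or> X \<in> Hom_rep G \<rho>' \<sigma>'" for X
    using that Hom_rep_iff[OF rep'(1,3)] Hom_rep_iff[OF rep'(2,4)] by auto
  have canc: "A' * (B' * X * B) * A = X"
    if "A' \<in> carrier_mat m m" "B' \<in> carrier_mat m m" "A \<in> carrier_mat n n" "B \<in> carrier_mat n n" "X \<in> carrier_mat m n"
      "A' * B' = 1\<^sub>m m" "B * A = 1\<^sub>m n" for A' B' A B X :: "cmat"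
  proof -
    have "A' * (B' * X * B) * A = (A' * B') * X * (B * A)"
      using that(1-5)
      by (simp add: assoc_mult_mat[of _ m m _ m _ n] assoc_mult_mat[of _ m m _ n _ n] assoc_mult_mat[of _ m n _ n _ n])
    then show ?thesis unfolding that(6,7) left_mult_one_mat[OF that(5)] right_mult_one_mat[OF that(5)] .
  qed
  have FF: "F' (F X) = X" "F (F' X) = X" if "X \<in> carrier_mat m n" for X
    unfolding F_def F'_def using canc that TS TS' by blast+
  have bij: "inj_on F (carrier V)" "F ` carrier V = carrier W"
  proof -
    show "inj_on F (carrier V)" by (rule inj_on_inverseI[of _ F']) (simp add: V_def FF(1) Hc)
    show "F ` carrier V = carrier W" unfolding V_def W_def
      using FV FW FF(2) Hc by (auto simp: image_iff) (metis)
  qed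
  have lin: "F (X + X') = F X + F X'" "F (c \<cdot>\<^sub>m X) = c \<cdot>\<^sub>m F X"
    if "X \<in> carrier_mat m n" "X' \<in> carrier_mat m n" for X X' c
    using that TS'(2) TS(3) by (simp_all add: F_def mult_add_distrib_mat[of _ m m _ n] add_mult_distrib_mat[of _ m n _ _ n]
        mult_smult_distrib[of _ m m _ n] mult_smult_assoc_mat[of _ m n _ n])
  have lF: "linear_map class_ring V W F"
    unfolding linear_map_def mod_hom_def mod_hom_axioms_def module_hom_def
    using vs FV lin(1) lin(2)[OF _ zero_carrier_mat] Hc
    by (auto simp: vectorspace_def V_def W_def module_mat_simps class_ring_simps)
  have "vectorspace.dim class_ring V = vectorspace.dim class_ring W"
    by (rule linear_map.dim_eq[OF lF fin[folded V_def] bij])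
  then show ?thesis
    unfolding dim_Hom_rep_def representation_degree[OF rep'(1)] representation_degree[OF rep'(2)]
      representation_degree[OF rep'(3)] representation_degree[OF rep'(4)] V_def W_def .
qed

text \<open>Equivalence is symmetric, so finite dimension of either space suffices. If neither were
  finite-dimensional, both dimensions would be \<open>LEAST\<close> of the same empty predicate;
  treating this case spares a proof that Hom spaces have finite dimension.\<close>

lemma dim_Hom_rep_equiv:
  assumes eq: "equiv_rep G \<rho> \<rho>'" "equiv_rep G \<sigma> \<sigma>'"
    and rep: "representation G n \<rho>" "representation G n' \<rho>'" "representation G m \<sigma>" "representation G m' \<sigma>'"
  shows "dim_Hom_rep G \<rho> \<sigma> = dim_Hom_rep G \<rho>' \<sigma>'"
proof -
  define V where "V = (module_mat TYPE(complex) m n)\<lparr>carrier := Hom_rep G \<rho> \<sigma>\<rparr>"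
  define W where "W = (module_mat TYPE(complex) m' n')\<lparr>carrier := Hom_rep G \<rho>' \<sigma>'\<rparr>"
  note sym = equiv_rep_sym[OF eq(1) rep(1,2)] equiv_rep_sym[OF eq(2) rep(3,4)]
  consider "vectorspace.fin_dim class_ring V" | "vectorspace.fin_dim class_ring W"
    | "\<not> vectorspace.fin_dim class_ring V" "\<not> vectorspace.fin_dim class_ring W" by blast
  then show ?thesis
  proof cases
    case 1
    then show ?thesis unfolding V_def by (rule dim_Hom_rep_equiv_fin_dim[OF eq rep])
  next
    case 2
    then show ?thesis unfolding W_def by (rule dim_Hom_rep_equiv_fin_dim[OF sym rep(2,1,4,3), symmetric])
  next
    case 3
    have vs: "vectorspace class_ring V" "vectorspace class_ring W"
      unfolding V_def W_def by (intro Hom_rep_vectorspace rep)+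
    have "vectorspace.dim class_ring V = vectorspace.dim class_ring W"
      using 3 unfolding vectorspace.dim_def[OF vs(1)] vectorspace.dim_def[OF vs(2)]
        vectorspace.fin_dim_def[OF vs(1)] vectorspace.fin_dim_def[OF vs(2)]
      by (intro arg_cong[of _ _ Least] ext) blast
    then show ?thesis unfolding dim_Hom_rep_def V_def W_def representation_degree[OF rep(1)]
      representation_degree[OF rep(2)] representation_degree[OF rep(3)] representation_degree[OF rep(4)] .
  qed
qed

lemma irrep_class_some:
  assumes "irreducible_rep G \<rho>"
  shows "irreducible_rep G (SOME \<mu>. \<mu> \<in> irrep_class G \<rho>)" "equiv_rep G \<rho> (SOME \<mu>. \<mu> \<in> irrep_class G \<rho>)"
  using someI[of "\<lambda>\<mu>. \<mu> \<in> irrep_class G \<rho>", OF irrep_class_self[OF assms]] by (auto simp: irrep_class_def)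

lemma mckay_arrows_class:
  assumes "irreducible_rep G \<rho>" "irreducible_rep G \<sigma>" "representation G k Q"
  shows "mckay_arrows G Q (irrep_class G \<rho>) (irrep_class G \<sigma>) = dim_Hom_rep G \<rho> (tensor_rep Q \<sigma>)"
proof -
  note r = irrep_class_some[OF assms(1)] and s = irrep_class_some[OF assms(2)]
  note rep = irreducible_representation[OF assms(1)] irreducible_representation[OF r(1)]
    irreducible_representation[OF assms(2)] irreducible_representation[OF s(1)]
  show ?thesis
    unfolding mckay_arrows_def
    by (rule dim_Hom_rep_equiv[symmetric, OF r(2)
          tensor_equiv[OF equiv_rep_refl[OF assms(3)] s(2) assms(3,3) rep(3,4)] rep(1,2)
          tensor_representation[OF assms(3) rep(3)] tensor_representation[OF assms(3) rep(4)]])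
qed

text \<open>Twisting both arguments by \<phi> preserves intertwiners, so the arrows between the
  images are the intertwiners from \<open>\<mu> \<circ> \<phi>\<close> to the tensor product of
  \<open>Q \<circ> \<phi>\<close> and \<open>\<nu> \<circ> \<phi>\<close>. The hypothesis on
  \<open>Q\<close> replaces \<open>Q \<circ> \<phi>\<close> by \<open>Q\<close>.\<close>

lemma irrep_transport_mckay_automorphism:
  assumes pair: "SL2_pair G Q" and \<phi>: "\<phi> \<in> iso G G" "equiv_rep G (Q \<circ> \<phi>) Q"
  shows "(\<lambda>r\<in>nontriv_irreps G. irrep_transport G \<phi> r) \<in> mckay_automorphisms G Q"
  unfolding mckay_automorphisms_def
proof (intro CollectI conjI ballI)
  have grp: "Group.group G" and Q: "representation G 2 Q" using pair by (auto simp: SL2_pair_def)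
  note inv = inv_into_iso[OF grp \<phi>(1)]
  have "bij_betw (irrep_transport G \<phi>) (nontriv_irreps G) (nontriv_irreps G)"
  proof (rule bij_betw_byWitness[where f' = "irrep_transport G (inv_into (carrier G) \<phi>)"])
    show "\<forall>r\<in>nontriv_irreps G. irrep_transport G (inv_into (carrier G) \<phi>) (irrep_transport G \<phi> r) = r"
      unfolding irrep_transport_comp[OF grp grp inv(1), symmetric] using irrep_transport_ident[OF grp] inv(2) by simp
    show "\<forall>r\<in>nontriv_irreps G. irrep_transport G \<phi> (irrep_transport G (inv_into (carrier G) \<phi>) r) = r"
      unfolding irrep_transport_comp[OF grp grp \<phi>(1), symmetric] using irrep_transport_ident[OF grp] inv(3) by simp
  qed (use irrep_transport_nontriv[OF grp grp \<phi>(1)] irrep_transport_nontriv[OF grp grp inv(1)] in auto)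
  then show "(\<lambda>r\<in>nontriv_irreps G. irrep_transport G \<phi> r) \<in> Bij (nontriv_irreps G)" by (simp add: Bij_def)
  fix X Z assume X: "X \<in> nontriv_irreps G" and Z: "Z \<in> nontriv_irreps G"
  obtain r where r: "r \<in> nontriv_irreps G" "irrep_transport G \<phi> X = r" using irrep_transport_nontriv[OF grp grp \<phi>(1) X] by blast
  obtain s where s: "s \<in> nontriv_irreps G" "irrep_transport G \<phi> Z = s" using irrep_transport_nontriv[OF grp grp \<phi>(1) Z] by blast
  obtain \<mu> where \<mu>: "irreducible_rep G \<mu>" "r = irrep_class G \<mu>" using nontriv_irrepsE[OF r(1)] by metis
  obtain \<nu> where \<nu>: "irreducible_rep G \<nu>" "s = irrep_class G \<nu>" using nontriv_irrepsE[OF s(1)] by metis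
  have "\<mu> \<circ> \<phi> \<in> X" using irrep_class_self[OF \<mu>(1)] \<mu>(2) r(2) by (auto simp: irrep_transport_def)
  then have X': "X = irrep_class G (\<mu> \<circ> \<phi>)" using nontriv_irrepsE[OF X] irrep_class_member(1) by metis
  have "\<nu> \<circ> \<phi> \<in> Z" using irrep_class_self[OF \<nu>(1)] \<nu>(2) s(2) by (auto simp: irrep_transport_def)
  then have Z': "Z = irrep_class G (\<nu> \<circ> \<phi>)" using nontriv_irrepsE[OF Z] irrep_class_member(1) by metis
  have irr: "irreducible_rep G (\<mu> \<circ> \<phi>)" "irreducible_rep G (\<nu> \<circ> \<phi>)" using irreducible_rep_twist[OF grp grp \<phi>(1)] \<mu>(1) \<nu>(1) by auto
  have Q': "representation G 2 (Q \<circ> \<phi>)" using representation_twist[OF grp grp \<phi>(1)] Q by blast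
  have tw: "tensor_rep Q \<nu> \<circ> \<phi> = tensor_rep (Q \<circ> \<phi>) (\<nu> \<circ> \<phi>)" by (auto simp: tensor_rep_def)
  have "mckay_arrows G Q X Z = dim_Hom_rep G (\<mu> \<circ> \<phi>) (tensor_rep Q (\<nu> \<circ> \<phi>))"
    unfolding X' Z' by (rule mckay_arrows_class[OF irr Q])
  also have "\<dots> = dim_Hom_rep G (\<mu> \<circ> \<phi>) (tensor_rep Q \<nu> \<circ> \<phi>)"
    unfolding tw
    by (rule dim_Hom_rep_equiv[symmetric, OF equiv_rep_refl tensor_equiv[OF \<phi>(2) equiv_rep_refl]])
      (rule irreducible_representation irr Q Q' tensor_representation)+
  also have "\<dots> = dim_Hom_rep G \<mu> (tensor_rep Q \<nu>)"
  proof -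
    interpret group_hom G G \<phi> using \<phi>(1) grp by (auto simp: group_hom_def group_hom_axioms_def iso_def)
    show ?thesis unfolding dim_Hom_rep_def Hom_rep_twist[OF grp grp \<phi>(1)] degree_rep_def by simp
  qed
  also have "\<dots> = mckay_arrows G Q r s" unfolding \<mu>(2) \<nu>(2) by (rule mckay_arrows_class[OF \<mu>(1) \<nu>(1) Q, symmetric])
  finally show "mckay_arrows G Q ((\<lambda>r\<in>nontriv_irreps G. irrep_transport G \<phi> r) X) ((\<lambda>r\<in>nontriv_irreps G. irrep_transport G \<phi> r) Z) = mckay_arrows G Q X Z"
    using X Z r(2) s(2) by simp
qed

section \<open>The linear action on \<open>\<complex>\<^sup>k \<times> \<complex>\<^sup>2\<close>\<close>

lemma
  fixes M :: "complex ^ 'n ^ 'n"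
  assumes "invertible M"
  shows matrix_inv_left: "matrix_inv M ** M = Finite_Cartesian_Product.mat 1"
    and matrix_inv_right: "M ** matrix_inv M = Finite_Cartesian_Product.mat 1"
proof -
  have "M ** matrix_inv M = Finite_Cartesian_Product.mat 1 \<and> matrix_inv M ** M = Finite_Cartesian_Product.mat 1"
    unfolding matrix_inv_def by (rule someI_ex) (use assms in \<open>simp add: invertible_def\<close>)
  then show "matrix_inv M ** M = Finite_Cartesian_Product.mat 1" "M ** matrix_inv M = Finite_Cartesian_Product.mat 1" by auto
qed

abbreviation I2 :: "complex ^ 2 ^ 2" where "I2 \<equiv> Finite_Cartesian_Product.mat 1"

definition idx2 :: "nat \<Rightarrow> 2" where
  "idx2 i = (if i = 0 then 1 else 2)"

text \<open>A bridge between two matrix types: charts use the finite Cartesian product,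
  representations use matrices with explicit dimensions.\<close>

definition jnf_mat :: "complex ^ 2 ^ 2 \<Rightarrow> cmat" where
  "jnf_mat M = Matrix.mat 2 2 (\<lambda>(i, j). M $ idx2 i $ idx2 j)"

definition jnf_vec :: "complex ^ 2 \<Rightarrow> cvec" where
  "jnf_vec w = Matrix.vec 2 (\<lambda>i. w $ idx2 i)"

lemma jnf_carrier [simp]: "jnf_mat M \<in> carrier_mat 2 2" "jnf_vec w \<in> carrier_vec 2"
  by (auto simp: jnf_mat_def jnf_vec_def)

lemma jnf_mat_entries: "jnf_mat M $$ (0,0) = M $ 1 $ 1" "jnf_mat M $$ (0,1) = M $ 1 $ 2"
  "jnf_mat M $$ (1,0) = M $ 2 $ 1" "jnf_mat M $$ (1,1) = M $ 2 $ 2"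
  by (auto simp: jnf_mat_def idx2_def)

lemma jnf_vec_entries: "(jnf_vec w) $v 0 = w $ 1" "(jnf_vec w) $v 1 = w $ 2"
  by (auto simp: jnf_vec_def idx2_def)

lemma jnf_mat_mult: "jnf_mat (M ** N) = jnf_mat M * jnf_mat N"
proof (subst mat_2_eq_iff)
  have e: "(jnf_mat M * jnf_mat N) $$ (i, j) = jnf_mat M $$ (i, 0) * jnf_mat N $$ (0, j) + jnf_mat M $$ (i, 1) * jnf_mat N $$ (1, j)"
    if "i < 2" "j < 2" for i j
    using index_mult_sum[OF jnf_carrier(1) jnf_carrier(1) that] by (simp add: numeral_2_eq_2)
  show "jnf_mat (M ** N) $$ (0, 0) = (jnf_mat M * jnf_mat N) $$ (0, 0) \<and>
    jnf_mat (M ** N) $$ (0, 1) = (jnf_mat M * jnf_mat N) $$ (0, 1) \<and>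
    jnf_mat (M ** N) $$ (1, 0) = (jnf_mat M * jnf_mat N) $$ (1, 0) \<and>
    jnf_mat (M ** N) $$ (1, 1) = (jnf_mat M * jnf_mat N) $$ (1, 1)"
    by (simp add: e jnf_mat_entries matrix_matrix_mult_def sum_2 del: One_nat_def index_mult_mat)
qed (auto intro!: mult_carrier_mat[of _ 2 2])

lemma jnf_mat_one: "jnf_mat I2 = 1\<^sub>m 2"
  by (subst mat_2_eq_iff) (simp_all add: jnf_mat_entries Finite_Cartesian_Product.mat_def del: One_nat_def)

lemma jnf_mat_inj: "jnf_mat M = jnf_mat N \<longleftrightarrow> M = N"
  by (subst mat_2_eq_iff) (auto simp: jnf_mat_entries Finite_Cartesian_Product.vec_eq_iff forall_2 simp del: One_nat_def)

lemma jnf_vec_inj: "jnf_vec v = jnf_vec w \<longleftrightarrow> v = w"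
proof
  assume "jnf_vec v = jnf_vec w"
  then have "v $ 1 = w $ 1" "v $ 2 = w $ 2" using jnf_vec_entries by metis+
  then show "v = w" by (simp add: Finite_Cartesian_Product.vec_eq_iff forall_2)
qed simp

lemma jnf_det: "Determinant.det (jnf_mat M) = Determinants.det M"
  using det_2_entries[OF jnf_carrier(1), of M] by (simp add: jnf_mat_entries Determinants.det_2 del: One_nat_def)

lemma jnf_mult_vec: "jnf_mat M *\<^sub>v jnf_vec w = jnf_vec (M *v w)"
proof (rule eq_vecI)
  fix i assume "i < dim_vec (jnf_vec (M *v w))"
  then have i: "i < 2" by (simp add: jnf_vec_def)
  then have "(jnf_mat M *\<^sub>v jnf_vec w) $v i =
      jnf_mat M $$ (i, 0) * (jnf_vec w) $v 0 + jnf_mat M $$ (i, 1) * (jnf_vec w) $v 1"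
    by (simp add: scalar_prod_def jnf_mat_def jnf_vec_def numeral_2_eq_2)
  then show "(jnf_mat M *\<^sub>v jnf_vec w) $v i = (jnf_vec (M *v w)) $v i"
    using i by (auto simp: jnf_vec_entries jnf_mat_def jnf_vec_def idx2_def matrix_vector_mult_def sum_2)
qed (auto simp: jnf_mat_def jnf_vec_def)

lemma jnf_vec_zero: "jnf_vec w = 0\<^sub>v 2 \<longleftrightarrow> w = 0"
proof -
  have "jnf_vec 0 = 0\<^sub>v 2" by (rule eq_vecI) (auto simp: jnf_vec_def)
  then show ?thesis using jnf_vec_inj by metis
qed

lemma jnf_vec_add: "jnf_vec (v + w) = jnf_vec v + jnf_vec w"
  by (rule eq_vecI) (auto simp: jnf_vec_def)

lemma jnf_vec_smult: "jnf_vec (a *s v) = a \<cdot>\<^sub>v jnf_vec v"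
  by (rule eq_vecI) (auto simp: jnf_vec_def)

lemma jnf_vec_surj: "w \<in> carrier_vec 2 \<Longrightarrow> \<exists>v. jnf_vec v = w"
  by (rule exI[of _ "\<chi> j. w $v (if j = 1 then 0 else 1)"])
    (auto simp: jnf_vec_def idx2_def less_2_cases_iff intro!: eq_vecI)

text \<open>A fixed nonzero vector is an eigenvector for the eigenvalue 1, so
  \<open>double_eigenvalue\<close> applies, with \<Gamma> regarded as an abstract group in its
  standard representation \<open>jnf_mat\<close>.\<close>

lemma SL2_subgroup_free:
  assumes \<Gamma>: "finite_SL2_subgroup \<Gamma>" and M: "M \<in> \<Gamma>" and w: "w \<noteq> 0" "M *v w = w"
  shows "M = I2"
proof -
  define G where "G = \<lparr>carrier = \<Gamma>, mult = (**), one = I2\<rparr>"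
  note S = \<Gamma>[unfolded finite_SL2_subgroup_def]
  have grp: "Group.group G"
  proof (rule groupI)
    fix x assume "x \<in> carrier G"
    then have x: "x \<in> \<Gamma>" by (simp add: G_def)
    then have "invertible x" using S by (auto simp: invertible_det_nz)
    then have "matrix_inv x ** x = I2" by (simp add: matrix_inv_left)
    then show "\<exists>y\<in>carrier G. y \<otimes>\<^bsub>G\<^esub> x = \<one>\<^bsub>G\<^esub>" using S x by (auto simp: G_def)
  qed (use S in \<open>auto simp: G_def matrix_mul_assoc\<close>)
  interpret sl2_group G jnf_mat
  proof (intro sl2_group.intro finite_group.intro sl2_group_axioms.intro finite_group_axioms.intro grp)
    show "finite (carrier G)" using S by (simp add: G_def)
    show "representation G 2 jnf_mat" by (auto simp: representation_def G_def jnf_mat_mult jnf_mat_one)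
    show "inj_on jnf_mat (carrier G)" by (auto simp: inj_on_def jnf_mat_inj)
    show "Determinant.det (jnf_mat g) = 1" if "g \<in> carrier G" for g using S that by (auto simp: G_def jnf_det)
  qed
  have "jnf_mat M = 1 \<cdot>\<^sub>m 1\<^sub>m 2"
  proof (rule double_eigenvalue[of M "jnf_vec w"])
    show "jnf_mat M *\<^sub>v jnf_vec w = 1 \<cdot>\<^sub>v jnf_vec w" unfolding jnf_mult_vec w(2) by simp
  qed (use M w(1) in \<open>simp_all add: G_def jnf_vec_zero\<close>)
  then have "jnf_mat M = jnf_mat I2" by (simp add: one_smult_one_mat jnf_mat_one)
  then show ?thesis by (simp add: jnf_mat_inj)
qed

locale split_coordinates =
  fixes e :: "2 \<Rightarrow> 'd::finite"
  assumes inj_e: "inj e"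
begin

definition normal_part :: "complex ^ 'd \<Rightarrow> complex ^ 2" where
  "normal_part v = (\<chi> j. v $ e j)"

definition normal_embed :: "complex ^ 2 \<Rightarrow> complex ^ 'd" where
  "normal_embed w = (\<chi> i. if i \<in> range e then w $ inv_into UNIV e i else 0)"

lemma first_factor_iff: "v \<in> first_factor e \<longleftrightarrow> normal_part v = 0"
  by (simp add: first_factor_def normal_part_def Finite_Cartesian_Product.vec_eq_iff)

lemma normal_part_embed [simp]: "normal_part (normal_embed w) = w"
  using inj_e by (simp add: normal_part_def normal_embed_def Finite_Cartesian_Product.vec_eq_iff)

lemma normal_part_linear: "normal_part (v + w) = normal_part v + normal_part w"
  "normal_part (v - w) = normal_part v - normal_part w" "normal_part (a *s v) = a *s normal_part v"
  "normal_part (c *\<^sub>R v) = c *\<^sub>R normal_part v"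
  by (simp_all add: normal_part_def Finite_Cartesian_Product.vec_eq_iff)

lemma normal_embed_linear: "normal_embed (v + w) = normal_embed v + normal_embed w"
  "normal_embed (a *s v) = a *s normal_embed v"
  by (simp_all add: normal_embed_def Finite_Cartesian_Product.vec_eq_iff)

lemma bounded_linear_normal_part: "bounded_linear normal_part"
  by (rule linear_conv_bounded_linear[THEN iffD1], rule linearI) (simp_all add: normal_part_linear)

lemma normal_part_act2 [simp]: "normal_part (act2 e M v) = M *v normal_part v"
  using inj_e by (simp add: normal_part_def act2_def Finite_Cartesian_Product.vec_eq_iff)

lemma act2_eq_iff: "v = w \<longleftrightarrow> normal_part v = normal_part w \<and> (\<forall>i. i \<notin> range e \<longrightarrow> v $ i = w $ i)"
proof
  assume r: "normal_part v = normal_part w \<and> (\<forall>i. i \<notin> range e \<longrightarrow> v $ i = w $ i)"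
  have "v $ i = w $ i" for i
  proof (cases "i \<in> range e")
    case True
    then obtain j where "i = e j" by blast
    moreover have "normal_part v $ j = normal_part w $ j" using r by simp
    ultimately show ?thesis by (simp add: normal_part_def)
  qed (use r in simp)
  then show "v = w" by (simp add: Finite_Cartesian_Product.vec_eq_iff)
qed simp

lemma normal_embed_outside: "i \<notin> range e \<Longrightarrow> normal_embed w $ i = 0"
  by (simp add: normal_embed_def)

lemma act2_outside: "i \<notin> range e \<Longrightarrow> act2 e M v $ i = v $ i"
  by (simp add: act2_def)

lemma act2_mult: "act2 e (M ** N) v = act2 e M (act2 e N v)"
  by (subst act2_eq_iff) (simp add: act2_outside matrix_vector_mul_assoc)

lemma act2_one: "act2 e I2 v = v"
  by (subst act2_eq_iff) (simp add: act2_outside)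

lemma act2_linear: "act2 e M (v + w) = act2 e M v + act2 e M w" "act2 e M (a *s v) = a *s act2 e M v"
  "act2 e M (c *\<^sub>R v) = c *\<^sub>R act2 e M v"
proof -
  show "act2 e M (v + w) = act2 e M v + act2 e M w"
    by (subst act2_eq_iff) (simp add: act2_outside normal_part_linear matrix_vector_right_distrib)
  show "act2 e M (a *s v) = a *s act2 e M v"
    by (subst act2_eq_iff) (simp add: act2_outside normal_part_linear vector_scalar_commute)
  have "M *v (c *\<^sub>R w) = c *\<^sub>R (M *v w)" for w
    by (simp add: matrix_vector_mult_def Finite_Cartesian_Product.vec_eq_iff sum_2 scaleR_add_right)
  then show "act2 e M (c *\<^sub>R v) = c *\<^sub>R act2 e M v"
    by (subst act2_eq_iff) (simp add: act2_outside normal_part_linear)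
qed

lemma bounded_linear_act2: "bounded_linear (act2 e M)"
  by (rule linear_conv_bounded_linear[THEN iffD1], rule linearI) (simp_all add: act2_linear)

lemma act2_first_factor [simp]: "v \<in> first_factor e \<Longrightarrow> act2 e M v = v"
  by (subst act2_eq_iff) (simp add: act2_outside first_factor_iff)

lemma act2_embed: "act2 e M (normal_embed w) = normal_embed (M *v w)"
  by (subst act2_eq_iff) (simp add: act2_outside normal_embed_outside)

lemma act2_free:
  assumes "finite_SL2_subgroup \<Gamma>" "M \<in> \<Gamma>" "N \<in> \<Gamma>" "v \<notin> first_factor e" "act2 e M v = act2 e N v"
  shows "M = N"
proof -
  note S = assms(1)[unfolded finite_SL2_subgroup_def]
  have inv: "invertible N" using S assms(3) by (auto simp: invertible_det_nz)
  have "act2 e (matrix_inv N ** M) v = act2 e (matrix_inv N ** N) v" by (simp only: act2_mult assms(5))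
  then have "act2 e (matrix_inv N ** M) v = v" by (simp add: matrix_inv_left[OF inv] act2_one)
  then have "(matrix_inv N ** M) *v normal_part v = normal_part v" by (metis normal_part_act2)
  then have "matrix_inv N ** M = I2"
    using SL2_subgroup_free[OF assms(1)] S assms(2-4) by (simp add: first_factor_iff)
  then have "N ** (matrix_inv N ** M) = N" by simp
  then show ?thesis by (simp add: matrix_mul_assoc matrix_inv_right[OF inv])
qed

text \<open>\<open>first_factor e\<close> has empty interior, witnessed by a short ray in a normal
  direction. The explicit ray serves both for one point off \<open>first_factor e\<close> near
  \<open>x\<close> and for a sequence of such points converging to \<open>x\<close>.\<close>

lemma open_not_subset_first_factor:
  assumes "open B" "x \<in> B"
  obtains t :: real where "t > 0" "\<And>s. 0 < s \<Longrightarrow> s < t \<Longrightarrow> x + s *\<^sub>R normal_embed (axis 1 1) \<in> B"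
    "\<And>s. x \<in> first_factor e \<Longrightarrow> s \<noteq> 0 \<Longrightarrow> x + s *\<^sub>R normal_embed (axis 1 1) \<notin> first_factor e"
proof -
  obtain r where r: "r > 0" "ball x r \<subseteq> B" using assms open_contains_ball by blast
  define u where "u = normal_embed (axis 1 1)"
  have u0: "u \<noteq> 0"
  proof
    assume "u = 0"
    then have "normal_part u = 0" by (simp add: normal_part_def Finite_Cartesian_Product.vec_eq_iff)
    then show False by (simp add: u_def axis_eq_0_iff)
  qed
  show ?thesis
  proof (rule that[of "r / norm u"])
    show "r / norm u > 0" using r u0 by simp
    fix s :: real
    show "x + s *\<^sub>R normal_embed (axis 1 1) \<in> B" if "0 < s" "s < r / norm u"
    proof -
      have "s * norm u < r" using that u0 by (simp add: field_simps)
      then have "dist x (x + s *\<^sub>R u) < r" using that by (simp add: dist_norm)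
      then show ?thesis using r(2) by (auto simp: u_def)
    qed
    show "x + s *\<^sub>R normal_embed (axis 1 1) \<notin> first_factor e" if "x \<in> first_factor e" "s \<noteq> 0"
      using that by (simp add: first_factor_iff normal_part_linear axis_eq_0_iff)
  qed
qed

text \<open>Two points outside \<open>first_factor e\<close> span a complex line that meets it in at most one
  point.\<close>

lemma connected_minus_first_factor:
  assumes B: "open B" "convex B"
  shows "connected (B - first_factor e)"
  unfolding connected_iff_connected_component
proof (intro ballI)
  fix u v assume u: "u \<in> B - first_factor e" and v: "v \<in> B - first_factor e"
  \<comment> \<open>The complex line through \<open>u\<close> and \<open>v\<close>. Its part in
    \<open>B\<close> is parametrised by a convex open set \<open>P\<close> of complex numbers, which
    stays connected when a countable set is removed.\<close>
  define l where "l s = u + s *s (v - u)" for s :: complex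
  have lin: "bounded_linear (\<lambda>s. s *s (v - u))"
    by (rule linear_conv_bounded_linear[THEN iffD1], rule linearI)
      (simp_all add: Finite_Cartesian_Product.vec_eq_iff algebra_simps)
  have cont: "continuous_on T l" for T
    unfolding l_def by (intro continuous_intros linear_continuous_on[OF lin])
  define P where "P = l -` B"
  have P: "open P" unfolding P_def using open_vimage[OF B(1)] cont by blast
  have cvx: "convex P"
  proof (rule convexI)
    fix x y and a b :: real assume xy: "x \<in> P" "y \<in> P" and ab: "0 \<le> a" "0 \<le> b" "a + b = 1"
    have "l (a *\<^sub>R x + b *\<^sub>R y) = a *\<^sub>R l x + b *\<^sub>R l y"
    proof -
      have "u = a *\<^sub>R u + b *\<^sub>R u" using ab by (metis scaleR_add_left scaleR_one)
      moreover have "(a *\<^sub>R x + b *\<^sub>R y) *s (v - u) = a *\<^sub>R (x *s (v - u)) + b *\<^sub>R (y *s (v - u))"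
        by (simp add: Finite_Cartesian_Product.vec_eq_iff algebra_simps)
      ultimately show ?thesis unfolding l_def by (simp add: scaleR_add_right)
    qed
    then show "a *\<^sub>R x + b *\<^sub>R y \<in> P" using convexD[OF B(2)] xy ab by (simp add: P_def)
  qed
  define N where "N = {s. l s \<in> first_factor e}"
  have uniq: "s = t" if "s \<in> N" "t \<in> N" for s t
  proof (rule ccontr)
    assume "s \<noteq> t"
    have z: "normal_part u + s *s normal_part (v - u) = 0" "normal_part u + t *s normal_part (v - u) = 0"
      using that by (auto simp: N_def l_def first_factor_iff normal_part_linear)
    then have "s *s normal_part (v - u) = t *s normal_part (v - u)" by (metis add_left_cancel)
    then have "s * normal_part (v - u) $ j = t * normal_part (v - u) $ j" for j
      by (metis vector_smult_component)
    then have "normal_part (v - u) = 0" using \<open>s \<noteq> t\<close> by (simp add: Finite_Cartesian_Product.vec_eq_iff)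
    then show False using z(1) u by (simp add: first_factor_iff)
  qed
  have "countable N"
  proof (cases "N = {}")
    case False
    then obtain s where "s \<in> N" by blast
    then have "N = {s}" using uniq by blast
    then show ?thesis by simp
  qed simp
  then have con: "connected (P - N)" using connected_open_diff_countable[of P N] P convex_connected[OF cvx] by simp
  have img: "connected (l ` (P - N))" by (rule connected_continuous_image[OF cont con])
  have "u = l 0" "v = l 1" by (simp_all add: l_def)
  then have "u \<in> l ` (P - N)" "v \<in> l ` (P - N)" using u v unfolding P_def N_def by (blast, blast)
  moreover have "l ` (P - N) \<subseteq> B - first_factor e" by (auto simp: P_def N_def)
  ultimately show "connected_component (B - first_factor e) u v"
    using img by (auto simp: connected_component_def)
qed

text \<open>Off \<open>first_factor e\<close>, which does not disconnect \<open>B\<close>, the group element is unique, hence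
  locally constant.\<close>

lemma lifts_differ_by_element:
  assumes \<Gamma>: "finite_SL2_subgroup \<Gamma>" and B: "open B" "convex B"
    and f: "continuous_on B f" and k: "continuous_on B k"
    and lift: "\<And>z. z \<in> B \<Longrightarrow> \<exists>M\<in>\<Gamma>. f z = act2 e M (k z)"
    and ff: "\<And>z. z \<in> B \<Longrightarrow> k z \<in> first_factor e \<longleftrightarrow> z \<in> first_factor e"
  shows "\<exists>M\<in>\<Gamma>. \<forall>z\<in>B. f z = act2 e M (k z)"
proof (cases "B - first_factor e = {}")
  case True
  have "B = {}"
  proof (rule ccontr)
    assume "B \<noteq> {}"
    then obtain x where x: "x \<in> B" by blast
    then obtain t :: real where t: "t > 0" "\<And>s. 0 < s \<Longrightarrow> s < t \<Longrightarrow> x + s *\<^sub>R normal_embed (axis 1 1) \<in> B"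
      "\<And>s. x \<in> first_factor e \<Longrightarrow> s \<noteq> 0 \<Longrightarrow> x + s *\<^sub>R normal_embed (axis 1 1) \<notin> first_factor e"
      using open_not_subset_first_factor[OF B(1)] by metis
    have "x \<in> first_factor e" using True x by blast
    then have "x + (t/2) *\<^sub>R normal_embed (axis 1 1) \<in> B - first_factor e" using t(1) t(2)[of "t/2"] t(3)[of "t/2"] by simp
    then show False using True by blast
  qed
  then show ?thesis using \<Gamma> by (auto simp: finite_SL2_subgroup_def)
next
  case False
  define B' where "B' = B - first_factor e"
  define P where "P M = {z \<in> B'. f z = act2 e M (k z)}" for M
  have fin: "finite \<Gamma>" using \<Gamma> by (simp add: finite_SL2_subgroup_def)
  have con: "connected B'" unfolding B'_def by (rule connected_minus_first_factor[OF B])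
  have cl: "closedin (top_of_set C) {z \<in> C. f z = act2 e M (k z)}" if "C \<subseteq> B" for M C
  proof -
    have "continuous_on C (\<lambda>z. f z - act2 e M (k z))"
      by (intro continuous_intros continuous_on_subset[OF f that] continuous_on_subset[OF k that]
          bounded_linear.continuous_on[OF bounded_linear_act2])
    from continuous_closedin_preimage_constant[OF this, of 0] show ?thesis by simp
  qed
  obtain z0 where z0: "z0 \<in> B'" using False by (auto simp: B'_def)
  then obtain M0 where M0: "M0 \<in> \<Gamma>" "f z0 = act2 e M0 (k z0)" using lift by (auto simp: B'_def)
  have uniq: "M = M'" if "M \<in> \<Gamma>" "M' \<in> \<Gamma>" "z \<in> P M" "z \<in> P M'" for M M' z
    by (rule act2_free[OF \<Gamma> that(1,2), of "k z"]) (use that ff in \<open>auto simp: P_def B'_def\<close>)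
  have compl: "B' - P M0 = (\<Union>M\<in>\<Gamma> - {M0}. P M)"
  proof (intro subset_antisym subsetI)
    fix z assume z: "z \<in> B' - P M0"
    then obtain M where "M \<in> \<Gamma>" "f z = act2 e M (k z)" using lift by (auto simp: B'_def)
    then show "z \<in> (\<Union>M\<in>\<Gamma> - {M0}. P M)" using z by (auto simp: P_def)
  next
    fix z assume "z \<in> (\<Union>M\<in>\<Gamma> - {M0}. P M)"
    then show "z \<in> B' - P M0" using uniq M0(1) by (auto simp: P_def)
  qed
  \<comment> \<open>Finitely many closed sets make up the complement of \<open>P M0\<close>, so
    \<open>P M0\<close> is both open and closed in the connected set \<open>B'\<close>.\<close>
  have "closedin (top_of_set B') (\<Union>M\<in>\<Gamma> - {M0}. P M)"
    using fin cl[of B'] by (intro closedin_Union) (auto simp: P_def B'_def)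
  then have "openin (top_of_set B') (B' - (B' - P M0))" unfolding compl[symmetric] by (metis openin_diff openin_subtopology_self)
  moreover have "B' - (B' - P M0) = P M0" by (auto simp: P_def)
  ultimately have "openin (top_of_set B') (P M0)" by simp
  moreover have "closedin (top_of_set B') (P M0)" unfolding P_def by (rule cl) (auto simp: B'_def)
  ultimately have "P M0 = {} \<or> P M0 = B'" using con connected_clopen by blast
  then have PB: "P M0 = B'" using z0 M0 by (auto simp: P_def)
  have "f z = act2 e M0 (k z)" if z: "z \<in> B" for z
  proof (cases "z \<in> first_factor e")
    case False
    then show ?thesis using PB z by (auto simp: P_def B'_def)
  next
    case True
    define Q where "Q = {z \<in> B. f z = act2 e M0 (k z)}"
    have clQ: "closedin (top_of_set B) Q" unfolding Q_def by (rule cl) simp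
    obtain t :: real where t: "t > 0" "\<And>s. 0 < s \<Longrightarrow> s < t \<Longrightarrow> z + s *\<^sub>R normal_embed (axis 1 1) \<in> B"
      "\<And>s. z \<in> first_factor e \<Longrightarrow> s \<noteq> 0 \<Longrightarrow> z + s *\<^sub>R normal_embed (axis 1 1) \<notin> first_factor e"
      using open_not_subset_first_factor[OF B(1) z] by metis
    \<comment> \<open>Points of \<open>B'\<close> approaching \<open>z\<close> along a normal ray;
      the equation holds at each of them and passes to the limit. The summand 2 keeps the parameter
      strictly below \<open>t\<close> already for \<open>n = 0\<close>.\<close>
    define zz where "zz n = z + (t / (real n + 2)) *\<^sub>R normal_embed (axis 1 1)" for n
    have "zz n \<in> Q" for n
    proof -
      have "0 < t / (real n + 2)" "t / (real n + 2) < t" using t(1) by (auto simp: field_simps intro!: add_pos_nonneg)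
      then have "zz n \<in> B'" unfolding zz_def B'_def using t(2)[of "t / (real n + 2)"] t(3)[OF True, of "t / (real n + 2)"] by simp
      then show ?thesis using PB by (auto simp: P_def Q_def B'_def)
    qed
    moreover have "zz \<longlonglongrightarrow> z"
    proof -
      have "(\<lambda>n. t / (real n + 2)) \<longlonglongrightarrow> 0" by real_asymp
      then have "(\<lambda>n. z + (t / (real n + 2)) *\<^sub>R normal_embed (axis 1 1)) \<longlonglongrightarrow> z + 0 *\<^sub>R normal_embed (axis 1 1)"
        by (intro tendsto_intros)
      then show ?thesis unfolding zz_def[abs_def] by simp
    qed
    ultimately have "z \<in> Q"
      using clQ z unfolding closedin_closed by (metis (no_types, lifting) Int_iff closed_sequentially)
    then show ?thesis by (simp add: Q_def)
  qed
  then show ?thesis using M0(1) by blast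
qed

end

section \<open>Holomorphic maps and changes of charts\<close>

text \<open>Holomorphy is defined coordinatewise; the joint derivative is assembled from the
  coordinate derivatives as a sum over the axes and is complex linear because they all are.\<close>

lemma holomorphic_map_derivative:
  assumes "holomorphic_map W \<psi>" "x \<in> W"
  obtains D where "(\<psi> has_derivative D) (at x)" "\<And>a v. D (a *s v) = a *s D v"
proof -
  have "\<forall>i. \<exists>D. ((\<lambda>z. \<psi> z $ i) has_derivative D) (at x) \<and> (\<forall>a v. D (a *s v) = a * D v)"
    using assms by (auto simp: holomorphic_map_def holomorphic_def)
  then obtain D where D: "\<And>i. ((\<lambda>z. \<psi> z $ i) has_derivative D i) (at x)" "\<And>i a v. D i (a *s v) = a * D i v"
    by metis
  have ax: "bounded_linear (\<lambda>c::complex. axis i c :: complex ^ 'a)" for i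
    by (rule linear_conv_bounded_linear[THEN iffD1], rule linearI)
      (simp_all add: Finite_Cartesian_Product.vec_eq_iff axis_def)
  have "((\<lambda>z. \<Sum>i\<in>UNIV. axis i (\<psi> z $ i)) has_derivative (\<lambda>v. \<Sum>i\<in>UNIV. axis i (D i v))) (at x)"
    by (intro has_derivative_sum bounded_linear.has_derivative[OF ax] D(1))
  moreover have "(\<Sum>i\<in>UNIV. axis i (f i)) = (\<chi> i. f i)" for f :: "'a \<Rightarrow> complex"
    by (simp add: Finite_Cartesian_Product.vec_eq_iff axis_def sum.delta)
  ultimately have "(\<psi> has_derivative (\<lambda>v. \<chi> i. D i v)) (at x)" by simp
  then show ?thesis by (rule that) (simp add: Finite_Cartesian_Product.vec_eq_iff D(2))
qed

lemma holomorphic_mapI: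
  assumes "\<And>x. x \<in> W \<Longrightarrow> \<exists>D. (\<psi> has_derivative D) (at x) \<and> (\<forall>a v. D (a *s v) = a *s D v)"
  shows "holomorphic_map W \<psi>"
  unfolding holomorphic_map_def holomorphic_def
proof (intro allI ballI)
  fix i x assume "x \<in> W"
  then obtain D where D: "(\<psi> has_derivative D) (at x)" "\<forall>a v. D (a *s v) = a *s D v" using assms by blast
  have "((\<lambda>z. \<psi> z $ i) has_derivative (\<lambda>v. D v $ i)) (at x)"
    by (rule bounded_linear.has_derivative[OF bounded_linear_vec_nth D(1)])
  then show "\<exists>E. ((\<lambda>z. \<psi> z $ i) has_derivative E) (at x) \<and> (\<forall>a v. E (a *s v) = a * E v)"
    using D(2) by (intro exI[of _ "\<lambda>v. D v $ i"]) simp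
qed

lemma holomorphic_map_cong:
  assumes "open W" "\<And>x. x \<in> W \<Longrightarrow> \<psi> x = \<omega> x" "holomorphic_map W \<psi>"
  shows "holomorphic_map W \<omega>"
proof (rule holomorphic_mapI)
  fix x assume x: "x \<in> W"
  obtain D where D: "(\<psi> has_derivative D) (at x)" "\<And>a v. D (a *s v) = a *s D v"
    using holomorphic_map_derivative[OF assms(3) x] by metis
  have "(\<omega> has_derivative D) (at x)"
    by (rule has_derivative_transform_within_open[OF D(1) assms(1) x]) (use assms(2) in auto)
  then show "\<exists>D. (\<omega> has_derivative D) (at x) \<and> (\<forall>a v. D (a *s v) = a *s D v)" using D(2) by blast
qed

lemma holomorphic_map_subset: "holomorphic_map W \<psi> \<Longrightarrow> V \<subseteq> W \<Longrightarrow> holomorphic_map V \<psi>"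
  by (auto simp: holomorphic_map_def holomorphic_def)

lemma holomorphic_map_compose:
  assumes "holomorphic_map W \<psi>" "holomorphic_map V \<omega>" "\<psi> ` W \<subseteq> V"
  shows "holomorphic_map W (\<omega> \<circ> \<psi>)"
proof (rule holomorphic_mapI)
  fix x assume x: "x \<in> W"
  obtain D where D: "(\<psi> has_derivative D) (at x)" "\<And>a v. D (a *s v) = a *s D v"
    using holomorphic_map_derivative[OF assms(1) x] by metis
  obtain E where E: "(\<omega> has_derivative E) (at (\<psi> x))" "\<And>a v. E (a *s v) = a *s E v"
    using holomorphic_map_derivative[OF assms(2), of "\<psi> x"] assms(3) x by blast
  have "(\<omega> \<circ> \<psi> has_derivative (\<lambda>v. E (D v))) (at x)"
    unfolding o_def by (rule has_derivative_compose[OF D(1) E(1)])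
  then show "\<exists>D. (\<omega> \<circ> \<psi> has_derivative D) (at x) \<and> (\<forall>a v. D (a *s v) = a *s D v)"
    using D(2) E(2) by (intro exI[of _ "\<lambda>v. E (D v)"]) simp
qed

lemma holomorphic_map_isCont: "holomorphic_map W \<psi> \<Longrightarrow> x \<in> W \<Longrightarrow> isCont \<psi> x"
  by (metis holomorphic_map_derivative has_derivative_continuous)

lemma holomorphic_map_continuous_on: "holomorphic_map W \<psi> \<Longrightarrow> continuous_on W \<psi>"
  by (meson holomorphic_map_isCont continuous_at_imp_continuous_on)

text \<open>Germs are handled through the filter \<open>nhds\<close>, which includes the point
  itself, so that one identity of germs can be substituted into another with
  \<open>eventually_compose_filterlim\<close>.\<close>

lemma isCont_iff_filterlim: "isCont f x \<longleftrightarrow> filterlim f (nhds (f x)) (nhds x)"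
  by (simp add: isCont_def tendsto_at_iff_tendsto_nhds)

lemma biholomorphic_inverse:
  assumes "biholomorphic W W' \<psi>"
  shows "biholomorphic W' W (inv_into W \<psi>)"
proof -
  have b: "bij_betw \<psi> W W'" using assms by (simp add: biholomorphic_def)
  have b': "bij_betw (inv_into W \<psi>) W' W" by (rule bij_betw_inv_into[OF b])
  have "holomorphic_map W (inv_into W' (inv_into W \<psi>))"
  proof (rule holomorphic_map_cong[of W \<psi>])
    fix x assume x: "x \<in> W"
    show "\<psi> x = inv_into W' (inv_into W \<psi>) x"
      by (rule inv_into_f_eq[symmetric]) (use b b' x in \<open>auto simp: bij_betw_def\<close>)
  qed (use assms in \<open>auto simp: biholomorphic_def\<close>)
  then show ?thesis using assms b' by (simp add: biholomorphic_def)
qed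

lemma biholomorphic_restrict:
  assumes "biholomorphic W W' \<psi>" "open V" "V \<subseteq> W"
  shows "biholomorphic V (\<psi> ` V) \<psi>"
proof -
  have b: "bij_betw \<psi> W W'" and W: "open W" "open W'" "holomorphic_map W \<psi>" "holomorphic_map W' (inv_into W \<psi>)"
    using assms by (auto simp: biholomorphic_def)
  have im: "\<psi> ` V = W' \<inter> inv_into W \<psi> -` V"
    using b assms(3) by (auto simp: bij_betw_def inv_into_f_f subset_iff f_inv_into_f image_iff) 
  have op: "open (\<psi> ` V)" unfolding im
    by (rule continuous_open_preimage[OF holomorphic_map_continuous_on[OF W(4)] W(2) assms(2)])
  have inj: "inj_on \<psi> W" using b by (auto simp: bij_betw_def)
  have "holomorphic_map (\<psi> ` V) (inv_into V \<psi>)"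
  proof (rule holomorphic_map_cong[OF op])
    show "holomorphic_map (\<psi> ` V) (inv_into W \<psi>)" by (rule holomorphic_map_subset[OF W(4)]) (use im in auto)
    fix y assume "y \<in> \<psi> ` V"
    then obtain x where x: "x \<in> V" "y = \<psi> x" by blast
    then show "inv_into W \<psi> y = inv_into V \<psi> y"
      using inj assms(3) inj_on_subset[OF inj assms(3)] by (auto simp: inv_into_f_f subset_iff)
  qed
  then show ?thesis
    using op assms inj_on_subset[OF inj assms(3)] holomorphic_map_subset[OF W(3) assms(3)]
    by (auto simp: biholomorphic_def bij_betw_def)
qed

lemma biholomorphic_compose:
  assumes "biholomorphic W V \<psi>" "biholomorphic V U \<omega>"
  shows "biholomorphic W U (\<omega> \<circ> \<psi>)"
proof -
  have b: "bij_betw \<psi> W V" "bij_betw \<omega> V U" using assms by (auto simp: biholomorphic_def)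
  have bc: "bij_betw (\<omega> \<circ> \<psi>) W U" by (rule bij_betw_trans[OF b])
  have h: "holomorphic_map W \<psi>" "holomorphic_map V \<omega>" "holomorphic_map V (inv_into W \<psi>)" "holomorphic_map U (inv_into V \<omega>)"
    and op: "open W" "open U" using assms by (auto simp: biholomorphic_def)
  have "holomorphic_map U (inv_into W \<psi> \<circ> inv_into V \<omega>)"
    by (rule holomorphic_map_compose[OF h(4,3)]) (use b(2) in \<open>auto simp: bij_betw_def inv_into_into\<close>)
  then have "holomorphic_map U (inv_into W (\<omega> \<circ> \<psi>))"
  proof (rule holomorphic_map_cong[OF op(2), rotated])
    fix y assume y: "y \<in> U"
    have v: "inv_into V \<omega> y \<in> V" "\<omega> (inv_into V \<omega> y) = y" using b(2) y by (auto simp: bij_betw_def inv_into_into f_inv_into_f)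
    have w: "inv_into W \<psi> (inv_into V \<omega> y) \<in> W" "\<psi> (inv_into W \<psi> (inv_into V \<omega> y)) = inv_into V \<omega> y"
      using b(1) v(1) by (auto simp: bij_betw_def inv_into_into f_inv_into_f)
    show "(inv_into W \<psi> \<circ> inv_into V \<omega>) y = inv_into W (\<omega> \<circ> \<psi>) y"
      by (rule inv_into_f_eq[symmetric]) (use bc v w in \<open>auto simp: bij_betw_def\<close>)
  qed
  moreover have "holomorphic_map W (\<omega> \<circ> \<psi>)" by (rule holomorphic_map_compose[OF h(1,2)]) (use b in \<open>auto simp: bij_betw_def\<close>)
  ultimately show ?thesis using bc op by (simp add: biholomorphic_def)
qed

section \<open>Germs of changes of charts\<close>

lemma chart_changeD:
  assumes "chart_change c x c' x' \<psi>"
  shows "\<psi> x = x'" "filterlim \<psi> (nhds x') (nhds x)" "\<forall>\<^sub>F z in nhds x. chart_change c z c' (\<psi> z) \<psi>"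
    "cmap c' x' = cmap c x" "x \<in> cdom c" "x' \<in> cdom c'"
proof -
  obtain W W' where W: "x \<in> W" "W \<subseteq> cdom c" "W' \<subseteq> cdom c'" "biholomorphic W W' \<psi>" "\<psi> x = x'"
    "\<forall>z \<in> W. cmap c' (\<psi> z) = cmap c z" using assms unfolding chart_change_def by blast
  then have "isCont \<psi> x" using holomorphic_map_isCont by (auto simp: biholomorphic_def)
  then show "filterlim \<psi> (nhds x') (nhds x)" using W(5) isCont_iff_filterlim by metis
  have "open W" using W(4) by (simp add: biholomorphic_def)
  then have "\<forall>\<^sub>F z in nhds x. z \<in> W" using W(1) eventually_nhds by blast
  then show "\<forall>\<^sub>F z in nhds x. chart_change c z c' (\<psi> z) \<psi>"
    by (rule eventually_mono) (use W in \<open>auto simp: chart_change_def\<close>)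
  show "cmap c' x' = cmap c x" "x \<in> cdom c" "\<psi> x = x'" using W by auto
  have "x' \<in> W'" using W by (auto simp: biholomorphic_def bij_betw_def)
  then show "x' \<in> cdom c'" using W by auto
qed

lemma chart_change_sym:
  assumes "chart_change c x c' x' \<psi>"
  obtains \<omega> where "chart_change c' x' c x \<omega>" "\<forall>\<^sub>F z in nhds x. \<omega> (\<psi> z) = z" "\<forall>\<^sub>F w in nhds x'. \<psi> (\<omega> w) = w"
proof -
  obtain W W' where W: "x \<in> W" "W \<subseteq> cdom c" "W' \<subseteq> cdom c'" "biholomorphic W W' \<psi>" "\<psi> x = x'"
    "\<forall>z \<in> W. cmap c' (\<psi> z) = cmap c z" using assms unfolding chart_change_def by blast
  have b: "bij_betw \<psi> W W'" and op: "open W" "open W'" using W(4) by (auto simp: biholomorphic_def)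
  have x': "x' \<in> W'" using W b by (auto simp: bij_betw_def)
  show ?thesis
  proof (rule that[of "inv_into W \<psi>"])
    show "chart_change c' x' c x (inv_into W \<psi>)"
      unfolding chart_change_def
    proof (intro exI conjI)
      show "biholomorphic W' W (inv_into W \<psi>)" by (rule biholomorphic_inverse[OF W(4)])
      show "inv_into W \<psi> x' = x" using b W(1,5) by (auto simp: bij_betw_inv_into_left)
      show "\<forall>z\<in>W'. cmap c (inv_into W \<psi> z) = cmap c' z"
      proof
        fix z assume "z \<in> W'"
        then have "inv_into W \<psi> z \<in> W" "\<psi> (inv_into W \<psi> z) = z"
          using b by (auto simp: bij_betw_def inv_into_into f_inv_into_f)
        then show "cmap c (inv_into W \<psi> z) = cmap c' z" using W(6) by metis
      qed
    qed (use W x' in auto)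
    have "\<forall>\<^sub>F z in nhds x. z \<in> W" "\<forall>\<^sub>F z in nhds x'. z \<in> W'" using op W(1) x' eventually_nhds by blast+
    then show "\<forall>\<^sub>F z in nhds x. inv_into W \<psi> (\<psi> z) = z" "\<forall>\<^sub>F w in nhds x'. \<psi> (inv_into W \<psi> w) = w"
      using b by (auto elim!: eventually_mono simp: bij_betw_inv_into_left bij_betw_inv_into_right)
  qed
qed

lemma chart_change_trans:
  assumes "chart_change c x c' x' \<psi>" "chart_change c' x' c'' x'' \<omega>"
  shows "chart_change c x c'' x'' (\<omega> \<circ> \<psi>)"
proof -
  obtain W W' where W: "x \<in> W" "W \<subseteq> cdom c" "W' \<subseteq> cdom c'" "biholomorphic W W' \<psi>" "\<psi> x = x'"
    "\<forall>z \<in> W. cmap c' (\<psi> z) = cmap c z" using assms(1) unfolding chart_change_def by blast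
  obtain V V' where V: "x' \<in> V" "V \<subseteq> cdom c'" "V' \<subseteq> cdom c''" "biholomorphic V V' \<omega>" "\<omega> x' = x''"
    "\<forall>z \<in> V. cmap c'' (\<omega> z) = cmap c' z" using assms(2) unfolding chart_change_def by blast
  have b: "bij_betw \<psi> W W'" and op: "open W" "open V" and h: "holomorphic_map W \<psi>"
    using W(4) V(4) by (auto simp: biholomorphic_def)
  define W0 where "W0 = W \<inter> \<psi> -` V"
  have W0: "open W0" "W0 \<subseteq> W" "x \<in> W0" "\<psi> ` W0 \<subseteq> V"
    unfolding W0_def using continuous_open_preimage[OF holomorphic_map_continuous_on[OF h] op] W V by auto
  have b1: "biholomorphic W0 (\<psi> ` W0) \<psi>" by (rule biholomorphic_restrict[OF W(4) W0(1,2)])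
  have b2: "biholomorphic (\<psi> ` W0) (\<omega> ` \<psi> ` W0) \<omega>"
    by (rule biholomorphic_restrict[OF V(4) _ W0(4)]) (use b1 in \<open>simp add: biholomorphic_def\<close>)
  show ?thesis
    unfolding chart_change_def
  proof (intro exI conjI)
    show "biholomorphic W0 (\<omega> ` \<psi> ` W0) (\<omega> \<circ> \<psi>)" by (rule biholomorphic_compose[OF b1 b2])
    show "\<omega> ` \<psi> ` W0 \<subseteq> cdom c''" using V(3,4) W0(4) by (auto simp: biholomorphic_def bij_betw_def)
    show "\<forall>z\<in>W0. cmap c'' ((\<omega> \<circ> \<psi>) z) = cmap c z"
    proof
      fix z assume "z \<in> W0"
      then have "z \<in> W" "\<psi> z \<in> V" using W0 by auto
      then show "cmap c'' ((\<omega> \<circ> \<psi>) z) = cmap c z" using W(6) V(6) by simp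
    qed
  qed (use W V W0 in auto)
qed

lemma (in split_coordinates) act2_derivative: "(act2 e M has_derivative act2 e M) (at x)"
  by (rule bounded_linear_imp_has_derivative[OF bounded_linear_act2])

section \<open>The charts of \<open>[Y]\<close>\<close>

locale ade_orbifold = split_coordinates e for e :: "2 \<Rightarrow> 'd::finite" +
  fixes Y :: "(complex ^ 'n::finite) set set" and A :: "('d, (complex ^ 'n) set) orb_chart set"
  assumes orb: "ADE_orbifold e Y A"
begin

abbreviation S :: "(complex ^ 'n) set set" where "S \<equiv> sing_locus Y"

lemma chart: "c \<in> A \<Longrightarrow> orbifold_chart (subtopology proj_space Y) c"
  using orb by (simp add: ADE_orbifold_def orbifold_atlas_def)

lemma topspace_charts: "topspace (subtopology proj_space Y) = (\<Union>c \<in> A. cmap c ` cdom c)"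
  using orb by (simp add: ADE_orbifold_def orbifold_atlas_def)

lemma chart_change_exists:
  "c \<in> A \<Longrightarrow> c' \<in> A \<Longrightarrow> x \<in> cdom c \<Longrightarrow> x' \<in> cdom c' \<Longrightarrow> cmap c x = cmap c' x' \<Longrightarrow> \<exists>\<psi>. chart_change c x c' x' \<psi>"
  using orb by (simp add: ADE_orbifold_def orbifold_atlas_def)

lemma open_cdom: "c \<in> A \<Longrightarrow> open (cdom c)"
  using chart by (simp add: orbifold_chart_def)

lemma cgrp_subgroup: "c \<in> A \<Longrightarrow> subgroup (cgrp c) (BijGroup (cdom c))"
  using chart by (simp add: orbifold_chart_def)

lemma cgrp_Bij: "c \<in> A \<Longrightarrow> g \<in> cgrp c \<Longrightarrow> g \<in> Bij (cdom c)"
  using subgroup.subset[OF cgrp_subgroup] by (auto simp: BijGroup_def)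

lemma cgrp_bij: "c \<in> A \<Longrightarrow> g \<in> cgrp c \<Longrightarrow> bij_betw g (cdom c) (cdom c)"
  using cgrp_Bij by (auto simp: Bij_def)

lemma cgrp_closed: "c \<in> A \<Longrightarrow> g \<in> cgrp c \<Longrightarrow> z \<in> cdom c \<Longrightarrow> g z \<in> cdom c"
  using cgrp_bij by (auto simp: bij_betw_def)

lemma cgrp_hol: "c \<in> A \<Longrightarrow> g \<in> cgrp c \<Longrightarrow> holomorphic_map (cdom c) g"
  using chart by (simp add: orbifold_chart_def)

lemma cmap_eq_iff: "c \<in> A \<Longrightarrow> x \<in> cdom c \<Longrightarrow> x' \<in> cdom c \<Longrightarrow> cmap c x = cmap c x' \<longleftrightarrow> (\<exists>g \<in> cgrp c. g x = x')"
  using chart by (simp add: orbifold_chart_def)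

lemma cmap_cgrp: "c \<in> A \<Longrightarrow> g \<in> cgrp c \<Longrightarrow> z \<in> cdom c \<Longrightarrow> cmap c (g z) = cmap c z"
  using cmap_eq_iff[of c z "g z"] cgrp_closed by auto

lemma finite_cgrp: "c \<in> A \<Longrightarrow> finite (cgrp c)"
  using chart by (simp add: orbifold_chart_def)

lemma cgrp_mult: "c \<in> A \<Longrightarrow> g \<in> cgrp c \<Longrightarrow> h \<in> cgrp c \<Longrightarrow> g \<otimes>\<^bsub>BijGroup (cdom c)\<^esub> h = (\<lambda>z\<in>cdom c. g (h z))"
  using cgrp_Bij by (simp add: BijGroup_def compose_def)

lemma cgrp_one: "c \<in> A \<Longrightarrow> (\<lambda>z\<in>cdom c. z) \<in> cgrp c"
  using subgroup.one_closed[OF cgrp_subgroup] by (simp add: BijGroup_def)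

lemma one_local_group: "\<one>\<^bsub>local_group c x\<^esub> = (\<lambda>z\<in>cdom c. z)"
  by (simp add: local_group_def BijGroup_def)

lemma mult_local_group: "c \<in> A \<Longrightarrow> g \<in> cgrp c \<Longrightarrow> h \<in> cgrp c \<Longrightarrow> g \<otimes>\<^bsub>local_group c x\<^esub> h = (\<lambda>z\<in>cdom c. g (h z))"
  using cgrp_mult by (simp add: local_group_def)

lemma cgrp_mult_closed: "c \<in> A \<Longrightarrow> g \<in> cgrp c \<Longrightarrow> h \<in> cgrp c \<Longrightarrow> (\<lambda>z\<in>cdom c. g (h z)) \<in> cgrp c"
  using subgroup.m_closed[OF cgrp_subgroup] cgrp_mult by metis

lemma cgrp_filterlim: "c \<in> A \<Longrightarrow> g \<in> cgrp c \<Longrightarrow> x \<in> cdom c \<Longrightarrow> filterlim g (nhds (g x)) (nhds x)"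
  using holomorphic_map_isCont[OF cgrp_hol] by (simp add: isCont_iff_filterlim)

lemma eventually_cdom: "c \<in> A \<Longrightarrow> x \<in> cdom c \<Longrightarrow> \<forall>\<^sub>F z in nhds x. z \<in> cdom c"
  using open_cdom eventually_nhds by blast

lemma cgrp_inverse:
  assumes "c \<in> A" "g \<in> cgrp c"
  obtains h where "h \<in> cgrp c" "\<And>z. z \<in> cdom c \<Longrightarrow> h (g z) = z" "\<And>z. z \<in> cdom c \<Longrightarrow> g (h z) = z"
proof -
  interpret Group.group "BijGroup (cdom c)" by (rule group_BijGroup)
  note sub = cgrp_subgroup[OF assms(1)]
  have h: "inv\<^bsub>BijGroup (cdom c)\<^esub> g \<in> cgrp c" (is "?h \<in> _") by (rule subgroup.m_inv_closed[OF sub assms(2)])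
  have gc: "g \<in> carrier (BijGroup (cdom c))" using subgroup.subset[OF sub] assms(2) by auto
  have "?h \<otimes>\<^bsub>BijGroup (cdom c)\<^esub> g = \<one>\<^bsub>BijGroup (cdom c)\<^esub>" "g \<otimes>\<^bsub>BijGroup (cdom c)\<^esub> ?h = \<one>\<^bsub>BijGroup (cdom c)\<^esub>"
    using gc by simp_all
  then have e: "(\<lambda>z\<in>cdom c. ?h (g z)) = (\<lambda>z\<in>cdom c. z)" "(\<lambda>z\<in>cdom c. g (?h z)) = (\<lambda>z\<in>cdom c. z)"
    using cgrp_mult[OF assms(1) h assms(2)] cgrp_mult[OF assms h] by (auto simp: BijGroup_def)
  show ?thesis by (rule that[OF h]) (use fun_cong[OF e(1)] fun_cong[OF e(2)] in \<open>auto simp: restrict_def split: if_splits\<close>, metis+)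
qed

lemma chart_change_cgrp:
  assumes c: "c \<in> A" and g: "g \<in> cgrp c" and x: "x \<in> cdom c"
  shows "chart_change c x c (g x) g"
proof -
  obtain h where h: "h \<in> cgrp c" "\<And>z. z \<in> cdom c \<Longrightarrow> h (g z) = z" "\<And>z. z \<in> cdom c \<Longrightarrow> g (h z) = z"
    using cgrp_inverse[OF c g] by metis
  have bij: "bij_betw g (cdom c) (cdom c)" by (rule cgrp_bij[OF c g])
  have "holomorphic_map (cdom c) (inv_into (cdom c) g)"
  proof (rule holomorphic_map_cong[OF open_cdom[OF c] _ cgrp_hol[OF c h(1)]])
    fix z assume z: "z \<in> cdom c"
    show "h z = inv_into (cdom c) g z"
      by (rule inv_into_f_eq[symmetric]) (use bij h z cgrp_closed[OF c] in \<open>auto simp: bij_betw_def\<close>)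
  qed
  then have "biholomorphic (cdom c) (cdom c) g" using open_cdom[OF c] bij cgrp_hol[OF c g] by (simp add: biholomorphic_def)
  then show ?thesis unfolding chart_change_def using x cmap_cgrp[OF c g] by blast
qed

text \<open>The charts in which the group is linear and the preimage of \<open>S\<close> is the
  coordinate subspace \<open>first_factor e\<close>. Every chart over a point of \<open>S\<close> is
  of this kind (\<open>sing_if\<close>), and in the others all isotropy is trivial
  (\<open>nonsing_fixed\<close>).\<close>

definition sing :: "('d, (complex ^ 'n) set) orb_chart \<Rightarrow> bool" where
  "sing c \<longleftrightarrow> c \<in> A \<and> ADE_chart e S c"

definition gam :: "('d, (complex ^ 'n) set) orb_chart \<Rightarrow> (complex ^ 2 ^ 2) set" where
  "gam c = (SOME \<Gamma>. ADE_group \<Gamma> \<and> cgrp c = (\<lambda>M. restrict (act2 e M) (cdom c)) ` \<Gamma>)"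

lemma sing_A: "sing c \<Longrightarrow> c \<in> A"
  by (simp add: sing_def)

lemma gam: "sing c \<Longrightarrow> ADE_group (gam c)" "sing c \<Longrightarrow> cgrp c = (\<lambda>M. restrict (act2 e M) (cdom c)) ` gam c"
  using someI_ex[of "\<lambda>\<Gamma>. ADE_group \<Gamma> \<and> cgrp c = (\<lambda>M. restrict (act2 e M) (cdom c)) ` \<Gamma>"]
  unfolding gam_def sing_def ADE_chart_def by blast+

lemma gam_SL2: "sing c \<Longrightarrow> finite_SL2_subgroup (gam c)"
  using gam(1) by (simp add: ADE_group_def)

lemma sing_preimage: "sing c \<Longrightarrow> x \<in> cdom c \<Longrightarrow> cmap c x \<in> S \<longleftrightarrow> x \<in> first_factor e"
  unfolding sing_def ADE_chart_def by blast

lemma sing_if: "c \<in> A \<Longrightarrow> x \<in> cdom c \<Longrightarrow> cmap c x \<in> S \<Longrightarrow> sing c"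
  using orb by (fastforce simp: ADE_orbifold_def sing_def)

lemma nonsing_fixed:
  assumes "c \<in> A" "\<not> sing c" "g \<in> cgrp c" "x \<in> cdom c" "g x = x"
  shows "g = (\<lambda>z\<in>cdom c. z)"
proof -
  have "cmap c x \<notin> S" using sing_if assms by blast
  then have "carrier (local_group c x) = {\<one>\<^bsub>local_group c x\<^esub>}" using orb assms(1,4) by (auto simp: ADE_orbifold_def)
  moreover have "g \<in> carrier (local_group c x)" using assms by (simp add: local_group_def)
  ultimately show ?thesis by (simp add: one_local_group)
qed

lemma cgrpE:
  assumes "sing c" "g \<in> cgrp c"
  obtains M where "M \<in> gam c" "g = restrict (act2 e M) (cdom c)" "\<And>z. z \<in> cdom c \<Longrightarrow> g z = act2 e M z"
  using assms gam(2)[OF assms(1)] by auto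

lemma cgrp_fix: "sing c \<Longrightarrow> g \<in> cgrp c \<Longrightarrow> z \<in> cdom c \<Longrightarrow> z \<in> first_factor e \<Longrightarrow> g z = z"
  by (erule (1) cgrpE) simp

lemma cgrp_eq_off:
  assumes "sing c" "g \<in> cgrp c" "h \<in> cgrp c" "z \<in> cdom c" "z \<notin> first_factor e" "g z = h z"
  shows "g = h"
proof -
  obtain M where M: "M \<in> gam c" "g = restrict (act2 e M) (cdom c)" "g z = act2 e M z" using cgrpE[OF assms(1,2)] assms(4) by metis
  obtain N where N: "N \<in> gam c" "h = restrict (act2 e N) (cdom c)" "h z = act2 e N z" using cgrpE[OF assms(1,3)] assms(4) by metis
  have "M = N" using act2_free[OF gam_SL2[OF assms(1)] M(1) N(1) assms(5)] M(3) N(3) assms(6) by simp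
  then show ?thesis using M N by simp
qed

text \<open>A nontrivial element with a fixed point rules out trivial isotropy, so the chart is
  linear, and off \<open>first_factor e\<close> a linear chart group acts freely. The twisted
  sectors therefore live over \<open>S\<close> only.\<close>

lemma fixed_first_factor:
  assumes "c \<in> A" "g \<in> cgrp c" "g \<noteq> (\<lambda>z\<in>cdom c. z)" "x \<in> cdom c" "g x = x"
  shows "sing c" "x \<in> first_factor e" "cmap c x \<in> S"
proof -
  show s: "sing c" using nonsing_fixed assms by blast
  show f: "x \<in> first_factor e"
  proof (rule ccontr)
    assume "x \<notin> first_factor e"
    then have "g = (\<lambda>z\<in>cdom c. z)" using cgrp_eq_off[OF s assms(2) cgrp_one[OF assms(1)] assms(4)] assms(4,5) by simp
    then show False using assms(3) by simp
  qed
  show "cmap c x \<in> S" using sing_preimage[OF s assms(4)] f by simp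
qed

text \<open>Any neighbourhood of \<open>x\<close> contains a point off
  \<open>first_factor e\<close>, where the group acts freely and one value determines the element.
  Equality of germs thus becomes equality of group elements.\<close>

lemma cgrp_eq_near:
  assumes c: "c \<in> A" and g: "g \<in> cgrp c" "h \<in> cgrp c" and x: "x \<in> cdom c" and s: "sing c"
    and near: "\<forall>\<^sub>F z in nhds x. g z = h z"
  shows "g = h"
proof -
  obtain U where U: "open U" "x \<in> U" "\<And>z. z \<in> U \<Longrightarrow> g z = h z" using near by (auto simp: eventually_nhds)
  have "open (U \<inter> cdom c)" "x \<in> U \<inter> cdom c" using U x open_cdom[OF c] by auto
  then obtain t :: real where t: "t > 0" "\<And>s. 0 < s \<Longrightarrow> s < t \<Longrightarrow> x + s *\<^sub>R normal_embed (axis 1 1) \<in> U \<inter> cdom c"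
      "\<And>s. x \<in> first_factor e \<Longrightarrow> s \<noteq> 0 \<Longrightarrow> x + s *\<^sub>R normal_embed (axis 1 1) \<notin> first_factor e"
    using open_not_subset_first_factor by metis
  show ?thesis
  proof (cases "x \<in> first_factor e")
    case True
    define z where "z = x + (t/2) *\<^sub>R normal_embed (axis 1 1)"
    have "z \<in> U \<inter> cdom c" "z \<notin> first_factor e" using t(1) t(2)[of "t/2"] t(3)[OF True, of "t/2"] by (auto simp: z_def)
    then show ?thesis using cgrp_eq_off[OF s g, of z] U(3) by auto
  next
    case False
    then show ?thesis using cgrp_eq_off[OF s g x] U by auto
  qed
qed

lemma cmap_inj_first_factor:
  assumes "sing c" "x \<in> cdom c" "x \<in> first_factor e" "x' \<in> cdom c" "cmap c x = cmap c x'"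
  shows "x = x'"
  using cmap_eq_iff[OF sing_A[OF assms(1)] assms(2,4)] cgrp_fix[OF assms(1) _ assms(2,3)] assms(5) by metis

lemma lift_element:
  assumes c: "sing c" and B: "open B" "convex B"
    and f: "continuous_on B f" "f ` B \<subseteq> cdom c" and k: "continuous_on B k" "k ` B \<subseteq> cdom c"
    and eq: "\<And>z. z \<in> B \<Longrightarrow> cmap c (k z) = cmap c (f z)"
    and ff: "\<And>z. z \<in> B \<Longrightarrow> k z \<in> first_factor e \<longleftrightarrow> z \<in> first_factor e"
  shows "\<exists>g\<in>cgrp c. \<forall>z\<in>B. f z = g (k z)"
proof -
  have "\<exists>M\<in>gam c. f z = act2 e M (k z)" if z: "z \<in> B" for z
  proof -
    have "\<exists>g\<in>cgrp c. g (k z) = f z" using cmap_eq_iff[OF sing_A[OF c], of "k z" "f z"] eq[OF z] f(2) k(2) z by (metis image_subset_iff)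
    then obtain g where g: "g \<in> cgrp c" "g (k z) = f z" by blast
    then obtain M where "M \<in> gam c" "\<And>w. w \<in> cdom c \<Longrightarrow> g w = act2 e M w" using cgrpE[OF c] by metis
    then show ?thesis using g(2) k(2) z by (metis image_subset_iff)
  qed
  from lifts_differ_by_element[OF gam_SL2[OF c] B f(1) k(1) this ff]
  obtain M where M: "M \<in> gam c" "\<forall>z\<in>B. f z = act2 e M (k z)" by blast
  show ?thesis
  proof (rule bexI[of _ "restrict (act2 e M) (cdom c)"])
    show "\<forall>z\<in>B. f z = restrict (act2 e M) (cdom c) (k z)" using M(2) k(2) by auto
    show "restrict (act2 e M) (cdom c) \<in> cgrp c" using M(1) gam(2)[OF c] by auto
  qed
qed

lemma chart_change_first_factor:
  assumes "chart_change c x c' x' \<psi>" "sing c" "sing c'"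
  shows "x' \<in> first_factor e \<longleftrightarrow> x \<in> first_factor e"
  using chart_changeD(4-6)[OF assms(1)] sing_preimage[OF assms(2)] sing_preimage[OF assms(3)] by metis

lemma eventually_ballE:
  assumes "\<forall>\<^sub>F z in nhds (x :: complex ^ 'd). P z"
  obtains r where "r > 0" "\<And>z. z \<in> ball x r \<Longrightarrow> P z"
  using assms unfolding eventually_nhds_metric by (auto simp: dist_commute)

text \<open>Near \<open>x\<close> both \<open>\<psi> \<circ> g\<close> and \<psi> are lifts to
  \<open>c'\<close> of the chart map of \<open>c\<close>, as \<open>g\<close> does not change the
  point of \<open>Y\<close>. The element by which they differ is the conjugate of
  \<open>g\<close>.\<close>

lemma chart_change_conjugates:
  assumes ch: "chart_change c x c' x' \<psi>" and s: "sing c" "sing c'" and x: "x \<in> first_factor e" and g: "g \<in> cgrp c"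
  shows "\<exists>g'\<in>cgrp c'. \<forall>\<^sub>F z in nhds x. \<psi> (g z) = g' (\<psi> z)"
proof -
  have xD: "x \<in> cdom c" using chart_changeD[OF ch] by simp
  have gx: "g x = x" by (rule cgrp_fix[OF s(1) g xD x])
  have gl: "filterlim g (nhds x) (nhds x)" using cgrp_filterlim[OF sing_A[OF s(1)] g xD] gx by simp
  have n1: "\<forall>\<^sub>F z in nhds x. chart_change c z c' (\<psi> z) \<psi>" by (rule chart_changeD(3)[OF ch])
  have "\<forall>\<^sub>F z in nhds x. chart_change c z c' (\<psi> z) \<psi> \<and> chart_change c (g z) c' (\<psi> (g z)) \<psi> \<and> isCont g z"
  proof (intro eventually_conj n1 eventually_compose_filterlim[OF n1 gl])
    show "\<forall>\<^sub>F z in nhds x. isCont g z"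
      using eventually_cdom[OF sing_A[OF s(1)] xD] holomorphic_map_isCont[OF cgrp_hol[OF sing_A[OF s(1)] g]]
      by (auto elim: eventually_mono)
  qed
  then obtain r where r: "r > 0" "\<And>z. z \<in> ball x r \<Longrightarrow> chart_change c z c' (\<psi> z) \<psi>"
    "\<And>z. z \<in> ball x r \<Longrightarrow> chart_change c (g z) c' (\<psi> (g z)) \<psi>" "\<And>z. z \<in> ball x r \<Longrightarrow> isCont g z"
    using eventually_ballE by (smt (verit, best))
  have cont\<psi>: "isCont \<psi> z" if "chart_change c z c' (\<psi> z) \<psi>" for z
    using chart_changeD(2)[OF that] by (simp add: isCont_iff_filterlim)
  have "\<exists>g'\<in>cgrp c'. \<forall>z\<in>ball x r. (\<psi> \<circ> g) z = g' (\<psi> z)"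
  proof (rule lift_element[OF s(2)])
    show "continuous_on (ball x r) (\<psi> \<circ> g)"
      by (rule continuous_at_imp_continuous_on) (use r cont\<psi> in \<open>auto intro!: continuous_at_compose\<close>)
    show "continuous_on (ball x r) \<psi>" by (rule continuous_at_imp_continuous_on) (use r cont\<psi> in auto)
    show "(\<psi> \<circ> g) ` ball x r \<subseteq> cdom c'" "\<psi> ` ball x r \<subseteq> cdom c'" using chart_changeD(6) r by fastforce+
    fix z assume z: "z \<in> ball x r"
    have "z \<in> cdom c" using chart_changeD(5)[OF r(2)[OF z]] .
    then show "cmap c' (\<psi> z) = cmap c' ((\<psi> \<circ> g) z)"
      using chart_changeD(4)[OF r(2)[OF z]] chart_changeD(4)[OF r(3)[OF z]] cmap_cgrp[OF sing_A[OF s(1)] g] by simp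
    show "\<psi> z \<in> first_factor e \<longleftrightarrow> z \<in> first_factor e" by (rule chart_change_first_factor[OF r(2)[OF z] s])
  qed auto
  then obtain g' where g': "g' \<in> cgrp c'" "\<forall>z\<in>ball x r. \<psi> (g z) = g' (\<psi> z)" by auto
  have "\<forall>\<^sub>F z in nhds x. z \<in> ball x r" using r(1) by (intro eventually_nhds_in_open) auto
  then have "\<forall>\<^sub>F z in nhds x. \<psi> (g z) = g' (\<psi> z)" by (rule eventually_mono) (use g'(2) in auto)
  then show ?thesis using g'(1) by blast
qed

text \<open>Compare \<psi> with the identity, which lifts the same map.\<close>

lemma chart_change_self:
  assumes ch: "chart_change c x c x \<psi>" and s: "sing c"
  shows "\<exists>k\<in>cgrp c. \<forall>\<^sub>F z in nhds x. \<psi> z = k z"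
proof -
  obtain r where r: "r > 0" "\<And>z. z \<in> ball x r \<Longrightarrow> chart_change c z c (\<psi> z) \<psi>"
    using eventually_ballE[OF chart_changeD(3)[OF ch]] by metis
  have "\<exists>k\<in>cgrp c. \<forall>z\<in>ball x r. \<psi> z = k (id z)"
  proof (rule lift_element[OF s])
    show "continuous_on (ball x r) \<psi>"
      by (rule continuous_at_imp_continuous_on, rule ballI)
        (unfold isCont_iff_filterlim, rule chart_changeD(2)[OF r(2)])
    show "\<psi> ` ball x r \<subseteq> cdom c" "id ` ball x r \<subseteq> cdom c" using chart_changeD(5,6) r by fastforce+
    show "cmap c (id z) = cmap c (\<psi> z)" if "z \<in> ball x r" for z using chart_changeD(4)[OF r(2)[OF that]] by simp
  qed (auto simp: id_def)
  then obtain k where k: "k \<in> cgrp c" "\<forall>z\<in>ball x r. \<psi> z = k z" by auto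
  have "\<forall>\<^sub>F z in nhds x. z \<in> ball x r" using r(1) by (intro eventually_nhds_in_open) auto
  then have "\<forall>\<^sub>F z in nhds x. \<psi> z = k z" by (rule eventually_mono) (use k(2) in auto)
  then show ?thesis using k(1) by blast
qed

end

section \<open>Conjugation of local groups by germs, and the points of the inertia space\<close>

definition germ_conj :: "complex ^ 'd::finite \<Rightarrow> (complex ^ 'd \<Rightarrow> complex ^ 'd) \<Rightarrow>
    (complex ^ 'd \<Rightarrow> complex ^ 'd) \<Rightarrow> (complex ^ 'd \<Rightarrow> complex ^ 'd) \<Rightarrow> bool" where
  "germ_conj x \<psi> g g' \<longleftrightarrow> (\<forall>\<^sub>F z in nhds x. \<psi> (g z) = g' (\<psi> z))"

lemma inertia_equiv_iff:
  "inertia_equiv ((c, g), x) ((c', g'), x') \<longleftrightarrow> (\<exists>\<psi>. chart_change c x c' x' \<psi> \<and> germ_conj x \<psi> g g')"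
  by (simp add: inertia_equiv_def germ_conj_def)

lemma germ_conj_trans:
  assumes ch: "chart_change c x c' x' \<psi>"
    and conj: "germ_conj x \<psi> g g'" "germ_conj x' \<omega> g' g''"
  shows "germ_conj x (\<omega> \<circ> \<psi>) g g''"
proof -
  have "\<forall>\<^sub>F z in nhds x. \<omega> (g' (\<psi> z)) = g'' (\<omega> (\<psi> z))"
    using eventually_compose_filterlim[OF conj(2)[unfolded germ_conj_def] chart_changeD(2)[OF ch]] .
  then show ?thesis using conj(1) unfolding germ_conj_def by eventually_elim simp
qed

lemma inertia_equiv_trans:
  assumes "inertia_equiv ((c, g), x) ((c', g'), x')" "inertia_equiv ((c', g'), x') ((c'', g''), x'')"
  shows "inertia_equiv ((c, g), x) ((c'', g''), x'')"
proof -
  obtain \<psi> where \<psi>: "chart_change c x c' x' \<psi>" "germ_conj x \<psi> g g'" using assms(1) by (auto simp: inertia_equiv_iff)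
  obtain \<omega> where \<omega>: "chart_change c' x' c'' x'' \<omega>" "germ_conj x' \<omega> g' g''" using assms(2) by (auto simp: inertia_equiv_iff)
  show ?thesis using chart_change_trans[OF \<psi>(1) \<omega>(1)] germ_conj_trans[OF \<psi> \<omega>(2)] inertia_equiv_iff by blast
qed

context ade_orbifold
begin

lemma germ_conj_sym:
  assumes ch: "chart_change c x c' x' \<psi>" and ch': "chart_change c' x' c x \<omega>"
    and inv: "\<forall>\<^sub>F z in nhds x. \<omega> (\<psi> z) = z" "\<forall>\<^sub>F w in nhds x'. \<psi> (\<omega> w) = w"
    and c: "c \<in> A" and g: "g \<in> cgrp c" "g x = x" and conj: "germ_conj x \<psi> g g'"
  shows "germ_conj x' \<omega> g' g"
proof -
  have xD: "x \<in> cdom c" using chart_changeD(5)[OF ch] .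
  have \<omega>l: "filterlim \<omega> (nhds x) (nhds x')" using chart_changeD(2)[OF ch'] .
  have gl: "filterlim g (nhds x) (nhds x)" using cgrp_filterlim[OF c g(1) xD] g(2) by simp
  have e1: "\<forall>\<^sub>F w in nhds x'. \<psi> (g (\<omega> w)) = g' (\<psi> (\<omega> w))"
    using eventually_compose_filterlim[OF conj[unfolded germ_conj_def] \<omega>l] .
  have e2: "\<forall>\<^sub>F w in nhds x'. \<omega> (\<psi> (g (\<omega> w))) = g (\<omega> w)"
    using eventually_compose_filterlim[OF inv(1) filterlim_compose[OF gl \<omega>l]] .
  show ?thesis unfolding germ_conj_def
    using e1 e2 inv(2)
  proof eventually_elim
    case (elim w)
    then show ?case by metis
  qed
qed

lemma inertia_equiv_refl:
  assumes "c \<in> A" "x \<in> cdom c" "g \<in> cgrp c" "g x = x"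
  shows "inertia_equiv ((c, g), x) ((c, g), x)"
proof -
  have "\<forall>\<^sub>F z in nhds x. (\<lambda>z\<in>cdom c. z) (g z) = g ((\<lambda>z\<in>cdom c. z) z)"
    using eventually_cdom[OF assms(1,2)] by (rule eventually_mono) (use cgrp_closed[OF assms(1,3)] in simp)
  then show ?thesis unfolding inertia_equiv_iff germ_conj_def
    using chart_change_cgrp[OF assms(1) cgrp_one[OF assms(1)] assms(2)] assms(2) by (intro exI[of _ "\<lambda>z\<in>cdom c. z"]) simp
qed

lemma inertia_equiv_sym:
  assumes "inertia_equiv ((c, g), x) ((c', g'), x')" "c \<in> A" "g \<in> cgrp c" "g x = x"
  shows "inertia_equiv ((c', g'), x') ((c, g), x)"
proof -
  obtain \<psi> where \<psi>: "chart_change c x c' x' \<psi>" "germ_conj x \<psi> g g'" using assms(1) by (auto simp: inertia_equiv_iff)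
  obtain \<omega> where \<omega>: "chart_change c' x' c x \<omega>" "\<forall>\<^sub>F z in nhds x. \<omega> (\<psi> z) = z" "\<forall>\<^sub>F w in nhds x'. \<psi> (\<omega> w) = w"
    by (rule chart_change_sym[OF \<psi>(1)], rule that)
  have "germ_conj x' \<omega> g' g" by (rule germ_conj_sym[OF \<psi>(1) \<omega> assms(2-4) \<psi>(2)])
  then show ?thesis using \<omega>(1) inertia_equiv_iff by blast
qed

text \<open>Precomposing with a local inverse of \<psi> shows that \<open>g1\<close> and
  \<open>g2\<close> agree near \<open>x'\<close>, hence everywhere. This uniqueness makes
  conjugation multiplicative and injective in \<open>chart_change_iso\<close>.\<close>

lemma germ_conj_unique:
  assumes ch: "chart_change c x c' x' \<psi>" and s: "sing c'" and g: "g1 \<in> cgrp c'" "g2 \<in> cgrp c'"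
    and conj: "germ_conj x \<psi> g g1" "germ_conj x \<psi> g g2"
  shows "g1 = g2"
proof -
  obtain \<omega> where \<omega>: "chart_change c' x' c x \<omega>" "\<forall>\<^sub>F z in nhds x. \<omega> (\<psi> z) = z" "\<forall>\<^sub>F w in nhds x'. \<psi> (\<omega> w) = w"
    by (rule chart_change_sym[OF ch], rule that)
  have "\<forall>\<^sub>F z in nhds x. g1 (\<psi> z) = g2 (\<psi> z)" using conj unfolding germ_conj_def by eventually_elim simp
  from eventually_compose_filterlim[OF this chart_changeD(2)[OF \<omega>(1)]] \<omega>(3)
  have "\<forall>\<^sub>F w in nhds x'. g1 w = g2 w" by eventually_elim simp
  then show ?thesis using cgrp_eq_near[OF sing_A[OF s] g _ s] chart_changeD(6)[OF ch] by blast
qed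

lemma carrier_local_group:
  assumes "sing c" "x \<in> cdom c" "x \<in> first_factor e"
  shows "carrier (local_group c x) = cgrp c"
  using cgrp_fix[OF assms(1) _ assms(2,3)] by (auto simp: local_group_def)

lemma group_local_group:
  assumes "sing c" "x \<in> cdom c" "x \<in> first_factor e"
  shows "Group.group (local_group c x)"
proof -
  have "local_group c x = (BijGroup (cdom c))\<lparr>carrier := cgrp c\<rparr>"
    using cgrp_fix[OF assms(1) _ assms(2,3)] by (auto simp: local_group_def intro!: arg_cong[where f = "\<lambda>C. (BijGroup (cdom c))\<lparr>carrier := C\<rparr>"])
  then show ?thesis
    using subgroup.subgroup_is_group[OF cgrp_subgroup[OF sing_A[OF assms(1)]] group_BijGroup] by simp
qed

text \<open>Choose for each \<open>g\<close> a conjugate under \<psi>. The image of a product and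
  the product of the images are both conjugates of the product, so uniqueness gives a homomorphism;
  the inverse germ gives injectivity and surjectivity.\<close>

lemma chart_change_iso:
  assumes ch: "chart_change c x c' x' \<psi>" and s: "sing c" "sing c'" and x: "x \<in> first_factor e"
  obtains \<phi> where "\<phi> \<in> iso (local_group c x) (local_group c' x')"
    "\<And>g. g \<in> cgrp c \<Longrightarrow> germ_conj x \<psi> g (\<phi> g)"
proof -
  have D: "x \<in> cdom c" "x' \<in> cdom c'" using chart_changeD(5,6)[OF ch] by auto
  have x': "x' \<in> first_factor e" using chart_change_first_factor[OF ch s] x by simp
  have cA: "c \<in> A" "c' \<in> A" using s sing_A by auto
  note car = carrier_local_group[OF s(1) D(1) x] carrier_local_group[OF s(2) D(2) x']
  obtain \<omega> where \<omega>: "chart_change c' x' c x \<omega>" "\<forall>\<^sub>F z in nhds x. \<omega> (\<psi> z) = z" "\<forall>\<^sub>F w in nhds x'. \<psi> (\<omega> w) = w"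
    by (rule chart_change_sym[OF ch], rule that)
  have "\<forall>g\<in>cgrp c. \<exists>g'\<in>cgrp c'. germ_conj x \<psi> g g'"
    using chart_change_conjugates[OF ch s x] by (auto simp: germ_conj_def)
  then obtain \<phi> where \<phi>: "\<And>g. g \<in> cgrp c \<Longrightarrow> \<phi> g \<in> cgrp c'" "\<And>g. g \<in> cgrp c \<Longrightarrow> germ_conj x \<psi> g (\<phi> g)" by metis
  have hom: "\<phi> (\<lambda>z\<in>cdom c. g (h z)) = (\<lambda>w\<in>cdom c'. \<phi> g (\<phi> h w))" if g: "g \<in> cgrp c" "h \<in> cgrp c" for g h
  proof (rule germ_conj_unique[OF ch s(2), where g = "\<lambda>z\<in>cdom c. g (h z)"])
    show "\<phi> (\<lambda>z\<in>cdom c. g (h z)) \<in> cgrp c'" "(\<lambda>w\<in>cdom c'. \<phi> g (\<phi> h w)) \<in> cgrp c'"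
      "germ_conj x \<psi> (\<lambda>z\<in>cdom c. g (h z)) (\<phi> (\<lambda>z\<in>cdom c. g (h z)))"
      using \<phi> cgrp_mult_closed cA g by auto
    have hl: "filterlim h (nhds x) (nhds x)" using cgrp_filterlim[OF cA(1) g(2) D(1)] cgrp_fix[OF s(1) g(2) D(1) x] by simp
    have "\<forall>\<^sub>F z in nhds x. \<psi> (g (h z)) = \<phi> g (\<psi> (h z))"
      using eventually_compose_filterlim[OF \<phi>(2)[OF g(1), unfolded germ_conj_def] hl] .
    moreover have "\<forall>\<^sub>F z in nhds x. \<psi> (h z) = \<phi> h (\<psi> z)" using \<phi>(2)[OF g(2)] by (simp add: germ_conj_def)
    moreover have "\<forall>\<^sub>F z in nhds x. chart_change c z c' (\<psi> z) \<psi>" by (rule chart_changeD(3)[OF ch])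
    ultimately show "germ_conj x \<psi> (\<lambda>z\<in>cdom c. g (h z)) (\<lambda>w\<in>cdom c'. \<phi> g (\<phi> h w))"
      unfolding germ_conj_def
    proof eventually_elim
      case (elim z)
      then show ?case using chart_changeD(5,6)[OF elim(3)] by simp
    qed
  qed
  have inj: "g = h" if g: "g \<in> cgrp c" "h \<in> cgrp c" "\<phi> g = \<phi> h" for g h
  proof -
    have 1: "germ_conj x' \<omega> (\<phi> g) g" by (rule germ_conj_sym[OF ch \<omega> cA(1) g(1) cgrp_fix[OF s(1) g(1) D(1) x] \<phi>(2)[OF g(1)]])
    have "germ_conj x' \<omega> (\<phi> h) h" by (rule germ_conj_sym[OF ch \<omega> cA(1) g(2) cgrp_fix[OF s(1) g(2) D(1) x] \<phi>(2)[OF g(2)]])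
    then show ?thesis using germ_conj_unique[OF \<omega>(1) s(1) g(1,2) 1] g(3) by simp
  qed
  have surj: "\<exists>g\<in>cgrp c. \<phi> g = g'" if g': "g' \<in> cgrp c'" for g'
  proof -
    obtain g where g: "g \<in> cgrp c" "germ_conj x' \<omega> g' g"
      using chart_change_conjugates[OF \<omega>(1) s(2,1) x' g'] by (auto simp: germ_conj_def)
    have "germ_conj x \<psi> g g'" by (rule germ_conj_sym[OF \<omega>(1) ch \<omega>(3,2) cA(2) g' cgrp_fix[OF s(2) g' D(2) x'] g(2)])
    then have "\<phi> g = g'" using germ_conj_unique[OF ch s(2) \<phi>(1)[OF g(1)] g' \<phi>(2)[OF g(1)]] by simp
    then show ?thesis using g(1) by blast
  qed
  have "\<phi> \<in> iso (local_group c x) (local_group c' x')"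
  proof (rule isoI)
    show "\<phi> \<in> hom (local_group c x) (local_group c' x')"
      by (rule homI) (use \<phi>(1) hom in \<open>simp_all add: car mult_local_group cA\<close>)
    show "bij_betw \<phi> (carrier (local_group c x)) (carrier (local_group c' x'))"
      unfolding car bij_betw_def inj_on_def using inj surj \<phi>(1) by blast
  qed
  then show ?thesis using that \<phi>(2) by blast
qed

text \<open>A change of charts from \<open>x\<close> to itself is the germ of a group element
  \<open>k\<close>, so conjugation of germs is conjugation in the local group, written without
  inverses as \<open>h\<close> after \<open>k\<close> equal to \<open>k\<close> after
  \<open>g\<close>.\<close>

lemma inertia_equiv_same_point:
  assumes s: "sing c" and x: "x \<in> cdom c" "x \<in> first_factor e" and g: "g \<in> cgrp c" "h \<in> cgrp c"
  shows "inertia_equiv ((c, g), x) ((c, h), x) \<longleftrightarrow> h \<in> conj_class (local_group c x) g"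
proof -
  have cA: "c \<in> A" by (rule sing_A[OF s])
  interpret G: Group.group "local_group c x" by (rule group_local_group[OF s x])
  note car = carrier_local_group[OF s x]
  have key: "h = k \<otimes>\<^bsub>local_group c x\<^esub> g \<otimes>\<^bsub>local_group c x\<^esub> inv\<^bsub>local_group c x\<^esub> k \<longleftrightarrow> germ_conj x k g h"
    if k: "k \<in> cgrp c" for k
  proof -
    have "h = k \<otimes>\<^bsub>local_group c x\<^esub> g \<otimes>\<^bsub>local_group c x\<^esub> inv\<^bsub>local_group c x\<^esub> k \<longleftrightarrow>
        h \<otimes>\<^bsub>local_group c x\<^esub> k = k \<otimes>\<^bsub>local_group c x\<^esub> g"
      using G.inv_solve_right[of "h" "k \<otimes>\<^bsub>local_group c x\<^esub> g" k] g k car G.m_closed by auto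
    also have "\<dots> \<longleftrightarrow> (\<lambda>z\<in>cdom c. h (k z)) = (\<lambda>z\<in>cdom c. k (g z))" using mult_local_group cA g k by simp
    also have "\<dots> \<longleftrightarrow> germ_conj x k g h"
    proof
      assume "(\<lambda>z\<in>cdom c. h (k z)) = (\<lambda>z\<in>cdom c. k (g z))"
      then have "h (k z) = k (g z)" if "z \<in> cdom c" for z using that by (metis restrict_apply')
      then show "germ_conj x k g h" using eventually_cdom[OF cA x(1)] unfolding germ_conj_def by (auto elim: eventually_mono)
    next
      assume "germ_conj x k g h"
      then have "\<forall>\<^sub>F z in nhds x. (\<lambda>z\<in>cdom c. h (k z)) z = (\<lambda>z\<in>cdom c. k (g z)) z"
        unfolding germ_conj_def using eventually_cdom[OF cA x(1)] by eventually_elim simp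
      then show "(\<lambda>z\<in>cdom c. h (k z)) = (\<lambda>z\<in>cdom c. k (g z))"
        using cgrp_eq_near[OF cA cgrp_mult_closed[OF cA g(2) k] cgrp_mult_closed[OF cA k g(1)] x(1) s] by blast
    qed
    finally show ?thesis .
  qed
  show ?thesis
  proof
    assume "inertia_equiv ((c, g), x) ((c, h), x)"
    then obtain \<psi> where \<psi>: "chart_change c x c x \<psi>" "germ_conj x \<psi> g h" by (auto simp: inertia_equiv_iff)
    obtain k where k: "k \<in> cgrp c" "\<forall>\<^sub>F z in nhds x. \<psi> z = k z" using chart_change_self[OF \<psi>(1) s] by blast
    have gl: "filterlim g (nhds x) (nhds x)" using cgrp_filterlim[OF cA g(1) x(1)] cgrp_fix[OF s g(1) x] by simp
    have "germ_conj x k g h"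
      using \<psi>(2) k(2) eventually_compose_filterlim[OF k(2) gl] unfolding germ_conj_def by eventually_elim simp
    then show "h \<in> conj_class (local_group c x) g" using key[OF k(1)] k(1) car unfolding conj_class_def by blast
  next
    assume "h \<in> conj_class (local_group c x) g"
    then obtain k where k: "k \<in> cgrp c" "germ_conj x k g h" using key car unfolding conj_class_def by blast
    have "chart_change c x c x k" using chart_change_cgrp[OF cA k(1) x(1)] cgrp_fix[OF s k(1) x] by simp
    then show "inertia_equiv ((c, g), x) ((c, h), x)" using k(2) inertia_equiv_iff by blast
  qed
qed

section \<open>The normal representation\<close>

definition lin :: "('d, (complex ^ 'n) set) orb_chart \<Rightarrow> (complex ^ 'd \<Rightarrow> complex ^ 'd) \<Rightarrow> complex ^ 2 ^ 2" where
  "lin c g = (SOME M. M \<in> gam c \<and> g = restrict (act2 e M) (cdom c))"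

definition lin_rep :: "('d, (complex ^ 'n) set) orb_chart \<Rightarrow> (complex ^ 'd \<Rightarrow> complex ^ 'd) \<Rightarrow> cmat" where
  "lin_rep c g = jnf_mat (lin c g)"

lemma lin:
  assumes "sing c" "g \<in> cgrp c"
  shows "lin c g \<in> gam c" "g = restrict (act2 e (lin c g)) (cdom c)"
proof -
  have "\<exists>M. M \<in> gam c \<and> g = restrict (act2 e M) (cdom c)" using cgrpE[OF assms] by metis
  then have "lin c g \<in> gam c \<and> g = restrict (act2 e (lin c g)) (cdom c)" unfolding lin_def by (rule someI_ex)
  then show "lin c g \<in> gam c" "g = restrict (act2 e (lin c g)) (cdom c)" by auto
qed

lemma lin_apply: "sing c \<Longrightarrow> g \<in> cgrp c \<Longrightarrow> z \<in> cdom c \<Longrightarrow> g z = act2 e (lin c g) z"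
  using lin(2) by (metis restrict_apply')

text \<open>The chart domain, being open and nonempty, contains a point off
  \<open>first_factor e\<close>, and there the action is free.\<close>

lemma lin_unique:
  assumes s: "sing c" and g: "g \<in> cgrp c" and M: "M \<in> gam c" "\<And>z. z \<in> cdom c \<Longrightarrow> g z = act2 e M z"
  shows "lin c g = M"
proof -
  have "open (cdom c)" "cdom c \<noteq> {}" using chart[OF sing_A[OF s]] by (auto simp: orbifold_chart_def)
  then obtain x where x: "x \<in> cdom c" by blast
  obtain t :: real where t: "t > 0" "\<And>s. 0 < s \<Longrightarrow> s < t \<Longrightarrow> x + s *\<^sub>R normal_embed (axis 1 1) \<in> cdom c"
      "\<And>s. x \<in> first_factor e \<Longrightarrow> s \<noteq> 0 \<Longrightarrow> x + s *\<^sub>R normal_embed (axis 1 1) \<notin> first_factor e"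
    using open_not_subset_first_factor[OF \<open>open (cdom c)\<close> x] by metis
  have "\<exists>z\<in>cdom c. z \<notin> first_factor e"
  proof (cases "x \<in> first_factor e")
    case True
    then show ?thesis using t(1) t(2)[of "t/2"] t(3)[OF True, of "t/2"] by (intro bexI[of _ "x + (t/2) *\<^sub>R normal_embed (axis 1 1)"]) auto
  qed (use x in blast)
  then obtain z where z: "z \<in> cdom c" "z \<notin> first_factor e" by blast
  show ?thesis using act2_free[OF gam_SL2[OF s] lin(1)[OF s g] M(1) z(2)] lin_apply[OF s g z(1)] M(2)[OF z(1)] by simp
qed

lemma gam_props:
  assumes "sing c"
  shows "I2 \<in> gam c" "M \<in> gam c \<Longrightarrow> N \<in> gam c \<Longrightarrow> M ** N \<in> gam c" "M \<in> gam c \<Longrightarrow> Determinants.det M = 1"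
  using gam_SL2[OF assms] by (auto simp: finite_SL2_subgroup_def)

lemma lin_mult:
  assumes "sing c" "g \<in> cgrp c" "h \<in> cgrp c"
  shows "lin c (\<lambda>z\<in>cdom c. g (h z)) = lin c g ** lin c h"
proof (rule lin_unique[OF assms(1) cgrp_mult_closed[OF sing_A[OF assms(1)] assms(2,3)]])
  show "lin c g ** lin c h \<in> gam c" using gam_props(2)[OF assms(1)] lin(1) assms by blast
  fix z assume z: "z \<in> cdom c"
  have "h z \<in> cdom c" using cgrp_closed[OF sing_A[OF assms(1)] assms(3) z] .
  then show "(\<lambda>z\<in>cdom c. g (h z)) z = act2 e (lin c g ** lin c h) z"
    using z lin_apply[OF assms(1,2)] lin_apply[OF assms(1,3) z] by (simp add: act2_mult)
qed

lemma lin_one: "sing c \<Longrightarrow> lin c (\<lambda>z\<in>cdom c. z) = I2"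
  by (rule lin_unique) (use cgrp_one[OF sing_A] gam_props(1) act2_one in auto)

lemma representation_lin_rep:
  assumes "sing c" "x \<in> cdom c" "x \<in> first_factor e"
  shows "representation (local_group c x) 2 (lin_rep c)"
  unfolding representation_def carrier_local_group[OF assms] one_local_group
  using assms(1) by (simp add: lin_rep_def lin_one jnf_mat_one mult_local_group[OF sing_A[OF assms(1)]] lin_mult jnf_mat_mult)

lemma SL2_pair_lin_rep:
  assumes "sing c" "x \<in> cdom c" "x \<in> first_factor e"
  shows "SL2_pair (local_group c x) (lin_rep c)"
  unfolding SL2_pair_def
proof (intro conjI ballI)
  show "Group.group (local_group c x)" by (rule group_local_group[OF assms])
  show "finite (carrier (local_group c x))" using finite_cgrp[OF sing_A[OF assms(1)]] carrier_local_group[OF assms] by simp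
  show "representation (local_group c x) 2 (lin_rep c)" by (rule representation_lin_rep[OF assms])
  show "inj_on (lin_rep c) (carrier (local_group c x))"
    unfolding carrier_local_group[OF assms] inj_on_def lin_rep_def jnf_mat_inj using lin(2)[OF assms(1)] by metis
  show "Determinant.det (lin_rep c g) = 1" if "g \<in> carrier (local_group c x)" for g
    using that gam_props(3)[OF assms(1)] lin(1)[OF assms(1)] by (simp add: carrier_local_group[OF assms] lin_rep_def jnf_det)
qed

lemma cgrp_derivative:
  assumes "sing c" "g \<in> cgrp c" "x \<in> cdom c"
  shows "(g has_derivative act2 e (lin c g)) (at x)"
  by (rule has_derivative_transform_within_open[OF act2_derivative open_cdom[OF sing_A[OF assms(1)]] assms(3)])
    (simp add: lin_apply[OF assms(1,2)])

lemma curve_in_first_factor: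
  assumes "(\<gamma> has_vector_derivative v) (at (0::real))" "\<forall>\<^sub>F t in nhds 0. \<gamma> t \<in> first_factor e"
  shows "v \<in> first_factor e"
proof -
  have "((\<lambda>t. normal_part (\<gamma> t)) has_vector_derivative normal_part v) (at 0)"
    by (rule bounded_linear.has_vector_derivative[OF bounded_linear_normal_part assms(1)])
  moreover have "((\<lambda>t. normal_part (\<gamma> t)) has_vector_derivative 0) (at 0)"
  proof -
    obtain U where U: "open U" "0 \<in> U" "\<And>t. t \<in> U \<Longrightarrow> \<gamma> t \<in> first_factor e" using assms(2) by (auto simp: eventually_nhds)
    show ?thesis
      by (rule has_vector_derivative_transform_within_open[OF has_vector_derivative_const[of 0] U(1,2)])
        (use U(3) first_factor_iff in simp)
  qed
  ultimately show ?thesis using vector_derivative_unique_at first_factor_iff by metis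
qed

lemma line_vector_derivative: "((\<lambda>t. x + t *\<^sub>R v) has_vector_derivative v) (at (0::real))" for x v :: "complex ^ 'd"
  by (auto intro!: derivative_eq_intros)

text \<open>A change of charts preserves the preimage of \<open>S\<close>, so its derivative maps
  \<open>first_factor e\<close> into itself, as seen on velocities of straight lines. It therefore
  induces a complex linear map \<open>M\<close> of the normal spaces, computed on the section
  \<open>normal_embed\<close>.\<close>

lemma chart_change_derivative:
  assumes ch: "chart_change c x c' x' \<psi>" and s: "sing c" "sing c'" and x: "x \<in> first_factor e"
  obtains D M where "(\<psi> has_derivative D) (at x)" "\<And>v. normal_part (D v) = M *v normal_part v"
proof -
  obtain W W' where W: "x \<in> W" "biholomorphic W W' \<psi>" using ch unfolding chart_change_def by blast
  then obtain D where D: "(\<psi> has_derivative D) (at x)" "\<And>a v. D (a *s v) = a *s D v"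
    using holomorphic_map_derivative[of W \<psi> x] by (metis biholomorphic_def)
  have Dff: "D v \<in> first_factor e" if v: "v \<in> first_factor e" for v
  proof (rule curve_in_first_factor)
    have "((\<lambda>t. \<psi> (x + t *\<^sub>R v)) has_derivative (\<lambda>t. D (t *\<^sub>R v))) (at 0)"
    proof (rule has_derivative_compose[where g = \<psi> and f = "\<lambda>t::real. x + t *\<^sub>R v" and f' = "\<lambda>t. t *\<^sub>R v" and g' = D])
      show "((\<lambda>t. x + t *\<^sub>R v) has_derivative (\<lambda>t. t *\<^sub>R v)) (at (0::real))"
        using line_vector_derivative[of x v] by (simp add: has_vector_derivative_def)
      show "(\<psi> has_derivative D) (at (x + 0 *\<^sub>R v))" using D(1) by simp
    qed
    then show "((\<lambda>t. \<psi> (x + t *\<^sub>R v)) has_vector_derivative D v) (at 0)"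
      using linear_scale[OF has_derivative_linear[OF D(1)]] by (simp add: has_vector_derivative_def)
    have "filterlim (\<lambda>t::real. x + t *\<^sub>R v) (nhds x) (nhds 0)"
    proof -
      have "isCont (\<lambda>t::real. x + t *\<^sub>R v) 0" by (intro continuous_intros)
      then show ?thesis by (simp add: isCont_iff_filterlim)
    qed
    from eventually_compose_filterlim[OF chart_changeD(3)[OF ch] this]
    have ev: "\<forall>\<^sub>F t in nhds (0::real). chart_change c (x + t *\<^sub>R v) c' (\<psi> (x + t *\<^sub>R v)) \<psi>" .
    show "\<forall>\<^sub>F t in nhds 0. \<psi> (x + t *\<^sub>R v) \<in> first_factor e"
    proof (rule eventually_mono[OF ev])
      fix t :: real assume "chart_change c (x + t *\<^sub>R v) c' (\<psi> (x + t *\<^sub>R v)) \<psi>"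
      from chart_change_first_factor[OF this s] show "\<psi> (x + t *\<^sub>R v) \<in> first_factor e"
        using x v by (simp add: first_factor_iff normal_part_linear)
    qed
  qed
  define T where "T w = normal_part (D (normal_embed w))" for w
  have add: "D (v + w) = D v + D w" for v w using linear_add[OF has_derivative_linear[OF D(1)]] .
  have lT: "Vector_Spaces.linear (*s) (*s) T"
    unfolding Vector_Spaces.linear_iff by (simp add: vec.vector_space_axioms T_def normal_part_linear normal_embed_linear add D(2))
  have T: "T w = matrix T *v w" for w using matrix_vector_mul(1)[OF lT] by metis
  have "normal_part (D v) = T (normal_part v)" for v
  proof -
    define u where "u = v - normal_embed (normal_part v)"
    have "D v = D (normal_embed (normal_part v)) + D u" unfolding add[symmetric] u_def by simp
    moreover have "D u \<in> first_factor e" by (rule Dff) (simp add: u_def first_factor_iff normal_part_linear)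
    ultimately show ?thesis by (simp add: T_def normal_part_linear first_factor_iff)
  qed
  then show ?thesis using that[OF D(1), of "matrix T"] T by simp
qed

lemma has_derivative_eventually_unique:
  assumes "(f has_derivative D) (at x)" "(k has_derivative E) (at x)" "\<forall>\<^sub>F z in nhds (x :: complex ^ 'd). f z = k z"
  shows "D = E"
proof -
  obtain U where U: "open U" "x \<in> U" "\<And>z. z \<in> U \<Longrightarrow> f z = k z" using assms(3) by (auto simp: eventually_nhds)
  have "(k has_derivative D) (at x)"
    by (rule has_derivative_transform_within_open[OF assms(1) U(1,2)]) (use U(3) in simp)
  then show ?thesis using has_derivative_unique assms(2) by blast
qed

text \<open>The induced isomorphism of normal spaces is the derivative of the change of charts
  modulo the tangent space of \<open>first_factor e\<close>.\<close>

lemma chart_change_equiv_rep: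
  assumes ch: "chart_change c x c' x' \<psi>" and s: "sing c" "sing c'" and x: "x \<in> first_factor e"
    and \<phi>: "\<phi> \<in> iso (local_group c x) (local_group c' x')" "\<And>g. g \<in> cgrp c \<Longrightarrow> germ_conj x \<psi> g (\<phi> g)"
  shows "equiv_rep (local_group c x) (lin_rep c' \<circ> \<phi>) (lin_rep c)"
proof -
  have xx: "x \<in> cdom c" "x' \<in> cdom c'" using chart_changeD(5,6)[OF ch] by auto
  have x': "x' \<in> first_factor e" using chart_change_first_factor[OF ch s] x by simp
  have \<psi>x: "\<psi> x = x'" using chart_changeD(1)[OF ch] .
  note car = carrier_local_group[OF s(1) xx(1) x] carrier_local_group[OF s(2) xx(2) x']
  obtain \<omega> where \<omega>: "chart_change c' x' c x \<omega>" "\<forall>\<^sub>F z in nhds x. \<omega> (\<psi> z) = z" "\<forall>\<^sub>F w in nhds x'. \<psi> (\<omega> w) = w"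
    by (rule chart_change_sym[OF ch], rule that)
  have \<omega>x: "\<omega> x' = x" using chart_changeD(1)[OF \<omega>(1)] .
  obtain D T where D: "(\<psi> has_derivative D) (at x)" "\<And>v. normal_part (D v) = T *v normal_part v"
    by (rule chart_change_derivative[OF ch s x], rule that)
  obtain E U where E: "(\<omega> has_derivative E) (at x')" "\<And>v. normal_part (E v) = U *v normal_part v"
    by (rule chart_change_derivative[OF \<omega>(1) s(2,1) x'], rule that)
  have inv: "E (D v) = v" if "(f has_derivative D) (at y)" "(k has_derivative E) (at (f y))" "\<forall>\<^sub>F z in nhds y. k (f z) = z"
    for f k D E v and y :: "complex ^ 'd"
    using has_derivative_eventually_unique[OF has_derivative_compose[OF that(1,2)] has_derivative_ident that(3)] by metis
  have eqv: "D (act2 e (lin c g) v) = act2 e (lin c' (\<phi> g)) (D v)" if g: "g \<in> cgrp c" for g v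
  proof -
    have \<phi>g: "\<phi> g \<in> cgrp c'" using iso_carrier[OF \<phi>(1)] g car by blast
    have "((\<lambda>z. \<psi> (g z)) has_derivative (\<lambda>v. D (act2 e (lin c g) v))) (at x)"
      by (rule has_derivative_compose[OF cgrp_derivative[OF s(1) g xx(1)]]) (use D(1) cgrp_fix[OF s(1) g xx(1) x] in simp)
    moreover have "((\<lambda>z. \<phi> g (\<psi> z)) has_derivative (\<lambda>v. act2 e (lin c' (\<phi> g)) (D v))) (at x)"
      by (rule has_derivative_compose[OF D(1)]) (use cgrp_derivative[OF s(2) \<phi>g xx(2)] \<psi>x in simp)
    ultimately have "(\<lambda>v. D (act2 e (lin c g) v)) = (\<lambda>v. act2 e (lin c' (\<phi> g)) (D v))"
      using has_derivative_eventually_unique \<phi>(2)[OF g] unfolding germ_conj_def by blast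
    then show ?thesis by metis
  qed
  have "E (D v) = v" for v by (rule inv[OF D(1) _ \<omega>(2)]) (simp add: \<psi>x E(1))
  moreover have "D (E v) = v" for v by (rule inv[OF E(1) _ \<omega>(3)]) (simp add: \<omega>x D(1))
  moreover have "U *v (T *v w) = normal_part (E (D (normal_embed w)))" "T *v (U *v w) = normal_part (D (E (normal_embed w)))" for w
    by (simp_all add: D(2) E(2))
  ultimately have PU: "T ** U = I2" "U ** T = I2"
    unfolding matrix_eq by (simp_all add: matrix_vector_mul_assoc[symmetric])
  have com: "T ** lin c g = lin c' (\<phi> g) ** T" if g: "g \<in> cgrp c" for g
    unfolding matrix_eq
  proof
    fix w
    have "T *v (lin c g *v w) = normal_part (D (act2 e (lin c g) (normal_embed w)))" by (simp add: D(2))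
    also have "\<dots> = lin c' (\<phi> g) *v (T *v w)" by (simp add: eqv[OF g] D(2))
    finally show "T ** lin c g *v w = lin c' (\<phi> g) ** T *v w" by (simp add: matrix_vector_mul_assoc)
  qed
  note R = representation_lin_rep[OF s(1) xx(1) x] representation_lin_rep[OF s(2) xx(2) x']
  have R': "representation (local_group c x) 2 (lin_rep c' \<circ> \<phi>)"
    by (rule representation_twist[OF group_local_group[OF s(1) xx(1) x] group_local_group[OF s(2) xx(2) x'] \<phi>(1), THEN iffD2]) (rule R(2))
  have "equiv_rep (local_group c x) (lin_rep c) (lin_rep c' \<circ> \<phi>)"
  proof (rule equiv_repI[OF R(1) R', of "jnf_mat T" "jnf_mat U"])
    show "jnf_mat T * jnf_mat U = 1\<^sub>m 2" "jnf_mat U * jnf_mat T = 1\<^sub>m 2"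
      by (simp_all add: jnf_mat_mult[symmetric] PU jnf_mat_one)
    show "jnf_mat T * lin_rep c g = (lin_rep c' \<circ> \<phi>) g * jnf_mat T" if "g \<in> carrier (local_group c x)" for g
      using com[of g] that car by (simp add: lin_rep_def jnf_mat_mult[symmetric])
  qed auto
  then show ?thesis by (rule equiv_rep_sym[OF _ R(1) R'])
qed

text \<open>One inclusion differentiates curves lying in a linear subspace; the other uses straight
  lines, which stay in the open chart domain for small time.\<close>

lemma tangent_space_sing:
  assumes s: "sing c" and x: "x \<in> cdom c" "x \<in> first_factor e"
  shows "tangent_space {z \<in> cdom c. cmap c z \<in> S} x = first_factor e"
proof (intro subset_antisym subsetI)
  fix v assume "v \<in> tangent_space {z \<in> cdom c. cmap c z \<in> S} x"
  then obtain \<gamma> :: "real \<Rightarrow> _" where \<gamma>: "(\<gamma> has_vector_derivative v) (at 0)"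
    "\<forall>\<^sub>F t in nhds 0. \<gamma> t \<in> {z \<in> cdom c. cmap c z \<in> S}" by (auto simp: tangent_space_def)
  show "v \<in> first_factor e"
    by (rule curve_in_first_factor[OF \<gamma>(1) eventually_mono[OF \<gamma>(2)]]) (use sing_preimage[OF s] in blast)
next
  fix v assume v: "v \<in> first_factor e"
  have "filterlim (\<lambda>t::real. x + t *\<^sub>R v) (nhds x) (nhds 0)"
  proof -
    have "isCont (\<lambda>t::real. x + t *\<^sub>R v) 0" by (intro continuous_intros)
    then show ?thesis by (simp add: isCont_iff_filterlim)
  qed
  from eventually_compose_filterlim[OF eventually_cdom[OF sing_A[OF s] x(1)] this]
  have "\<forall>\<^sub>F t in nhds (0::real). x + t *\<^sub>R v \<in> {z \<in> cdom c. cmap c z \<in> S}"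
  proof (rule eventually_mono)
    fix t :: real assume d: "x + t *\<^sub>R v \<in> cdom c"
    have "x + t *\<^sub>R v \<in> first_factor e" using x(2) v by (simp add: first_factor_iff normal_part_linear)
    then show "x + t *\<^sub>R v \<in> {z \<in> cdom c. cmap c z \<in> S}" using sing_preimage[OF s d] d by simp
  qed
  then show "v \<in> tangent_space {z \<in> cdom c. cmap c z \<in> S} x"
    unfolding tangent_space_def using line_vector_derivative[of x v]
    by (intro CollectI exI[of _ "\<lambda>t. x + t *\<^sub>R v"]) simp
qed

lemma normal_rep_lin_rep:
  assumes s: "sing c" and x: "x \<in> cdom c" "x \<in> first_factor e"
  shows "normal_rep S c x 2 (lin_rep c)"
  unfolding normal_rep_def tangent_space_sing[OF assms] carrier_local_group[OF assms]
proof (intro conjI exI[of _ "\<lambda>v. jnf_vec (normal_part v)"] allI ballI)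
  show "representation (local_group c x) 2 (lin_rep c)" by (rule representation_lin_rep[OF assms])
  show "range (\<lambda>v. jnf_vec (normal_part v)) = carrier_vec 2"
  proof (intro subset_antisym subsetI)
    fix w :: "cvec" assume "w \<in> carrier_vec 2"
    then obtain v where "jnf_vec v = w" using jnf_vec_surj by blast
    then have "w = jnf_vec (normal_part (normal_embed v))" by simp
    then show "w \<in> range (\<lambda>v. jnf_vec (normal_part v))" by blast
  qed auto
  show "{v. jnf_vec (normal_part v) = 0\<^sub>v 2} = first_factor e" by (auto simp: jnf_vec_zero first_factor_iff)
  fix g v assume g: "g \<in> cgrp c"
  have "frechet_derivative g (at x) = act2 e (lin c g)" using frechet_derivative_at[OF cgrp_derivative[OF s g x(1)]] by simp
  then show "jnf_vec (normal_part (frechet_derivative g (at x) v)) = lin_rep c g *\<^sub>v jnf_vec (normal_part v)"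
    by (simp add: lin_rep_def jnf_mult_vec)
qed (simp_all add: normal_part_linear jnf_vec_add jnf_vec_smult)

lemma jnf_mult_vec_general:
  assumes "\<And>v w. L (v + w) = L v + L w" "\<And>a v. L (a *s v) = a \<cdot>\<^sub>v L v" "\<And>w. L w \<in> carrier_vec n"
  shows "\<exists>B\<in>carrier_mat n 2. \<forall>w :: complex ^ 2. B *\<^sub>v jnf_vec w = L w"
proof -
  define B where "B = Matrix.mat n 2 (\<lambda>(i, j). Matrix.vec_index (L (axis (idx2 j) 1)) i)"
  have "B *\<^sub>v jnf_vec w = L w" for w
  proof -
    have "w = (w $ 1) *s axis 1 1 + (w $ 2) *s axis 2 1"
      by (simp add: Finite_Cartesian_Product.vec_eq_iff forall_2 axis_def)
    then have "L w = (w $ 1) \<cdot>\<^sub>v L (axis 1 1) + (w $ 2) \<cdot>\<^sub>v L (axis 2 1)" using assms(1,2) by metis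
    moreover have "(B *\<^sub>v jnf_vec w) $v i =
        w $ 1 * (L (axis 1 1)) $v i + w $ 2 * (L (axis 2 1)) $v i" if "i < n" for i
      using that by (simp add: B_def jnf_vec_def idx2_def scalar_prod_def numeral_2_eq_2)
    ultimately show ?thesis using assms(3)[of "axis 1 1"] assms(3)[of "axis 2 1"]
      by (intro eq_vecI) (auto simp: B_def)
  qed
  moreover have "B \<in> carrier_mat n 2" by (simp add: B_def)
  ultimately show ?thesis by blast
qed

text \<open>\<open>L\<close> vanishes exactly on \<open>first_factor e\<close> and is onto, so it
  factors through \<open>normal_part\<close> as an isomorphism \<open>B\<close> from the
  two-dimensional normal space, compatible with the group. As \<open>B\<close> has the two-sided
  inverse \<open>C\<close>, comparing traces gives \<open>n = 2\<close>.\<close>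

lemma normal_rep_unique:
  assumes s: "sing c" and x: "x \<in> cdom c" "x \<in> first_factor e" and Q: "normal_rep S c x n Q"
  shows "n = 2" "equiv_rep (local_group c x) Q (lin_rep c)"
proof -
  note car = carrier_local_group[OF s x]
  obtain L :: "complex ^ 'd \<Rightarrow> cvec" where R: "representation (local_group c x) n Q"
    and L: "range L = carrier_vec n" "\<And>v w. L (v + w) = L v + L w" "\<And>a v. L (a *s v) = a \<cdot>\<^sub>v L v"
      "{v. L v = 0\<^sub>v n} = first_factor e" "\<And>g v. g \<in> cgrp c \<Longrightarrow> L (frechet_derivative g (at x) v) = Q g *\<^sub>v L v"
    using Q unfolding normal_rep_def tangent_space_sing[OF s x] car by blast
  have Lc: "L v \<in> carrier_vec n" for v using L(1) by blast
  have Lff: "L v = L (normal_embed (normal_part v))" for v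
  proof -
    have "L (v - normal_embed (normal_part v)) = 0\<^sub>v n"
    proof -
      have "v - normal_embed (normal_part v) \<in> first_factor e" by (simp add: first_factor_iff normal_part_linear)
      then show ?thesis using L(4) by blast
    qed
    moreover have "L v = L (normal_embed (normal_part v)) + L (v - normal_embed (normal_part v))" by (simp add: L(2)[symmetric])
    ultimately show ?thesis using Lc by simp
  qed
  obtain B :: "cmat" where B: "B \<in> carrier_mat n 2" "\<And>w. B *\<^sub>v jnf_vec w = L (normal_embed w)"
  proof -
    have "\<exists>B\<in>carrier_mat n 2. \<forall>w. B *\<^sub>v jnf_vec w = L (normal_embed w)"
      by (rule jnf_mult_vec_general) (simp_all only: L(2,3) Lc normal_embed_linear)
    then show ?thesis using that by blast
  qed
  have "\<forall>j. \<exists>w. L (normal_embed w) = unit_vec n j"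
  proof
    fix j
    have "unit_vec n j \<in> range L" unfolding L(1) by simp
    then obtain v where "unit_vec n j = L v" by blast
    then show "\<exists>w. L (normal_embed w) = unit_vec n j" using Lff[of v] by (intro exI[of _ "normal_part v"]) simp
  qed
  then obtain u where u: "\<And>j. L (normal_embed (u j)) = unit_vec n j" using choice[of "\<lambda>j w. L (normal_embed w) = unit_vec n j"] by blast
  \<comment> \<open>The columns are normal vectors that \<open>L\<close> sends to the unit vectors,
    which makes \<open>C\<close> a right inverse of \<open>B\<close>; that it is a left inverse
    follows from the kernel of \<open>L\<close>.\<close>
  define C where "C = Matrix.mat_of_cols 2 (map (\<lambda>j. jnf_vec (u j)) [0..<n])"
  have C: "C \<in> carrier_mat 2 n" using mat_of_cols_carrier(1)[of 2 "map (\<lambda>j. jnf_vec (u j)) [0..<n]"] by (simp add: C_def)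
  have colC: "col C j = jnf_vec (u j)" if "j < n" for j
    using that by (simp add: C_def)
  have BC: "B * C = 1\<^sub>m n"
  proof (rule mat_eq_mult_vecI[where n = n and m = n])
    show "B * C \<in> carrier_mat n n" using B(1) C by simp
    have "col (B * C) j = unit_vec n j" if "j < n" for j
      using that C colC B u by (simp add: col_mult2[OF B(1) C that])
    then have "B * C = 1\<^sub>m n" using B(1) C by (intro mat_col_eqI) auto
    then show "B * C *\<^sub>v v = 1\<^sub>m n *\<^sub>v v" for v by simp
  qed auto
  have CB: "C * B = 1\<^sub>m 2"
  proof (rule mat_eq_mult_vecI[where n = 2 and m = 2])
    show "C * B \<in> carrier_mat 2 2" using B(1) C by simp
    fix v :: "cvec" assume v: "v \<in> carrier_vec 2"
    then obtain w where w: "v = jnf_vec w" using jnf_vec_surj by metis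
    have Cc: "C * B *\<^sub>v v \<in> carrier_vec 2" using B(1) C v by auto
    then obtain w' where w': "C * B *\<^sub>v v = jnf_vec w'" using jnf_vec_surj by metis
    have "B *\<^sub>v (C * B *\<^sub>v v) = (B * C) *\<^sub>v (B *\<^sub>v v)"
      using B(1) C v by (simp add: assoc_mult_mat_vec[of _ n 2 _ n] assoc_mult_mat_vec[of _ 2 n _ 2])
    also have "\<dots> = B *\<^sub>v v" unfolding BC using B(1) v by simp
    finally have "B *\<^sub>v jnf_vec w' = B *\<^sub>v jnf_vec w" unfolding w'[symmetric] w[symmetric] .
    then have "L (normal_embed w') = L (normal_embed w)" by (simp only: B(2))
    then have "L (normal_embed w' + (-1) *s normal_embed w) = 0\<^sub>v n"
      using Lc[of "normal_embed w"] unfolding L(2,3) by (auto intro!: eq_vecI)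
    then have "normal_embed w' + (-1) *s normal_embed w \<in> first_factor e" using L(4) by blast
    then have "w' = w" by (simp add: first_factor_iff normal_part_linear)
    then show "C * B *\<^sub>v v = 1\<^sub>m 2 *\<^sub>v v" using w w' v by simp
  qed auto
  show n: "n = 2" by (rule mutually_inverse_square[OF B(1) C BC CB])
  have com: "B * lin_rep c g = Q g * B" if g: "g \<in> cgrp c" for g
  proof (rule mat_eq_mult_vecI[where n = n and m = 2])
    have Qg: "Q g \<in> carrier_mat n n" using R g car by (auto simp: representation_def)
    have lg: "lin_rep c g \<in> carrier_mat 2 2" by (simp add: lin_rep_def)
    show "B * lin_rep c g \<in> carrier_mat n 2" "Q g * B \<in> carrier_mat n 2" using B(1) Qg lg by auto
    fix v :: "cvec" assume v: "v \<in> carrier_vec 2"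
    then obtain w where w: "v = jnf_vec w" using jnf_vec_surj by metis
    have fr: "frechet_derivative g (at x) = act2 e (lin c g)" using frechet_derivative_at[OF cgrp_derivative[OF s g x(1)]] by simp
    have "(B * lin_rep c g) *\<^sub>v v = B *\<^sub>v (lin_rep c g *\<^sub>v v)" by (rule assoc_mult_mat_vec[OF B(1) lg v])
    also have "\<dots> = L (normal_embed (lin c g *v w))" by (simp add: w lin_rep_def jnf_mult_vec B(2))
    also have "\<dots> = Q g *\<^sub>v L (normal_embed w)" using L(5)[OF g, of "normal_embed w"] by (simp add: fr act2_embed)
    also have "\<dots> = Q g *\<^sub>v (B *\<^sub>v v)" by (simp add: w B(2))
    also have "\<dots> = (Q g * B) *\<^sub>v v" by (rule assoc_mult_mat_vec[OF Qg B(1) v, symmetric])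
    finally show "B * lin_rep c g *\<^sub>v v = Q g * B *\<^sub>v v" .
  qed
  have "equiv_rep (local_group c x) (lin_rep c) Q"
    by (rule equiv_repI[OF representation_lin_rep[OF s x] R B(1) C BC CB]) (use com car in simp)
  then show "equiv_rep (local_group c x) Q (lin_rep c)"
    by (rule equiv_rep_sym[OF _ representation_lin_rep[OF s x] R])
qed

text \<open>Needed because the identification is applied to an arbitrary matrix form
  \<open>Q\<close> of the normal representation, which is related to \<open>lin_rep c\<close> by an
  equivalence.\<close>

lemma SL2_pair_equiv:
  assumes "SL2_pair G Q" "equiv_rep G Q' Q" "representation G 2 Q'"
  shows "SL2_pair G Q'"
proof -
  have Q: "representation G 2 Q" using assms(1) by (simp add: SL2_pair_def)
  obtain T S where TS: "T \<in> carrier_mat 2 2" "S \<in> carrier_mat 2 2" "T * S = 1\<^sub>m 2" "S * T = 1\<^sub>m 2"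
    "\<And>g. g \<in> carrier G \<Longrightarrow> T * Q' g = Q g * T" using equiv_repE[OF assms(2,3) Q] by metis
  have Q': "Q' g \<in> carrier_mat 2 2" "Q g \<in> carrier_mat 2 2" if "g \<in> carrier G" for g using assms(3) Q that by (auto simp: representation_def)
  have rec: "Q g = T * Q' g * S" if g: "g \<in> carrier G" for g
  proof -
    have "T * Q' g * S = Q g * T * S" by (simp add: TS(5)[OF g])
    also have "\<dots> = Q g * (T * S)" by (rule assoc_mult_mat[OF Q'(2)[OF g] TS(1,2)])
    finally show ?thesis using TS(3) Q'(2)[OF g] by simp
  qed
  have "inj_on Q' (carrier G)"
  proof (rule inj_onI)
    fix g h assume "g \<in> carrier G" "h \<in> carrier G" "Q' g = Q' h"
    then have "Q g = Q h" using rec by simp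
    then show "g = h" using assms(1) \<open>g \<in> carrier G\<close> \<open>h \<in> carrier G\<close> by (auto simp: SL2_pair_def inj_on_def)
  qed
  moreover have "Determinant.det (Q' g) = 1" if g: "g \<in> carrier G" for g
  proof -
    have "Determinant.det T * Determinant.det (Q' g) = Determinant.det (Q g) * Determinant.det T"
      unfolding det_mult[OF TS(1) Q'(1)[OF g], symmetric] det_mult[OF Q'(2)[OF g] TS(1), symmetric] TS(5)[OF g] ..
    moreover have "Determinant.det T \<noteq> 0"
      using det_mult[OF TS(1,2)] TS(3) by auto
    ultimately show ?thesis using assms(1) g by (simp add: SL2_pair_def)
  qed
  ultimately show ?thesis using assms by (simp add: SL2_pair_def)
qed

end

section \<open>The covering of the singular locus by the twisted sectors\<close>

lemma topspace_quotient_topology: "topspace (quotient_topology X q) = q ` topspace X"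
proof
  show "topspace (quotient_topology X q) \<subseteq> q ` topspace X"
    using openin_topspace[of "quotient_topology X q"] by (simp only: openin_quotient_topology)
  have "openin (quotient_topology X q) (q ` topspace X)"
  proof -
    have "{x \<in> topspace X. q x \<in> q ` topspace X} = topspace X" by blast
    then show ?thesis unfolding openin_quotient_topology by simp
  qed
  then show "q ` topspace X \<subseteq> topspace (quotient_topology X q)" by (rule openin_subset)
qed

lemma openin_top_of_setI:
  fixes Z :: "'a::topological_space set"
  assumes "T \<subseteq> Z" "\<And>x. x \<in> T \<Longrightarrow> \<forall>\<^sub>F z in nhds x. z \<in> Z \<longrightarrow> z \<in> T"
  shows "openin (top_of_set Z) T"
proof (subst openin_subopen, intro ballI)
  fix x assume x: "x \<in> T"
  obtain U where U: "open U" "x \<in> U" "\<forall>z\<in>U. z \<in> Z \<longrightarrow> z \<in> T"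
    using assms(2)[OF x, unfolded eventually_nhds] by blast
  have "openin (top_of_set Z) (Z \<inter> U)" by (rule openin_open_Int[OF U(1)])
  moreover have "x \<in> Z \<inter> U" "Z \<inter> U \<subseteq> T" using x assms(1) U by auto
  ultimately show "\<exists>U. openin (top_of_set Z) U \<and> x \<in> U \<and> U \<subseteq> T" by blast
qed

context ade_orbifold
begin

abbreviation IC where "IC \<equiv> topspace (inertia_cover A)"

abbreviation Tw where "Tw \<equiv> twisted_space A"

abbreviation B :: "(complex ^ 'n) set topology" where "B \<equiv> subtopology proj_space S"

abbreviation one :: "('d, (complex ^ 'n) set) orb_chart \<Rightarrow> complex ^ 'd \<Rightarrow> complex ^ 'd" where
  "one c \<equiv> (\<lambda>z\<in>cdom c. z)"

text \<open>For a chart with \<open>sing c\<close> this is the part lying over \<open>S\<close>; the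
  group fixes it pointwise, so \<open>cmap c\<close> is injective on it and it serves as a
  coordinate patch of \<open>S\<close>.\<close>

definition zone :: "('d, (complex ^ 'n) set) orb_chart \<Rightarrow> (complex ^ 'd) set" where
  "zone c = cdom c \<inter> first_factor e"

text \<open>For fixed \<open>c\<close> and \<open>g\<close>, a local section of the projection to
  \<open>S\<close>: the class of \<open>g\<close> followed along \<open>zone c\<close>.\<close>

definition sheet where
  "sheet c g x = inertia_proj A ((c, g), x)"

definition TP :: "('d, (complex ^ 'n) set) inertia_pt set" where
  "TP = {((c, g), x) | c g x. sing c \<and> g \<in> cgrp c \<and> g \<noteq> one c \<and> x \<in> zone c}"

lemma zoneD: "x \<in> zone c \<Longrightarrow> x \<in> cdom c" "x \<in> zone c \<Longrightarrow> x \<in> first_factor e"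
  by (auto simp: zone_def)

lemma mem_cover: "((c, g), x) \<in> IC \<longleftrightarrow> c \<in> A \<and> g \<in> cgrp c \<and> x \<in> cdom c \<and> g x = x"
  by (auto simp: inertia_cover_def)

lemma TP_iff: "((c, g), x) \<in> TP \<longleftrightarrow> sing c \<and> g \<in> cgrp c \<and> g \<noteq> one c \<and> x \<in> zone c"
  by (simp add: TP_def)

lemma TP_iff': "((c, g), x) \<in> TP \<longleftrightarrow> ((c, g), x) \<in> IC \<and> g \<noteq> one c"
proof
  assume "((c, g), x) \<in> TP"
  then have "sing c" "g \<in> cgrp c" "g \<noteq> one c" "x \<in> cdom c" "x \<in> first_factor e" by (auto simp: TP_iff zone_def)
  then show "((c, g), x) \<in> IC \<and> g \<noteq> one c" unfolding mem_cover using cgrp_fix sing_A by auto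
next
  assume "((c, g), x) \<in> IC \<and> g \<noteq> one c"
  then have "c \<in> A" "g \<in> cgrp c" "g \<noteq> one c" "x \<in> cdom c" "g x = x" by (auto simp: mem_cover)
  then show "((c, g), x) \<in> TP" using fixed_first_factor[of c g x] by (auto simp: TP_iff zone_def)
qed

lemma sheet_in_cover: "sing c \<Longrightarrow> g \<in> cgrp c \<Longrightarrow> x \<in> zone c \<Longrightarrow> ((c, g), x) \<in> IC"
  using cgrp_fix sing_A zoneD by (simp add: mem_cover)

lemma fst_proj [simp]: "fst (inertia_proj A ((c, g), x)) = cmap c x"
  by (simp add: inertia_proj_def)

lemma fst_sheet [simp]: "fst (sheet c g x) = cmap c x"
  by (simp add: sheet_def)

lemma mem_snd_proj: "v \<in> snd (inertia_proj A ((c, g), x)) \<longleftrightarrow> v \<in> IC \<and> inertia_equiv ((c, g), x) v"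
  by (simp add: inertia_proj_def)

lemma inertia_proj_eq_iff:
  assumes "((c, g), x) \<in> IC" "((c', g'), x') \<in> IC"
  shows "inertia_proj A ((c, g), x) = inertia_proj A ((c', g'), x') \<longleftrightarrow> inertia_equiv ((c, g), x) ((c', g'), x')"
proof
  assume "inertia_proj A ((c, g), x) = inertia_proj A ((c', g'), x')"
  moreover have "((c', g'), x') \<in> snd (inertia_proj A ((c', g'), x'))"
    unfolding mem_snd_proj using assms(2) inertia_equiv_refl by (simp add: mem_cover)
  ultimately have "((c', g'), x') \<in> snd (inertia_proj A ((c, g), x))" by simp
  then show "inertia_equiv ((c, g), x) ((c', g'), x')" by (simp add: mem_snd_proj)
next
  assume eq: "inertia_equiv ((c, g), x) ((c', g'), x')"
  have sym: "inertia_equiv ((c', g'), x') ((c, g), x)" by (rule inertia_equiv_sym[OF eq]) (use assms(1) in \<open>auto simp: mem_cover\<close>)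
  obtain \<psi> where "chart_change c x c' x' \<psi>" using eq by (auto simp: inertia_equiv_iff)
  then have "cmap c' x' = cmap c x" by (rule chart_changeD(4))
  moreover have "inertia_equiv ((c, g), x) v \<longleftrightarrow> inertia_equiv ((c', g'), x') v" for v
  proof -
    obtain c2 g2 x2 where v: "v = ((c2, g2), x2)" by (metis prod.exhaust)
    show ?thesis unfolding v using inertia_equiv_trans[OF eq, of c2 g2 x2] inertia_equiv_trans[OF sym, of c2 g2 x2] by blast
  qed
  ultimately show "inertia_proj A ((c, g), x) = inertia_proj A ((c', g'), x')" by (simp add: inertia_proj_def)
qed

text \<open>If \<open>g'\<close> were the identity, the conjugating germ \<psi> would make
  \<open>g\<close> the identity near \<open>x\<close>, hence everywhere.\<close>

lemma TP_saturated:
  assumes u: "((c, g), x) \<in> TP" and v: "((c', g'), x') \<in> IC" and eq: "inertia_equiv ((c, g), x) ((c', g'), x')"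
  shows "((c', g'), x') \<in> TP"
  unfolding TP_iff'
proof (intro conjI v notI)
  assume g': "g' = one c'"
  have s: "sing c" "g \<in> cgrp c" "g \<noteq> one c" "x \<in> cdom c" "x \<in> first_factor e" using u by (auto simp: TP_iff zone_def)
  note cA = sing_A[OF s(1)]
  obtain \<psi> where \<psi>: "chart_change c x c' x' \<psi>" "germ_conj x \<psi> g g'" using eq by (auto simp: inertia_equiv_iff)
  obtain \<omega> where \<omega>: "chart_change c' x' c x \<omega>" "\<forall>\<^sub>F z in nhds x. \<omega> (\<psi> z) = z" "\<forall>\<^sub>F w in nhds x'. \<psi> (\<omega> w) = w"
    by (rule chart_change_sym[OF \<psi>(1)], rule that)
  have gl: "filterlim g (nhds x) (nhds x)" using cgrp_filterlim[OF cA s(2,4)] cgrp_fix[OF s(1,2,4,5)] by simp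
  have "\<forall>\<^sub>F z in nhds x. g z = one c z"
    using \<psi>(2)[unfolded germ_conj_def] chart_changeD(3)[OF \<psi>(1)] \<omega>(2) eventually_compose_filterlim[OF \<omega>(2) gl]
  proof eventually_elim
    case (elim z)
    have "\<psi> z \<in> cdom c'" "z \<in> cdom c" using chart_changeD(5,6)[OF elim(2)] by auto
    then have "\<psi> (g z) = \<psi> z" using elim(1) g' by simp
    then have "g z = z" using elim(3,4) by simp
    then show ?case using \<open>z \<in> cdom c\<close> by simp
  qed
  then have "g = one c" using cgrp_eq_near[OF cA s(2) cgrp_one[OF cA] s(4,1)] by blast
  then show False using s(3) by blast
qed

lemma TP_subset: "TP \<subseteq> IC"
proof
  fix u assume u: "u \<in> TP"
  obtain c g x where "u = ((c, g), x)" by (metis prod.exhaust)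
  then show "u \<in> IC" using u TP_iff' by blast
qed

lemma TP_preimage:
  assumes "u \<in> IC" "inertia_proj A u \<in> inertia_proj A ` TP"
  shows "u \<in> TP"
proof -
  obtain c' g' x' where u: "u = ((c', g'), x')" by (metis prod.exhaust)
  obtain v where v: "v \<in> TP" "inertia_proj A u = inertia_proj A v" using assms(2) by blast
  obtain c g x where v': "v = ((c, g), x)" by (metis prod.exhaust)
  have "inertia_equiv ((c, g), x) ((c', g'), x')"
    using inertia_proj_eq_iff[of c g x c' g' x'] assms(1) TP_subset v u v' by auto
  then show ?thesis using TP_saturated v(1) assms(1) u v' by blast
qed

text \<open>In the disjoint union \<open>TP\<close> consists of the entire summands with nontrivial
  \<open>g\<close>. The property passes to the quotient because \<open>TP\<close> is saturated
  (\<open>TP_preimage\<close>).\<close>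

lemma clopen_TP: "openin (inertia_cover A) TP" "closedin (inertia_cover A) TP"
proof -
  have e: "{x. ((c, g), x) \<in> TP} = (if g = one c then {} else {x \<in> cdom c. g x = x})" if "c \<in> A" "g \<in> cgrp c" for c g
    using that by (auto simp: TP_iff' mem_cover)
  show "openin (inertia_cover A) TP"
    using TP_subset unfolding inertia_cover_def openin_sum_topology by (auto simp: e)
  show "closedin (inertia_cover A) TP"
    using TP_subset unfolding inertia_cover_def closedin_sum_topology by (auto simp: e)
qed

lemma topspace_inertia_space: "topspace (inertia_space A) = inertia_proj A ` IC"
  by (simp add: inertia_space_def topspace_quotient_topology)

lemma clopen_image_TP:
  "openin (inertia_space A) (inertia_proj A ` TP)" "closedin (inertia_space A) (inertia_proj A ` TP)"
proof -
  have e: "{u \<in> IC. inertia_proj A u \<in> inertia_proj A ` TP} = TP"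
    using TP_preimage TP_subset by blast
  show "openin (inertia_space A) (inertia_proj A ` TP)"
    unfolding inertia_space_def openin_quotient_topology e using clopen_TP(1) TP_subset by blast
  have "{u \<in> IC. inertia_proj A u \<in> topspace (inertia_space A) - inertia_proj A ` TP} =
      IC - TP"
    using TP_preimage unfolding topspace_inertia_space by blast
  then have "openin (inertia_space A) (topspace (inertia_space A) - inertia_proj A ` TP)"
    unfolding inertia_space_def openin_quotient_topology using clopen_TP(2) by (simp add: closedin_def topspace_quotient_topology)
  then show "closedin (inertia_space A) (inertia_proj A ` TP)"
    unfolding closedin_def topspace_inertia_space using TP_subset by blast
qed

text \<open>The image of \<open>TP\<close> is open and closed, so each connected component lies
  inside it or misses it; the components inside are the twisted sectors. An explicit set thereby
  replaces the connected components of the definition.\<close>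

lemma Union_twisted_sectors: "\<Union> (twisted_sectors A) = inertia_proj A ` TP"
proof (intro subset_antisym subsetI)
  fix k assume "k \<in> \<Union> (twisted_sectors A)"
  then obtain K where K: "k \<in> K" "K \<in> connected_components_of (inertia_space A)"
    "\<forall>(y, C) \<in> K. \<forall>((c, g), x) \<in> C. g \<noteq> \<one>\<^bsub>local_group c x\<^esub>" by (auto simp: twisted_sectors_def)
  have "k \<in> topspace (inertia_space A)" using K(1,2) Union_connected_components_of[of "inertia_space A"] by blast
  then obtain u where u: "u \<in> IC" "k = inertia_proj A u"
    unfolding topspace_inertia_space by blast
  obtain c g x where ue: "u = ((c, g), x)" by (metis prod.exhaust)
  have uk: "u \<in> snd k" using u inertia_equiv_refl unfolding ue u(2) mem_snd_proj by (simp add: mem_cover)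
  have "\<forall>((c, g), x) \<in> snd k. g \<noteq> \<one>\<^bsub>local_group c x\<^esub>"
    using bspec[OF K(3,1)] by (simp add: case_prod_unfold)
  from bspec[OF this uk] have "g \<noteq> one c" by (simp add: ue one_local_group)
  then show "k \<in> inertia_proj A ` TP" using u ue TP_iff' by blast
next
  fix k assume k: "k \<in> inertia_proj A ` TP"
  then have "k \<in> topspace (inertia_space A)" using TP_subset unfolding topspace_inertia_space by blast
  then obtain K where K: "k \<in> K" "K \<in> connected_components_of (inertia_space A)"
    using Union_connected_components_of[of "inertia_space A"] by blast
  have sub: "K \<subseteq> inertia_proj A ` TP"
    using connectedin_clopen_cases[OF connectedin_connected_components_of[OF K(2)] clopen_image_TP(2,1)] k K(1)
    by (auto simp: disjnt_def)
  have "g \<noteq> \<one>\<^bsub>local_group c x\<^esub>" if yC: "(y, C) \<in> K" "((c, g), x) \<in> C" for y C c g x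
  proof -
    have "(y, C) \<in> inertia_proj A ` TP" using sub yC(1) by blast
    then obtain v where v: "v \<in> TP" "(y, C) = inertia_proj A v" by blast
    obtain c' g' x' where v': "v = ((c', g'), x')" by (metis prod.exhaust)
    have "C = snd (inertia_proj A ((c', g'), x'))" using v(2) v' by (metis snd_conv)
    then have "((c, g), x) \<in> IC" "inertia_equiv ((c', g'), x') ((c, g), x)"
      using yC(2) mem_snd_proj by auto
    then have "((c, g), x) \<in> TP" using TP_saturated v(1) v' by blast
    then show ?thesis by (simp add: TP_iff one_local_group)
  qed
  then have "K \<in> twisted_sectors A" using K(2) unfolding twisted_sectors_def by blast
  then show "k \<in> \<Union> (twisted_sectors A)" using K(1) by blast
qed

lemma topspace_twisted: "topspace Tw = inertia_proj A ` TP"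
  unfolding twisted_space_def Union_twisted_sectors using openin_subset[OF clopen_image_TP(1)] by auto

section \<open>Sheets over the coordinate patches of the singular locus\<close>

lemma twistedE:
  assumes "u \<in> topspace Tw"
  obtains c g x where "sing c" "g \<in> cgrp c" "g \<noteq> one c" "x \<in> zone c" "u = sheet c g x"
  using assms unfolding topspace_twisted TP_def sheet_def by blast

lemma sheet_twisted: "sing c \<Longrightarrow> g \<in> cgrp c \<Longrightarrow> g \<noteq> one c \<Longrightarrow> x \<in> zone c \<Longrightarrow> sheet c g x \<in> topspace Tw"
  unfolding topspace_twisted sheet_def using TP_iff by blast

text \<open>The quotient topology is tested on the summands of the cover, and those outside
  \<open>TP\<close> contribute empty preimages. What remains is the final topology for all
  sheets.\<close>

lemma openin_twisted:
  "openin Tw V \<longleftrightarrow> V \<subseteq> topspace Tw \<and>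
    (\<forall>c g. sing c \<and> g \<in> cgrp c \<and> g \<noteq> one c \<longrightarrow> openin (top_of_set (zone c)) {x \<in> zone c. sheet c g x \<in> V})"
proof (cases "V \<subseteq> topspace Tw")
  case V: True
  define P where "P = {u \<in> IC. inertia_proj A u \<in> V}"
  have "openin Tw V \<longleftrightarrow> openin (inertia_space A) V"
    unfolding twisted_space_def Union_twisted_sectors
    using openin_open_subtopology[OF clopen_image_TP(1)] V by (simp add: topspace_twisted)
  also have "\<dots> \<longleftrightarrow> openin (inertia_cover A) P"
    unfolding inertia_space_def openin_quotient_topology P_def using V TP_subset by (auto simp: topspace_twisted)
  also have "\<dots> \<longleftrightarrow> (\<forall>i\<in>Sigma A cgrp. openin (case i of (c, g) \<Rightarrow> top_of_set {x \<in> cdom c. g x = x}) {x. (i, x) \<in> P})"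
    unfolding inertia_cover_def openin_sum_topology by (auto simp: P_def inertia_cover_def)
  also have "\<dots> \<longleftrightarrow> (\<forall>c g. sing c \<and> g \<in> cgrp c \<and> g \<noteq> one c \<longrightarrow> openin (top_of_set (zone c)) {x \<in> zone c. sheet c g x \<in> V})"
  proof -
    have PT: "P \<subseteq> TP" using V TP_preimage by (auto simp: P_def topspace_twisted)
    have Pe: "{x. ((c, g), x) \<in> P} = {x \<in> zone c. sheet c g x \<in> V}" if "sing c" "g \<in> cgrp c" "g \<noteq> one c" for c g
    proof -
      have "((c, g), x) \<in> P \<longleftrightarrow> x \<in> zone c \<and> sheet c g x \<in> V" for x
        using PT that sheet_in_cover TP_iff unfolding P_def sheet_def by blast
      then show ?thesis by blast
    qed
    have P0: "{x. ((c, g), x) \<in> P} = {}" if "\<not> (sing c \<and> g \<in> cgrp c \<and> g \<noteq> one c)" for c g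
      using that PT TP_iff by blast
    have Z: "{x \<in> cdom c. g x = x} = zone c" if "sing c" "g \<in> cgrp c" "g \<noteq> one c" for c g
      using that fixed_first_factor(2)[OF sing_A[OF that(1)] that(2,3)] cgrp_fix[OF that(1,2)] by (auto simp: zone_def)
    have "openin (top_of_set {x \<in> cdom c. g x = x}) {x. ((c, g), x) \<in> P} \<longleftrightarrow>
        (sing c \<and> g \<in> cgrp c \<and> g \<noteq> one c \<longrightarrow> openin (top_of_set (zone c)) {x \<in> zone c. sheet c g x \<in> V})" for c g
    proof (cases "sing c \<and> g \<in> cgrp c \<and> g \<noteq> one c")
      case False
      then show ?thesis using openin_empty unfolding P0[OF False] by blast
    qed (use Pe[of c g] Z[of c g] in simp)
    then show ?thesis using sing_A by (simp add: Ball_def split_paired_All) blast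
  qed
  finally show ?thesis using V by simp
qed (use openin_subset in blast)

lemma S_subset_Y: "S \<subseteq> Y"
  by (auto simp: sing_locus_def)

lemma base_chart:
  assumes "y \<in> topspace B"
  obtains c x where "sing c" "x \<in> zone c" "cmap c x = y"
proof -
  have "y \<in> topspace (subtopology proj_space Y)" "y \<in> S" using assms S_subset_Y by auto
  then obtain c x where "c \<in> A" "x \<in> cdom c" "y = cmap c x" unfolding topspace_charts by blast
  moreover from this have "sing c" using sing_if \<open>y \<in> S\<close> by blast
  moreover from this have "x \<in> zone c" using sing_preimage \<open>y \<in> S\<close> calculation by (auto simp: zone_def)
  ultimately show ?thesis using that by blast
qed

text \<open>Chart maps are open into \<open>Y\<close>, and \<open>zone c\<close> is the full
  preimage of \<open>S\<close> in the chart, so intersecting with \<open>S\<close> keeps images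
  open. Injectivity comes from the group fixing \<open>zone c\<close> pointwise.\<close>

lemma cmap_zone:
  assumes "sing c"
  shows "x \<in> zone c \<Longrightarrow> cmap c x \<in> topspace B"
    and "inj_on (cmap c) (zone c)"
    and "openin (top_of_set (zone c)) W \<Longrightarrow> openin B (cmap c ` W)"
    and "continuous_map (top_of_set (zone c)) B (cmap c)"
proof -
  note cA = sing_A[OF assms]
  have o: "continuous_map (top_of_set (cdom c)) (subtopology proj_space Y) (cmap c)"
    "open_map (top_of_set (cdom c)) (subtopology proj_space Y) (cmap c)" using chart[OF cA] by (auto simp: orbifold_chart_def)
  have zS: "x \<in> cdom c \<Longrightarrow> cmap c x \<in> S \<longleftrightarrow> x \<in> zone c" for x using sing_preimage[OF assms] by (auto simp: zone_def)
  have zY: "cmap c x \<in> topspace (subtopology proj_space Y)" if "x \<in> cdom c" for x using cA that topspace_charts by blast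
  show in_B: "cmap c x \<in> topspace B" if x: "x \<in> zone c" for x
    using zY[OF zoneD(1)[OF x]] zS[OF zoneD(1)[OF x]] x by auto
  show "inj_on (cmap c) (zone c)" using cmap_inj_first_factor[OF assms] zoneD by (auto simp: inj_on_def)
  show "openin B (cmap c ` W)" if W: "openin (top_of_set (zone c)) W"
  proof -
    obtain U where U: "open U" "W = zone c \<inter> U" using W by (auto simp: openin_open)
    have "openin (top_of_set (cdom c)) (cdom c \<inter> U)" using U(1) by auto
    then have "openin (subtopology proj_space Y) (cmap c ` (cdom c \<inter> U))" using o(2) by (simp add: open_map_def)
    then obtain V where V: "openin proj_space V" "cmap c ` (cdom c \<inter> U) = V \<inter> Y" by (auto simp: openin_subtopology)
    have "cmap c ` W = V \<inter> S"
    proof (intro subset_antisym subsetI)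
      fix y assume "y \<in> cmap c ` W"
      then obtain x where x: "x \<in> zone c" "x \<in> U" "y = cmap c x" using U(2) by blast
      then have "y \<in> V \<inter> Y" using V(2) zoneD(1) by blast
      then show "y \<in> V \<inter> S" using x zS zoneD(1) by blast
    next
      fix y assume y: "y \<in> V \<inter> S"
      then have "y \<in> cmap c ` (cdom c \<inter> U)" using V(2) S_subset_Y by blast
      then obtain x where "x \<in> cdom c" "x \<in> U" "y = cmap c x" by blast
      then show "y \<in> cmap c ` W" using zS y U(2) by blast
    qed
    then show ?thesis using V(1) by (auto simp: openin_subtopology)
  qed
  show "continuous_map (top_of_set (zone c)) B (cmap c)"
  proof -
    have "continuous_map (subtopology (top_of_set (cdom c)) (zone c)) (subtopology proj_space Y) (cmap c)"
      by (rule continuous_map_from_subtopology[OF o(1)])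
    moreover have "subtopology (top_of_set (cdom c)) (zone c) = top_of_set (zone c)"
      by (simp add: subtopology_subtopology zone_def Int_assoc[symmetric])
    ultimately have "continuous_map (top_of_set (zone c)) proj_space (cmap c)" by (simp add: continuous_map_in_subtopology)
    then show ?thesis using in_B by (auto simp: continuous_map_in_subtopology)
  qed
qed

text \<open>The whole chart group fixes every point of \<open>zone c\<close>, so the local groups
  are equal and not just isomorphic. Conjugacy of \<open>g\<close> and \<open>h\<close> therefore
  does not vary along a patch, which is why sheets that meet coincide.\<close>

lemma local_group_eq:
  assumes "sing c" "x \<in> zone c" "x' \<in> zone c"
  shows "local_group c x = local_group c x'"
proof -
  have "{g \<in> cgrp c. g x = x} = cgrp c" "{g \<in> cgrp c. g x' = x'} = cgrp c"
    using cgrp_fix[OF assms(1)] zoneD assms(2,3) by blast+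
  then show ?thesis by (simp only: local_group_def)
qed

lemma sheet_eq_iff:
  assumes "sing c" "g \<in> cgrp c" "h \<in> cgrp c" "x \<in> zone c"
  shows "sheet c g x = sheet c h x \<longleftrightarrow> h \<in> conj_class (local_group c x) g"
  unfolding sheet_def inertia_proj_eq_iff[OF sheet_in_cover[OF assms(1,2,4)] sheet_in_cover[OF assms(1,3,4)]]
  by (rule inertia_equiv_same_point[OF assms(1) zoneD[OF assms(4)] assms(2,3)])

lemma sheets_meet:
  assumes "sing c" "g \<in> cgrp c" "h \<in> cgrp c" "x \<in> zone c" "x' \<in> zone c" "sheet c g x = sheet c h x'" "z \<in> zone c"
  shows "x = x'" "sheet c g z = sheet c h z"
proof -
  have "cmap c x = cmap c x'" using assms(6) fst_sheet by metis
  then show xx: "x = x'" using cmap_zone(2)[OF assms(1)] assms(4,5) by (auto simp: inj_on_def)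
  have "h \<in> conj_class (local_group c z) g"
    using sheet_eq_iff[OF assms(1-4)] assms(6) xx local_group_eq[OF assms(1,4,7)] by simp
  then show "sheet c g z = sheet c h z" using sheet_eq_iff[OF assms(1-3,7)] by simp
qed

text \<open>Collects the properties of isomorphisms coming from changes of charts that survive
  composition along a path; the nontrivial elements mentioned last are the ones that index
  sheets.\<close>

definition admissible where
  "admissible c x c' x' \<phi> \<longleftrightarrow> \<phi> \<in> iso (local_group c x) (local_group c' x') \<and>
    equiv_rep (local_group c x) (lin_rep c' \<circ> \<phi>) (lin_rep c) \<and>
    (\<forall>g\<in>cgrp c. g \<noteq> one c \<longrightarrow> \<phi> g \<in> cgrp c' \<and> \<phi> g \<noteq> one c')"

lemma admissibleD: "admissible c x c' x' \<phi> \<Longrightarrow> g \<in> cgrp c \<Longrightarrow> g \<noteq> one c \<Longrightarrow> \<phi> g \<in> cgrp c'"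
  "admissible c x c' x' \<phi> \<Longrightarrow> g \<in> cgrp c \<Longrightarrow> g \<noteq> one c \<Longrightarrow> \<phi> g \<noteq> one c'"
  by (auto simp: admissible_def)

text \<open>A change of charts at the common point conjugates \<open>g\<close> to
  \<open>\<phi> g\<close>, and inertia-equivalent pairs give the same point. Sheets from different
  charts can thus be compared inside one chart.\<close>

lemma sheet_transfer:
  assumes s: "sing c" "sing c'" and x: "x \<in> zone c" "x' \<in> zone c'" and eq: "cmap c x = cmap c' x'"
  obtains \<phi> where "admissible c x c' x' \<phi>" "\<And>g. g \<in> cgrp c \<Longrightarrow> sheet c g x = sheet c' (\<phi> g) x'"
proof -
  obtain \<psi> where \<psi>: "chart_change c x c' x' \<psi>"
    using chart_change_exists[OF sing_A[OF s(1)] sing_A[OF s(2)] zoneD(1)[OF x(1)] zoneD(1)[OF x(2)] eq] by blast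
  obtain \<phi> where \<phi>: "\<phi> \<in> iso (local_group c x) (local_group c' x')"
    "\<And>g. g \<in> cgrp c \<Longrightarrow> germ_conj x \<psi> g (\<phi> g)" using chart_change_iso[OF \<psi> s zoneD(2)[OF x(1)]] by blast
  have cl: "\<phi> g \<in> cgrp c'" if "g \<in> cgrp c" for g
    using iso_carrier[OF \<phi>(1)] that carrier_local_group[OF s(1) zoneD[OF x(1)]] carrier_local_group[OF s(2) zoneD[OF x(2)]] by blast
  have ie: "inertia_equiv ((c, g), x) ((c', \<phi> g), x')" if "g \<in> cgrp c" for g using \<psi> \<phi>(2)[OF that] inertia_equiv_iff by blast
  have nt: "\<phi> g \<noteq> one c'" if g: "g \<in> cgrp c" "g \<noteq> one c" for g
  proof -
    have "((c, g), x) \<in> TP" using s(1) g x(1) TP_iff by blast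
    then have "((c', \<phi> g), x') \<in> TP" using TP_saturated sheet_in_cover[OF s(2) cl[OF g(1)] x(2)] ie[OF g(1)] by blast
    then show ?thesis by (simp add: TP_iff)
  qed
  show ?thesis
  proof (rule that)
    show "admissible c x c' x' \<phi>"
      using \<phi>(1) chart_change_equiv_rep[OF \<psi> s zoneD(2)[OF x(1)] \<phi>] cl nt by (simp add: admissible_def)
    show "sheet c g x = sheet c' (\<phi> g) x'" if g: "g \<in> cgrp c" for g
      unfolding sheet_def using inertia_proj_eq_iff[OF sheet_in_cover[OF s(1) g x(1)] sheet_in_cover[OF s(2) cl[OF g] x(2)]] ie[OF g] by simp
  qed
qed

text \<open>The germ \<psi> identifying the two sheets at a common point conjugates
  \<open>g'\<close> to \<open>g\<close> at all nearby points as well, so points of the second sheet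
  near the common one lie on the first.\<close>

lemma sheet_open:
  assumes s: "sing c" "g \<in> cgrp c" "g \<noteq> one c" and W: "openin (top_of_set (zone c)) W"
  shows "openin Tw (sheet c g ` W)"
  unfolding openin_twisted
proof (intro conjI allI impI)
  have WZ: "W \<subseteq> zone c" using openin_subset[OF W] by simp
  then show "sheet c g ` W \<subseteq> topspace Tw" using sheet_twisted[OF s] by blast
  obtain U where U: "open U" "W = zone c \<inter> U" using W by (auto simp: openin_open)
  fix c' g' assume h: "sing c' \<and> g' \<in> cgrp c' \<and> g' \<noteq> one c'"
  show "openin (top_of_set (zone c')) {x \<in> zone c'. sheet c' g' x \<in> sheet c g ` W}"
  proof (rule openin_top_of_setI)
    fix x' assume "x' \<in> {x \<in> zone c'. sheet c' g' x \<in> sheet c g ` W}"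
    then obtain x where x: "x' \<in> zone c'" "x \<in> W" "sheet c' g' x' = sheet c g x" by blast
    have "inertia_equiv ((c', g'), x') ((c, g), x)"
      using x(3) inertia_proj_eq_iff[OF sheet_in_cover[of c' g' x'] sheet_in_cover[OF s(1,2), of x]] h x(1,2) WZ
      unfolding sheet_def by blast
    then obtain \<psi> where \<psi>: "chart_change c' x' c x \<psi>" "germ_conj x' \<psi> g' g" by (auto simp: inertia_equiv_iff)
    have "\<forall>\<^sub>F z in nhds x'. germ_conj z \<psi> g' g"
      using \<psi>(2) unfolding germ_conj_def by (subst eventually_eventually)
    moreover have "\<forall>\<^sub>F z in nhds x'. \<psi> z \<in> U"
    proof -
      have "\<forall>\<^sub>F w in nhds x. w \<in> U" using U x(2) by (intro eventually_nhds_in_open) auto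
      from eventually_compose_filterlim[OF this chart_changeD(2)[OF \<psi>(1)]] show ?thesis .
    qed
    ultimately show "\<forall>\<^sub>F z in nhds x'. z \<in> zone c' \<longrightarrow> z \<in> {x \<in> zone c'. sheet c' g' x \<in> sheet c g ` W}"
      using chart_changeD(3)[OF \<psi>(1)]
    proof eventually_elim
      case (elim z)
      show ?case
      proof
        assume z: "z \<in> zone c'"
        have "\<psi> z \<in> zone c"
          using chart_change_first_factor[OF elim(3)] h s(1) zoneD(2)[OF z] chart_changeD(6)[OF elim(3)] by (auto simp: zone_def)
        have "inertia_equiv ((c', g'), z) ((c, g), \<psi> z)" unfolding inertia_equiv_iff using elim(1,3) by blast
        moreover have "\<psi> z \<in> W" using \<open>\<psi> z \<in> zone c\<close> elim(2) U(2) by blast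
        ultimately have "sheet c' g' z = sheet c g (\<psi> z)"
          using inertia_proj_eq_iff[OF sheet_in_cover[of c' g' z] sheet_in_cover[OF s(1,2), of "\<psi> z"]] h z \<open>\<psi> z \<in> zone c\<close>
          unfolding sheet_def by blast
        then show "z \<in> {x \<in> zone c'. sheet c' g' x \<in> sheet c g ` W}" using z \<open>\<psi> z \<in> W\<close> by blast
      qed
    qed
  qed blast
qed

lemma sheet_continuous:
  assumes "sing c" "g \<in> cgrp c" "g \<noteq> one c"
  shows "continuous_map (top_of_set (zone c)) Tw (sheet c g)"
  unfolding continuous_map_def using sheet_twisted[OF assms] assms by (auto simp: openin_twisted)

lemma homeomorphic_cmap:
  assumes "sing c"
  shows "homeomorphic_map (top_of_set (zone c)) (subtopology B (cmap c ` zone c)) (cmap c)"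
proof (rule bijective_open_imp_homeomorphic_map)
  show "continuous_map (top_of_set (zone c)) (subtopology B (cmap c ` zone c)) (cmap c)"
    using cmap_zone(4)[OF assms] by (simp only: continuous_map_in_subtopology) auto
  have "openin B (cmap c ` zone c)" by (rule cmap_zone(3)[OF assms]) auto
  then show "open_map (top_of_set (zone c)) (subtopology B (cmap c ` zone c)) (cmap c)"
    unfolding open_map_def using openin_open_subtopology cmap_zone(3)[OF assms] openin_subset
    by (metis (no_types, lifting) image_mono topspace_euclidean_subtopology)
  show "cmap c ` topspace (top_of_set (zone c)) = topspace (subtopology B (cmap c ` zone c))"
    using cmap_zone(1)[OF assms] by auto
qed (use cmap_zone(2)[OF assms] in simp)

text \<open>The section \<open>sheet c g\<close> and the chart map \<open>cmap c\<close> are both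
  homeomorphisms onto open sets, and \<open>fst\<close> is the second after the inverse of the
  first.\<close>

lemma homeomorphic_sheet:
  assumes "sing c" "g \<in> cgrp c" "g \<noteq> one c"
  shows "homeomorphic_map (subtopology Tw (sheet c g ` zone c)) (subtopology B (cmap c ` zone c)) fst"
proof -
  have h: "homeomorphic_map (top_of_set (zone c)) (subtopology Tw (sheet c g ` zone c)) (sheet c g)"
  proof (rule bijective_open_imp_homeomorphic_map)
    show "continuous_map (top_of_set (zone c)) (subtopology Tw (sheet c g ` zone c)) (sheet c g)"
      using sheet_continuous[OF assms] by (simp only: continuous_map_in_subtopology) auto
    have "openin Tw (sheet c g ` zone c)" by (rule sheet_open[OF assms]) auto
    then show "open_map (top_of_set (zone c)) (subtopology Tw (sheet c g ` zone c)) (sheet c g)"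
      unfolding open_map_def using openin_open_subtopology sheet_open[OF assms] openin_subset
      by (metis (no_types, lifting) image_mono topspace_euclidean_subtopology)
    show "sheet c g ` topspace (top_of_set (zone c)) = topspace (subtopology Tw (sheet c g ` zone c))"
      using sheet_twisted[OF assms] by auto
    show "inj_on (sheet c g) (topspace (top_of_set (zone c)))"
      using sheets_meet(1)[OF assms(1,2,2)] by (auto simp: inj_on_def)
  qed
  then obtain k where k: "homeomorphic_maps (top_of_set (zone c)) (subtopology Tw (sheet c g ` zone c)) (sheet c g) k"
    using homeomorphic_map_maps by blast
  then have hk: "homeomorphic_map (subtopology Tw (sheet c g ` zone c)) (top_of_set (zone c)) k"
    and sk: "\<And>y. y \<in> topspace (subtopology Tw (sheet c g ` zone c)) \<Longrightarrow> sheet c g (k y) = y"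
    by (auto simp: homeomorphic_maps_map)
  show ?thesis
  proof (rule homeomorphic_map_eq[OF homeomorphic_map_compose[OF hk homeomorphic_cmap[OF assms(1)]]])
    fix y assume "y \<in> topspace (subtopology Tw (sheet c g ` zone c))"
    from sk[OF this] show "(cmap c \<circ> k) y = fst y" using fst_sheet comp_apply by metis
  qed
qed

text \<open>Guarantees that every fibre is nonempty, so that the covering is surjective; it comes
  from the exclusion of the trivial group in \<open>ADE_group\<close>.\<close>

lemma nontrivial_element:
  assumes "sing c" shows "\<exists>g\<in>cgrp c. g \<noteq> one c"
proof -
  obtain M where M: "M \<in> gam c" "M \<noteq> I2"
    using gam(1)[OF assms] gam_props(1)[OF assms] by (auto simp: ADE_group_def)
  have g: "restrict (act2 e M) (cdom c) \<in> cgrp c" using gam(2)[OF assms] M(1) by blast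
  have "lin c (restrict (act2 e M) (cdom c)) = M" by (rule lin_unique[OF assms g M(1)]) simp
  then have "restrict (act2 e M) (cdom c) \<noteq> one c" using lin_one[OF assms] M(2) by metis
  then show ?thesis using g by blast
qed

theorem twisted_covering: "covering_map Tw B fst"
  unfolding covering_map_def
proof (intro conjI ballI)
  have inB: "fst u \<in> topspace B" if u: "u \<in> topspace Tw" for u
    by (rule twistedE[OF u]) (use cmap_zone(1) in auto)
  show "continuous_map Tw B fst"
    unfolding continuous_map_def
  proof (intro conjI allI impI)
    show "fst \<in> topspace Tw \<rightarrow> topspace B" using inB by blast
    fix U assume U: "openin B U"
    show "openin Tw {u \<in> topspace Tw. fst u \<in> U}"
      unfolding openin_twisted
    proof (intro conjI allI impI)
      fix c g assume h: "sing c \<and> g \<in> cgrp c \<and> g \<noteq> one c"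
      have "{x \<in> zone c. sheet c g x \<in> {u \<in> topspace Tw. fst u \<in> U}} = {x \<in> zone c. cmap c x \<in> U}"
        using sheet_twisted h by auto
      then show "openin (top_of_set (zone c)) {x \<in> zone c. sheet c g x \<in> {u \<in> topspace Tw. fst u \<in> U}}"
        using openin_continuous_map_preimage[OF cmap_zone(4) U] h by simp
    qed blast
  qed
  show "fst ` topspace Tw = topspace B"
  proof (intro subset_antisym subsetI)
    fix y assume "y \<in> topspace B"
    then obtain c x where c: "sing c" "x \<in> zone c" "cmap c x = y" by (rule base_chart)
    obtain g where g: "g \<in> cgrp c" "g \<noteq> one c" using nontrivial_element[OF c(1)] by blast
    have "sheet c g x \<in> topspace Tw" "fst (sheet c g x) = y" using sheet_twisted[OF c(1) g c(2)] c(3) by auto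
    then show "y \<in> fst ` topspace Tw" by blast
  qed (use inB in blast)
  fix b assume "b \<in> topspace B"
  then obtain c x where c: "sing c" "x \<in> zone c" "cmap c x = b" by (rule base_chart)
  \<comment> \<open>The sheets over one patch, collected as a set: conjugate elements give the same
    sheet, and different sheets are disjoint by \<open>sheets_meet\<close>. By
    \<open>sheet_transfer\<close> every point over the patch lies on one of them.\<close>
  define \<V> where "\<V> = (\<lambda>g. sheet c g ` zone c) ` {g \<in> cgrp c. g \<noteq> one c}"
  show "\<exists>U. openin B U \<and> b \<in> U \<and> (\<exists>\<V>. \<Union>\<V> = {u \<in> topspace Tw. fst u \<in> U} \<and> pairwise disjnt \<V> \<and>
      (\<forall>V\<in>\<V>. openin Tw V \<and> homeomorphic_map (subtopology Tw V) (subtopology B U) fst))"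
  proof (intro exI[of _ "cmap c ` zone c"] exI[of _ \<V>] conjI ballI)
    show "openin B (cmap c ` zone c)" by (rule cmap_zone(3)[OF c(1)]) auto
    show "b \<in> cmap c ` zone c" using c by blast
    show "\<Union>\<V> = {u \<in> topspace Tw. fst u \<in> cmap c ` zone c}"
    proof (intro subset_antisym subsetI)
      fix u assume "u \<in> \<Union>\<V>"
      then show "u \<in> {u \<in> topspace Tw. fst u \<in> cmap c ` zone c}"
        using sheet_twisted[OF c(1)] by (auto simp: \<V>_def)
    next
      fix u assume u: "u \<in> {u \<in> topspace Tw. fst u \<in> cmap c ` zone c}"
      then have "u \<in> topspace Tw" by blast
      then obtain c' g' x' where u': "sing c'" "g' \<in> cgrp c'" "g' \<noteq> one c'" "x' \<in> zone c'" "u = sheet c' g' x'" by (rule twistedE)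
      obtain z where z: "z \<in> zone c" "cmap c' x' = cmap c z" using u u'(5) by auto
      obtain \<phi> where \<phi>: "admissible c' x' c z \<phi>" "\<And>g. g \<in> cgrp c' \<Longrightarrow> sheet c' g x' = sheet c (\<phi> g) z"
        by (rule sheet_transfer[OF u'(1) c(1) u'(4) z(1,2)], rule that)
      show "u \<in> \<Union>\<V>" unfolding \<V>_def using admissibleD[OF \<phi>(1) u'(2,3)] \<phi>(2)[OF u'(2)] u'(5) z(1) by blast
    qed
    show "pairwise disjnt \<V>"
    proof (rule pairwiseI)
      fix V V' assume V: "V \<in> \<V>" "V' \<in> \<V>" "V \<noteq> V'"
      then obtain g h where gh: "g \<in> cgrp c" "V = sheet c g ` zone c" "h \<in> cgrp c" "V' = sheet c h ` zone c" by (auto simp: \<V>_def)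
      show "disjnt V V'"
      proof (rule ccontr)
        assume "\<not> disjnt V V'"
        then obtain w where "w \<in> V" "w \<in> V'" unfolding disjnt_iff by blast
        then obtain x x' where "x \<in> zone c" "x' \<in> zone c" "sheet c g x = sheet c h x'" unfolding gh(2,4) by blast
        then have "sheet c g z = sheet c h z" if "z \<in> zone c" for z using sheets_meet(2)[OF c(1) gh(1,3)] that by blast
        then show False using V(3) gh by auto
      qed
    qed
    fix V assume "V \<in> \<V>"
    then obtain g where g: "g \<in> cgrp c" "g \<noteq> one c" "V = sheet c g ` zone c" by (auto simp: \<V>_def)
    show "openin Tw V" unfolding g(3) by (rule sheet_open[OF c(1) g(1,2)]) auto
    show "homeomorphic_map (subtopology Tw V) (subtopology B (cmap c ` zone c)) fst"
      unfolding g(3) by (rule homeomorphic_sheet[OF c(1) g(1,2)])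
  qed
qed

section \<open>The fibre over a point as the set of nontrivial classes\<close>

lemma class_at_sheet:
  assumes "sing c" "g \<in> cgrp c" "x \<in> zone c"
  shows "class_at c x (sheet c g x) = conj_class (local_group c x) g"
proof -
  interpret G: Group.group "local_group c x" by (rule group_local_group[OF assms(1) zoneD[OF assms(3)]])
  note car = carrier_local_group[OF assms(1) zoneD[OF assms(3)]]
  have "h \<in> class_at c x (sheet c g x) \<longleftrightarrow> h \<in> conj_class (local_group c x) g" for h
  proof (cases "h \<in> cgrp c")
    case True
    then show ?thesis
      using sheet_in_cover[OF assms(1) True assms(3)] inertia_equiv_same_point[OF assms(1) zoneD[OF assms(3)] assms(2) True]
      unfolding class_at_def sheet_def mem_Collect_eq mem_snd_proj by simp
  next
    case False
    moreover have "conj_class (local_group c x) g \<subseteq> cgrp c"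
      using assms(2) unfolding conj_class_def car[symmetric] by auto
    ultimately show ?thesis unfolding class_at_def sheet_def mem_Collect_eq mem_snd_proj mem_cover by blast
  qed
  then show ?thesis by blast
qed

lemma twisted_fiber_eq:
  assumes "sing c" "x \<in> zone c"
  shows "twisted_fiber A (cmap c x) = (\<lambda>g. sheet c g x) ` {g \<in> cgrp c. g \<noteq> one c}"
proof (intro subset_antisym subsetI)
  fix u assume u: "u \<in> twisted_fiber A (cmap c x)"
  then have "u \<in> topspace Tw" by (simp add: twisted_fiber_def)
  then obtain c' g' x' where u': "sing c'" "g' \<in> cgrp c'" "g' \<noteq> one c'" "x' \<in> zone c'" "u = sheet c' g' x'" by (rule twistedE)
  have e: "cmap c' x' = cmap c x" using u u'(5) by (simp add: twisted_fiber_def)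
  obtain \<phi> where \<phi>: "admissible c' x' c x \<phi>" "\<And>g. g \<in> cgrp c' \<Longrightarrow> sheet c' g x' = sheet c (\<phi> g) x"
    by (rule sheet_transfer[OF u'(1) assms(1) u'(4) assms(2) e], rule that)
  show "u \<in> (\<lambda>g. sheet c g x) ` {g \<in> cgrp c. g \<noteq> one c}" using admissibleD[OF \<phi>(1) u'(2,3)] \<phi>(2)[OF u'(2)] u'(5) by blast
next
  fix u assume "u \<in> (\<lambda>g. sheet c g x) ` {g \<in> cgrp c. g \<noteq> one c}"
  then show "u \<in> twisted_fiber A (cmap c x)" using sheet_twisted[OF assms(1) _ _ assms(2)] by (auto simp: twisted_fiber_def)
qed

lemma bij_betw_class_at:
  assumes "sing c" "x \<in> zone c"
  shows "bij_betw (class_at c x) (twisted_fiber A (cmap c x)) (nontriv_conj_classes (local_group c x))"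
proof -
  interpret G: finite_group "local_group c x"
    using group_local_group[OF assms(1) zoneD[OF assms(2)]] finite_cgrp[OF sing_A[OF assms(1)]] carrier_local_group[OF assms(1) zoneD[OF assms(2)]]
    by (simp add: finite_group_def finite_group_axioms_def)
  note car = carrier_local_group[OF assms(1) zoneD[OF assms(2)]]
  have triv: "conj_class (local_group c x) g = {\<one>\<^bsub>local_group c x\<^esub>} \<longleftrightarrow> g = one c" if g: "g \<in> cgrp c" for g
  proof
    assume "conj_class (local_group c x) g = {\<one>\<^bsub>local_group c x\<^esub>}"
    moreover have "g \<in> conj_class (local_group c x) g" using G.conj_class_self g car by blast
    ultimately show "g = one c" by (simp add: one_local_group)
  next
    assume "g = one c"
    then have "g = \<one>\<^bsub>local_group c x\<^esub>" by (simp add: one_local_group)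
    then show "conj_class (local_group c x) g = {\<one>\<^bsub>local_group c x\<^esub>}"
      using G.one_closed unfolding conj_class_def by force
  qed
  show ?thesis
    unfolding bij_betw_def
  proof
    show "inj_on (class_at c x) (twisted_fiber A (cmap c x))"
      unfolding twisted_fiber_eq[OF assms]
    proof (rule inj_onI)
      fix u v assume "u \<in> (\<lambda>g. sheet c g x) ` {g \<in> cgrp c. g \<noteq> one c}" "v \<in> (\<lambda>g. sheet c g x) ` {g \<in> cgrp c. g \<noteq> one c}"
        and e: "class_at c x u = class_at c x v"
      then obtain g h where gh: "g \<in> cgrp c" "u = sheet c g x" "h \<in> cgrp c" "v = sheet c h x" by blast
      have "conj_class (local_group c x) g = conj_class (local_group c x) h"
        using e gh class_at_sheet[OF assms(1) _ assms(2)] by simp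
      moreover have "h \<in> conj_class (local_group c x) h" using G.conj_class_self gh(3) car by blast
      ultimately show "u = v" using sheet_eq_iff[OF assms(1) gh(1,3) assms(2)] gh by simp
    qed
    have "class_at c x ` twisted_fiber A (cmap c x) = conj_class (local_group c x) ` {g \<in> cgrp c. g \<noteq> one c}"
      unfolding twisted_fiber_eq[OF assms] image_image
      by (rule image_cong) (use class_at_sheet[OF assms(1) _ assms(2)] in auto)
    also have "\<dots> = nontriv_conj_classes (local_group c x)"
      unfolding nontriv_conj_classes_eq car using triv by blast
    finally show "class_at c x ` twisted_fiber A (cmap c x) = nontriv_conj_classes (local_group c x)" .
  qed
qed

end

section \<open>Monodromy\<close>

lemma equiv_rep_iso_comp:
  assumes grp: "Group.group G" "Group.group G'" and \<phi>: "\<phi> \<in> iso G G'"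
    and rep: "representation G n \<rho>" "representation G' n \<rho>'" "representation G' n (\<rho>'' \<circ> \<phi>')"
    and eq: "equiv_rep G (\<rho>' \<circ> \<phi>) \<rho>" "equiv_rep G' (\<rho>'' \<circ> \<phi>') \<rho>'"
  shows "equiv_rep G (\<rho>'' \<circ> (\<phi>' \<circ> \<phi>)) \<rho>"
proof -
  have "equiv_rep G ((\<rho>'' \<circ> \<phi>') \<circ> \<phi>) (\<rho>' \<circ> \<phi>)" using equiv_rep_twist[OF grp \<phi>] eq(2) by blast
  moreover have "representation G n (\<rho>' \<circ> \<phi>)" "representation G n ((\<rho>'' \<circ> \<phi>') \<circ> \<phi>)"
    using representation_twist[OF grp \<phi>] rep(2,3) by blast+
  ultimately have "equiv_rep G ((\<rho>'' \<circ> \<phi>') \<circ> \<phi>) \<rho>" using equiv_rep_trans eq(1) rep(1) by blast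
  then show ?thesis by (simp add: o_assoc)
qed

lemma pathin_near:
  assumes "pathin X \<gamma>" "openin X W" "\<gamma> t \<in> W" "t \<in> {0..1}"
  obtains d where "d > 0" "\<And>u. u \<in> {0..1} \<Longrightarrow> \<bar>u - t\<bar> < d \<Longrightarrow> \<gamma> u \<in> W"
proof -
  have "openin (top_of_set {0..1}) {u \<in> {0..1}. \<gamma> u \<in> W}"
    using openin_continuous_map_preimage[OF assms(1)[unfolded pathin_def] assms(2)] by simp
  then obtain d where "d > 0" "\<forall>u\<in>{0..1}. dist u t < d \<longrightarrow> u \<in> {u \<in> {0..1}. \<gamma> u \<in> W}"
    using assms(3,4) unfolding openin_euclidean_subtopology_iff by blast
  then show ?thesis using that[of d] by (auto simp: dist_real_def)
qed

context ade_orbifold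
begin

text \<open>Bisection of the interval: near each time the two lifts stay in single sheets, and
  sheets of one chart that meet once agree throughout. This gives the uniqueness required by the
  \<open>THE\<close> in \<open>monodromy\<close>.\<close>

lemma lifts_agree:
  assumes \<eta>: "pathin Tw \<eta>1" "pathin Tw \<eta>2"
    and proj: "\<And>t. t \<in> {0..1} \<Longrightarrow> fst (\<eta>1 t) = fst (\<eta>2 t)" and start: "\<eta>1 0 = \<eta>2 0"
  shows "\<eta>1 1 = \<eta>2 (1 :: real)"
proof -
  have ts: "\<eta>1 t \<in> topspace Tw" "\<eta>2 t \<in> topspace Tw" if "t \<in> {0..1}" for t
    using \<eta> that path_image_subset_topspace by (fastforce simp: path_image_def)+
  have "(0::real) \<le> 0 \<and> (0::real) \<le> 1 \<and> (1::real) \<le> 1 \<longrightarrow> \<eta>1 0 = \<eta>2 0 \<longrightarrow> \<eta>1 1 = \<eta>2 1"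
  proof (rule Bolzano[of 0 1 "\<lambda>s t. 0 \<le> s \<and> s \<le> t \<and> t \<le> 1 \<longrightarrow> \<eta>1 s = \<eta>2 s \<longrightarrow> \<eta>1 t = \<eta>2 t"])
    fix t0 :: real assume t0: "0 \<le> t0" "t0 \<le> 1"
    have t01: "t0 \<in> {0..1}" using t0 by simp
    obtain c g x where c: "sing c" "g \<in> cgrp c" "g \<noteq> one c" "x \<in> zone c" "\<eta>1 t0 = sheet c g x"
      using ts(1)[OF t01] by (rule twistedE)
    obtain c' g' x' where c': "sing c'" "g' \<in> cgrp c'" "g' \<noteq> one c'" "x' \<in> zone c'" "\<eta>2 t0 = sheet c' g' x'"
      using ts(2)[OF t01] by (rule twistedE)
    have cm: "cmap c' x' = cmap c x" using proj[of t0] t0 c(5) c'(5) by simp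
    \<comment> \<open>The second sheet is rewritten in the chart of the first, where
      \<open>sheets_meet\<close> can compare them.\<close>
    obtain \<phi> where \<phi>: "admissible c' x' c x \<phi>" "\<And>g. g \<in> cgrp c' \<Longrightarrow> sheet c' g x' = sheet c (\<phi> g) x"
      by (rule sheet_transfer[OF c'(1) c(1) c'(4) c(4) cm], rule that)
    define h where "h = \<phi> g'"
    have h: "h \<in> cgrp c" "h \<noteq> one c" "\<eta>2 t0 = sheet c h x" using admissibleD[OF \<phi>(1) c'(2,3)] \<phi>(2)[OF c'(2)] c'(5) by (simp_all add: h_def)
    have W: "openin Tw (sheet c g ` zone c)" "openin Tw (sheet c h ` zone c)"
      using sheet_open[OF c(1)] c(2,3) h(1,2) by auto
    obtain d1 where d1: "d1 > 0" "\<And>u. u \<in> {0..1} \<Longrightarrow> \<bar>u - t0\<bar> < d1 \<Longrightarrow> \<eta>1 u \<in> sheet c g ` zone c"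
      by (rule pathin_near[OF \<eta>(1) W(1) _ t01], use c(4,5) in blast, rule that)
    obtain d2 where d2: "d2 > 0" "\<And>u. u \<in> {0..1} \<Longrightarrow> \<bar>u - t0\<bar> < d2 \<Longrightarrow> \<eta>2 u \<in> sheet c h ` zone c"
      by (rule pathin_near[OF \<eta>(2) W(2) _ t01], use c(4) h(3) in blast, rule that)
    show "\<exists>d>0. \<forall>s t. s \<le> t0 \<and> t0 \<le> t \<and> t - s < d \<longrightarrow> (0 \<le> s \<and> s \<le> t \<and> t \<le> 1 \<longrightarrow> \<eta>1 s = \<eta>2 s \<longrightarrow> \<eta>1 t = \<eta>2 t)"
    proof (intro exI[of _ "min d1 d2"] conjI allI impI)
      fix s t assume st: "s \<le> t0 \<and> t0 \<le> t \<and> t - s < min d1 d2" "0 \<le> s \<and> s \<le> t \<and> t \<le> 1" and eq: "\<eta>1 s = \<eta>2 s"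
      obtain a where a: "a \<in> zone c" "\<eta>1 s = sheet c g a" using d1(2)[of s] st by auto
      obtain b where b: "b \<in> zone c" "\<eta>2 s = sheet c h b" using d2(2)[of s] st by auto
      obtain a' where a': "a' \<in> zone c" "\<eta>1 t = sheet c g a'" using d1(2)[of t] st by auto
      obtain b' where b': "b' \<in> zone c" "\<eta>2 t = sheet c h b'" using d2(2)[of t] st by auto
      have "cmap c a' = cmap c b'" using proj[of t] st a'(2) b'(2) by simp
      then have "a' = b'" using cmap_zone(2)[OF c(1)] a' b' by (auto simp: inj_on_def)
      moreover have "sheet c g a' = sheet c h a'"
        using sheets_meet(2)[OF c(1,2) h(1) a(1) b(1) _ a'(1)] eq a b by simp
      ultimately show "\<eta>1 t = \<eta>2 t" using a' b' by simp
    qed (use d1 d2 in auto)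
  qed auto
  then show ?thesis using start by simp
qed

section \<open>Transport of group elements along a path\<close>

definition lift_joins where
  "lift_joins \<gamma> s t u v \<longleftrightarrow> (\<exists>\<eta>. continuous_map (top_of_set {s..t}) Tw \<eta> \<and>
    (\<forall>r\<in>{s..t}. fst (\<eta> r) = \<gamma> r) \<and> \<eta> s = u \<and> \<eta> (t::real) = v)"

text \<open>One \<phi> serves all sheets simultaneously. A separate element for each
  \<open>g\<close> would describe only a permutation of classes, whereas the McKay graph calls for a
  group isomorphism compatible with the normal representations.\<close>

definition transports_by where
  "transports_by \<gamma> s t c x c' x' \<phi> \<longleftrightarrow> admissible c x c' x' \<phi> \<and>
    (\<forall>g\<in>cgrp c. g \<noteq> one c \<longrightarrow> lift_joins \<gamma> s t (sheet c g x) (sheet c' (\<phi> g) x'))"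

lemma admissible_comp:
  assumes c: "sing c" "x \<in> zone c" "sing c'" "x' \<in> zone c'" "sing c''" "x'' \<in> zone c''"
    and \<phi>: "admissible c x c' x' \<phi>" "admissible c' x' c'' x'' \<phi>'"
  shows "admissible c x c'' x'' (\<phi>' \<circ> \<phi>)"
proof -
  note grp = group_local_group[OF c(1) zoneD[OF c(2)]] group_local_group[OF c(3) zoneD[OF c(4)]] group_local_group[OF c(5) zoneD[OF c(6)]]
  note rep = representation_lin_rep[OF c(1) zoneD[OF c(2)]] representation_lin_rep[OF c(3) zoneD[OF c(4)]] representation_lin_rep[OF c(5) zoneD[OF c(6)]]
  have i: "\<phi> \<in> iso (local_group c x) (local_group c' x')" "\<phi>' \<in> iso (local_group c' x') (local_group c'' x'')"
    and e: "equiv_rep (local_group c x) (lin_rep c' \<circ> \<phi>) (lin_rep c)" "equiv_rep (local_group c' x') (lin_rep c'' \<circ> \<phi>') (lin_rep c')"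
    using \<phi> by (auto simp: admissible_def)
  have rep': "representation (local_group c' x') 2 (lin_rep c'' \<circ> \<phi>')"
    using representation_twist[OF grp(2,3) i(2)] rep(3) by blast
  show ?thesis
    unfolding admissible_def using iso_set_trans[OF i] equiv_rep_iso_comp[OF grp(1,2) i(1) rep(1,2) rep' e] admissibleD[OF \<phi>(1)] admissibleD[OF \<phi>(2)]
    by simp
qed

text \<open>Quantifying over all charts at both ends makes concatenation possible: whatever chart is
  used at the intermediate time, both halves apply to it.\<close>

definition transport :: "(real \<Rightarrow> (complex ^ 'n) set) \<Rightarrow> real \<Rightarrow> real \<Rightarrow> bool" where
  "transport \<gamma> s t \<longleftrightarrow> (\<forall>c x c' x'. sing c \<longrightarrow> x \<in> zone c \<longrightarrow> cmap c x = \<gamma> s \<longrightarrow>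
    sing c' \<longrightarrow> x' \<in> zone c' \<longrightarrow> cmap c' x' = \<gamma> t \<longrightarrow> (\<exists>\<phi>. transports_by \<gamma> s t c x c' x' \<phi>))"

lemma transport_trans:
  assumes \<gamma>: "pathin B \<gamma>" and st: "0 \<le> s" "s \<le> t" "t \<le> u" "u \<le> 1" and tr: "transport \<gamma> s t" "transport \<gamma> t u"
  shows "transport \<gamma> s u"
  unfolding transport_def
proof (intro allI impI)
  fix c x c'' x'' assume c: "sing c" "x \<in> zone c" "cmap c x = \<gamma> s" and c'': "sing c''" "x'' \<in> zone c''" "cmap c'' x'' = \<gamma> u"
  have "\<gamma> t \<in> topspace B" using path_image_subset_topspace[OF \<gamma>] st by (auto simp: path_image_def)
  then obtain c' x' where c': "sing c'" "x' \<in> zone c'" "cmap c' x' = \<gamma> t" by (rule base_chart)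
  obtain \<phi> where \<phi>: "transports_by \<gamma> s t c x c' x' \<phi>"
    using tr(1)[unfolded transport_def, rule_format, OF c c'] by blast
  obtain \<phi>' where \<phi>': "transports_by \<gamma> t u c' x' c'' x'' \<phi>'"
    using tr(2)[unfolded transport_def, rule_format, OF c' c''] by blast
  show "\<exists>\<phi>. transports_by \<gamma> s u c x c'' x'' \<phi>"
    unfolding transports_by_def
  proof (intro exI[of _ "\<phi>' \<circ> \<phi>"] conjI ballI impI)
    have ad: "admissible c x c' x' \<phi>" "admissible c' x' c'' x'' \<phi>'" using \<phi> \<phi>' by (auto simp: transports_by_def)
    show "admissible c x c'' x'' (\<phi>' \<circ> \<phi>)" by (rule admissible_comp[OF c(1,2) c'(1,2) c''(1,2) ad])
    fix g assume g: "g \<in> cgrp c" "g \<noteq> one c"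
    have h: "lift_joins \<gamma> s t (sheet c g x) (sheet c' (\<phi> g) x')" using \<phi> g by (simp add: transports_by_def)
    have h': "lift_joins \<gamma> t u (sheet c' (\<phi> g) x') (sheet c'' (\<phi>' (\<phi> g)) x'')"
      using \<phi>' admissibleD[OF ad(1) g] by (simp add: transports_by_def)
    obtain \<eta> where \<eta>: "continuous_map (top_of_set {s..t}) Tw \<eta>"
      "\<forall>r\<in>{s..t}. fst (\<eta> r) = \<gamma> r" "\<eta> s = sheet c g x" "\<eta> t = sheet c' (\<phi> g) x'" using h unfolding lift_joins_def by blast
    obtain \<eta>' where \<eta>': "continuous_map (top_of_set {t..u}) Tw \<eta>'"
      "\<forall>r\<in>{t..u}. fst (\<eta>' r) = \<gamma> r" "\<eta>' t = sheet c' (\<phi> g) x'" "\<eta>' u = sheet c'' (\<phi>' (\<phi> g)) x''" using h' unfolding lift_joins_def by blast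
    define \<kappa> where "\<kappa> v = (if v \<le> t then \<eta> v else \<eta>' v)" for v
    have sub: "{v \<in> {s..u}. v \<le> t} = {s..t}" "{v \<in> {s..u}. t \<le> v} = {t..u}" using st by auto
    have "continuous_map (top_of_set {s..u}) Tw \<kappa>"
      unfolding \<kappa>_def[abs_def]
    proof (rule continuous_map_cases_le)
      show "continuous_map (top_of_set {s..u}) euclideanreal (\<lambda>v. v)" "continuous_map (top_of_set {s..u}) euclideanreal (\<lambda>v. t)" by auto
      show "continuous_map (subtopology (top_of_set {s..u}) {v \<in> topspace (top_of_set {s..u}). v \<le> t}) Tw \<eta>"
        using \<eta>(1) sub(1) st by (simp add: subtopology_subtopology Int_absorb1)
      show "continuous_map (subtopology (top_of_set {s..u}) {v \<in> topspace (top_of_set {s..u}). t \<le> v}) Tw \<eta>'"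
        using \<eta>'(1) sub(2) st by (simp add: subtopology_subtopology Int_absorb1)
    qed (use \<eta>(4) \<eta>'(3) in simp)
    moreover have "\<forall>v\<in>{s..u}. fst (\<kappa> v) = \<gamma> v" using \<eta>(2) \<eta>'(2) by (auto simp: \<kappa>_def)
    moreover have "\<kappa> s = sheet c g x" using \<eta>(3) st by (simp add: \<kappa>_def)
    moreover have "\<kappa> u = sheet c'' ((\<phi>' \<circ> \<phi>) g) x''" using \<eta>(4) \<eta>'(3,4) st by (cases "u = t") (auto simp: \<kappa>_def)
    ultimately show "lift_joins \<gamma> s u (sheet c g x) (sheet c'' ((\<phi>' \<circ> \<phi>) g) x'')" unfolding lift_joins_def by blast
  qed
qed

text \<open>While the path stays in one patch, the lift keeps the group element of \<open>c0\<close>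
  constant and moves only the base point, through the inverse \<open>k\<close> of the chart map.
  Changes of charts occur at the two ends alone, and \<open>local_group_eq\<close> identifies the
  local groups at \<open>x0\<close> and \<open>x1\<close>.\<close>

lemma transport_local:
  assumes \<gamma>: "pathin B \<gamma>" and st: "0 \<le> s" "s \<le> t" "t \<le> 1" and c0: "sing c0"
    and near: "\<And>u. u \<in> {s..t} \<Longrightarrow> \<gamma> u \<in> cmap c0 ` zone c0"
  shows "transport \<gamma> s t"
  unfolding transport_def
proof (intro allI impI)
  fix c x c' x' assume c: "sing c" "x \<in> zone c" "cmap c x = \<gamma> s" and c': "sing c'" "x' \<in> zone c'" "cmap c' x' = \<gamma> t"
  obtain k where k: "homeomorphic_maps (top_of_set (zone c0)) (subtopology B (cmap c0 ` zone c0)) (cmap c0) k"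
    using homeomorphic_cmap[OF c0] homeomorphic_map_maps by blast
  have kc: "continuous_map (subtopology B (cmap c0 ` zone c0)) (top_of_set (zone c0)) k" using k by (simp add: homeomorphic_maps_def)
  have tsB: "\<gamma> u \<in> topspace (subtopology B (cmap c0 ` zone c0))" if "u \<in> {s..t}" for u
    using near[OF that] cmap_zone(1)[OF c0] by auto
  have kz: "k (\<gamma> u) \<in> zone c0" "cmap c0 (k (\<gamma> u)) = \<gamma> u" if "u \<in> {s..t}" for u
    using k tsB[OF that] continuous_map_funspace[OF kc] by (auto simp: homeomorphic_maps_def)
  have "continuous_map (top_of_set {s..t}) B \<gamma>"
    using continuous_map_from_subtopology_mono[OF \<gamma>[unfolded pathin_def]] st by auto
  then have "continuous_map (top_of_set {s..t}) (subtopology B (cmap c0 ` zone c0)) \<gamma>"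
    using near by (simp only: continuous_map_in_subtopology) auto
  then have kcont: "continuous_map (top_of_set {s..t}) (top_of_set (zone c0)) (k \<circ> \<gamma>)" using kc continuous_map_compose by blast
  have s0: "s \<in> {s..t}" "t \<in> {s..t}" using st by auto
  define x0 where "x0 = k (\<gamma> s)"
  define x1 where "x1 = k (\<gamma> t)"
  have x01: "x0 \<in> zone c0" "x1 \<in> zone c0" "cmap c0 x0 = \<gamma> s" "cmap c0 x1 = \<gamma> t" using kz s0 by (auto simp: x0_def x1_def)
  have G0: "local_group c0 x0 = local_group c0 x1" by (rule local_group_eq[OF c0 x01(1,2)])
  have e: "cmap c x = cmap c0 x0" "cmap c0 x1 = cmap c' x'" using c c' x01 by auto
  obtain \<phi> where \<phi>: "admissible c x c0 x0 \<phi>" "\<And>g. g \<in> cgrp c \<Longrightarrow> sheet c g x = sheet c0 (\<phi> g) x0"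
    by (rule sheet_transfer[OF c(1) c0 c(2) x01(1) e(1)], rule that)
  obtain \<phi>' where \<phi>': "admissible c0 x1 c' x' \<phi>'" "\<And>g. g \<in> cgrp c0 \<Longrightarrow> sheet c0 g x1 = sheet c' (\<phi>' g) x'"
    by (rule sheet_transfer[OF c0 c'(1) x01(2) c'(2) e(2)], rule that)
  have ad: "admissible c x c0 x1 \<phi>" using \<phi>(1) G0 by (simp add: admissible_def)
  show "\<exists>\<phi>. transports_by \<gamma> s t c x c' x' \<phi>"
    unfolding transports_by_def
  proof (intro exI[of _ "\<phi>' \<circ> \<phi>"] conjI ballI impI)
    show "admissible c x c' x' (\<phi>' \<circ> \<phi>)" by (rule admissible_comp[OF c(1,2) c0 x01(2) c'(1,2) ad \<phi>'(1)])
    fix g assume g: "g \<in> cgrp c" "g \<noteq> one c"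
    note h = admissibleD[OF ad g]
    have "continuous_map (top_of_set {s..t}) Tw (sheet c0 (\<phi> g) \<circ> (k \<circ> \<gamma>))"
      by (rule continuous_map_compose[OF kcont sheet_continuous[OF c0 h]])
    moreover have "\<forall>u\<in>{s..t}. fst ((sheet c0 (\<phi> g) \<circ> (k \<circ> \<gamma>)) u) = \<gamma> u" using kz(2) by simp
    moreover have "(sheet c0 (\<phi> g) \<circ> (k \<circ> \<gamma>)) s = sheet c g x" using \<phi>(2)[OF g(1)] by (simp add: x0_def)
    moreover have "(sheet c0 (\<phi> g) \<circ> (k \<circ> \<gamma>)) t = sheet c' ((\<phi>' \<circ> \<phi>) g) x'" using \<phi>'(2)[OF h(1)] by (simp add: x1_def)
    ultimately show "lift_joins \<gamma> s t (sheet c g x) (sheet c' ((\<phi>' \<circ> \<phi>) g) x')" unfolding lift_joins_def by blast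
  qed
qed

text \<open>Each time has a neighbourhood that \<gamma> maps into one patch; \<open>Bolzano\<close>
  glues the resulting local transports by \<open>transport_trans\<close>.\<close>

lemma transport_path:
  assumes \<gamma>: "pathin B \<gamma>"
  shows "transport \<gamma> 0 1"
proof -
  have "0 \<le> (0::real) \<and> 0 \<le> (1::real) \<and> 1 \<le> (1::real) \<longrightarrow> transport \<gamma> 0 1"
  proof (rule Bolzano[of 0 1 "\<lambda>s t. 0 \<le> s \<and> s \<le> t \<and> t \<le> 1 \<longrightarrow> transport \<gamma> s t"])
    fix s t u assume "0 \<le> s \<and> s \<le> t \<and> t \<le> 1 \<longrightarrow> transport \<gamma> s t" "0 \<le> t \<and> t \<le> u \<and> u \<le> 1 \<longrightarrow> transport \<gamma> t u" "s \<le> t" "t \<le> u"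
    then show "0 \<le> s \<and> s \<le> u \<and> u \<le> 1 \<longrightarrow> transport \<gamma> s u" using transport_trans[OF \<gamma>, of s t u] by auto
  next
    fix t0 :: real assume t0: "0 \<le> t0" "t0 \<le> 1"
    have "\<gamma> t0 \<in> topspace B" using path_image_subset_topspace[OF \<gamma>] t0 by (auto simp: path_image_def)
    then obtain c x where c: "sing c" "x \<in> zone c" "cmap c x = \<gamma> t0" by (rule base_chart)
    have op: "openin B (cmap c ` zone c)" by (rule cmap_zone(3)[OF c(1)]) auto
    have t1: "\<gamma> t0 \<in> cmap c ` zone c" "t0 \<in> {0..1}" using c t0 by auto
    obtain d where d: "d > 0" "\<And>u. u \<in> {0..1} \<Longrightarrow> \<bar>u - t0\<bar> < d \<Longrightarrow> \<gamma> u \<in> cmap c ` zone c"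
      by (rule pathin_near[OF \<gamma> op t1], rule that)
    show "\<exists>d>0. \<forall>s t. s \<le> t0 \<and> t0 \<le> t \<and> t - s < d \<longrightarrow> (0 \<le> s \<and> s \<le> t \<and> t \<le> 1 \<longrightarrow> transport \<gamma> s t)"
    proof (intro exI[of _ d] conjI allI impI d(1))
      fix s t assume st: "s \<le> t0 \<and> t0 \<le> t \<and> t - s < d" "0 \<le> s \<and> s \<le> t \<and> t \<le> 1"
      show "transport \<gamma> s t"
        by (rule transport_local[OF \<gamma> _ _ _ c(1)]) (use st d(2) in auto)
    qed
  qed auto
  then show ?thesis by simp
qed

lemma monodromy_sheet:
  assumes \<gamma>: "pathin B \<gamma>" "\<gamma> 0 = cmap c x" "\<gamma> 1 = cmap c x" and c: "sing c" "x \<in> zone c"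
  obtains \<phi> where "\<phi> \<in> iso (local_group c x) (local_group c x)" "equiv_rep (local_group c x) (lin_rep c \<circ> \<phi>) (lin_rep c)"
    "\<And>g. g \<in> cgrp c \<Longrightarrow> g \<noteq> one c \<Longrightarrow> \<phi> g \<in> cgrp c"
    "\<And>g. g \<in> cgrp c \<Longrightarrow> g \<noteq> one c \<Longrightarrow> monodromy Tw fst \<gamma> (sheet c g x) = sheet c (\<phi> g) x"
proof -
  obtain \<phi> where "transports_by \<gamma> 0 1 c x c x \<phi>"
    using transport_path[OF \<gamma>(1), unfolded transport_def, rule_format, OF c \<gamma>(2)[symmetric] c \<gamma>(3)[symmetric]] by blast
  then have \<phi>: "\<phi> \<in> iso (local_group c x) (local_group c x)" "equiv_rep (local_group c x) (lin_rep c \<circ> \<phi>) (lin_rep c)"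
    and l: "\<forall>g\<in>cgrp c. g \<noteq> one c \<longrightarrow> \<phi> g \<in> cgrp c \<and> \<phi> g \<noteq> one c \<and> lift_joins \<gamma> 0 1 (sheet c g x) (sheet c (\<phi> g) x)"
    unfolding transports_by_def admissible_def by auto
  show ?thesis
  proof (rule that[OF \<phi>])
    fix g assume g: "g \<in> cgrp c" "g \<noteq> one c"
    then show "\<phi> g \<in> cgrp c" using l by blast
    obtain \<eta> where \<eta>: "pathin Tw \<eta>" "\<forall>u\<in>{0..1}. fst (\<eta> u) = \<gamma> u" "\<eta> 0 = sheet c g x" "\<eta> 1 = sheet c (\<phi> g) x"
      using l g unfolding pathin_def lift_joins_def by blast
    show "monodromy Tw fst \<gamma> (sheet c g x) = sheet c (\<phi> g) x"
      unfolding monodromy_def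
    proof (rule the_equality)
      show "\<exists>\<eta>. pathin Tw \<eta> \<and> (\<forall>t\<in>{0..1}. fst (\<eta> t) = \<gamma> t) \<and> \<eta> 0 = sheet c g x \<and> \<eta> 1 = sheet c (\<phi> g) x"
        using \<eta> by blast
      fix w assume "\<exists>\<eta>. pathin Tw \<eta> \<and> (\<forall>t\<in>{0..1}. fst (\<eta> t) = \<gamma> t) \<and> \<eta> 0 = sheet c g x \<and> \<eta> 1 = w"
      then obtain \<kappa> where \<kappa>: "pathin Tw \<kappa>" "\<forall>t\<in>{0..1}. fst (\<kappa> t) = \<gamma> t" "\<kappa> 0 = sheet c g x" "\<kappa> 1 = w" by blast
      have "\<kappa> 1 = \<eta> 1" by (rule lifts_agree[OF \<kappa>(1) \<eta>(1)]) (use \<kappa> \<eta> in auto)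
      then show "w = sheet c (\<phi> g) x" using \<kappa>(4) \<eta>(4) by simp
    qed
  qed
qed

text \<open>The loop acts on classes by an automorphism \<phi> compatible with
  \<open>lin_rep c\<close>. Compatibility passes to the given \<open>Q\<close> through their
  equivalence, and naturality of \<theta> turns the action on classes into
  \<open>irrep_transport G \<phi>\<close>, which is a McKay automorphism.\<close>

lemma monodromy_mckay:
  assumes \<theta>: "canonical_identification \<theta>" and c: "sing c" "x \<in> zone c" and Q: "normal_rep S c x n Q"
    and \<gamma>: "pathin B \<gamma>" "\<gamma> 0 = cmap c x" "\<gamma> 1 = cmap c x"
  defines "G \<equiv> local_group c x"
  defines "F \<equiv> \<theta> G Q \<circ> class_at c x"
  shows "n = 2" "bij_betw F (twisted_fiber A (cmap c x)) (nontriv_irreps G)"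
    "(\<lambda>r\<in>nontriv_irreps G. F (monodromy Tw fst \<gamma> (inv_into (twisted_fiber A (cmap c x)) F r))) \<in> mckay_automorphisms G Q"
proof -
  note u = normal_rep_unique[OF c(1) zoneD[OF c(2)] Q, folded G_def]
  show n: "n = 2" by (rule u(1))
  have car: "carrier G = cgrp c" unfolding G_def by (rule carrier_local_group[OF c(1) zoneD[OF c(2)]])
  have grp: "Group.group G" unfolding G_def by (rule group_local_group[OF c(1) zoneD[OF c(2)]])
  interpret FG: finite_group G
    using grp finite_cgrp[OF sing_A[OF c(1)]] car by (simp add: finite_group_def finite_group_axioms_def)
  have rQ: "representation G 2 Q" using Q n by (simp add: normal_rep_def G_def)
  have rl: "representation G 2 (lin_rep c)" unfolding G_def by (rule representation_lin_rep[OF c(1) zoneD[OF c(2)]])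
  have pair: "SL2_pair G Q"
    by (rule SL2_pair_equiv[OF _ u(2) rQ]) (unfold G_def, rule SL2_pair_lin_rep[OF c(1) zoneD[OF c(2)]])
  have b\<theta>: "bij_betw (\<theta> G Q) (nontriv_conj_classes G) (nontriv_irreps G)" using \<theta> pair by (simp add: canonical_identification_def)
  show bF: "bij_betw F (twisted_fiber A (cmap c x)) (nontriv_irreps G)"
    unfolding F_def using bij_betw_trans[OF bij_betw_class_at[OF c, folded G_def] b\<theta>] .
  obtain \<phi> where \<phi>': "\<phi> \<in> iso (local_group c x) (local_group c x)" "equiv_rep (local_group c x) (lin_rep c \<circ> \<phi>) (lin_rep c)"
    "\<And>g. g \<in> cgrp c \<Longrightarrow> g \<noteq> one c \<Longrightarrow> \<phi> g \<in> cgrp c"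
    "\<And>g. g \<in> cgrp c \<Longrightarrow> g \<noteq> one c \<Longrightarrow> monodromy Tw fst \<gamma> (sheet c g x) = sheet c (\<phi> g) x"
    by (rule monodromy_sheet[OF \<gamma> c], rule that)
  note \<phi> = \<phi>'[folded G_def]
  have rl\<phi>: "representation G 2 (lin_rep c \<circ> \<phi>)" "representation G 2 (Q \<circ> \<phi>)"
    using representation_twist[OF grp grp \<phi>(1)] rl rQ by blast+
  have "equiv_rep G (Q \<circ> \<phi>) (lin_rep c \<circ> \<phi>)" using equiv_rep_twist[OF grp grp \<phi>(1)] u(2) by blast
  then have "equiv_rep G (Q \<circ> \<phi>) (lin_rep c)" using equiv_rep_trans \<phi>(2) rl\<phi> rl by blast
  then have eqQ: "equiv_rep G (Q \<circ> \<phi>) Q" using equiv_rep_trans equiv_rep_sym[OF u(2)] rl\<phi> rl rQ n by blast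
  have "F (monodromy Tw fst \<gamma> (inv_into (twisted_fiber A (cmap c x)) F r)) = irrep_transport G \<phi> r"
    if r: "r \<in> nontriv_irreps G" for r
  proof -
    define v where "v = inv_into (twisted_fiber A (cmap c x)) F r"
    have v: "v \<in> twisted_fiber A (cmap c x)" "F v = r" using bF r
      by (auto simp: v_def bij_betw_def inv_into_into f_inv_into_f)
    obtain g where g: "g \<in> cgrp c" "g \<noteq> one c" "v = sheet c g x" using v(1) twisted_fiber_eq[OF c] by blast
    have cl: "class_at c x v = conj_class G g" unfolding g(3) G_def by (rule class_at_sheet[OF c(1) g(1) c(2)])
    have nt: "conj_class G g \<in> nontriv_conj_classes G" using bij_betw_class_at[OF c] v(1) cl by (auto simp: bij_betw_def G_def)
    have "class_at c x (monodromy Tw fst \<gamma> v) = conj_class G (\<phi> g)"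
      unfolding g(3) \<phi>'(4)[OF g(1,2)] G_def by (rule class_at_sheet[OF c(1) \<phi>'(3)[OF g(1,2)] c(2)])
    also have "\<dots> = \<phi> ` conj_class G g"
      using FG.conj_class_image[OF grp \<phi>(1)] g(1) car by metis
    finally have "F (monodromy Tw fst \<gamma> v) = \<theta> G Q (\<phi> ` conj_class G g)" by (simp add: F_def)
    also have "\<dots> = irrep_transport G \<phi> (\<theta> G Q (conj_class G g))"
      unfolding irrep_transport_def using \<theta> pair \<phi>(1) eqQ nt unfolding canonical_identification_def by blast
    also have "\<theta> G Q (conj_class G g) = r" using v(2) cl by (simp add: F_def)
    finally show ?thesis by (simp add: v_def)
  qed
  then have "(\<lambda>r\<in>nontriv_irreps G. F (monodromy Tw fst \<gamma> (inv_into (twisted_fiber A (cmap c x)) F r))) =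
      (\<lambda>r\<in>nontriv_irreps G. irrep_transport G \<phi> r)" by (intro restrict_ext)
  then show "(\<lambda>r\<in>nontriv_irreps G. F (monodromy Tw fst \<gamma> (inv_into (twisted_fiber A (cmap c x)) F r))) \<in> mckay_automorphisms G Q"
    using irrep_transport_mckay_automorphism[OF pair \<phi>(1) eqQ] by simp
qed

end

theorem proposition3p3:
  fixes Y :: "(complex ^ 'n::finite) set set"
    and e :: "2 \<Rightarrow> 'd::finite"
    and A :: "('d, (complex ^ 'n) set) orb_chart set"
  defines "S \<equiv> sing_locus Y"
  assumes "projective_variety Y"
    and "inj e"
    and "transversal_ADE e Y"
    and "ADE_orbifold e Y A"
  shows "covering_map (twisted_space A) (subtopology proj_space S) fst \<and>
    (\<exists>\<theta>. canonical_identification \<theta> \<and>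
      (\<forall>c \<in> A. \<forall>x \<in> cdom c. cmap c x \<in> S \<longrightarrow>
        (let y = cmap c x; G = local_group c x in
          bij_betw (class_at c x) (twisted_fiber A y) (nontriv_conj_classes G) \<and>
          (\<exists>Q. normal_rep S c x 2 Q) \<and>
          (\<forall>n Q. normal_rep S c x n Q \<longrightarrow>
            n = 2 \<and>
            (let F = \<theta> G Q \<circ> class_at c x in
              bij_betw F (twisted_fiber A y) (nontriv_irreps G) \<and>
              (\<forall>\<gamma>. pathin (subtopology proj_space S) \<gamma> \<and> \<gamma> 0 = y \<and> \<gamma> 1 = y \<longrightarrow>
                (\<lambda>r \<in> nontriv_irreps G.
                   F (monodromy (twisted_space A) fst \<gamma> (inv_into (twisted_fiber A y) F r)))
                \<in> mckay_automorphisms G Q))))))"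
proof -
  interpret ade_orbifold e Y A by (intro ade_orbifold.intro split_coordinates.intro ade_orbifold_axioms.intro assms)
  obtain \<theta> :: "(complex ^ 'd \<Rightarrow> complex ^ 'd) monoid \<Rightarrow> ((complex ^ 'd \<Rightarrow> complex ^ 'd) \<Rightarrow> complex Matrix.mat) \<Rightarrow>
      (complex ^ 'd \<Rightarrow> complex ^ 'd) set \<Rightarrow> ((complex ^ 'd \<Rightarrow> complex ^ 'd) \<Rightarrow> complex Matrix.mat) set"
    where \<theta>: "canonical_identification \<theta>" using canonical_identification_exists by blast
  show ?thesis
    unfolding S_def Let_def
  proof (intro conjI exI[of _ \<theta>] \<theta> ballI impI allI)
    show "covering_map (twisted_space A) (subtopology proj_space (sing_locus Y)) fst" by (rule twisted_covering)
    fix c x assume c: "c \<in> A" "x \<in> cdom c" "cmap c x \<in> sing_locus Y"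
    have s: "sing c" by (rule sing_if[OF c])
    have z: "x \<in> zone c" using sing_preimage[OF s c(2)] c(2,3) by (simp add: zone_def)
    show "bij_betw (class_at c x) (twisted_fiber A (cmap c x)) (nontriv_conj_classes (local_group c x))"
      by (rule bij_betw_class_at[OF s z])
    show "\<exists>Q. normal_rep (sing_locus Y) c x 2 Q" using normal_rep_lin_rep[OF s zoneD[OF z]] by blast
    fix n Q assume Q: "normal_rep (sing_locus Y) c x n Q"
    \<comment> \<open>The constant loop instantiates the path in \<open>monodromy_mckay\<close>,
      whose first two conclusions concern the degree and the fibre.\<close>
    have const: "pathin (subtopology proj_space (sing_locus Y)) (\<lambda>_. cmap c x)"
      using cmap_zone(1)[OF s z] by (simp add: pathin_def)
    show "n = 2" "bij_betw (\<theta> (local_group c x) Q \<circ> class_at c x) (twisted_fiber A (cmap c x)) (nontriv_irreps (local_group c x))"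
      using monodromy_mckay(1,2)[OF \<theta> s z Q const refl refl] by blast+
    fix \<gamma> assume "pathin (subtopology proj_space (sing_locus Y)) \<gamma> \<and> \<gamma> 0 = cmap c x \<and> \<gamma> 1 = cmap c x"
    then show "(\<lambda>r\<in>nontriv_irreps (local_group c x). (\<theta> (local_group c x) Q \<circ> class_at c x)
        (monodromy (twisted_space A) fst \<gamma> (inv_into (twisted_fiber A (cmap c x)) (\<theta> (local_group c x) Q \<circ> class_at c x) r)))
      \<in> mckay_automorphisms (local_group c x) Q"
      using monodromy_mckay(3)[OF \<theta> s z Q, of \<gamma>] by blast
  qed
qed



end
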